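(* Let $u_0 \in H^2_0(\mathbb{T})$. Under the flux and noise assumptions below, there exists a unique strong solution $(u(t))_{t\geq0}$ to the equation $$\mathrm{d}u = -\partial_x A(u)\,\mathrm{d}t + \nu\,\partial_{xx}u\,\mathrm{d}t + \sum_{k\geq1} g_k\,\mathrm{d}W^k(t),\qquad x\in\mathbb{T},\ t\geq0,$$ with initial condition $u_0$. Moreover, the solution depends continuously on the initial data in the following sense. Let $(u_0^{(j)})_{j\geq1}$ be a sequence in $H^2_0(\mathbb{T})$ with $\lim_{j\to\infty}\|u_0-u_0^{(j)}\|_{H^2_0(\mathbb{T})}=0$, and let $u^{(j)}$ denote the strong solution with initial condition $u_0^{(j)}$, driven by the same Brownian motions. Then for every $T\geq0$, almost surely, $$\lim_{j\to\infty}\sup_{t\in[0,T]}\|u(t)-u^{(j)}(t)\|_{H^2_0(\mathbb{T})}=0.$$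
   Context: Notation. $\mathbb{T}=\mathbb{R}/\mathbb{Z}$ is the one-dimensional torus. For $p\in[1,+\infty]$, $L^p_0(\mathbb{T})$ is the set of $v\in L^p(\mathbb{T})$ with $\int_{\mathbb{T}}v\,\mathrm{d}x=0$, equipped with the $L^p$ norm. For $m\geq1$ let $e_{2m-1}(x)=\sqrt2\sin(2\pi mx)$, $e_{2m}(x)=\sqrt2\cos(2\pi mx)$ and $\lambda_{2m-1}=\lambda_{2m}=-(2\pi m)^2$. This is an orthonormal basis of $L^2_0(\mathbb{T})$ with $\partial_{xx}e_m=\lambda_me_m$. For $s\geq0$, $H^s_0(\mathbb{T})$ is the Hilbert space of $v\in L^2_0(\mathbb{T})$ with $\|v\|_{H^s_0(\mathbb{T})}^2:=\sum_{m\geq1}(-\lambda_m)^s\langle v,e_m\rangle_{L^2}^2<\infty$. For integer $s$ this equals $\int_{\mathbb{T}}|\partial_x^sv|^2\,\mathrm{d}x$. Assumptions. The flux $A:\mathbb{R}\to\mathbb{R}$ is $C^2$ and $A''$ is locally Lipschitz continuous. There exist $C_1>0$ and an integer $p_A\geq1$ with $|A'(v)|\leq C_1(1+|v|^{p_A})$ for all $v\in\mathbb{R}$. The viscosity $\nu>0$ is fixed. The noise functions satisfy $g_k\in H^2_0(\mathbb{T})$ for all $k\geq1$, with $D_0:=\sum_{k\geq1}\|g_k\|_{H^2_0(\mathbb{T})}^2<+\infty$. Stochastic setting. $(\Omega,\mathcal{F},\mathbb{P})$ is a probability space with a normal filtration $(\mathcal{F}_t)_{t\geq0}$. On it, $(W^k)_{k\geq1}$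 are independent real $(\mathcal{F}_t)$-Brownian motions. We set $W^Q(t):=\sum_{k\geq1}g_kW^k(t)$; this series converges in $L^2(\Omega,C([0,T],H^2_0(\mathbb{T})))$ for every $T>0$. Strong solution. A strong solution with initial condition $u_0\in H^2_0(\mathbb{T})$ is an $(\mathcal{F}_t)$-adapted $H^2_0(\mathbb{T})$-valued process $(u(t))_{t\geq0}$ such that, almost surely: - the map $t\mapsto u(t)$ is continuous from $[0,\infty)$ to $H^2_0(\mathbb{T})$; - for all $t\geq0$, $u(t)=u_0+\int_0^t\big(-\partial_xA(u(s))+\nu\partial_{xx}u(s)\big)\,\mathrm{d}s+W^Q(t)$, where the integral is a Bochner integral in $L^2_0(\mathbb{T})$. *)

theory Defs
  imports "HOL-Probability.Probability"
begin

text \<open>A function on the torus is represented by a function real => real; only its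
values on [0,1] matter (all quantities below are integrals over [0,1] w.r.t. Lebesgue measure).\<close>

definition ebasis :: "nat \<Rightarrow> real \<Rightarrow> real" where
  "ebasis n x = (if odd n then sqrt 2 * sin (2 * pi * real ((n + 1) div 2) * x)
                 else sqrt 2 * cos (2 * pi * real ((n + 1) div 2) * x))"

definition lam :: "nat \<Rightarrow> real" where
  "lam n = - (2 * pi * real ((n + 1) div 2))\<^sup>2"

definition coef :: "(real \<Rightarrow> real) \<Rightarrow> nat \<Rightarrow> real" where
  "coef v n = integral\<^sup>L (lebesgue_on {0..1}) (\<lambda>x. v x * ebasis n x)"

definition L20 :: "(real \<Rightarrow> real) \<Rightarrow> bool" where
  "L20 v \<longleftrightarrow> v \<in> borel_measurable (lebesgue_on {0..1})
      \<and> integrable (lebesgue_on {0..1}) (\<lambda>x. (v x)\<^sup>2)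
      \<and> integral\<^sup>L (lebesgue_on {0..1}) v = 0"

definition H20 :: "(real \<Rightarrow> real) \<Rightarrow> bool" where
  "H20 v \<longleftrightarrow> L20 v \<and> summable (\<lambda>m. (- lam (Suc m))\<^sup>2 * (coef v (Suc m))\<^sup>2)"

definition H2norm :: "(real \<Rightarrow> real) \<Rightarrow> real" where
  "H2norm v = sqrt (\<Sum>m. (- lam (Suc m))\<^sup>2 * (coef v (Suc m))\<^sup>2)"

definition flux_assms :: "(real \<Rightarrow> real) \<Rightarrow> bool" where
  "flux_assms A \<longleftrightarrow>
     (\<forall>x. A differentiable (at x))
   \<and> (\<forall>x. deriv A differentiable (at x))
   \<and> (\<forall>R. \<exists>L. \<forall>x y. \<bar>x\<bar> \<le> R \<longrightarrow> \<bar>y\<bar> \<le> R \<longrightarrow>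
          \<bar>deriv (deriv A) x - deriv (deriv A) y\<bar> \<le> L * \<bar>x - y\<bar>)
   \<and> (\<exists>C1 > 0. \<exists>pA :: nat. pA \<ge> 1 \<and> (\<forall>v. \<bar>deriv A v\<bar> \<le> C1 * (1 + \<bar>v\<bar> ^ pA)))"

definition normal_filtration :: "'a measure \<Rightarrow> (real \<Rightarrow> 'a set set) \<Rightarrow> bool" where
  "normal_filtration M F \<longleftrightarrow>
     (\<forall>t\<ge>0. sigma_algebra (space M) (F t) \<and> F t \<subseteq> sets M)
   \<and> (\<forall>s t. 0 \<le> s \<longrightarrow> s \<le> t \<longrightarrow> F s \<subseteq> F t)
   \<and> (\<forall>t\<ge>0. F t = (\<Inter>s\<in>{t<..}. F s))
   \<and> null_sets M \<subseteq> F 0"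

definition F_brownian :: "'a measure \<Rightarrow> (real \<Rightarrow> 'a set set) \<Rightarrow> ('a \<Rightarrow> real \<Rightarrow> real) \<Rightarrow> bool" where
  "F_brownian M F B \<longleftrightarrow>
     (AE \<omega> in M. B \<omega> 0 = 0 \<and> continuous_on {0..} (B \<omega>))
   \<and> (\<forall>t\<ge>0. (\<lambda>\<omega>. B \<omega> t) \<in> borel_measurable (sigma (space M) (F t)))
   \<and> (\<forall>s t. 0 \<le> s \<longrightarrow> s < t \<longrightarrow>
        distributed M lborel (\<lambda>\<omega>. B \<omega> t - B \<omega> s) (\<lambda>x. ennreal (normal_density 0 (sqrt (t - s)) x))
      \<and> (\<forall>E\<in>F s. \<forall>C\<in>sets borel.
           measure M (E \<inter> {\<omega>\<in>space M. B \<omega> t - B \<omega> s \<in> C})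
           = measure M E * measure M {\<omega>\<in>space M. B \<omega> t - B \<omega> s \<in> C}))"

text \<open>W^Q = sum_k g_k W^k: WQ is (a version of) the limit of the partial sums in
  L^2(Omega, C([0,T], H^2_0)) for every T.\<close>
definition noise_WQ :: "'a measure \<Rightarrow> (nat \<Rightarrow> 'a \<Rightarrow> real \<Rightarrow> real) \<Rightarrow> (nat \<Rightarrow> real \<Rightarrow> real)
    \<Rightarrow> ('a \<Rightarrow> real \<Rightarrow> real \<Rightarrow> real) \<Rightarrow> bool" where
  "noise_WQ M W g WQ \<longleftrightarrow>
     (AE \<omega> in M. (\<forall>t\<ge>0. H20 (WQ \<omega> t))
        \<and> (\<forall>t\<ge>0. ((\<lambda>s. H2norm (WQ \<omega> s - WQ \<omega> t)) \<longlongrightarrow> 0) (at t within {0..})))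
   \<and> (\<forall>T\<ge>0.
        (\<forall>n. integrable M (\<lambda>\<omega>. (SUP t\<in>{0..T}. H2norm (WQ \<omega> t - (\<lambda>x. \<Sum>k<n. W k \<omega> t * g k x)))\<^sup>2))
      \<and> (\<lambda>n. integral\<^sup>L M (\<lambda>\<omega>. (SUP t\<in>{0..T}. H2norm (WQ \<omega> t - (\<lambda>x. \<Sum>k<n. W k \<omega> t * g k x)))\<^sup>2))
          \<longlonglongrightarrow> 0)"

text \<open>The L^2_0-valued integral identity is expressed through the coefficients w.r.t. the
  orthonormal basis e_m (m >= 1); the coefficient of -d/dx A(v) is computed by integration
  by parts on the torus (weak derivative): <-d/dx A(v), e_m> = int_0^1 A(v) e_m',
  and <nu d^2/dx^2 v, e_m> = nu lambda_m <v, e_m>.\<close>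
definition strong_solution :: "'a measure \<Rightarrow> (real \<Rightarrow> 'a set set) \<Rightarrow> (real \<Rightarrow> real) \<Rightarrow> real
    \<Rightarrow> ('a \<Rightarrow> real \<Rightarrow> real \<Rightarrow> real) \<Rightarrow> (real \<Rightarrow> real) \<Rightarrow> ('a \<Rightarrow> real \<Rightarrow> real \<Rightarrow> real) \<Rightarrow> bool" where
  "strong_solution M F A \<nu> WQ u0 u \<longleftrightarrow>
     (\<forall>\<omega>\<in>space M. \<forall>t\<ge>0. H20 (u \<omega> t))
   \<and> (\<forall>t\<ge>0. \<forall>m\<ge>1. (\<lambda>\<omega>. coef (u \<omega> t) m) \<in> borel_measurable (sigma (space M) (F t)))
   \<and> (AE \<omega> in M.
        (\<forall>t\<ge>0. ((\<lambda>s. H2norm (u \<omega> s - u \<omega> t)) \<longlongrightarrow> 0) (at t within {0..}))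
      \<and> (\<forall>t\<ge>0. \<forall>m\<ge>1.
           coef (u \<omega> t) m
           = coef u0 m
             + integral\<^sup>L (lebesgue_on {0..t})
                 (\<lambda>s. integral\<^sup>L (lebesgue_on {0..1}) (\<lambda>x. A (u \<omega> s x) * deriv (ebasis m) x)
                      + \<nu> * lam m * coef (u \<omega> s) m)
             + coef (WQ \<omega> t) m))"

end

theory Submission
  imports Defs
begin

text \<open>
  Everything is read off the coefficients with respect to the trigonometric basis: a strong solution
  is a continuous path in a weighted sequence space (norm \<open>nrm\<close>) that satisfies a scalar integral
  equation in every mode, equivalently a mild equation. Retracting the nonlinearity radially to the
  ball of radius \<open>R\<close> makes it Lipschitz from \<open>H\<^sup>2\<close> to \<open>H\<^sup>1\<close>, so that Picard iteration yields a
  global solution \<open>uR R\<close>, adapted because all iterates are; a weighted Gronwall estimate yields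
  uniqueness and continuous dependence pathwise.

  Non-explosion combines two estimates. First, for every \<open>q\<close> the noise-free flow
  contracts \<open>L\<^bsup>2q\<^esup>\<close>, so freezing the noise between the grid points \<open>i / n\<close> and letting
  it jump there raises \<open>E \<integral> u\<^bsup>2q\<^esup>\<close> by a factor \<open>1 + C / n\<close> per step, because the increments are
  centred, Gaussian and independent of the past; Fatou's lemma transfers the resulting bound, uniformly in \<open>R\<close>,
  to \<open>uR R\<close>. Secondly, a bound on the time integral of \<open>\<integral> A(u)\<^bsup>10\<^esup>\<close> bounds the \<open>H\<^sup>2\<close> norm
  independently of \<open>R\<close>. Hence almost surely some \<open>uR R\<close> stays below \<open>R\<close> on \<open>[0, T]\<close>, and the limit
  \<open>R \<rightarrow> \<infinity>\<close> is the solution.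
\<close>

subsection \<open>Trigonometric series on the torus\<close>

text \<open>Three choices shape the argument. The stochastic convolution is integrated by parts in
  each mode, so every equation is deterministic once the noise path is fixed. The price is that a
  path must be dominated, mode by mode, by a summable sequence (\<open>gp\<close>); that sequence is
  extracted from a maximal inequality in each mode. Secondly, the chain rule and integration by
  parts in \<open>x\<close> are applied to trigonometric truncations only, and the resulting
  inequalities pass to the limit. The event is encoded by the vanishing of a time integral
  (\<open>Dex\<close>), and with frozen noise it is already known at the left end of a grid cell,
  before the next increment is drawn. The power 10 is twice 5: the kernel of the
  \<open>H^{3/4}\<close> estimate behaves like \<open>(t - s)^{-3/4}\<close>, Young's inequality
  with exponents 5/4 and 5 turns this into the integrable \<open>(t - s)^{-15/16}\<close>, and
  \<open>A(u)^2\<close> becomes \<open>A(u)^10\<close>.\<close>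

abbreviation torus :: "real measure" where "torus \<equiv> lebesgue_on {0..1}"
abbreviation tint :: "(real \<Rightarrow> real) \<Rightarrow> real" where "tint \<equiv> integral\<^sup>L torus"
abbreviation ton :: "real \<Rightarrow> real measure" where "ton t \<equiv> lebesgue_on {0..t}"
abbreviation sint :: "real \<Rightarrow> (real \<Rightarrow> real) \<Rightarrow> real" where "sint t \<equiv> integral\<^sup>L (ton t)"
type_synonym seq = "nat \<Rightarrow> real"

text \<open>Mode \<open>m\<close> is \<open>e\<^bsub>m+1\<^esub>\<close>; \<open>pr\<close> exchanges sine and cosine of equal frequency.\<close>

definition kap :: seq where "kap m = 2 * pi * (real (m div 2) + 1)"

definition eb :: "nat \<Rightarrow> real \<Rightarrow> real" where
  "eb m x = (if even m then sqrt 2 * sin (kap m * x) else sqrt 2 * cos (kap m * x))"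

definition pr :: "nat \<Rightarrow> nat" where "pr m = (if even m then m + 1 else m - 1)"

definition sg :: seq where "sg m = (if even m then 1 else -1)"

text \<open>The derivative of \<open>eb m\<close> (see \<open>eb_deriv\<close>), written through the
  partner mode so that sums of derivatives can be reindexed along the involution
  \<open>pr\<close>.\<close>

definition deb :: "nat \<Rightarrow> real \<Rightarrow> real" where "deb m x = sg m * kap m * eb (pr m) x"

lemma ebasis_Suc: "ebasis (Suc m) = eb m"
  by (rule ext) (simp add: ebasis_def eb_def kap_def algebra_simps)

lemma lam_Suc: "lam (Suc m) = - (kap m)\<^sup>2"
  by (simp add: lam_def kap_def algebra_simps)

lemma coef_Suc: "coef v (Suc m) = tint (\<lambda>x. v x * eb m x)"
  by (simp add: coef_def ebasis_Suc)

lemma kap_gt: "real m + 1 \<le> kap m"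
proof -
  have "real m + 1 \<le> 2 * (real (m div 2) + 1)"
    by (cases "even m") (auto elim!: evenE oddE)
  also have "\<dots> \<le> pi * (2 * (real (m div 2) + 1))"
    using pi_gt3 by (intro mult_right_mono[of 1 pi, simplified]) auto
  finally show ?thesis by (simp add: kap_def algebra_simps)
qed

lemma kap_ge1: "1 \<le> kap m" and kap_pos [simp]: "0 < kap m" and kap_nz [simp]: "kap m \<noteq> 0"
  and kap_nonneg [simp]: "0 \<le> kap m"
  using kap_gt[of m] by (auto simp: less_eq_real_def)

lemma kap_pr [simp]: "kap (pr m) = kap m"
  by (auto simp: kap_def pr_def elim!: evenE oddE)

lemma pr_pr [simp]: "pr (pr m) = m"
  by (auto simp: pr_def)

lemma inj_pr: "inj_on pr S"
  by (metis inj_onI pr_pr)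

lemma sg_pr [simp]: "sg (pr m) = - sg m"
  by (auto simp: sg_def pr_def)

lemma sg_sq [simp]: "sg m * sg m = 1" "(sg m)^2 = 1" "\<bar>sg m\<bar> = 1"
  by (auto simp: sg_def)

lemma sg_sq_left [simp]: "sg m * (sg m * x) = x"
  by (auto simp: sg_def)

lemma eb_deriv: "(eb m has_real_derivative deb m x) (at x within S)"
proof -
  have "(eb m has_real_derivative deb m x) (at x)"
  proof (cases "even m")
    case True
    then have "eb m = (\<lambda>x. sqrt 2 * sin (kap m * x))" by (auto simp: eb_def)
    moreover have "kap (Suc m) = kap m" using kap_pr[of m] True by (simp add: pr_def)
    ultimately show ?thesis
      using True by (auto intro!: derivative_eq_intros simp: deb_def sg_def pr_def eb_def)
  next
    case False
    then have "eb m = (\<lambda>x. sqrt 2 * cos (kap m * x))" by (auto simp: eb_def)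
    moreover have "kap (m - 1) = kap m" using kap_pr[of m] False by (simp add: pr_def)
    ultimately show ?thesis
      using False by (auto intro!: derivative_eq_intros simp: deb_def sg_def pr_def eb_def)
  qed
  then show ?thesis by (rule has_field_derivative_at_within)
qed

lemma deb_deriv: "(deb m has_real_derivative - ((kap m)^2 * eb m x)) (at x within S)"
proof -
  have "((\<lambda>x. sg m * kap m * eb (pr m) x) has_real_derivative sg m * kap m * deb (pr m) x) (at x within S)"
    by (intro DERIV_cmult eb_deriv)
  then show ?thesis by (simp add: deb_def[abs_def] power2_eq_square mult_ac)
qed

lemma deriv_ebasis: "deriv (ebasis (Suc m)) x = deb m x"
  unfolding ebasis_Suc using eb_deriv[of m x UNIV] by (rule DERIV_imp_deriv)

lemma eb_cont [continuous_intros]: "continuous_on S (eb m)"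
  using eb_deriv by (meson DERIV_continuous continuous_on_eq_continuous_within)

lemma deb_cont [continuous_intros]: "continuous_on S (deb m)"
  using deb_deriv by (meson DERIV_continuous continuous_on_eq_continuous_within)

lemma eb_meas [measurable]: "eb m \<in> borel_measurable borel" "deb m \<in> borel_measurable borel"
  by (auto intro!: borel_measurable_continuous_onI continuous_intros)

lemma eb_bound: "\<bar>eb m x\<bar> \<le> sqrt 2"
  by (auto simp: eb_def abs_mult)

lemma eb_periodic: "eb m 1 = eb m 0"
proof -
  have "sin (kap m) = 0" "cos (kap m) = 1"
    using sin_int_2pin[of "int (m div 2) + 1"] cos_int_2pin[of "int (m div 2) + 1"]
    by (simp_all add: kap_def algebra_simps)
  then show ?thesis by (simp add: eb_def)
qed

lemma deb_periodic: "deb m 1 = deb m 0"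
  by (simp add: deb_def eb_periodic)

lemma torus_prob: "prob_space torus"
  by (rule prob_spaceI) (simp add: emeasure_restrict_space)

interpretation torus: prob_space torus by (rule torus_prob)

lemma torus_meas_borel: "f \<in> borel_measurable borel \<Longrightarrow> f \<in> borel_measurable torus"
  by (simp add: measurable_restrict_space1 measurable_completion)

lemma torus_meas_cont: "continuous_on {0..1} f \<Longrightarrow> f \<in> borel_measurable torus" for f :: "real \<Rightarrow> real"
  by (rule borel_measurable_integrable, rule continuous_imp_integrable_real)

lemma torus_int_cont [intro]: "continuous_on {0..1} f \<Longrightarrow> integrable torus f" for f :: "real \<Rightarrow> real"
  by (rule continuous_imp_integrable_real)

lemma torus_eq_integral: "continuous_on {0..1} f \<Longrightarrow> tint f = integral {0..1} f" for f :: "real \<Rightarrow> real"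
  by (rule lebesgue_integral_eq_integral[OF continuous_imp_integrable_real]) auto

lemma torus_FTC:
  fixes F f :: "real \<Rightarrow> real"
  assumes "\<And>x. x \<in> {0..1} \<Longrightarrow> (F has_real_derivative f x) (at x within {0..1})" "continuous_on {0..1} f"
  shows "tint f = F 1 - F 0"
proof -
  have "(f has_integral F 1 - F 0) {0..1}"
    using assms by (intro fundamental_theorem_of_calculus)
      (auto simp: has_real_derivative_iff_has_vector_derivative)
  then show ?thesis using torus_eq_integral[OF assms(2)] by (simp add: integral_unique)
qed

lemma torus_IBP:
  fixes f f' g g' :: "real \<Rightarrow> real"
  assumes f: "\<And>x. x \<in> {0..1} \<Longrightarrow> (f has_real_derivative f' x) (at x within {0..1})" "continuous_on {0..1} f'"
    and g: "\<And>x. x \<in> {0..1} \<Longrightarrow> (g has_real_derivative g' x) (at x within {0..1})" "continuous_on {0..1} g'"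
    and per: "f 1 * g 1 = f 0 * g 0"
  shows "tint (\<lambda>x. f x * g' x) = - tint (\<lambda>x. f' x * g x)"
proof -
  have c: "continuous_on {0..1} f" "continuous_on {0..1} g"
    using f(1) g(1) by (meson DERIV_continuous continuous_on_eq_continuous_within)+
  have "tint (\<lambda>x. f' x * g x + f x * g' x) = f 1 * g 1 - f 0 * g 0"
    by (rule torus_FTC[where F="\<lambda>x. f x * g x"])
      (use f g c in \<open>auto intro!: derivative_eq_intros continuous_intros\<close>)
  moreover have "tint (\<lambda>x. f' x * g x + f x * g' x)
    = tint (\<lambda>x. f' x * g x) + tint (\<lambda>x. f x * g' x)"
    by (intro Bochner_Integration.integral_add torus_int_cont) (use f g c in \<open>auto intro!: continuous_intros\<close>)
  ultimately show ?thesis using per by simp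
qed

lemma eb_sq_pr: "(eb m x)^2 + (eb (pr m) x)^2 = 2"
proof (cases "even m")
  case True
  moreover have "kap (Suc m) = kap m" using kap_pr[of m] True by (simp add: pr_def)
  ultimately show ?thesis
    by (simp add: eb_def pr_def power_mult_distrib flip: distrib_left)
next
  case False
  moreover have "kap (m - 1) = kap m" using kap_pr[of m] False by (simp add: pr_def)
  ultimately show ?thesis
    by (simp add: eb_def pr_def power_mult_distrib flip: distrib_left)
qed

lemma eb_IBP:
  "tint (\<lambda>x. deb m x * deb k x) = (kap m)^2 * tint (\<lambda>x. eb m x * eb k x)"
proof -
  have "tint (\<lambda>x. deb m x * deb k x) = - tint (\<lambda>x. - ((kap m)^2 * eb m x) * eb k x)"
    by (rule torus_IBP) (auto intro!: eb_deriv deb_deriv continuous_intros simp: eb_periodic deb_periodic)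
  also have "\<dots> = - tint (\<lambda>x. - (kap m)\<^sup>2 * (eb m x * eb k x))"
    by (simp add: mult_ac)
  finally show ?thesis by (simp only: integral_mult_right_zero)
qed

text \<open>Two integrations by parts show that the inner product is unchanged when one eigenvalue
  replaces the other, so modes of different frequency are orthogonal. For equal frequency only
  \<open>m\<close> and its partner remain: their product is a multiple of the derivative of a
  square, and their equal square norms add up to 2 by the pointwise identity
  \<open>eb_sq_pr\<close>.\<close>

lemma eb_orth: "tint (\<lambda>x. eb m x * eb k x) = (if m = k then 1 else 0)"
proof (cases "kap m = kap k")
  case False
  have "(kap m)^2 * tint (\<lambda>x. eb m x * eb k x) = (kap k)^2 * tint (\<lambda>x. eb m x * eb k x)"
    using eb_IBP[of m k] eb_IBP[of k m] by (simp only: mult.commute[of "deb k _"] mult.commute[of "eb k _"])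
  moreover have "(kap m)^2 \<noteq> (kap k)\<^sup>2" using False by (simp add: power2_eq_iff_nonneg)
  ultimately show ?thesis using False by auto
next
  case True
  then have "m div 2 = k div 2" by (simp add: kap_def)
  then have mk: "k = m \<or> k = pr m"
    unfolding pr_def by (cases "even m"; cases "even k") (auto elim!: evenE oddE)
  have 1: "tint (\<lambda>x. eb m x * eb (pr m) x) = 0"
  proof -
    have "tint (\<lambda>x. eb m x * deb m x) = - tint (\<lambda>x. deb m x * eb m x)"
      by (rule torus_IBP) (auto intro!: eb_deriv deb_deriv continuous_intros simp: eb_periodic deb_periodic)
    then have "tint (\<lambda>x. eb m x * deb m x) = 0" by (simp add: mult.commute)
    moreover have "tint (\<lambda>x. eb m x * deb m x) = sg m * kap m * tint (\<lambda>x. eb m x * eb (pr m) x)"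
      unfolding deb_def by (subst integral_mult_right_zero[symmetric]) (simp add: mult_ac)
    moreover have "sg m * kap m \<noteq> 0" by (auto simp: sg_def)
    ultimately show ?thesis by simp
  qed
  have 2: "tint (\<lambda>x. eb m x * eb m x) = 1"
  proof -
    have "(kap m)^2 * tint (\<lambda>x. eb (pr m) x * eb (pr m) x) = tint (\<lambda>x. deb m x * deb m x)"
      unfolding deb_def by (subst integral_mult_right_zero[symmetric])
        (rule Bochner_Integration.integral_cong, auto simp: power2_eq_square sg_def)
    with eb_IBP[of m m] have e: "tint (\<lambda>x. eb (pr m) x * eb (pr m) x) = tint (\<lambda>x. eb m x * eb m x)"
      by simp
    have "tint (\<lambda>x. eb m x * eb m x + eb (pr m) x * eb (pr m) x) = tint (\<lambda>x. 2)"
      by (rule Bochner_Integration.integral_cong) (use eb_sq_pr in \<open>auto simp: power2_eq_square\<close>)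
    moreover have "tint (\<lambda>x. eb m x * eb m x + eb (pr m) x * eb (pr m) x)
      = tint (\<lambda>x. eb m x * eb m x) + tint (\<lambda>x. eb (pr m) x * eb (pr m) x)"
      by (intro Bochner_Integration.integral_add torus_int_cont continuous_intros)
    ultimately show ?thesis using e by (simp add: measure_restrict_space)
  qed
  have "pr m \<noteq> m" by (auto simp: pr_def elim!: oddE)
  then show ?thesis using mk 1 2 by auto
qed

lemma eb_mean: "tint (eb m) = 0"
proof -
  have "tint (\<lambda>x. - ((kap m)^2 * eb m x)) = deb m 1 - deb m 0"
    by (rule torus_FTC) (auto intro!: deb_deriv continuous_intros)
  then show ?thesis by (simp add: deb_periodic)
qed

lemma trig_sum_L2:
  assumes "finite S"
  shows "tint (\<lambda>x. (\<Sum>m\<in>S. a m * eb m x)^2) = (\<Sum>m\<in>S. (a m)^2)"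
proof -
  have "tint (\<lambda>x. (\<Sum>m\<in>S. a m * eb m x)^2)
      = tint (\<lambda>x. \<Sum>m\<in>S. \<Sum>k\<in>S. a m * a k * (eb m x * eb k x))"
    by (simp add: power2_eq_square sum_product mult_ac)
  also have "\<dots> = (\<Sum>m\<in>S. \<Sum>k\<in>S. a m * a k * tint (\<lambda>x. eb m x * eb k x))"
    by (subst Bochner_Integration.integral_sum, fastforce intro!: continuous_intros)
       (intro sum.cong refl, subst Bochner_Integration.integral_sum, fastforce intro!: continuous_intros, simp)
  also have "\<dots> = (\<Sum>m\<in>S. \<Sum>k\<in>S. if k = m then a m * a m else 0)"
    by (intro sum.cong refl) (auto simp: eb_orth)
  also have "\<dots> = (\<Sum>m\<in>S. (a m)^2)"
    by (simp add: assms power2_eq_square)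
  finally show ?thesis .
qed

lemma bessel:
  fixes h :: "real \<Rightarrow> real"
  assumes "continuous_on {0..1} h" "finite S"
  shows "(\<Sum>m\<in>S. (tint (\<lambda>x. h x * eb m x))^2) \<le> tint (\<lambda>x. (h x)^2)"
proof -
  let ?a = "\<lambda>m. tint (\<lambda>x. h x * eb m x)"
  let ?p = "\<lambda>x. \<Sum>m\<in>S. ?a m * eb m x"
  have c: "continuous_on {0..1} ?p" by (intro continuous_intros)
  have "0 \<le> tint (\<lambda>x. (h x - ?p x)^2)" by simp
  also have "tint (\<lambda>x. (h x - ?p x)^2)
    = tint (\<lambda>x. (h x)^2 - 2 * (h x * ?p x) + (?p x)^2)"
    by (rule Bochner_Integration.integral_cong) (auto simp: power2_eq_square algebra_simps)
  also have "\<dots> = tint (\<lambda>x. (h x)^2) - 2 * tint (\<lambda>x. h x * ?p x) + tint (\<lambda>x. (?p x)^2)"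
    using assms(1) c
    by (subst Bochner_Integration.integral_add; (subst Bochner_Integration.integral_diff)?; fastforce intro!: continuous_intros)
  also have "tint (\<lambda>x. h x * ?p x) = (\<Sum>m\<in>S. ?a m * ?a m)"
    using assms(1)
    by (simp only: sum_distrib_left, subst Bochner_Integration.integral_sum)
       (fastforce intro!: continuous_intros, simp only: mult.left_commute[of "h _"] integral_mult_right_zero)
  also have "tint (\<lambda>x. (?p x)^2) = (\<Sum>m\<in>S. (?a m)^2)"
    by (rule trig_sum_L2[OF assms(2)])
  finally show ?thesis by (simp add: power2_eq_square)
qed

section \<open>The weighted sequence space and its trigonometric series\<close>

definition Hs :: "seq \<Rightarrow> bool" where
  "Hs c \<longleftrightarrow> summable (\<lambda>m. kap m ^ 4 * (c m)^2)"

text \<open>The \<open>H^2\<close> norm read on coefficients, with \<open>kap m ^ 4\<close> the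
  square of the eigenvalue. A divergent series has no meaningful sum, hence the premise
  \<open>Hs\<close> on most estimates.\<close>

definition nrm :: "seq \<Rightarrow> real" where
  "nrm c = sqrt (\<Sum>m. kap m ^ 4 * (c m)^2)"

abbreviation nrmd :: "seq \<Rightarrow> seq \<Rightarrow> real" where "nrmd c d \<equiv> nrm (\<lambda>m. c m - d m)"

definition ser :: "seq \<Rightarrow> real \<Rightarrow> real" where
  "ser c x = (\<Sum>m. c m * eb m x)"

definition tr :: "nat \<Rightarrow> seq \<Rightarrow> seq" where
  "tr N c m = (if m < N then c m else 0)"

lemma H20_iff: "H20 v \<longleftrightarrow> L20 v \<and> Hs (\<lambda>m. coef v (Suc m))"
  by (simp add: H20_def Hs_def lam_Suc flip: power_mult)

lemma H2norm_eq: "H2norm v = nrm (\<lambda>m. coef v (Suc m))"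
  by (simp add: H2norm_def nrm_def lam_Suc flip: power_mult)

lemma nrm_sq: "Hs c \<Longrightarrow> (nrm c)\<^sup>2 = (\<Sum>m. kap m ^ 4 * (c m)^2)"
  by (simp add: nrm_def Hs_def suminf_nonneg)

lemma nrm_nonneg [simp]: "Hs c \<Longrightarrow> 0 \<le> nrm c"
  by (simp add: nrm_def Hs_def suminf_nonneg)

lemma nrm_sum_le: "Hs c \<Longrightarrow> finite S \<Longrightarrow> (\<Sum>m\<in>S. kap m ^ 4 * (c m)^2) \<le> (nrm c)^2"
  by (simp add: nrm_sq) (auto simp: Hs_def intro!: sum_le_suminf)

text \<open>Membership and norm bound come together from partial sums; most estimates below are
  thereby reduced to finitely many modes.\<close>

lemma nrm_leI:
  assumes "\<And>n. (\<Sum>m<n. kap m ^ 4 * (c m)^2) \<le> B^2" "0 \<le> B"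
  shows "Hs c" "nrm c \<le> B"
proof -
  show *: "Hs c" unfolding Hs_def
    by (rule summableI_nonneg_bounded[of _ "B^2"]) (use assms in auto)
  then have "(\<Sum>m. kap m ^ 4 * (c m)^2) \<le> B^2"
    unfolding Hs_def using assms(1) by (intro suminf_le_const) auto
  then show "nrm c \<le> B" unfolding nrm_def using assms(2) by (rule real_le_lsqrt[rotated -1])

qed

lemma nrm_L2: "L2_set (\<lambda>m. (kap m)^2 * c m) S = sqrt (\<Sum>m\<in>S. kap m ^ 4 * (c m)^2)"
  by (simp add: L2_set_def power_mult_distrib flip: power_mult)

lemma Hs_add: assumes "Hs c" "Hs d"
  shows "Hs (\<lambda>m. c m + d m)" "nrm (\<lambda>m. c m + d m) \<le> nrm c + nrm d"
proof -
  have *: "(\<Sum>m<n. kap m ^ 4 * (c m + d m)^2) \<le> (nrm c + nrm d)^2" for n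
  proof -
    have "sqrt (\<Sum>m<n. kap m ^ 4 * (c m + d m)^2) = L2_set (\<lambda>m. (kap m)^2 * c m + (kap m)^2 * d m) {..<n}"
      by (simp add: nrm_L2 flip: distrib_left)
    also have "\<dots> \<le> L2_set (\<lambda>m. (kap m)^2 * c m) {..<n} + L2_set (\<lambda>m. (kap m)^2 * d m) {..<n}"
      by (rule L2_set_triangle_ineq)
    also have "\<dots> \<le> nrm c + nrm d"
      unfolding nrm_L2 by (intro add_mono real_le_lsqrt nrm_sum_le assms sum_nonneg) (use assms in auto)
    finally show ?thesis using assms
      by (metis add_nonneg_nonneg nrm_nonneg real_sqrt_le_iff real_sqrt_unique)
  qed
  show "Hs (\<lambda>m. c m + d m)" "nrm (\<lambda>m. c m + d m) \<le> nrm c + nrm d"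
    using nrm_leI[of "\<lambda>m. c m + d m" "nrm c + nrm d"] * assms by auto
qed

lemma Hs_scale [intro]: "Hs c \<Longrightarrow> Hs (\<lambda>m. r * c m)"
  unfolding Hs_def using summable_mult[of "\<lambda>m. kap m ^ 4 * (c m)^2" "r^2"]
  by (simp add: power_mult_distrib mult_ac)

lemma nrm_scale: "Hs c \<Longrightarrow> nrm (\<lambda>m. r * c m) = \<bar>r\<bar> * nrm c"
  unfolding Hs_def nrm_def using suminf_mult[of "\<lambda>m. kap m ^ 4 * (c m)^2" "r^2"]
  by (simp add: power_mult_distrib mult_ac real_sqrt_mult[symmetric] flip: real_sqrt_abs)

lemma Hs_zero [simp]: "Hs (\<lambda>m. 0)" "nrm (\<lambda>m. 0) = 0"
  by (simp_all add: Hs_def nrm_def)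

lemma nrm_minus: "nrmd c d = nrmd d c"
  by (simp add: nrm_def power2_commute)

lemma Hs_diff: assumes "Hs c" "Hs d"
  shows "Hs (\<lambda>m. c m - d m)" "nrmd c d \<le> nrm c + nrm d"
  using Hs_add[OF assms(1) Hs_scale[OF assms(2), of "-1"]] nrm_scale[OF assms(2), of "-1"] by auto

lemma nrm_diff_triangle: assumes "Hs c" "Hs d" "Hs e"
  shows "nrmd c e \<le> nrmd c d + nrmd d e"
  using Hs_add(2)[OF Hs_diff(1)[OF assms(1,2)] Hs_diff(1)[OF assms(2,3)]] by simp

lemma nrm_diff_ge: assumes "Hs c" "Hs d" shows "\<bar>nrm c - nrm d\<bar> \<le> nrmd c d"
  using Hs_add(2)[OF Hs_diff(1)[OF assms] assms(2)] Hs_add(2)[OF Hs_diff(1)[OF assms(2,1)] assms(1)]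
    nrm_minus[of c d] by simp

lemma nrm_comp: assumes "Hs c" shows "(kap m)^2 * \<bar>c m\<bar> \<le> nrm c" "\<bar>c m\<bar> \<le> nrm c"
proof -
  have "((kap m)^2 * \<bar>c m\<bar>)^2 \<le> (nrm c)^2"
    using nrm_sum_le[OF assms, of "{m}"] by (simp add: power_mult_distrib flip: power_mult)
  then show *: "(kap m)^2 * \<bar>c m\<bar> \<le> nrm c" using assms by (simp add: power2_le_iff_abs_le)
  have "1 * \<bar>c m\<bar> \<le> (kap m)^2 * \<bar>c m\<bar>" using kap_ge1[of m] by (intro mult_right_mono one_le_power) auto
  then show "\<bar>c m\<bar> \<le> nrm c" using * by simp
qed

lemma nrm_eq_0: "Hs c \<Longrightarrow> nrm c = 0 \<Longrightarrow> c m = 0"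
  using nrm_comp(2)[of c m] by simp

lemma kap_inv_summable: "summable (\<lambda>m. 1 / (kap m)^2)"
proof (rule summable_comparison_test_ev)
  show "summable (\<lambda>n. inverse (real (Suc n) ^ 2))"
    using inverse_power_summable[of 2, where 'a=real] summable_Suc_iff[of "\<lambda>n. inverse (real n ^ 2)"] by simp
  show "\<forall>\<^sub>F n in sequentially. norm (1 / (kap n)^2) \<le> inverse (real (Suc n) ^ 2)"
    using kap_gt by (auto simp: inverse_eq_divide add.commute intro!: always_eventually frac_le power_mono)
qed

text \<open>Tail of the Cauchy-Schwarz constant in the embedding of \<open>H^1\<close> coefficients
  into \<open>l^1\<close>. \<open>kinv 0\<close> enters the sup-norm constant \<open>C0\<close>; the
  decay of \<open>kinv N\<close> measures what a truncation discards.\<close>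

definition kinv :: seq where "kinv N = sqrt (\<Sum>m. 1 / (kap (m + N))^2)"

lemma kinv_nonneg [simp]: "0 \<le> kinv N"
  using kap_inv_summable by (auto simp: kinv_def intro!: suminf_nonneg summable_ignore_initial_segment[of "\<lambda>m. 1 / (kap m)^2"])

lemma kinv_tendsto: "kinv \<longlonglongrightarrow> 0"
proof -
  have "(\<lambda>N. \<Sum>m. 1 / (kap (m + N))^2) \<longlonglongrightarrow> 0"
    using suminf_exist_split2[OF kap_inv_summable] by simp
  from tendsto_real_sqrt[OF this] show ?thesis by (simp add: kinv_def[abs_def])
qed

lemma kinv_sum_le: assumes "finite S" "\<And>m. m \<in> S \<Longrightarrow> N \<le> m" shows "(\<Sum>m\<in>S. 1 / (kap m)^2) \<le> (kinv N)^2"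
proof -
  have s: "summable (\<lambda>m. 1 / (kap (m + N))^2)"
    using summable_ignore_initial_segment[OF kap_inv_summable] .
  have "(\<Sum>m\<in>S. 1 / (kap m)^2) = (\<Sum>m\<in>(\<lambda>m. m - N) ` S. 1 / (kap (m + N))^2)"
    by (subst sum.reindex) (use assms(2) in \<open>auto intro!: inj_on_diff_nat sum.cong\<close>)
  also have "\<dots> \<le> (\<Sum>m. 1 / (kap (m + N))^2)"
    by (rule sum_le_suminf[OF s]) (use assms in auto)
  finally show ?thesis using s by (simp add: kinv_def suminf_nonneg)
qed

lemma sum_kap_le_gen:
  assumes "finite S" "\<And>m. m \<in> S \<Longrightarrow> N \<le> m" "(\<Sum>m\<in>S. (kap m)^2 * (a m)^2) \<le> B^2" "0 \<le> B"
  shows "(\<Sum>m\<in>S. \<bar>a m\<bar>) \<le> kinv N * B"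
proof -
  have "(\<Sum>m\<in>S. \<bar>a m\<bar>) = (\<Sum>m\<in>S. \<bar>1 / kap m\<bar> * \<bar>kap m * a m\<bar>)"
    by (auto intro!: sum.cong simp: abs_mult)
  also have "\<dots> \<le> L2_set (\<lambda>m. 1 / kap m) S * L2_set (\<lambda>m. kap m * a m) S"
    by (rule L2_set_mult_ineq)
  also have "\<dots> \<le> kinv N * B"
    unfolding L2_set_def power_mult_distrib power_divide power_one
    using kinv_sum_le[OF assms(1,2)] assms(3,4)
    by (intro mult_mono real_le_lsqrt) (auto intro!: sum_nonneg)
  finally show ?thesis .
qed

text \<open>The \<open>H^2\<close> norm pays for one extra power of \<open>kap\<close>, so the
  coefficients of the first derivative are absolutely summable as well. Hence one constant
  \<open>C0\<close> bounds a function and its derivative.\<close>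

lemma sum_kap_abs:
  assumes "Hs c" "finite S" "\<And>m. m \<in> S \<Longrightarrow> N \<le> m"
  shows "(\<Sum>m\<in>S. kap m * \<bar>c m\<bar>) \<le> kinv N * nrm c" "(\<Sum>m\<in>S. \<bar>c m\<bar>) \<le> kinv N * nrm c"
proof -
  have "(\<Sum>m\<in>S. \<bar>kap m * c m\<bar>) \<le> kinv N * nrm c"
    using assms nrm_sum_le[OF assms(1,2)]
    by (intro sum_kap_le_gen) (auto simp: power_mult_distrib mult.assoc[symmetric] simp flip: power_add)
  then show *: "(\<Sum>m\<in>S. kap m * \<bar>c m\<bar>) \<le> kinv N * nrm c" by (simp add: abs_mult)
  have "(\<Sum>m\<in>S. \<bar>c m\<bar>) \<le> (\<Sum>m\<in>S. kap m * \<bar>c m\<bar>)"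
    using mult_right_mono[OF kap_ge1 abs_ge_zero] by (intro sum_mono) simp
  then show "(\<Sum>m\<in>S. \<bar>c m\<bar>) \<le> kinv N * nrm c" using * by simp
qed

lemma Hs_summable: assumes "Hs c" shows "summable (\<lambda>m. \<bar>c m\<bar>)"
  by (rule summableI_nonneg_bounded[of _ "kinv 0 * nrm c"]) (use sum_kap_abs(2)[OF assms, of _ 0] in auto)

definition C0 :: real where "C0 = sqrt 2 * kinv 0"

lemma C0_nonneg [simp]: "0 \<le> C0" by (simp add: C0_def)

lemma ser_summable_gen: assumes "summable (\<lambda>m. \<bar>c m\<bar>)" shows "summable (\<lambda>m. c m * eb m x)"
proof (rule summable_rabs_cancel, rule summable_comparison_test_ev)
  show "summable (\<lambda>m. \<bar>c m\<bar> * sqrt 2)" using assms by (rule summable_mult2)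
  show "\<forall>\<^sub>F n in sequentially. norm \<bar>c n * eb n x\<bar> \<le> \<bar>c n\<bar> * sqrt 2"
    using eb_bound by (auto simp: abs_mult intro!: always_eventually mult_left_mono)
qed

lemma ser_summable: "Hs c \<Longrightarrow> summable (\<lambda>m. c m * eb m x)"
  by (intro ser_summable_gen Hs_summable)

lemma ser_abs_le: assumes "summable (\<lambda>m. \<bar>c m\<bar>)" shows "\<bar>ser c x\<bar> \<le> sqrt 2 * (\<Sum>m. \<bar>c m\<bar>)"
proof -
  have s: "summable (\<lambda>m. \<bar>c m * eb m x\<bar>)"
  proof (rule summable_comparison_test_ev)
    show "summable (\<lambda>m. \<bar>c m\<bar> * sqrt 2)" using assms by (rule summable_mult2)
    show "\<forall>\<^sub>F n in sequentially. norm \<bar>c n * eb n x\<bar> \<le> \<bar>c n\<bar> * sqrt 2"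
      using eb_bound by (auto simp: abs_mult intro!: always_eventually mult_left_mono)
  qed
  have "\<bar>ser c x\<bar> \<le> (\<Sum>m. \<bar>c m * eb m x\<bar>)" unfolding ser_def by (rule summable_rabs[OF s])
  also have "\<dots> \<le> (\<Sum>m. sqrt 2 * \<bar>c m\<bar>)"
    using eb_bound by (intro suminf_le s summable_mult assms) (auto simp: abs_mult mult.commute intro!: mult_left_mono)
  finally show ?thesis using assms by (simp add: suminf_mult)
qed

lemma ser_bound: assumes "Hs c" shows "\<bar>ser c x\<bar> \<le> C0 * nrm c"
proof -
  have "(\<Sum>m. \<bar>c m\<bar>) \<le> kinv 0 * nrm c"
    using Hs_summable[OF assms] sum_kap_abs(2)[OF assms, of _ 0] by (intro suminf_le_const) auto
  then have "sqrt 2 * (\<Sum>m. \<bar>c m\<bar>) \<le> C0 * nrm c" unfolding C0_def mult.assoc by (intro mult_left_mono) auto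
  then show ?thesis using ser_abs_le[OF Hs_summable[OF assms], of x] by linarith
qed

lemma ser_diff: "Hs c \<Longrightarrow> Hs d \<Longrightarrow> ser (\<lambda>m. c m - d m) x = ser c x - ser d x"
  unfolding ser_def by (subst suminf_diff) (auto simp: ser_summable algebra_simps)

lemma ser_add: "Hs c \<Longrightarrow> Hs d \<Longrightarrow> ser (\<lambda>m. c m + d m) x = ser c x + ser d x"
  unfolding ser_def by (subst suminf_add) (auto simp: ser_summable algebra_simps)

lemma ser_diff_bound: "Hs c \<Longrightarrow> Hs d \<Longrightarrow> \<bar>ser c x - ser d x\<bar> \<le> C0 * nrmd c d"
  using ser_bound[OF Hs_diff(1), of c d x] by (simp add: ser_diff)

lemma ser_cont_gen: assumes "summable (\<lambda>m. \<bar>c m\<bar>)" shows "continuous_on S (ser c)"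
proof -
  have "uniform_limit S (\<lambda>n x. \<Sum>m<n. c m * eb m x) (ser c) sequentially"
    unfolding ser_def
  proof (rule Weierstrass_m_test)
    show "norm (c n * eb n x) \<le> \<bar>c n\<bar> * sqrt 2" for n x
      using eb_bound by (auto simp: abs_mult intro!: mult_left_mono)
    show "summable (\<lambda>n. \<bar>c n\<bar> * sqrt 2)" using assms by (rule summable_mult2)
  qed
  then show ?thesis
    by (rule uniform_limit_theorem[rotated]) (auto intro!: always_eventually continuous_intros)
qed

lemma ser_cont: "Hs c \<Longrightarrow> continuous_on S (ser c)"
  by (intro ser_cont_gen Hs_summable)

text \<open>Termwise integration against a test function bounded by 2, which covers both the basis
  functions, bounded by \<open>sqrt 2\<close>, and the constant 1 that yields the mean.\<close>

lemma ser_coef_gen: assumes "summable (\<lambda>m. \<bar>c m\<bar>)"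
  shows "tint (\<lambda>x. ser c x * eb m x) = c m" "tint (ser c) = 0"
proof -
  have b: "AE x in torus. summable (\<lambda>i. norm (c i * eb i x * f x))" "summable (\<lambda>i. \<integral>x. norm (c i * eb i x * f x) \<partial>torus)"
    if f: "continuous_on {0..1} f" "\<And>x. \<bar>f x\<bar> \<le> 2" for f
  proof -
    have le: "norm (c i * eb i x * f x) \<le> \<bar>c i\<bar> * (sqrt 2 * 2)" for i x
      unfolding mult.assoc real_norm_def abs_mult using eb_bound[of i x] f(2)[of x]
      by (intro mult_left_mono mult_mono) auto
    show "AE x in torus. summable (\<lambda>i. norm (c i * eb i x * f x))"
      by (intro AE_I2 summable_comparison_test_ev[OF _ summable_mult2[OF assms, of "sqrt 2 * 2"]] always_eventually allI)
         (use le in auto)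
    have "(\<integral>x. norm (c i * eb i x * f x) \<partial>torus) \<le> \<bar>c i\<bar> * (sqrt 2 * 2)" for i
      by (intro torus.integral_le_const AE_I2 le torus_int_cont continuous_intros f)
    then show "summable (\<lambda>i. \<integral>x. norm (c i * eb i x * f x) \<partial>torus)"
      by (intro summable_comparison_test_ev[OF _ summable_mult2[OF assms, of "sqrt 2 * 2"]] always_eventually allI) auto
  qed
  have sw: "tint (\<lambda>x. ser c x * f x) = (\<Sum>i. c i * tint (\<lambda>x. eb i x * f x))"
    if f: "continuous_on {0..1} f" "\<And>x. \<bar>f x\<bar> \<le> 2" for f
  proof -
    have "tint (\<lambda>x. ser c x * f x) = (\<integral>x. (\<Sum>i. c i * eb i x * f x) \<partial>torus)"
      by (simp add: ser_def suminf_mult2[OF ser_summable_gen[OF assms]])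
    also have "\<dots> = (\<Sum>i. \<integral>x. c i * eb i x * f x \<partial>torus)"
      by (rule integral_suminf[OF _ b[OF f]]) (intro torus_int_cont continuous_intros f)
    finally show ?thesis by (simp add: mult.assoc)
  qed
  have "\<bar>eb m x\<bar> \<le> 2" for x using eb_bound[of m x] sqrt2_less_2 by linarith
  from sw[OF eb_cont this] have "tint (\<lambda>x. ser c x * eb m x) = (\<Sum>i. if i = m then c m else 0)"
    by (simp add: eb_orth if_distrib cong: if_cong)
  then show "tint (\<lambda>x. ser c x * eb m x) = c m"
    using sums_unique[OF sums_single[of m "\<lambda>_. c m"]] by simp
  show "tint (ser c) = 0" using sw[of "\<lambda>_. 1"] by (simp add: eb_mean)
qed

lemma tr_Hs [simp]: "Hs (tr N c)"
  unfolding Hs_def by (rule summable_finite[of "{..<N}"]) (auto simp: tr_def)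

lemma tr_nrm_le: "Hs c \<Longrightarrow> nrm (tr N c) \<le> nrm c"
  by (intro nrm_leI(2) order_trans[OF sum_mono nrm_sum_le]) (auto simp: tr_def)

lemma tr_diff: "(\<lambda>m. tr N c m - tr N d m) = tr N (\<lambda>m. c m - d m)"
  by (auto simp: tr_def)

lemma ser_tr: "ser (tr N c) x = (\<Sum>m<N. c m * eb m x)"
  unfolding ser_def by (subst suminf_finite[of "{..<N}"]) (auto simp: tr_def)

lemma tr_tail_sq: assumes "Hs c" shows "(nrmd c (tr N c))^2 = (\<Sum>m. kap (m + N) ^ 4 * (c (m + N))^2)"
proof -
  have "(nrmd c (tr N c))^2 = (\<Sum>m. kap m ^ 4 * (c m - tr N c m)^2)"
    using Hs_diff(1)[OF assms tr_Hs] by (rule nrm_sq)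
  also have "\<dots> = (\<Sum>m. kap (m + N) ^ 4 * (c (m + N) - tr N c (m + N))^2) + (\<Sum>m<N. kap m ^ 4 * (c m - tr N c m)^2)"
    using Hs_diff(1)[OF assms tr_Hs] unfolding Hs_def by (rule suminf_split_initial_segment)
  finally show ?thesis by (simp add: tr_def)
qed

lemma tr_tendsto: assumes "Hs c" shows "(\<lambda>N. nrmd c (tr N c)) \<longlonglongrightarrow> 0"
proof -
  have "(\<lambda>N. \<Sum>m. kap (m + N) ^ 4 * (c (m + N))^2) \<longlonglongrightarrow> 0"
    using suminf_exist_split2[OF assms[unfolded Hs_def]] by simp
  then have "(\<lambda>N. (nrmd c (tr N c))^2) \<longlonglongrightarrow> 0" by (simp add: tr_tail_sq assms)
  from tendsto_real_sqrt[OF this] show ?thesis using Hs_diff(1)[OF assms tr_Hs] by simp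
qed

lemma ser_tr_tendsto: assumes "Hs c" shows "(\<lambda>N. ser (tr N c) x) \<longlonglongrightarrow> ser c x"
  unfolding ser_tr using summable_LIMSEQ[OF ser_summable[OF assms]] by (simp add: ser_def)

lemma ser_tr_unif: assumes "Hs c" shows "uniform_limit S (\<lambda>N. ser (tr N c)) (ser c) sequentially"
proof (rule uniform_limitI)
  fix e :: real assume "e > 0"
  then have "e / (C0 + 1) > 0" by (simp add: add_nonneg_pos)
  from order_tendstoD(2)[OF tr_tendsto[OF assms] this]
  show "\<forall>\<^sub>F n in sequentially. \<forall>x\<in>S. dist (ser (tr n c) x) (ser c x) < e"
  proof eventually_elim
    case (elim N)
    show ?case
    proof
      fix x
      have "\<bar>ser c x - ser (tr N c) x\<bar> \<le> C0 * nrmd c (tr N c)"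
        by (rule ser_diff_bound[OF assms tr_Hs])
      also have "\<dots> \<le> (C0 + 1) * nrmd c (tr N c)"
        using Hs_diff(1)[OF assms tr_Hs] by (intro mult_right_mono) auto
      also have "\<dots> < e" using elim by (simp add: pos_less_divide_eq add_nonneg_pos mult.commute)
      finally show "dist (ser (tr N c) x) (ser c x) < e" by (simp add: dist_real_def abs_minus_commute)
    qed
  qed
qed

section \<open>Completeness of the trigonometric system in L^1\<close>

lemma eb_int_prod: "integrable torus d \<Longrightarrow> integrable torus (\<lambda>x. d x * eb m x)"
  by (rule Bochner_Integration.integrable_bound[of _ "\<lambda>x. sqrt 2 * d x"])
     (use eb_bound[of m] in \<open>auto simp: abs_mult mult.commute intro!: mult_left_mono
        borel_measurable_times[OF borel_measurable_integrable torus_meas_borel[OF eb_meas(1)]]\<close>)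

lemma torus_mult_bounded:
  fixes d h :: "real \<Rightarrow> real"
  assumes "integrable torus d" "continuous_on {0..1} h"
  shows "integrable torus (\<lambda>x. d x * h x)"
proof -
  obtain B where B: "\<And>x. x \<in> {0..1} \<Longrightarrow> \<bar>h x\<bar> \<le> B"
    using compact_imp_bounded[OF compact_continuous_image[OF assms(2) compact_Icc]]
    by (fastforce simp: bounded_iff)
  show ?thesis
  proof (rule Bochner_Integration.integrable_bound[of _ "\<lambda>x. B * d x"])
    show "AE x in torus. norm (d x * h x) \<le> norm (B * d x)"
    proof (rule AE_I2)
      fix x assume "x \<in> space torus"
      then have "\<bar>h x\<bar> \<le> \<bar>B\<bar>" using B[of x] by auto
      then show "norm (d x * h x) \<le> norm (B * d x)"
        using mult_left_mono[of "\<bar>h x\<bar>" "\<bar>B\<bar>" "\<bar>d x\<bar>"] by (simp add: abs_mult mult.commute)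
    qed
    show "(\<lambda>x. d x * h x) \<in> borel_measurable torus"
      by (rule borel_measurable_times[OF borel_measurable_integrable[OF assms(1)] torus_meas_cont[OF assms(2)]])
  qed (use assms in auto)
qed

text \<open>Stone-Weierstrass on the unit circle: a continuous function with equal end values is
  uniformly close to a polynomial in cosine and sine, and orthogonality of \<open>d\<close> to all
  frequencies survives multiplication by cosine and sine through the product-to-sum
  formulas.\<close>

lemma trig_complete_cont:
  fixes d f :: "real \<Rightarrow> real"
  assumes d: "integrable torus d" "tint d = 0"
    and coef0: "\<And>m. tint (\<lambda>x. d x * eb m x) = 0"
    and f: "continuous_on {0..1} f" "f 0 = f 1"
  shows "tint (\<lambda>x. d x * f x) = 0"
proof -
  have base: "tint (\<lambda>x. d x * cos (2 * pi * of_int k * x)) = 0 \<and>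
    tint (\<lambda>x. d x * sin (2 * pi * of_int k * x)) = 0" for k :: int
  proof -
    have pos: "tint (\<lambda>x. d x * cos (2 * pi * real n * x)) = 0 \<and>
      tint (\<lambda>x. d x * sin (2 * pi * real n * x)) = 0" for n
    proof (cases n)
      case 0 then show ?thesis using d by simp
    next
      case (Suc j)
      have "eb (2 * j) x = sqrt 2 * sin (2 * pi * real n * x)"
        "eb (Suc (2 * j)) x = sqrt 2 * cos (2 * pi * real n * x)" for x
        by (simp_all add: eb_def kap_def Suc algebra_simps)
      then show ?thesis using coef0[of "2 * j"] coef0[of "Suc (2 * j)"]
        by (simp add: mult.left_commute[of "d _"])
    qed
    show ?thesis
    proof (cases "k \<ge> 0")
      case True then show ?thesis using pos[of "nat k"] by simp
    next
      case False then show ?thesis using pos[of "nat (- k)"] by simp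
    qed
  qed
  \<comment> \<open>The frequency ranges over all integers, so that the shift from \<open>k\<close>
    to \<open>k - 1\<close> in the product formulas stays inside the family.\<close>
  define P where "P h \<longleftrightarrow> continuous_on {0..1} h \<and> (\<forall>k::int.
      tint (\<lambda>x. d x * (h x * cos (2 * pi * of_int k * x))) = 0 \<and>
      tint (\<lambda>x. d x * (h x * sin (2 * pi * of_int k * x))) = 0)" for h :: "real \<Rightarrow> real"
  have Pint: "integrable torus (\<lambda>x. d x * (h x * cos (2 * pi * of_int k * x)))"
    "integrable torus (\<lambda>x. d x * (h x * sin (2 * pi * of_int k * x)))" if "P h" for h and k :: int
    using that unfolding P_def by (auto intro!: torus_mult_bounded d continuous_intros)
  have Padd: "P (\<lambda>x. g x + h x)" if "P g" "P h" for g h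
    using that unfolding P_def distrib_left distrib_right
    by (simp add: Bochner_Integration.integral_add[OF Pint(1)[OF that(1)] Pint(1)[OF that(2)]]
        Bochner_Integration.integral_add[OF Pint(2)[OF that(1)] Pint(2)[OF that(2)]] continuous_on_add)
  have Pscale: "P (\<lambda>x. a * h x)" if "P h" for h a
    using that unfolding P_def mult.assoc mult.left_commute[of "d _" a] integral_mult_right_zero
    by (simp add: continuous_on_mult_left)
  have Pcs: "P (\<lambda>x. cos (2 * pi * x) * h x) \<and> P (\<lambda>x. sin (2 * pi * x) * h x)" if h: "P h" for h
  proof -
    note I = Pint[OF h]
    have c: "2 * pi * of_int (k + 1) * x = 2 * pi * of_int k * x + 2 * pi * x"
      "2 * pi * of_int (k - 1) * x = 2 * pi * of_int k * x - 2 * pi * x" for k :: int and x :: real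
      by (simp_all add: algebra_simps)
    have z: "tint (\<lambda>x. d x * (h x * cos (2 * pi * of_int k * x))) = 0"
      "tint (\<lambda>x. d x * (h x * sin (2 * pi * of_int k * x))) = 0" for k :: int
      using h unfolding P_def by auto
    have prod: "tint (\<lambda>x. d x * ((u x * h x) * v x)) = 0"
      if e: "\<And>x. u x * v x = 1/2 * (p x + r * q x)" and i: "integrable torus (\<lambda>x. d x * (h x * p x))" "integrable torus (\<lambda>x. d x * (h x * q x))"
        and z: "tint (\<lambda>x. d x * (h x * p x)) = 0" "tint (\<lambda>x. d x * (h x * q x)) = 0" for u v p q r
    proof -
      have "tint (\<lambda>x. d x * ((u x * h x) * v x)) = tint (\<lambda>x. 1/2 * (d x * (h x * p x)) + r/2 * (d x * (h x * q x)))"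
      proof (intro Bochner_Integration.integral_cong refl)
        fix x
        have "d x * ((u x * h x) * v x) = d x * (h x * (u x * v x))" by simp
        then show "d x * ((u x * h x) * v x) = 1/2 * (d x * (h x * p x)) + r/2 * (d x * (h x * q x))" unfolding e by (simp add: algebra_simps)
      qed
      then show ?thesis using i z by simp
    qed
    have 1: "tint (\<lambda>x. d x * ((cos (2 * pi * x) * h x) * cos (2 * pi * of_int k * x))) = 0" for k :: int
      by (rule prod[OF _ I(1)[of "k + 1"] I(1)[of "k - 1"] z(1)[of "k + 1"] z(1)[of "k - 1"], where r=1]) (simp add: c cos_add cos_diff algebra_simps)
    have 2: "tint (\<lambda>x. d x * ((cos (2 * pi * x) * h x) * sin (2 * pi * of_int k * x))) = 0" for k :: int
      by (rule prod[OF _ I(2)[of "k + 1"] I(2)[of "k - 1"] z(2)[of "k + 1"] z(2)[of "k - 1"], where r=1]) (simp add: c sin_add sin_diff algebra_simps)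
    have 3: "tint (\<lambda>x. d x * ((sin (2 * pi * x) * h x) * cos (2 * pi * of_int k * x))) = 0" for k :: int
      by (rule prod[OF _ I(2)[of "k + 1"] I(2)[of "k - 1"] z(2)[of "k + 1"] z(2)[of "k - 1"], where r="-1"]) (simp add: c sin_add sin_diff algebra_simps)
    have 4: "tint (\<lambda>x. d x * ((sin (2 * pi * x) * h x) * sin (2 * pi * of_int k * x))) = 0" for k :: int
      by (rule prod[OF _ I(1)[of "k - 1"] I(1)[of "k + 1"] z(1)[of "k - 1"] z(1)[of "k + 1"], where r="-1"]) (simp add: c cos_add cos_diff algebra_simps)
    have "continuous_on {0..1} h" using h by (simp add: P_def)
    then show ?thesis using 1 2 3 4 unfolding P_def by (auto intro!: continuous_intros)
  qed
  have poly: "P h \<Longrightarrow> P (\<lambda>x. g (cis (2 * pi * x)) * h x)" if "real_polynomial_function g" for g h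
    using that
  proof (induction arbitrary: h rule: real_polynomial_function.induct)
    case (linear f)
    interpret f: bounded_linear f by fact
    have "f (cis t) = f 1 * cos t + f \<i> * sin t" for t
    proof -
      have "cis t = cos t *\<^sub>R 1 + sin t *\<^sub>R \<i>" by (simp add: complex_eq_iff)
      then have "f (cis t) = f (cos t *\<^sub>R 1 + sin t *\<^sub>R \<i>)" by (rule arg_cong)
      also have "\<dots> = f 1 * cos t + f \<i> * sin t" unfolding f.add f.scaleR by simp
      finally show ?thesis .
    qed
    then have "(\<lambda>x. f (cis (2 * pi * x)) * h x) = (\<lambda>x. f 1 * (cos (2 * pi * x) * h x) + f \<i> * (sin (2 * pi * x) * h x))"
      by (simp only: distrib_right mult.assoc)
    moreover have "P (\<lambda>x. f 1 * (cos (2 * pi * x) * h x) + f \<i> * (sin (2 * pi * x) * h x))"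
      using Pcs[OF linear(2)] by (intro Padd Pscale) auto
    ultimately show ?case by (simp only:)
  next
    case (const c) show ?case by (rule Pscale[OF const])
  next
    case (add f g) show ?case unfolding distrib_right by (rule Padd[OF add.IH(1)[OF add.prems] add.IH(2)[OF add.prems]])
  next
    case (mult f g)
    from mult.IH(1)[OF mult.IH(2)[OF mult.prems]] show ?case by (simp only: mult.assoc)
  qed
  have P1: "P (\<lambda>x. 1)" unfolding P_def using base by auto
  have small: "\<bar>tint (\<lambda>x. d x * f x)\<bar> \<le> e * tint (\<lambda>x. \<bar>d x\<bar>)" if "e > 0" for e
  proof -
    let ?G = "f \<circ> (\<lambda>z. Arg2pi z / (2 * pi))"
    \<comment> \<open>The trivial homotopy of the loop \<open>f\<close> with itself is a device for
      obtaining continuity of \<open>f\<close> transported to the circle by the argument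
      function.\<close>
    have "homotopic_loops UNIV f f"
      using f by (simp add: homotopic_loops_refl path_def pathfinish_def pathstart_def)
    from homotopic_with_imp_continuous[OF homotopic_loops_imp_homotopic_circlemaps[OF this]]
    have "continuous_on (sphere 0 1) ?G" by auto
    then obtain g where g: "real_polynomial_function g" "\<And>x. x \<in> sphere 0 1 \<Longrightarrow> \<bar>?G x - g x\<bar> < e"
      using Stone_Weierstrass_real_polynomial_function[OF compact_sphere] \<open>e > 0\<close> by blast
    have gf: "\<bar>f x - g (cis (2 * pi * x))\<bar> < e" if "x \<in> {0..1}" for x
    proof (cases "x = 1")
      case True
      then show ?thesis using g(2)[of 1] f(2) by (simp add: Arg2pi_of_real[of 1, simplified])
    next
      case False
      then have "Arg2pi (exp (\<i> * of_real (2 * pi * x))) = 2 * pi * x"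
        using that by (intro Arg2pi_unique[of 1]) auto
      then show ?thesis using g(2)[of "cis (2 * pi * x)"] by (simp add: cis_conv_exp)
    qed
    have Pg: "P (\<lambda>x. g (cis (2 * pi * x)))" using poly[OF g(1) P1] by simp
    then have 0: "tint (\<lambda>x. d x * g (cis (2 * pi * x))) = 0"
      unfolding P_def by (auto dest: spec[of _ 0])
    have i: "integrable torus (\<lambda>x. d x * f x)" "integrable torus (\<lambda>x. d x * g (cis (2 * pi * x)))"
      using Pg f unfolding P_def by (auto intro!: torus_mult_bounded d)
    have le: "\<bar>d x * f x - d x * g (cis (2 * pi * x))\<bar> \<le> e * \<bar>d x\<bar>" if "x \<in> space torus" for x
    proof -
      have "\<bar>f x - g (cis (2 * pi * x))\<bar> \<le> e" using gf[of x] that by simp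
      from mult_left_mono[OF this abs_ge_zero[of "d x"]] show ?thesis
        unfolding right_diff_distrib[symmetric] abs_mult mult.commute[of e] .
    qed
    have "\<bar>tint (\<lambda>x. d x * f x - d x * g (cis (2 * pi * x)))\<bar>
        \<le> tint (\<lambda>x. \<bar>d x * f x - d x * g (cis (2 * pi * x))\<bar>)"
      by (rule integral_abs_bound)
    also have "\<dots> \<le> tint (\<lambda>x. e * \<bar>d x\<bar>)"
      by (intro integral_mono integrable_abs Bochner_Integration.integrable_diff i integrable_mult_right d le)
    finally have "\<bar>tint (\<lambda>x. d x * f x - d x * g (cis (2 * pi * x)))\<bar> \<le> e * tint (\<lambda>x. \<bar>d x\<bar>)"
      by simp
    then show ?thesis by (simp add: Bochner_Integration.integral_diff[OF i] 0)
  qed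
  have "\<bar>tint (\<lambda>x. d x * f x)\<bar> \<le> 0"
  proof (rule field_le_epsilon)
    fix r :: real assume "r > 0"
    define b where "b = tint (\<lambda>x. \<bar>d x\<bar>)"
    have b: "b \<ge> 0" unfolding b_def by (rule integral_nonneg_AE) auto
    then have "r / (b + 1) > 0" using \<open>r > 0\<close> by (intro divide_pos_pos) linarith+
    note small[OF this, folded b_def]
    also have "r / (b + 1) * b = r * (b / (b + 1))" by simp
    also have "\<dots> \<le> r * 1" using b \<open>r > 0\<close> by (intro mult_left_mono) (auto simp: divide_le_eq)
    finally show "\<bar>tint (\<lambda>x. d x * f x)\<bar> \<le> 0 + r" by simp
  qed
  then show ?thesis by simp
qed

text \<open>Testing against \<open>sgn (d x)\<close> gives the integral of \<bar>d\<bar>;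
  measurability supplies continuous functions that converge to the sign almost everywhere.\<close>

lemma trig_complete:
  fixes d :: "real \<Rightarrow> real"
  assumes d: "integrable torus d" "tint d = 0"
    and coef0: "\<And>m. tint (\<lambda>x. d x * eb m x) = 0"
  shows "AE x in torus. d x = 0"
proof -
  have "(\<lambda>x. sgn (d x)) \<in> borel_measurable torus"
    using borel_measurable_integrable[OF d(1)] by (simp add: borel_measurable_sgn)
  then have "(\<lambda>x. sgn (d x)) measurable_on {0..1}"
    by (subst measurable_on_iff_borel_measurable) auto
  then obtain N g where N: "negligible N" and g: "\<And>n. continuous_on UNIV (g n)"
    and lim: "\<And>x. x \<notin> N \<Longrightarrow> (\<lambda>n. g n x) \<longlonglongrightarrow> (if x \<in> {0..1} then sgn (d x) else 0)"
    unfolding measurable_on_def by blast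
  \<comment> \<open>The clamp to [-1,1] provides the dominating function \<bar>d\<bar>. The second
    factor vanishes at 0 and 1, which makes the end values equal, and tends to 1 in between.\<close>
  define f where "f n x = max (-1) (min 1 (g n x)) * min 1 (real n * (x * (1 - x)))" for n x
  have fc: "continuous_on {0..1} (f n)" for n
    unfolding f_def by (intro continuous_intros continuous_on_subset[OF g]) auto
  have fb: "\<bar>f n x\<bar> \<le> 1" if "x \<in> {0..1}" for n x
  proof -
    have "0 \<le> real n * (x * (1 - x))" using that by auto
    then have "\<bar>max (-1) (min 1 (g n x))\<bar> \<le> 1" "\<bar>min 1 (real n * (x * (1 - x)))\<bar> \<le> 1" by auto
    from mult_mono[OF this] show ?thesis unfolding f_def abs_mult by simp
  qed
  have zero: "tint (\<lambda>x. d x * f n x) = 0" for n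
    by (rule trig_complete_cont[OF d coef0 fc]) (simp add: f_def)
  have "N \<in> null_sets lebesgue" using N by (simp add: negligible_iff_null_sets)
  then have "AE x in lebesgue. x \<notin> N" by (rule AE_not_in)
  moreover have "AE x in lebesgue. x \<noteq> (0::real)" "AE x in lebesgue. x \<noteq> (1::real)"
    by (auto intro!: AE_not_in negligible_sing[unfolded negligible_iff_null_sets] simp: AE_completion AE_lborel_singleton)
  ultimately have ae: "AE x in torus. x \<notin> N \<and> 0 < x \<and> x < 1"
    by (subst AE_restrict_space_iff) (auto simp: less_eq_real_def)
  have "(\<lambda>n. tint (\<lambda>x. d x * f n x)) \<longlonglongrightarrow> tint (\<lambda>x. d x * sgn (d x))"
  proof (rule integral_dominated_convergence[where w="\<lambda>x. \<bar>d x\<bar>"])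
    show "AE x in torus. (\<lambda>n. d x * f n x) \<longlonglongrightarrow> d x * sgn (d x)"
      using ae
    proof eventually_elim
      case (elim x)
      have l1: "(\<lambda>n. max (-1) (min 1 (g n x))) \<longlonglongrightarrow> max (-1) (min 1 (sgn (d x)))"
        using lim[of x] elim by (intro tendsto_intros) auto
      have "x * (1 - x) > 0" using elim by simp
      then obtain n0 :: nat where n0: "1 < real n0 * (x * (1 - x))" using reals_Archimedean3 by blast
      have "\<forall>\<^sub>F n in sequentially. min 1 (real n * (x * (1 - x))) = 1"
        using eventually_ge_at_top[of n0]
      proof eventually_elim
        case (elim n)
        then have "real n0 * (x * (1 - x)) \<le> real n * (x * (1 - x))"
          using \<open>x * (1 - x) > 0\<close> by (intro mult_right_mono) auto
        then show ?case using n0 by simp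
      qed
      then have l2: "(\<lambda>n. min 1 (real n * (x * (1 - x)))) \<longlonglongrightarrow> 1" by (rule tendsto_eventually)
      have "max (-1) (min 1 (sgn (d x))) = sgn (d x)" by (auto simp: sgn_if)
      then show ?case unfolding f_def using tendsto_mult[OF tendsto_const tendsto_mult[OF l1 l2], of "d x"] by simp
    qed
    show "AE x in torus. norm (d x * f n x) \<le> \<bar>d x\<bar>" for n
      using fb by (auto simp: abs_mult intro!: AE_I2 mult_left_le)
    show "(\<lambda>x. d x * f n x) \<in> borel_measurable torus" for n
      by (rule borel_measurable_times[OF borel_measurable_integrable[OF d(1)] torus_meas_cont[OF fc]])
    show "(\<lambda>x. d x * sgn (d x)) \<in> borel_measurable torus"
      using borel_measurable_integrable[OF d(1)] \<open>(\<lambda>x. sgn (d x)) \<in> borel_measurable torus\<close> by (rule borel_measurable_times)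
  qed (use d in auto)
  then have "tint (\<lambda>x. d x * sgn (d x)) = 0" using LIMSEQ_unique[OF _ tendsto_const] by (simp add: zero)
  then have "tint (\<lambda>x. \<bar>d x\<bar>) = 0" by (simp add: abs_sgn)
  then have "AE x in torus. \<bar>d x\<bar> = 0" using d(1) by (subst (asm) integral_nonneg_eq_0_iff_AE) auto
  then show ?thesis by simp
qed

lemma L20_integrable: "L20 v \<Longrightarrow> integrable torus v"
  unfolding L20_def by (auto intro: torus.square_integrable_imp_integrable)

lemma ser_coef: assumes "Hs c" shows "coef (ser c) (Suc m) = c m"
  by (simp add: coef_Suc ser_coef_gen(1)[OF Hs_summable[OF assms]])

lemma ser_L20: assumes "Hs c" shows "L20 (ser c)"
  unfolding L20_def using ser_coef_gen(2)[OF Hs_summable[OF assms]]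
  by (auto intro!: torus_meas_cont torus_int_cont continuous_intros ser_cont assms)

lemma ser_H20: "Hs c \<Longrightarrow> H20 (ser c)"
  by (simp add: H20_iff ser_L20 ser_coef)

text \<open>The difference from the series is integrable with vanishing mean and coefficients. The
  lemma identifies members of \<open>H20\<close> with their series and later represents the
  transport term of a truncation.\<close>

lemma trig_ext:
  assumes "integrable torus v" "tint v = 0" "summable (\<lambda>m. \<bar>tint (\<lambda>x. v x * eb m x)\<bar>)"
  shows "AE x in torus. v x = ser (\<lambda>m. tint (\<lambda>x. v x * eb m x)) x"
proof -
  let ?s = "ser (\<lambda>m. tint (\<lambda>x. v x * eb m x))"
  have i: "integrable torus ?s" by (intro torus_int_cont ser_cont_gen assms)
  have "AE x in torus. v x - ?s x = 0"
  proof (rule trig_complete)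
    show "integrable torus (\<lambda>x. v x - ?s x)" "tint (\<lambda>x. v x - ?s x) = 0"
      using i assms ser_coef_gen(2)[OF assms(3)] by auto
    show "tint (\<lambda>x. (v x - ?s x) * eb m x) = 0" for m
      using eb_int_prod[OF assms(1), of m] eb_int_prod[OF i, of m] ser_coef_gen(1)[OF assms(3), of m]
      by (simp add: left_diff_distrib)
  qed
  then show ?thesis by simp
qed

lemma H20_ser_AE: assumes "H20 v" shows "AE x in torus. v x = ser (\<lambda>m. coef v (Suc m)) x"
proof -
  have v: "L20 v" "Hs (\<lambda>m. coef v (Suc m))" using assms by (auto simp: H20_iff)
  have "tint v = 0" using v(1) by (simp add: L20_def)
  from trig_ext[OF L20_integrable[OF v(1)] this Hs_summable[OF v(2), unfolded coef_Suc]]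
  show ?thesis unfolding coef_Suc .
qed

lemma coef_diff: assumes "L20 u" "L20 v" shows "coef (u - v) (Suc m) = coef u (Suc m) - coef v (Suc m)"
  using eb_int_prod[OF L20_integrable[OF assms(1)], of m] eb_int_prod[OF L20_integrable[OF assms(2)], of m]
  by (simp add: coef_Suc left_diff_distrib)

lemma L20_lincomb:
  assumes "\<And>k. k \<in> S \<Longrightarrow> L20 (g k)" "finite S"
  shows "coef (\<lambda>x. \<Sum>k\<in>S. a k * g k x) (Suc m) = (\<Sum>k\<in>S. a k * coef (g k) (Suc m))"
proof -
  have i: "integrable torus (\<lambda>x. g k x * eb m x)" if "k \<in> S" for k
    using eb_int_prod[OF L20_integrable[OF assms(1)[OF that]]] .
  have "coef (\<lambda>x. \<Sum>k\<in>S. a k * g k x) (Suc m) = tint (\<lambda>x. \<Sum>k\<in>S. a k * (g k x * eb m x))"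
    by (simp add: coef_Suc sum_distrib_right mult.assoc)
  also have "\<dots> = (\<Sum>k\<in>S. a k * tint (\<lambda>x. g k x * eb m x))"
    using i by (subst Bochner_Integration.integral_sum) auto
  finally show ?thesis by (simp add: coef_Suc)
qed

lemma torus_measure [simp]: "measure torus {0..1} = 1"
  using torus.prob_space by simp

section \<open>Trigonometric polynomials, their derivatives and Bessel estimates\<close>

definition tp :: "nat \<Rightarrow> seq \<Rightarrow> real \<Rightarrow> real" where "tp N c x = (\<Sum>m<N. c m * eb m x)"
definition tp1 :: "nat \<Rightarrow> seq \<Rightarrow> real \<Rightarrow> real" where "tp1 N c x = (\<Sum>m<N. c m * deb m x)"
definition tp2 :: "nat \<Rightarrow> seq \<Rightarrow> real \<Rightarrow> real" where "tp2 N c x = (\<Sum>m<N. (- (kap m)\<^sup>2 * c m) * eb m x)"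

lemma ser_tr_tp: "ser (tr N c) = tp N c"
  by (rule ext) (simp add: ser_tr tp_def)

lemma tp_deriv: "(tp N c has_real_derivative tp1 N c x) (at x within S)"
  unfolding tp_def[abs_def] tp1_def by (intro DERIV_sum DERIV_cmult eb_deriv)

lemma tp1_deriv: "(tp1 N c has_real_derivative tp2 N c x) (at x within S)"
proof -
  have "((\<lambda>x. \<Sum>m<N. c m * deb m x) has_real_derivative (\<Sum>m<N. c m * (- ((kap m)^2 * eb m x)))) (at x within S)"
    by (intro DERIV_sum DERIV_cmult deb_deriv)
  then show ?thesis by (simp add: tp1_def[abs_def] tp2_def mult_ac)
qed

lemma tp_cont [continuous_intros]: "continuous_on S (tp N c)" "continuous_on S (tp1 N c)" "continuous_on S (tp2 N c)"
  unfolding tp_def[abs_def] tp1_def[abs_def] tp2_def[abs_def] by (intro continuous_intros)+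

lemma tp_per: "tp N c 1 = tp N c 0" "tp1 N c 1 = tp1 N c 0"
  by (simp_all add: tp_def tp1_def eb_periodic deb_periodic)

lemma tp_bound: "Hs c \<Longrightarrow> \<bar>tp N c x\<bar> \<le> C0 * nrm c"
  using ser_bound[OF tr_Hs, of N c x] mult_left_mono[OF tr_nrm_le[of c N] C0_nonneg]
  by (simp add: ser_tr_tp)

lemma deb_bound: "\<bar>deb m x\<bar> \<le> sqrt 2 * kap m"
  using eb_bound[of "pr m" x] by (simp add: deb_def abs_mult mult.commute)

lemma tp1_bound: assumes "Hs c" shows "\<bar>tp1 N c x\<bar> \<le> C0 * nrm c"
proof -
  have "\<bar>tp1 N c x\<bar> \<le> (\<Sum>m<N. sqrt 2 * (kap m * \<bar>c m\<bar>))"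
    unfolding tp1_def
    by (rule order_trans[OF sum_abs], rule sum_mono, subst abs_mult)
      (rule order_trans[OF mult_left_mono[OF deb_bound abs_ge_zero]], simp)
  also have "\<dots> \<le> sqrt 2 * (kinv 0 * nrm c)"
    unfolding sum_distrib_left[symmetric] using sum_kap_abs(1)[OF assms, of "{..<N}" 0]
    by (intro mult_left_mono) auto
  finally show ?thesis by (simp add: C0_def mult.assoc)
qed

lemma tp_diff: "tp N c x - tp N d x = tp N (\<lambda>m. c m - d m) x"
  "tp1 N c x - tp1 N d x = tp1 N (\<lambda>m. c m - d m) x"
  "tp2 N c x - tp2 N d x = tp2 N (\<lambda>m. c m - d m) x"
  unfolding tp_def tp1_def tp2_def sum_subtractf[symmetric]
  by (auto intro!: sum.cong simp: algebra_simps)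

lemma tp2_L2: "tint (\<lambda>x. (tp2 N c x)^2) = (\<Sum>m<N. kap m ^ 4 * (c m)^2)"
  unfolding tp2_def trig_sum_L2[OF finite_lessThan] by (simp add: power_mult_distrib flip: power_mult)

lemma tp2_L2_le: "Hs c \<Longrightarrow> tint (\<lambda>x. (tp2 N c x)^2) \<le> (nrm c)^2"
  by (simp add: tp2_L2 nrm_sum_le)

text \<open>Differentiation swaps each sine with its cosine, so the orthonormal expansion runs over
  the image of the index set under \<open>pr\<close>.\<close>

lemma tp1_L2: "tint (\<lambda>x. (tp1 N c x)^2) = (\<Sum>m<N. (kap m)^2 * (c m)^2)"
proof -
  have "tp1 N c x = (\<Sum>k\<in>pr ` {..<N}. (c (pr k) * (sg (pr k) * kap k)) * eb k x)" for x
    unfolding tp1_def deb_def by (subst sum.reindex[OF inj_pr]) (auto intro!: sum.cong)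
  then have "tint (\<lambda>x. (tp1 N c x)^2) = (\<Sum>k\<in>pr ` {..<N}. (c (pr k) * (sg (pr k) * kap k))^2)"
    by (simp only: trig_sum_L2 finite_imageI finite_lessThan)
  also have "\<dots> = (\<Sum>m<N. (kap m)^2 * (c m)^2)"
    by (subst sum.reindex[OF inj_pr]) (auto intro!: sum.cong simp: power_mult_distrib)
  finally show ?thesis .
qed

lemma deriv_coef1:
  assumes "\<And>x. x \<in> {0..1} \<Longrightarrow> (h has_real_derivative h1 x) (at x within {0..1})" "continuous_on {0..1} h1" "h 1 = h 0"
  shows "tint (\<lambda>x. h x * deb m x) = - tint (\<lambda>x. h1 x * eb m x)"
  using assms by (intro torus_IBP) (auto intro!: eb_deriv continuous_intros simp: eb_periodic)

lemma deriv_coef2: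
  assumes "\<And>x. x \<in> {0..1} \<Longrightarrow> (h has_real_derivative h1 x) (at x within {0..1})" "h 1 = h 0"
    and "\<And>x. x \<in> {0..1} \<Longrightarrow> (h1 has_real_derivative h2 x) (at x within {0..1})" "continuous_on {0..1} h2" "h1 1 = h1 0"
  shows "kap m * tint (\<lambda>x. h x * deb m x) = - sg m * tint (\<lambda>x. h2 x * eb (pr m) x)"
proof -
  have c: "continuous_on {0..1} h1"
    using assms(3) by (meson DERIV_continuous continuous_on_eq_continuous_within)
  have "kap m * tint (\<lambda>x. h x * deb m x) = - (kap m * tint (\<lambda>x. h1 x * eb m x))"
    using deriv_coef1[OF assms(1) c assms(2)] by simp
  also have "kap m * tint (\<lambda>x. h1 x * eb m x) = - sg m * tint (\<lambda>x. h1 x * deb (pr m) x)"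
    unfolding deb_def by (subst (1 2) integral_mult_right_zero[symmetric]) (simp add: mult_ac)
  also have "tint (\<lambda>x. h1 x * deb (pr m) x) = - tint (\<lambda>x. h2 x * eb (pr m) x)"
    using deriv_coef1[OF assms(3-5)] by simp
  finally show ?thesis by simp
qed

lemma bessel1:
  assumes "\<And>x. x \<in> {0..1} \<Longrightarrow> (h has_real_derivative h1 x) (at x within {0..1})" "continuous_on {0..1} h1" "h 1 = h 0"
    "finite S"
  shows "(\<Sum>m\<in>S. (tint (\<lambda>x. h x * deb m x))^2) \<le> tint (\<lambda>x. (h1 x)^2)"
  using bessel[OF assms(2,4)] deriv_coef1[OF assms(1-3)] by simp

text \<open>The second derivative of \<open>h\<close> pays for the extra power of
  \<open>kap\<close>. The second integration by parts lands on the partner mode, and injectivity of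
  \<open>pr\<close> keeps Bessel's inequality applicable.\<close>

lemma bessel2:
  assumes "\<And>x. x \<in> {0..1} \<Longrightarrow> (h has_real_derivative h1 x) (at x within {0..1})" "h 1 = h 0"
    and "\<And>x. x \<in> {0..1} \<Longrightarrow> (h1 has_real_derivative h2 x) (at x within {0..1})" "continuous_on {0..1} h2" "h1 1 = h1 0"
    and "finite S"
  shows "(\<Sum>m\<in>S. (kap m)^2 * (tint (\<lambda>x. h x * deb m x))^2) \<le> tint (\<lambda>x. (h2 x)^2)"
proof -
  have "(\<Sum>m\<in>S. (kap m)^2 * (tint (\<lambda>x. h x * deb m x))^2)
      = (\<Sum>m\<in>S. (tint (\<lambda>x. h2 x * eb (pr m) x))^2)"
    using deriv_coef2[OF assms(1-5)] by (simp flip: power_mult_distrib) (simp add: power_mult_distrib)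
  also have "\<dots> = (\<Sum>k\<in>pr ` S. (tint (\<lambda>x. h2 x * eb k x))^2)"
    by (subst sum.reindex[OF inj_pr]) simp
  also have "\<dots> \<le> tint (\<lambda>x. (h2 x)^2)"
    by (rule bessel[OF assms(4)]) (use assms in auto)
  finally show ?thesis .
qed

definition h1sq :: "seq \<Rightarrow> real" where "h1sq c = (\<Sum>m. (kap m)^2 * (c m)^2)"

lemma h1_summable: assumes "Hs c" shows "summable (\<lambda>m. (kap m)^2 * (c m)^2)"
proof (rule summable_comparison_test_ev[OF _ assms[unfolded Hs_def]], rule always_eventually, rule allI)
  fix m
  have "(kap m)^2 \<le> kap m ^ 4" using kap_ge1[of m] by (intro power_increasing) auto
  then show "norm ((kap m)^2 * (c m)^2) \<le> kap m ^ 4 * (c m)^2" by (simp add: mult_right_mono)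
qed

lemma h1sq_le: assumes "Hs c" shows "h1sq c \<le> (nrm c)^2"
  unfolding h1sq_def nrm_sq[OF assms]
proof (intro suminf_le h1_summable assms assms[unfolded Hs_def] allI)
  fix m
  have "(kap m)^2 \<le> kap m ^ 4" using kap_ge1[of m] by (intro power_increasing) auto
  then show "(kap m)^2 * (c m)^2 \<le> kap m ^ 4 * (c m)^2" by (simp add: mult_right_mono)
qed

lemma h1sq_nonneg: "Hs c \<Longrightarrow> 0 \<le> h1sq c"
  unfolding h1sq_def by (intro suminf_nonneg h1_summable) auto

lemma h1sq_sum_le: "Hs c \<Longrightarrow> finite S \<Longrightarrow> (\<Sum>m\<in>S. (kap m)^2 * (c m)^2) \<le> h1sq c"
  unfolding h1sq_def by (intro sum_le_suminf h1_summable) auto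

subsection \<open>The nonlinearity\<close>

locale flux =
  fixes A :: "real \<Rightarrow> real" and \<nu> :: real
  assumes flux: "flux_assms A" and nu: "\<nu> > 0"
begin

abbreviation mu :: seq where "mu m \<equiv> \<nu> * (kap m)^2"

lemma A_deriv: "(A has_real_derivative deriv A x) (at x within S)"
proof -
  have "A differentiable (at x)" using flux unfolding flux_assms_def by blast
  then show ?thesis
    unfolding DERIV_deriv_iff_real_differentiable[symmetric] by (rule has_field_derivative_at_within)
qed

lemma A1_deriv: "(deriv A has_real_derivative deriv (deriv A) x) (at x within S)"
proof -
  have "deriv A differentiable (at x)" using flux unfolding flux_assms_def by blast
  then show ?thesis
    unfolding DERIV_deriv_iff_real_differentiable[symmetric] by (rule has_field_derivative_at_within)
qed

lemma A_cont: "continuous_on S A"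
  using A_deriv by (meson DERIV_continuous continuous_on_eq_continuous_within)

lemma A1_cont: "continuous_on S (deriv A)"
  using A1_deriv by (meson DERIV_continuous continuous_on_eq_continuous_within)

lemma A2_lip: "\<exists>L\<ge>0. \<forall>x y. \<bar>x\<bar> \<le> R \<longrightarrow> \<bar>y\<bar> \<le> R \<longrightarrow> \<bar>deriv (deriv A) x - deriv (deriv A) y\<bar> \<le> L * \<bar>x - y\<bar>"
proof -
  obtain L where L: "\<And>x y. \<bar>x\<bar> \<le> R \<Longrightarrow> \<bar>y\<bar> \<le> R \<Longrightarrow> \<bar>deriv (deriv A) x - deriv (deriv A) y\<bar> \<le> L * \<bar>x - y\<bar>"
    using flux unfolding flux_assms_def by meson
  have "L * a \<le> \<bar>L\<bar> * a" if "0 \<le> a" for a using that by (intro mult_right_mono) auto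
  then show ?thesis using L by (intro exI[of _ "\<bar>L\<bar>"]) (meson abs_ge_zero order_trans)
qed

text \<open>Continuity of the second derivative is drawn from its local Lipschitz bound, since the
  other clauses of \<open>flux_assms\<close> speak of differentiability of \<open>A\<close> and
  \<open>deriv A\<close> only.\<close>

lemma A2_cont: "continuous_on S (deriv (deriv A))"
proof -
  have "isCont (deriv (deriv A)) x" for x
  proof -
    obtain L where L: "L \<ge> 0" "\<And>u v. \<bar>u\<bar> \<le> \<bar>x\<bar> + 1 \<Longrightarrow> \<bar>v\<bar> \<le> \<bar>x\<bar> + 1 \<Longrightarrow>
        \<bar>deriv (deriv A) u - deriv (deriv A) v\<bar> \<le> L * \<bar>u - v\<bar>"
      using A2_lip[of "\<bar>x\<bar> + 1"] by blast
    have "((\<lambda>u. deriv (deriv A) u - deriv (deriv A) x) \<longlongrightarrow> 0) (at x)"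
    proof (rule Lim_null_comparison)
      show "\<forall>\<^sub>F u in at x. norm (deriv (deriv A) u - deriv (deriv A) x) \<le> L * \<bar>u - x\<bar>"
        using eventually_at_ball[of 1 x UNIV, simplified]
        by eventually_elim (auto simp: dist_real_def intro!: L(2))
      show "((\<lambda>u. L * \<bar>u - x\<bar>) \<longlongrightarrow> 0) (at x)" by (auto intro!: tendsto_eq_intros)
    qed
    then show ?thesis by (simp add: isCont_def LIM_zero_iff)
  qed
  then show ?thesis by (simp add: continuous_at_imp_continuous_on)
qed

lemma A_meas [measurable]: "A \<in> borel_measurable borel"
  by (intro borel_measurable_continuous_onI A_cont)

lemma A_bounds: "\<exists>M\<ge>0. \<forall>x y. \<bar>x\<bar> \<le> R \<longrightarrow> \<bar>y\<bar> \<le> R \<longrightarrow> \<bar>A x\<bar> \<le> M \<and> \<bar>deriv A x\<bar> \<le> M \<and> \<bar>deriv (deriv A) x\<bar> \<le> M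
   \<and> \<bar>deriv A x - deriv A y\<bar> \<le> M * \<bar>x - y\<bar> \<and> \<bar>deriv (deriv A) x - deriv (deriv A) y\<bar> \<le> M * \<bar>x - y\<bar>"
proof -
  obtain L where L: "L \<ge> 0" "\<And>u v. \<bar>u\<bar> \<le> R \<Longrightarrow> \<bar>v\<bar> \<le> R \<Longrightarrow> \<bar>deriv (deriv A) u - deriv (deriv A) v\<bar> \<le> L * \<bar>u - v\<bar>"
    using A2_lip[of R] by blast
  have bd: "\<exists>B. \<forall>x\<in>{-R..R}. \<bar>f x\<bar> \<le> B" if "continuous_on {-R..R} f" for f :: "real \<Rightarrow> real"
    using compact_imp_bounded[OF compact_continuous_image[OF that compact_Icc]]
    by (auto simp: bounded_iff)
  obtain B0 B1 B2 where B: "\<forall>x\<in>{-R..R}. \<bar>A x\<bar> \<le> B0" "\<forall>x\<in>{-R..R}. \<bar>deriv A x\<bar> \<le> B1" "\<forall>x\<in>{-R..R}. \<bar>deriv (deriv A) x\<bar> \<le> B2"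
    using bd[OF A_cont] bd[OF A1_cont] bd[OF A2_cont] by blast
  define M where "M = \<bar>L\<bar> + \<bar>B0\<bar> + \<bar>B1\<bar> + \<bar>B2\<bar>"
  have M: "M \<ge> 0" "L \<le> M" "B0 \<le> M" "B1 \<le> M" "B2 \<le> M" by (auto simp: M_def)
  have lip: "\<bar>deriv A x - deriv A y\<bar> \<le> M * \<bar>x - y\<bar>" if "\<bar>x\<bar> \<le> R" "\<bar>y\<bar> \<le> R" for x y
  proof -
    have "norm (deriv A x - deriv A y) \<le> M * norm (x - y)"
      by (rule field_differentiable_bound[of "{-R..R}" _ "deriv (deriv A)"])
         (use B(3) M that in \<open>auto intro!: A1_deriv order_trans[of _ B2 M]\<close>)
    then show ?thesis by simp
  qed
  show ?thesis
  proof (intro exI[of _ M] conjI allI impI M(1))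
    fix x y assume xy: "\<bar>x\<bar> \<le> R" "\<bar>y\<bar> \<le> R"
    then have "x \<in> {-R..R}" by auto
    then show "\<bar>A x\<bar> \<le> M" "\<bar>deriv A x\<bar> \<le> M" "\<bar>deriv (deriv A) x\<bar> \<le> M"
      using B M by fastforce+
    show "\<bar>deriv A x - deriv A y\<bar> \<le> M * \<bar>x - y\<bar>" by (rule lip[OF xy])
    show "\<bar>deriv (deriv A) x - deriv (deriv A) y\<bar> \<le> M * \<bar>x - y\<bar>"
      using L(2)[OF xy] mult_right_mono[OF M(2), of "\<bar>x - y\<bar>"] by linarith
  qed
qed

text \<open>The coefficient of minus the derivative of \<open>A(u)\<close>, with the derivative
  moved onto the basis function, so that it makes sense for merely continuous
  \<open>u\<close>.\<close>

definition Fm :: "seq \<Rightarrow> seq" where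
  "Fm c m = tint (\<lambda>x. A (ser c x) * deb m x)"

abbreviation A10 :: "seq \<Rightarrow> real" where "A10 c \<equiv> tint (\<lambda>x. A (ser c x) ^ 10)"

lemma Aser_cont: "Hs c \<Longrightarrow> continuous_on S (\<lambda>x. A (ser c x))"
  by (rule continuous_on_compose2[OF A_cont[of UNIV] ser_cont]) auto

lemma Fm_tendsto:
  assumes c: "\<And>n. Hs (c n)" "\<And>x. (\<lambda>n. ser (c n) x) \<longlonglongrightarrow> ser d x" "\<And>n x. \<bar>ser (c n) x\<bar> \<le> B" and d: "Hs d"
  shows "(\<lambda>n. Fm (c n) m) \<longlonglongrightarrow> Fm d m"
proof -
  obtain M where M: "M \<ge> 0" "\<And>x. \<bar>x\<bar> \<le> B \<Longrightarrow> \<bar>A x\<bar> \<le> M" using A_bounds[of B] by blast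
  show ?thesis unfolding Fm_def
  proof (rule integral_dominated_convergence[where w="\<lambda>x. M * (sqrt 2 * kap m)"])
    show "(\<lambda>x. A (ser d x) * deb m x) \<in> borel_measurable torus" "(\<lambda>x. A (ser (c n) x) * deb m x) \<in> borel_measurable torus" for n
      by (intro torus_meas_cont continuous_intros Aser_cont c d)+
    have "isCont A x" for x using A_cont[of UNIV] by (simp add: continuous_on_eq_continuous_at)
    then show "AE x in torus. (\<lambda>n. A (ser (c n) x) * deb m x) \<longlonglongrightarrow> A (ser d x) * deb m x"
      using c(2) by (intro AE_I2 tendsto_intros isCont_tendsto_compose[of _ A])
    show "AE x in torus. norm (A (ser (c n) x) * deb m x) \<le> M * (sqrt 2 * kap m)" for n
      unfolding real_norm_def abs_mult using deb_bound[of m] M c(3)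
      by (intro AE_I2 mult_mono) auto
  qed simp
qed

lemma Fm_tr_tendsto: assumes "Hs c" shows "(\<lambda>N. Fm (tr N c) m) \<longlonglongrightarrow> Fm c m"
  by (rule Fm_tendsto[OF tr_Hs ser_tr_tendsto[OF assms] _ assms, of "C0 * nrm c"])
     (use tp_bound[OF assms] in \<open>simp add: ser_tr_tp\<close>)

lemma Atp_deriv: "((\<lambda>x. A (tp N c x)) has_real_derivative deriv A (tp N c x) * tp1 N c x) (at x within S)"
  by (rule DERIV_chain2[OF A_deriv tp_deriv])

lemma Atp_deriv2: "((\<lambda>x. deriv A (tp N c x) * tp1 N c x) has_real_derivative
    deriv (deriv A) (tp N c x) * (tp1 N c x)^2 + deriv A (tp N c x) * tp2 N c x) (at x within S)"
  by (rule DERIV_cong[OF DERIV_mult[OF DERIV_chain2[OF A1_deriv tp_deriv] tp1_deriv]])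
     (simp add: power2_eq_square algebra_simps)

lemma Atp_cont [continuous_intros]:
  "continuous_on S (\<lambda>x. A (tp N c x))" "continuous_on S (\<lambda>x. deriv A (tp N c x))" "continuous_on S (\<lambda>x. deriv (deriv A) (tp N c x))"
  by (auto intro: continuous_on_compose2[OF A_cont[of UNIV]] continuous_on_compose2[OF A1_cont[of UNIV]]
      continuous_on_compose2[OF A2_cont[of UNIV]] tp_cont)

lemma Fm_tp_diff: "Fm (tr N c) m - Fm (tr N d) m = tint (\<lambda>x. (A (tp N c x) - A (tp N d x)) * deb m x)"
  unfolding Fm_def ser_tr_tp left_diff_distrib
  by (rule Bochner_Integration.integral_diff[symmetric]) (intro torus_int_cont continuous_intros)+

lemma three_sq: "((a::real) + b + c)^2 \<le> 3 * a^2 + 3 * b^2 + 3 * c^2"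
proof -
  have "0 \<le> (a - b)^2 + (b - c)^2 + (a - c)^2" by simp
  then show ?thesis by (simp add: power2_eq_square algebra_simps)
qed

text \<open>The weight \<open>(kap m)^2\<close> measures the flux term in \<open>H^1\<close>, that
  is, two derivatives of \<open>A(u) - A(v)\<close> in \<open>L^2\<close>. On truncations these
  derivatives are explicit and local Lipschitz bounds for \<open>deriv A\<close> and its derivative
  control them, uniformly in the truncation level; the estimate then passes to the limit for each
  finite set of modes.\<close>

lemma Fm_lipschitz:
  obtains K where "K \<ge> 0" "\<And>c d S. \<lbrakk>Hs c; Hs d; nrm c \<le> R; nrm d \<le> R; finite S\<rbrakk> \<Longrightarrow>
    (\<Sum>m\<in>S. (kap m)^2 * (Fm c m - Fm d m)^2) \<le> K * (nrmd c d)^2"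
proof -
  define B where "B = C0 * R"
  obtain M where M: "M \<ge> 0" and Mb: "\<And>x y. \<bar>x\<bar> \<le> B \<Longrightarrow> \<bar>y\<bar> \<le> B \<Longrightarrow> \<bar>deriv A x\<bar> \<le> M \<and> \<bar>deriv (deriv A) x\<bar> \<le> M
     \<and> \<bar>deriv A x - deriv A y\<bar> \<le> M * \<bar>x - y\<bar> \<and> \<bar>deriv (deriv A) x - deriv (deriv A) y\<bar> \<le> M * \<bar>x - y\<bar>"
    using A_bounds[of B] by blast
  \<comment> \<open>Via \<open>three_sq\<close> the summands belong to the two terms with the second
    derivative of \<open>A\<close>, to the difference of \<open>deriv A\<close> multiplied by
    \<open>tp2 N c\<close> (of \<open>L^2\<close> norm at most \<open>R\<close>), and to
    \<open>deriv A\<close> multiplied by the second derivative of the difference.\<close>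
  define K where "K = 3 * (M * C0 * (B^2 + 2 * B))^2 + 3 * (M * C0)^2 * R^2 + 3 * M^2"
  have "(\<Sum>m\<in>S. (kap m)^2 * (Fm c m - Fm d m)^2) \<le> K * (nrmd c d)^2"
    if H: "Hs c" "Hs d" "nrm c \<le> R" "nrm d \<le> R" "finite S" for c d S
  proof -
    let ?e = "\<lambda>m. c m - d m"
    define \<delta> where "\<delta> = nrm ?e"
    have He: "Hs ?e" by (rule Hs_diff(1)[OF H(1,2)])
    have d0: "0 \<le> \<delta>" using He by (simp add: \<delta>_def)
    have R0: "0 \<le> R" using H(3) nrm_nonneg[OF H(1)] by linarith
    then have B0: "0 \<le> B" by (simp add: B_def)
    have fin: "(\<Sum>m\<in>S. (kap m)^2 * (Fm (tr N c) m - Fm (tr N d) m)^2) \<le> K * \<delta>\<^sup>2" for N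
    proof -
      define h2 where "h2 x = deriv (deriv A) (tp N c x) * (tp1 N c x)^2 + deriv A (tp N c x) * tp2 N c x
        - (deriv (deriv A) (tp N d x) * (tp1 N d x)^2 + deriv A (tp N d x) * tp2 N d x)" for x
      have h2c: "continuous_on {0..1} h2" unfolding h2_def by (intro continuous_intros)
      have "(\<Sum>m\<in>S. (kap m)^2 * (tint (\<lambda>x. (A (tp N c x) - A (tp N d x)) * deb m x))^2) \<le> tint (\<lambda>x. (h2 x)^2)"
        unfolding h2_def
        by (rule bessel2[OF DERIV_diff[OF Atp_deriv Atp_deriv] _ DERIV_diff[OF Atp_deriv2 Atp_deriv2]])
           (auto simp: tp_per intro!: continuous_intros H)
      also have "\<dots> \<le> tint (\<lambda>x. 3 * (M * C0 * \<delta> * (B^2 + 2 * B))^2 + 3 * ((M * C0 * \<delta>)^2 * (tp2 N c x)^2)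
           + 3 * (M^2 * (tp2 N ?e x)^2))"
      proof (rule integral_mono)
        show "integrable torus (\<lambda>x. (h2 x)^2)" by (intro torus_int_cont continuous_intros h2c)
        show "integrable torus (\<lambda>x. 3 * (M * C0 * \<delta> * (B^2 + 2 * B))^2 + 3 * ((M * C0 * \<delta>)^2 * (tp2 N c x)^2)
           + 3 * (M^2 * (tp2 N ?e x)^2))" by (intro torus_int_cont continuous_intros)
        fix x
        have b: "\<bar>tp N c x\<bar> \<le> B" "\<bar>tp N d x\<bar> \<le> B" "\<bar>tp1 N c x\<bar> \<le> B" "\<bar>tp1 N d x\<bar> \<le> B"
          using tp_bound[OF H(1), of N x] tp_bound[OF H(2), of N x] tp1_bound[OF H(1), of N x] tp1_bound[OF H(2), of N x]
            mult_left_mono[OF H(3) C0_nonneg] mult_left_mono[OF H(4) C0_nonneg] by (auto simp: B_def)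
        have e: "\<bar>tp N c x - tp N d x\<bar> \<le> C0 * \<delta>" "\<bar>tp1 N c x - tp1 N d x\<bar> \<le> C0 * \<delta>"
          unfolding tp_diff \<delta>_def by (rule tp_bound[OF He] tp1_bound[OF He])+
        note m = Mb[OF b(1,2)] Mb[OF b(2,1)]
        have l1: "\<bar>deriv (deriv A) (tp N c x) - deriv (deriv A) (tp N d x)\<bar> \<le> M * (C0 * \<delta>)"
          "\<bar>deriv A (tp N c x) - deriv A (tp N d x)\<bar> \<le> M * (C0 * \<delta>)"
          using m mult_left_mono[OF e(1) M] by linarith+
        have t1: "\<bar>(deriv (deriv A) (tp N c x) - deriv (deriv A) (tp N d x)) * (tp1 N c x)^2\<bar> \<le> M * (C0 * \<delta>) * B^2"
          unfolding abs_mult using b(3) l1 B0 by (intro mult_mono) (auto intro: abs_le_square_iff[THEN iffD1] simp: abs_le_square_iff[symmetric])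
        have t2: "\<bar>deriv (deriv A) (tp N d x) * ((tp1 N c x - tp1 N d x) * (tp1 N c x + tp1 N d x))\<bar> \<le> M * ((C0 * \<delta>) * (2 * B))"
          unfolding abs_mult using m e b d0 M by (intro mult_mono) (auto intro: order_trans[OF abs_triangle_ineq])
        have t3: "\<bar>(deriv A (tp N c x) - deriv A (tp N d x)) * tp2 N c x\<bar> \<le> M * (C0 * \<delta>) * \<bar>tp2 N c x\<bar>"
          unfolding abs_mult using l1 by (intro mult_right_mono) auto
        have t4: "\<bar>deriv A (tp N d x) * tp2 N ?e x\<bar> \<le> M * \<bar>tp2 N ?e x\<bar>"
          unfolding abs_mult using m by (intro mult_right_mono) auto
        have "h2 x = (deriv (deriv A) (tp N c x) - deriv (deriv A) (tp N d x)) * (tp1 N c x)^2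
          + deriv (deriv A) (tp N d x) * ((tp1 N c x - tp1 N d x) * (tp1 N c x + tp1 N d x))
          + (deriv A (tp N c x) - deriv A (tp N d x)) * tp2 N c x + deriv A (tp N d x) * tp2 N ?e x"
          unfolding h2_def tp_diff(3)[symmetric] by (simp add: power2_eq_square algebra_simps)
        then have "\<bar>h2 x\<bar> \<le> M * C0 * \<delta> * (B^2 + 2 * B) + M * C0 * \<delta> * \<bar>tp2 N c x\<bar> + M * \<bar>tp2 N ?e x\<bar>"
          using t1 t2 t3 t4 by (simp add: algebra_simps)
        then have "(h2 x)^2 \<le> (M * C0 * \<delta> * (B^2 + 2 * B) + M * C0 * \<delta> * \<bar>tp2 N c x\<bar> + M * \<bar>tp2 N ?e x\<bar>)^2"
          by (metis abs_ge_zero power2_abs power_mono)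
        also have "\<dots> \<le> 3 * (M * C0 * \<delta> * (B^2 + 2 * B))^2 + 3 * (M * C0 * \<delta> * \<bar>tp2 N c x\<bar>)^2 + 3 * (M * \<bar>tp2 N ?e x\<bar>)^2"
          by (rule three_sq)
        finally show "(h2 x)^2 \<le> 3 * (M * C0 * \<delta> * (B^2 + 2 * B))^2 + 3 * ((M * C0 * \<delta>)^2 * (tp2 N c x)^2)
           + 3 * (M^2 * (tp2 N ?e x)^2)" by (simp add: power_mult_distrib)
      qed
      also have "\<dots> = 3 * (M * C0 * \<delta> * (B^2 + 2 * B))^2 + 3 * ((M * C0 * \<delta>)^2 * tint (\<lambda>x. (tp2 N c x)^2))
           + 3 * (M^2 * tint (\<lambda>x. (tp2 N ?e x)^2))"
      proof -
        have i: "integrable torus (\<lambda>x. (tp2 N c x)^2)" "integrable torus (\<lambda>x. (tp2 N ?e x)^2)"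
          by (intro torus_int_cont continuous_intros)+
        show ?thesis using i by simp
      qed
      also have "\<dots> \<le> 3 * (M * C0 * \<delta> * (B^2 + 2 * B))^2 + 3 * ((M * C0 * \<delta>)^2 * R^2) + 3 * (M^2 * \<delta>\<^sup>2)"
        using order_trans[OF tp2_L2_le[OF H(1), of N] power_mono[OF H(3) nrm_nonneg[OF H(1)]]] tp2_L2_le[OF He, of N]
        by (intro add_mono mult_left_mono) (auto simp: \<delta>_def)
      also have "\<dots> = K * \<delta>\<^sup>2"
        by (simp only: K_def power_mult_distrib) (simp add: distrib_left distrib_right mult_ac)
      finally show ?thesis by (simp add: Fm_tp_diff)
    qed
    have "(\<lambda>N. \<Sum>m\<in>S. (kap m)^2 * (Fm (tr N c) m - Fm (tr N d) m)^2) \<longlonglongrightarrow> (\<Sum>m\<in>S. (kap m)^2 * (Fm c m - Fm d m)^2)"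
      by (intro tendsto_intros Fm_tr_tendsto H)
    then show ?thesis using fin unfolding \<delta>_def by (intro LIMSEQ_le_const2) auto
  qed
  moreover have "K \<ge> 0" by (simp add: K_def)
  ultimately show ?thesis using that by blast
qed

lemma Fm_zero: "Fm (\<lambda>_. 0) m = 0"
proof -
  have "tint (deb m) = 0"
    using eb_mean[of "pr m"] by (simp add: deb_def[abs_def])
  then show ?thesis by (simp add: Fm_def ser_def)
qed

text \<open>The constant sees only the sup norm of the function. The first bound is linear in the
  squared \<open>H^1\<close> norm, the second linear in the squared \<open>H^2\<close> norm once
  \<open>H^1\<close> is controlled, as the two Gronwall stages of \<open>bootstrap\<close>
  require.\<close>

lemma Fm_h1_bound:
  obtains K where "K \<ge> 0" "\<And>c S. \<lbrakk>Hs c; \<And>x. \<bar>ser c x\<bar> \<le> B; finite S\<rbrakk> \<Longrightarrow>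
    (\<Sum>m\<in>S. (Fm c m)^2) \<le> K * h1sq c"
    "\<And>c S. \<lbrakk>Hs c; \<And>x. \<bar>ser c x\<bar> \<le> B; finite S\<rbrakk> \<Longrightarrow>
    (\<Sum>m\<in>S. (kap m)^2 * (Fm c m)^2) \<le> K * (h1sq c + 1) * (nrm c)^2"
proof -
  \<comment> \<open>By uniform convergence the truncations exceed the sup bound of the full series
    by less than 1 for large \<open>N\<close>; hence the ball of radius
    \<open>B + 1\<close>.\<close>
  obtain M where M: "M \<ge> 0" and Mb: "\<And>x. \<bar>x\<bar> \<le> B + 1 \<Longrightarrow> \<bar>deriv A x\<bar> \<le> M \<and> \<bar>deriv (deriv A) x\<bar> \<le> M"
    using A_bounds[of "B + 1"] by blast
  define K where "K = M^2 + 2 * M^2 + 2 * M^2 * C0^2"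
  have K: "K \<ge> 0" "M^2 \<le> K" "2 * M^2 * C0^2 \<le> K" "2 * M^2 \<le> K" by (auto simp: K_def)
  have ev: "\<forall>\<^sub>F N in sequentially. \<forall>x. \<bar>tp N c x\<bar> \<le> B + 1" if c: "Hs c" "\<And>x. \<bar>ser c x\<bar> \<le> B" for c
  proof -
    have "\<forall>\<^sub>F N in sequentially. \<forall>x\<in>UNIV. dist (ser (tr N c) x) (ser c x) < 1"
      using ser_tr_unif[OF c(1)] by (rule uniform_limitD) simp
    then show ?thesis
    proof eventually_elim
      case (elim N)
      show ?case
      proof
        fix x show "\<bar>tp N c x\<bar> \<le> B + 1"
          using elim[rule_format, of x] c(2)[of x] by (simp add: ser_tr_tp dist_real_def)
      qed
    qed
  qed
  show ?thesis
  proof (rule that[OF K(1)])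
    fix c :: seq and S :: "nat set" assume c: "Hs c" "\<And>x. \<bar>ser c x\<bar> \<le> B" and S: "finite S"
    have lim: "(\<lambda>N. \<Sum>m\<in>S. (Fm (tr N c) m)^2) \<longlonglongrightarrow> (\<Sum>m\<in>S. (Fm c m)^2)"
      by (intro tendsto_intros Fm_tr_tendsto c)
    have "\<forall>\<^sub>F N in sequentially. (\<Sum>m\<in>S. (Fm (tr N c) m)^2) \<le> K * h1sq c"
      using ev[OF c]
    proof eventually_elim
      case (elim N)
      have "(\<Sum>m\<in>S. (Fm (tr N c) m)^2) \<le> tint (\<lambda>x. (deriv A (tp N c x) * tp1 N c x)^2)"
        unfolding Fm_def ser_tr_tp by (rule bessel1[OF Atp_deriv]) (auto simp: tp_per intro!: continuous_intros S)
      also have "\<dots> \<le> tint (\<lambda>x. M^2 * (tp1 N c x)^2)"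
        using Mb elim M by (intro integral_mono torus_int_cont continuous_intros)
          (auto simp: power_mult_distrib intro!: mult_right_mono simp: abs_le_square_iff[symmetric])
      also have "\<dots> = M^2 * (\<Sum>m<N. (kap m)^2 * (c m)^2)" by (simp add: tp1_L2)
      also have "\<dots> \<le> K * h1sq c" using h1sq_sum_le[OF c(1), of "{..<N}"] K
        by (intro mult_mono) (auto intro!: sum_nonneg)
      finally show ?case .
    qed
    from tendsto_upperbound[OF lim this] show "(\<Sum>m\<in>S. (Fm c m)^2) \<le> K * h1sq c" by simp
  next
    fix c :: seq and S :: "nat set" assume c: "Hs c" "\<And>x. \<bar>ser c x\<bar> \<le> B" and S: "finite S"
    have lim: "(\<lambda>N. \<Sum>m\<in>S. (kap m)^2 * (Fm (tr N c) m)^2) \<longlonglongrightarrow> (\<Sum>m\<in>S. (kap m)^2 * (Fm c m)^2)"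
      by (intro tendsto_intros Fm_tr_tendsto c)
    have "\<forall>\<^sub>F N in sequentially. (\<Sum>m\<in>S. (kap m)^2 * (Fm (tr N c) m)^2) \<le> K * (h1sq c + 1) * (nrm c)^2"
      using ev[OF c]
    proof eventually_elim
      case (elim N)
      have "(\<Sum>m\<in>S. (kap m)^2 * (Fm (tr N c) m)^2) \<le> tint (\<lambda>x. (deriv (deriv A) (tp N c x) * (tp1 N c x)^2 + deriv A (tp N c x) * tp2 N c x)^2)"
        unfolding Fm_def ser_tr_tp by (rule bessel2[OF Atp_deriv _ Atp_deriv2]) (auto simp: tp_per intro!: continuous_intros S)
      also have "\<dots> \<le> tint (\<lambda>x. 2 * M^2 * C0^2 * (nrm c)^2 * (tp1 N c x)^2 + 2 * M^2 * (tp2 N c x)^2)"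
      proof (intro integral_mono torus_int_cont continuous_intros)
        fix x
        have m: "\<bar>deriv A (tp N c x)\<bar> \<le> M" "\<bar>deriv (deriv A) (tp N c x)\<bar> \<le> M" using Mb elim by auto
        \<comment> \<open>One factor of the squared first derivative is bounded pointwise by
          \<open>C0 * nrm c\<close>; the other is kept for the \<open>H^1\<close> norm.\<close>
        have "\<bar>deriv (deriv A) (tp N c x) * (tp1 N c x)^2\<bar> \<le> M * ((C0 * nrm c) * \<bar>tp1 N c x\<bar>)"
          unfolding abs_mult power2_eq_square using m tp1_bound[OF c(1), of N x] by (intro mult_mono) auto
        moreover have "\<bar>deriv A (tp N c x) * tp2 N c x\<bar> \<le> M * \<bar>tp2 N c x\<bar>"
          unfolding abs_mult using m by (intro mult_right_mono) auto
        ultimately have "\<bar>deriv (deriv A) (tp N c x) * (tp1 N c x)^2 + deriv A (tp N c x) * tp2 N c x\<bar>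
           \<le> M * ((C0 * nrm c) * \<bar>tp1 N c x\<bar>) + M * \<bar>tp2 N c x\<bar>" by linarith
        then have "(deriv (deriv A) (tp N c x) * (tp1 N c x)^2 + deriv A (tp N c x) * tp2 N c x)^2
           \<le> (M * ((C0 * nrm c) * \<bar>tp1 N c x\<bar>) + M * \<bar>tp2 N c x\<bar>)^2"
          by (metis abs_ge_zero power2_abs power_mono)
        also have "\<dots> \<le> 2 * (M * ((C0 * nrm c) * \<bar>tp1 N c x\<bar>))^2 + 2 * (M * \<bar>tp2 N c x\<bar>)^2"
          using sum_squares_bound[of "M * ((C0 * nrm c) * \<bar>tp1 N c x\<bar>)" "M * \<bar>tp2 N c x\<bar>"] by (simp add: power2_sum)
        finally show "(deriv (deriv A) (tp N c x) * (tp1 N c x)^2 + deriv A (tp N c x) * tp2 N c x)^2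
          \<le> 2 * M^2 * C0^2 * (nrm c)^2 * (tp1 N c x)^2 + 2 * M^2 * (tp2 N c x)^2"
          by (simp add: power_mult_distrib mult_ac)
      qed
      also have "\<dots> = 2 * M^2 * C0^2 * (nrm c)^2 * (\<Sum>m<N. (kap m)^2 * (c m)^2) + 2 * M^2 * tint (\<lambda>x. (tp2 N c x)^2)"
      proof -
        have i: "integrable torus (\<lambda>x. (tp2 N c x)^2)" "integrable torus (\<lambda>x. (tp1 N c x)^2)"
          by (intro torus_int_cont continuous_intros)+
        show ?thesis using i by (simp add: tp1_L2)
      qed
      also have "\<dots> \<le> K * ((nrm c)^2 * h1sq c) + K * (nrm c)^2"
        unfolding mult.assoc[of _ "(nrm c)^2" "\<Sum>m<N. (kap m)^2 * (c m)^2"]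
        using h1sq_sum_le[OF c(1), of "{..<N}"] K tp2_L2_le[OF c(1), of N]
        by (intro add_mono mult_mono mult_nonneg_nonneg) (auto intro!: sum_nonneg)
      finally show ?case by (simp add: algebra_simps)
    qed
    from tendsto_upperbound[OF lim this] show "(\<Sum>m\<in>S. (kap m)^2 * (Fm c m)^2) \<le> K * (h1sq c + 1) * (nrm c)^2" by simp
  qed
qed

text \<open>Dividing by \<open>(kap m)^2\<close> cancels the derivative of the basis function and
  leaves Bessel's inequality for \<open>A(u)\<close>: an \<open>H^-1\<close> estimate of the flux
  term.\<close>

lemma Fm_L2_bound:
  assumes "Hs c" "finite S"
  shows "(\<Sum>m\<in>S. (Fm c m)^2 / (kap m)^2) \<le> tint (\<lambda>x. (A (ser c x))^2)"
proof -
  have "(Fm c m)^2 / (kap m)^2 = (tint (\<lambda>x. A (ser c x) * eb (pr m) x))^2" for m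
  proof -
    have "Fm c m = sg m * kap m * tint (\<lambda>x. A (ser c x) * eb (pr m) x)"
      unfolding Fm_def deb_def by (subst integral_mult_right_zero[symmetric]) (simp add: mult_ac)
    then show ?thesis by (simp add: power_mult_distrib)
  qed
  then have "(\<Sum>m\<in>S. (Fm c m)^2 / (kap m)^2) = (\<Sum>k\<in>pr ` S. (tint (\<lambda>x. A (ser c x) * eb k x))^2)"
    by (subst sum.reindex[OF inj_pr]) simp
  also have "\<dots> \<le> tint (\<lambda>x. (A (ser c x))^2)"
    by (rule bessel[OF Aser_cont]) (use assms in auto)
  finally show ?thesis .
qed

end

subsection \<open>Duhamel convolution and the truncated equation\<close>

text \<open>Duhamel's integral for the scalar equation \<open>c' = f - \<mu> c\<close> with zero
  initial value. For \<mu> = 0 it is the plain time integral, as used in \<open>Dex\<close>.\<close>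

definition conv :: "real \<Rightarrow> (real \<Rightarrow> real) \<Rightarrow> real \<Rightarrow> real" where
  "conv \<mu> f t = sint t (\<lambda>s. exp (- \<mu> * (t - s)) * f s)"

lemma ae_ne_Icc: "AE s in lebesgue_on {a..b::real}. s \<noteq> c"
proof -
  have "AE s in lebesgue. s \<noteq> c" by (simp add: AE_completion AE_lborel_singleton)
  then have "AE s in lebesgue. s \<in> {a..b} \<longrightarrow> s \<noteq> c" by eventually_elim auto
  then show ?thesis by (subst AE_restrict_space_iff) simp_all
qed

lemma conv_cong: "(\<And>s. s \<in> {0..t} \<Longrightarrow> f s = g s) \<Longrightarrow> conv \<mu> f t = conv \<mu> g t"
  unfolding conv_def by (rule Bochner_Integration.integral_cong) auto

lemma ton_meas_borel: "f \<in> borel_measurable borel \<Longrightarrow> f \<in> borel_measurable (ton t)"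
  by (simp add: measurable_restrict_space1 measurable_completion)

lemma ton_meas_ind:
  fixes f :: "real \<Rightarrow> real"
  assumes "(\<lambda>s. indicator J s * f s) \<in> borel_measurable borel" "{0..t} \<subseteq> J"
  shows "f \<in> borel_measurable (ton t)"
proof -
  have "(\<lambda>s. indicator J s * f s) \<in> borel_measurable (ton t)"
    by (rule ton_meas_borel[OF assms(1)])
  also have "?this \<longleftrightarrow> f \<in> borel_measurable (ton t)"
    using assms(2) by (intro measurable_cong) (auto simp: indicator_def)
  finally show ?thesis .
qed

lemma ton_meas_sub:
  assumes "f \<in> borel_measurable (ton T)" "t \<le> T"
  shows "f \<in> borel_measurable (ton t)"
proof -
  have "restrict_space (ton T) {0..t} = ton t"
    using assms(2) by (simp add: restrict_restrict_space Int_absorb1)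
  then show ?thesis using measurable_restrict_space1[OF assms(1), of "{0..t}"] by simp
qed

lemma ton_finite: "finite_measure (lebesgue_on {a..b::real})"
  by (rule finite_measure_lebesgue_on) simp

lemma ton_int:
  fixes f :: "real \<Rightarrow> real"
  assumes "f \<in> borel_measurable (lebesgue_on {a..b})" "\<And>s. s \<in> {a..b} \<Longrightarrow> \<bar>f s\<bar> \<le> B"
  shows "integrable (lebesgue_on {a..b}) f"
proof -
  interpret finite_measure "lebesgue_on {a..b}" by (rule ton_finite)
  show ?thesis by (rule integrable_const_bound[of _ B]) (use assms in auto)
qed

lemma ton_int_cont: "continuous_on {a..b} f \<Longrightarrow> integrable (lebesgue_on {a..b}) f" for f :: "real \<Rightarrow> real"
  by (rule continuous_imp_integrable_real)

lemma ton_meas_cont: "continuous_on {a..b} f \<Longrightarrow> f \<in> borel_measurable (lebesgue_on {a..b})" for f :: "real \<Rightarrow> real"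
  by (rule borel_measurable_integrable, rule continuous_imp_integrable_real)

lemma ton_lborel:
  fixes f :: "real \<Rightarrow> real"
  assumes "f \<in> borel_measurable borel"
  shows "integral\<^sup>L (lebesgue_on {a..b}) f = (\<integral>s. indicator {a..b} s * f s \<partial>lborel)"
proof -
  have "integral\<^sup>L (lebesgue_on {a..b}) f = (\<integral>s. indicator {a..b} s *\<^sub>R f s \<partial>lebesgue)"
    by (rule integral_restrict_space) simp
  also have "\<dots> = (\<integral>s. indicator {a..b} s *\<^sub>R f s \<partial>lborel)"
    using assms by (intro integral_completion) simp
  finally show ?thesis by simp
qed

lemma ton_FTC:
  fixes F f :: "real \<Rightarrow> real"
  assumes "\<And>x. x \<in> {a..b} \<Longrightarrow> (F has_real_derivative f x) (at x within {a..b})" "continuous_on {a..b} f" "a \<le> b"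
  shows "integral\<^sup>L (lebesgue_on {a..b}) f = F b - F a"
proof -
  have "(f has_integral F b - F a) {a..b}"
    using assms by (intro fundamental_theorem_of_calculus)
      (auto simp: has_real_derivative_iff_has_vector_derivative)
  moreover have "integral\<^sup>L (lebesgue_on {a..b}) f = integral {a..b} f"
    by (rule lebesgue_integral_eq_integral[OF continuous_imp_integrable_real[OF assms(2)]]) auto
  ultimately show ?thesis by (simp add: integral_unique)
qed

lemma int_exp_le:
  fixes \<theta> t :: real
  assumes "\<theta> > 0" "0 \<le> t"
  shows "sint t (\<lambda>s. exp (\<theta> * s)) \<le> exp (\<theta> * t) / \<theta>"
proof -
  have "sint t (\<lambda>s. exp (\<theta> * s)) = exp (\<theta> * t) / \<theta> - exp (\<theta> * 0) / \<theta>"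
    by (rule ton_FTC[where F="\<lambda>s. exp (\<theta> * s) / \<theta>"]) (use assms in \<open>auto intro!: derivative_eq_intros continuous_intros\<close>)
  then show ?thesis using assms by simp
qed

lemma int_exp_kernel:
  fixes \<mu> t :: real
  assumes "\<mu> > 0" "0 \<le> t"
  shows "sint t (\<lambda>s. exp (- \<mu> * (t - s))) = (1 - exp (- \<mu> * t)) / \<mu>"
proof -
  have "sint t (\<lambda>s. exp (- \<mu> * (t - s))) = exp (- \<mu> * (t - t)) / \<mu> - exp (- \<mu> * (t - 0)) / \<mu>"
    by (rule ton_FTC[where F="\<lambda>s. exp (- \<mu> * (t - s)) / \<mu>"]) (use assms in \<open>auto intro!: derivative_eq_intros continuous_intros\<close>)
  then show ?thesis by (simp add: diff_divide_distrib)
qed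

lemma int_CS:
  fixes f g :: "'b \<Rightarrow> real"
  assumes "integrable M (\<lambda>x. (f x)^2)" "integrable M (\<lambda>x. (g x)^2)" "integrable M (\<lambda>x. f x * g x)"
  shows "(\<integral>x. f x * g x \<partial>M)^2 \<le> (\<integral>x. (f x)^2 \<partial>M) * (\<integral>x. (g x)^2 \<partial>M)"
proof -
  define a b c where "a = (\<integral>x. (f x)^2 \<partial>M)" and "b = (\<integral>x. (g x)^2 \<partial>M)" and "c = (\<integral>x. f x * g x \<partial>M)"
  have q: "0 \<le> r^2 * a + 2 * r * s * c + s^2 * b" for r s
  proof -
    have "0 \<le> (\<integral>x. (r * f x + s * g x)^2 \<partial>M)" by simp
    also have "\<dots> = (\<integral>x. r^2 * (f x)^2 + 2 * r * s * (f x * g x) + s^2 * (g x)^2 \<partial>M)"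
      by (rule Bochner_Integration.integral_cong) (auto simp: power2_eq_square algebra_simps)
    also have "\<dots> = r^2 * a + 2 * r * s * c + s^2 * b"
      unfolding a_def b_def c_def using assms by simp
    finally show ?thesis .
  qed
  have ab: "0 \<le> a" "0 \<le> b" by (auto simp: a_def b_def)
  have "c^2 \<le> a * b"
  proof (cases "b = 0")
    case True
    have "c = 0"
    proof (rule ccontr)
      assume "c \<noteq> 0"
      have "2 * (- (a + 1) / (2 * c)) * c = - (a + 1)" using \<open>c \<noteq> 0\<close> by simp
      moreover have "0 \<le> 1^2 * a + 2 * 1 * (- (a + 1) / (2 * c)) * c + (- (a + 1) / (2 * c))^2 * b" by (rule q)
      ultimately show False using True by simp
    qed
    then show ?thesis using ab by simp
  next
    case False
    have "0 \<le> b^2 * a + 2 * b * (- c) * c + (- c)^2 * b" by (rule q)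
    then have "0 \<le> b * (a * b - c\<^sup>2)" by (simp add: power2_eq_square algebra_simps)
    then show ?thesis using ab False by (simp add: zero_le_mult_iff)
  qed
  then show ?thesis by (simp add: a_def b_def c_def)
qed

lemma conv_integrable:
  fixes f :: "real \<Rightarrow> real"
  assumes "f \<in> borel_measurable (ton t)" "\<And>s. s \<in> {0..t} \<Longrightarrow> \<bar>f s\<bar> \<le> B" "0 \<le> \<mu>"
  shows "integrable (ton t) (\<lambda>s. exp (- \<mu> * (t - s)) * f s)"
proof (rule ton_int)
  show "(\<lambda>s. exp (- \<mu> * (t - s)) * f s) \<in> borel_measurable (ton t)"
    by (intro borel_measurable_times assms(1) ton_meas_cont continuous_intros)
  fix s assume s: "s \<in> {0..t}"
  then have "exp (- \<mu> * (t - s)) \<le> 1" using assms(3) by (auto simp: mult_nonneg_nonneg)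
  then show "\<bar>exp (- \<mu> * (t - s)) * f s\<bar> \<le> 1 * B"
    unfolding abs_mult using assms(2)[OF s] by (intro mult_mono) auto
qed

lemma conv_diff:
  fixes f :: "real \<Rightarrow> real"
  assumes "f \<in> borel_measurable (ton t)" "\<And>s. s \<in> {0..t} \<Longrightarrow> \<bar>f s\<bar> \<le> B"
    "g \<in> borel_measurable (ton t)" "\<And>s. s \<in> {0..t} \<Longrightarrow> \<bar>g s\<bar> \<le> B'" "0 \<le> \<mu>"
  shows "conv \<mu> f t - conv \<mu> g t = conv \<mu> (\<lambda>s. f s - g s) t"
proof -
  have "(\<lambda>s. exp (- \<mu> * (t - s)) * (f s - g s)) = (\<lambda>s. exp (- \<mu> * (t - s)) * f s - exp (- \<mu> * (t - s)) * g s)"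
    by (rule ext) (rule right_diff_distrib)
  then show ?thesis unfolding conv_def
    using Bochner_Integration.integral_diff[OF conv_integrable[OF assms(1,2,5)] conv_integrable[OF assms(3,4,5)]] by simp
qed

text \<open>In Cauchy-Schwarz the squared kernel integrates to at most
  \<open>1 / (2 * \<mu>)\<close>. With \<open>\<mu> = \<nu> * (kap m)^2\<close> this is the gain of
  one derivative by the heat semigroup, with a constant that does not depend on
  \<open>t\<close>.\<close>

lemma conv_sq_le:
  fixes f :: "real \<Rightarrow> real"
  assumes f: "f \<in> borel_measurable (ton t)" "\<And>s. s \<in> {0..t} \<Longrightarrow> \<bar>f s\<bar> \<le> B" and "\<mu> > 0" "0 \<le> t"
  shows "(conv \<mu> f t)^2 \<le> 1 / (2 * \<mu>) * sint t (\<lambda>s. (f s)^2)"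
proof -
  have f2: "integrable (ton t) (\<lambda>s. (f s)^2)"
    by (rule ton_int[of _ _ _ "B^2"]) (use f in \<open>auto simp: abs_le_square_iff[symmetric] intro: order_trans[OF _ abs_ge_self]\<close>)
  have "(conv \<mu> f t)^2 \<le> sint t (\<lambda>s. (exp (- \<mu> * (t - s)))^2) * sint t (\<lambda>s. (f s)^2)"
    unfolding conv_def by (rule int_CS[OF _ f2 conv_integrable[OF f]])
      (use assms in \<open>auto intro!: ton_int_cont continuous_intros\<close>)
  also have "sint t (\<lambda>s. (exp (- \<mu> * (t - s)))^2)
    = sint t (\<lambda>s. exp (- (2 * \<mu>) * (t - s)))"
    by (simp add: exp_double[symmetric] algebra_simps)
  also have "\<dots> = (1 - exp (- (2 * \<mu>) * t)) / (2 * \<mu>)" by (rule int_exp_kernel) (use assms in auto)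
  also have "\<dots> \<le> 1 / (2 * \<mu>)" using assms by (intro divide_right_mono) auto
  finally show ?thesis by (simp add: mult_right_mono)
qed

lemma conv_energy_int:
  fixes f :: "nat \<Rightarrow> real \<Rightarrow> real"
  assumes f: "\<And>m. m \<in> S \<Longrightarrow> f m \<in> borel_measurable (ton t)" "\<And>m s. m \<in> S \<Longrightarrow> s \<in> {0..t} \<Longrightarrow> \<bar>f m s\<bar> \<le> B m"
    and "\<nu> > 0" "0 \<le> t" "\<And>m. m \<in> S \<Longrightarrow> 0 \<le> \<omega> m"
  shows "(\<Sum>m\<in>S. \<omega> m * (kap m)^2 * (conv (\<nu> * (kap m)^2) (f m) t)^2)
    \<le> 1 / (2 * \<nu>) * sint t (\<lambda>s. \<Sum>m\<in>S. \<omega> m * (f m s)^2)"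
proof -
  have i: "integrable (ton t) (\<lambda>s. (f m s)^2)" if "m \<in> S" for m
    by (rule ton_int[of _ _ _ "(B m)^2"]) (use f that in \<open>auto simp: abs_le_square_iff[symmetric] intro: order_trans[OF _ abs_ge_self]\<close>)
  have "(\<Sum>m\<in>S. \<omega> m * (kap m)^2 * (conv (\<nu> * (kap m)^2) (f m) t)^2)
    \<le> (\<Sum>m\<in>S. \<omega> m * (kap m)^2 * (1 / (2 * (\<nu> * (kap m)^2)) * sint t (\<lambda>s. (f m s)^2)))"
    by (intro sum_mono mult_left_mono conv_sq_le f) (use assms in auto)
  also have "\<dots> = (\<Sum>m\<in>S. 1 / (2 * \<nu>) * sint t (\<lambda>s. \<omega> m * (f m s)^2))"
    using assms by (intro sum.cong) auto
  also have "\<dots> = 1 / (2 * \<nu>) * sint t (\<lambda>s. \<Sum>m\<in>S. \<omega> m * (f m s)^2)"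
    using i by (subst Bochner_Integration.integral_sum) (auto simp: sum_distrib_left)
  finally show ?thesis .
qed

text \<open>For data growing like \<open>exp (\<theta> * s)\<close> the bound carries a factor
  \<open>1 / \<theta>\<close>; a suitable rate turns Duhamel maps into contractions in a weighted
  sup norm.\<close>

lemma conv_energy:
  fixes f :: "nat \<Rightarrow> real \<Rightarrow> real"
  assumes f: "\<And>m. m \<in> S \<Longrightarrow> f m \<in> borel_measurable (ton t)" "\<And>m s. m \<in> S \<Longrightarrow> s \<in> {0..t} \<Longrightarrow> \<bar>f m s\<bar> \<le> B m"
    and "\<nu> > 0" "0 \<le> t" "\<And>m. m \<in> S \<Longrightarrow> 0 \<le> \<omega> m" "\<theta> > 0" "0 \<le> b"
    and b: "\<And>s. s \<in> {0..t} \<Longrightarrow> (\<Sum>m\<in>S. \<omega> m * (f m s)^2) \<le> b * exp (\<theta> * s)"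
  shows "(\<Sum>m\<in>S. \<omega> m * (kap m)^2 * (conv (\<nu> * (kap m)^2) (f m) t)^2) \<le> b * exp (\<theta> * t) / (2 * \<nu> * \<theta>)"
proof -
  have i: "integrable (ton t) (\<lambda>s. (f m s)^2)" if "m \<in> S" for m
    by (rule ton_int[of _ _ _ "(B m)^2"]) (use f that in \<open>auto simp: abs_le_square_iff[symmetric] intro: order_trans[OF _ abs_ge_self]\<close>)
  have "sint t (\<lambda>s. \<Sum>m\<in>S. \<omega> m * (f m s)^2) \<le> sint t (\<lambda>s. b * exp (\<theta> * s))"
    by (rule integral_mono[OF Bochner_Integration.integrable_sum[OF integrable_mult_right[OF i]]])
       (auto intro!: ton_int_cont continuous_intros b)
  also have "\<dots> \<le> b * (exp (\<theta> * t) / \<theta>)"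
    using mult_left_mono[OF int_exp_le[of \<theta> t], of b] assms by (simp only: integral_mult_right_zero)
  finally have "1 / (2 * \<nu>) * sint t (\<lambda>s. \<Sum>m\<in>S. \<omega> m * (f m s)^2) \<le> 1 / (2 * \<nu>) * (b * (exp (\<theta> * t) / \<theta>))"
    using assms by (intro mult_left_mono) auto
  moreover have "(\<Sum>m\<in>S. \<omega> m * (kap m)^2 * (conv (\<nu> * (kap m)^2) (f m) t)^2)
    \<le> 1 / (2 * \<nu>) * sint t (\<lambda>s. \<Sum>m\<in>S. \<omega> m * (f m s)^2)"
    by (rule conv_energy_int[where B=B]) (use assms in auto)
  ultimately have "(\<Sum>m\<in>S. \<omega> m * (kap m)^2 * (conv (\<nu> * (kap m)^2) (f m) t)^2) \<le> 1 / (2 * \<nu>) * (b * (exp (\<theta> * t) / \<theta>))"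
    by (rule order_trans[rotated])
  then show ?thesis by simp
qed

lemma conv_abs_le:
  fixes f :: "real \<Rightarrow> real"
  assumes f: "f \<in> borel_measurable (ton t)" "\<And>s. s \<in> {0..t} \<Longrightarrow> \<bar>f s\<bar> \<le> B" and "\<mu> > 0" "0 \<le> t" "0 \<le> B"
  shows "\<mu> * \<bar>conv \<mu> f t\<bar> \<le> B"
proof -
  have "\<bar>conv \<mu> f t\<bar> \<le> sint t (\<lambda>s. \<bar>exp (- \<mu> * (t - s)) * f s\<bar>)"
    unfolding conv_def by (rule integral_abs_bound)
  also have "\<dots> \<le> sint t (\<lambda>s. B * exp (- \<mu> * (t - s)))"
    by (intro integral_mono integrable_abs conv_integrable[OF f] ton_int_cont continuous_intros)
       (use assms in \<open>auto simp: abs_mult mult.commute intro!: mult_right_mono\<close>)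
  also have "\<dots> = B * ((1 - exp (- \<mu> * t)) / \<mu>)" using int_exp_kernel[of \<mu> t] assms by simp
  finally have "\<mu> * \<bar>conv \<mu> f t\<bar> \<le> \<mu> * (B * ((1 - exp (- \<mu> * t)) / \<mu>))" using assms by (intro mult_left_mono) auto
  also have "\<dots> = B * (1 - exp (- \<mu> * t))" using assms by simp
  also have "\<dots> \<le> B * 1" using assms by (intro mult_left_mono) auto
  finally show ?thesis by simp
qed

lemma conv_HK:
  fixes f :: "real \<Rightarrow> real"
  assumes "f \<in> borel_measurable (ton t)" "\<And>s. s \<in> {0..t} \<Longrightarrow> \<bar>f s\<bar> \<le> B" "0 \<le> \<mu>"
  shows "conv \<mu> f t = exp (- \<mu> * t) * integral {0..t} (\<lambda>s. exp (\<mu> * s) * f s)"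
proof -
  have "conv \<mu> f t = integral {0..t} (\<lambda>s. exp (- \<mu> * (t - s)) * f s)"
    unfolding conv_def by (rule lebesgue_integral_eq_integral[OF conv_integrable[OF assms]]) auto
  also have "\<dots> = integral {0..t} (\<lambda>s. exp (- \<mu> * t) * (exp (\<mu> * s) * f s))"
  proof (rule Henstock_Kurzweil_Integration.integral_cong)
    fix s
    have "exp (- \<mu> * (t - s)) = exp (- \<mu> * t) * exp (\<mu> * s)" by (simp add: right_diff_distrib flip: exp_add)
    then show "exp (- \<mu> * (t - s)) * f s = exp (- \<mu> * t) * (exp (\<mu> * s) * f s)" by simp
  qed
  finally show ?thesis by simp
qed

lemma conv_cont:
  fixes f :: "real \<Rightarrow> real"
  assumes f: "f \<in> borel_measurable (ton T)" "\<And>s. s \<in> {0..T} \<Longrightarrow> \<bar>f s\<bar> \<le> B" and "0 \<le> \<mu>"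
  shows "continuous_on {0..T} (conv \<mu> f)"
proof -
  have "integrable (ton T) (\<lambda>s. exp (\<mu> * s) * f s)"
  proof (rule ton_int[of _ _ _ "exp (\<mu> * T) * B"])
    show "(\<lambda>s. exp (\<mu> * s) * f s) \<in> borel_measurable (ton T)"
      by (intro borel_measurable_times f ton_meas_cont continuous_intros)
    show "\<bar>exp (\<mu> * s) * f s\<bar> \<le> exp (\<mu> * T) * B" if "s \<in> {0..T}" for s
      unfolding abs_mult using that f(2)[OF that] assms(3) by (intro mult_mono) (auto intro: mult_left_mono)
  qed
  then have "(\<lambda>s. exp (\<mu> * s) * f s) integrable_on {0..T}"
    using integrable_on_lebesgue_on by fastforce
  then have "continuous_on {0..T} (\<lambda>t. exp (- \<mu> * t) * integral {0..t} (\<lambda>s. exp (\<mu> * s) * f s))"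
    by (intro continuous_intros indefinite_integral_continuous_1)
  also have "?this \<longleftrightarrow> ?thesis"
  proof (rule continuous_on_cong[OF refl])
    fix t assume t: "t \<in> {0..T}"
    have "f \<in> borel_measurable (ton t)"
      by (rule ton_meas_sub[OF f(1)]) (use t in auto)
    then show "exp (- \<mu> * t) * integral {0..t} (\<lambda>s. exp (\<mu> * s) * f s) = conv \<mu> f t"
      by (intro conv_HK[symmetric, of _ _ B]) (use f t assms in auto)
  qed
  finally show ?thesis .
qed

lemma conv_ODE:
  fixes f :: "real \<Rightarrow> real"
  assumes f: "continuous_on {0..T} f" and "0 \<le> \<mu>" "t \<in> {0..T}"
  shows "(conv \<mu> f has_real_derivative f t - \<mu> * conv \<mu> f t) (at t within {0..T})"
proof -
  obtain B where B: "\<And>s. s \<in> {0..T} \<Longrightarrow> \<bar>f s\<bar> \<le> B"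
    using compact_imp_bounded[OF compact_continuous_image[OF f compact_Icc]] by (fastforce simp: bounded_iff)
  have eq: "exp (- \<mu> * s) * integral {0..s} (\<lambda>s. exp (\<mu> * s) * f s) = conv \<mu> f s" if "s \<in> {0..T}" for s
    by (rule conv_HK[symmetric, of _ _ B])
       (use B that assms in \<open>auto intro!: ton_meas_cont continuous_on_subset[OF f]\<close>)
  have "((\<lambda>t. integral {0..t} (\<lambda>s. exp (\<mu> * s) * f s)) has_real_derivative exp (\<mu> * t) * f t) (at t within {0..T})"
    by (rule integral_has_real_derivative) (use assms in \<open>auto intro!: continuous_intros\<close>)
  then have "((\<lambda>t. exp (- \<mu> * t) * integral {0..t} (\<lambda>s. exp (\<mu> * s) * f s)) has_real_derivative
     exp (- \<mu> * t) * (- \<mu>) * integral {0..t} (\<lambda>s. exp (\<mu> * s) * f s) + exp (- \<mu> * t) * (exp (\<mu> * t) * f t)) (at t within {0..T})"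
    by (auto intro!: derivative_eq_intros)
  moreover have "exp (- \<mu> * t) * (- \<mu>) * integral {0..t} (\<lambda>s. exp (\<mu> * s) * f s) + exp (- \<mu> * t) * (exp (\<mu> * t) * f t) = f t - \<mu> * conv \<mu> f t"
    using eq[OF assms(3)] by (simp add: exp_minus field_simps)
  ultimately have "((\<lambda>t. exp (- \<mu> * t) * integral {0..t} (\<lambda>s. exp (\<mu> * s) * f s)) has_real_derivative f t - \<mu> * conv \<mu> f t) (at t within {0..T})"
    by simp
  then show ?thesis
    by (rule has_field_derivative_transform_within[OF _ zero_less_one assms(3)]) (use eq in auto)
qed

text \<open>Let \<open>S\<close> be the supremum of \<open>\<phi> s * exp (- \<kappa> * s)\<close>;
  the step inequality gives \<open>S \<le> a + S / 2\<close>, and half of \<open>S\<close> is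
  absorbed. Finiteness of \<open>S\<close> comes from boundedness of \<phi>, so paths with jumps are
  covered.\<close>

lemma gronwall_weighted:
  fixes \<phi> :: "real \<Rightarrow> real"
  assumes bd: "\<And>t. t \<in> {0..T} \<Longrightarrow> \<phi> t \<le> B" and "0 \<le> \<kappa>" "0 \<le> a"
    and pos: "\<And>t. t \<in> {0..T} \<Longrightarrow> 0 \<le> \<phi> t"
    and step: "\<And>t S. t \<in> {0..T} \<Longrightarrow> 0 \<le> S \<Longrightarrow> (\<And>s. s \<in> {0..t} \<Longrightarrow> \<phi> s \<le> S * exp (\<kappa> * s)) \<Longrightarrow> \<phi> t \<le> a + S * exp (\<kappa> * t) / 2"
    and t: "t \<in> {0..T}"
  shows "\<phi> t \<le> 2 * a * exp (\<kappa> * t)"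
proof -
  define S where "S = (SUP s\<in>{0..T}. \<phi> s * exp (- \<kappa> * s))"
  have le: "\<phi> s * exp (- \<kappa> * s) \<le> B" if "s \<in> {0..T}" for s
  proof -
    have "\<phi> s * exp (- \<kappa> * s) \<le> \<phi> s * 1" using that assms(2) pos[OF that] by (intro mult_left_mono) auto
    then show ?thesis using bd[OF that] by simp
  qed
  have bdd: "bdd_above ((\<lambda>s. \<phi> s * exp (- \<kappa> * s)) ` {0..T})" by (intro bdd_aboveI2[of _ _ B] le)
  have up: "\<phi> s \<le> S * exp (\<kappa> * s)" if "s \<in> {0..T}" for s
  proof -
    have "\<phi> s * exp (- \<kappa> * s) \<le> S" unfolding S_def by (rule cSUP_upper[OF that bdd])
    then have "\<phi> s * exp (- \<kappa> * s) * exp (\<kappa> * s) \<le> S * exp (\<kappa> * s)" by (intro mult_right_mono) auto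
    then show ?thesis by (simp add: mult.assoc flip: exp_add)
  qed
  have S0: "0 \<le> S" using up[OF t] pos[OF t] by (metis exp_gt_zero mult_le_cancel_right_pos mult_zero_left order_trans zero_le_mult_iff less_le_not_le)
  have "S \<le> a + S / 2" unfolding S_def
  proof (rule cSUP_least)
    show "{0..T} \<noteq> {}" using t by auto
    fix s assume s: "s \<in> {0..T}"
    have "\<phi> s \<le> a + S * exp (\<kappa> * s) / 2" by (rule step[OF s S0]) (use s up in auto)
    then have "\<phi> s * exp (- \<kappa> * s) \<le> (a + S * exp (\<kappa> * s) / 2) * exp (- \<kappa> * s)" by (intro mult_right_mono) auto
    also have "\<dots> = a * exp (- \<kappa> * s) + S / 2" by (simp add: exp_minus field_simps)
    also have "a * exp (- \<kappa> * s) \<le> a * 1" using s assms by (intro mult_left_mono) auto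
    finally show "\<phi> s * exp (- \<kappa> * s) \<le> a + (SUP s\<in>{0..T}. \<phi> s * exp (- \<kappa> * s)) / 2" by (simp add: S_def)
  qed
  then have "S \<le> 2 * a" by simp
  then have "S * exp (\<kappa> * t) \<le> 2 * a * exp (\<kappa> * t)" by (intro mult_right_mono) auto
  then show ?thesis using up[OF t] by linarith
qed

text \<open>Lower semicontinuity of the norm under convergence of each mode: every partial sum obeys
  the bound and converges.\<close>

lemma nrm_limit:
  assumes "\<And>m. (\<lambda>j. c j m) \<longlonglongrightarrow> c' m" "\<And>j. Hs (\<lambda>m. c j m - d m)" "\<And>j. nrmd (c j) d \<le> B"
  shows "Hs (\<lambda>m. c' m - d m)" "nrmd c' d \<le> B"
proof -
  have B: "0 \<le> B" using assms(3)[of 0] nrm_nonneg[OF assms(2)[of 0]] by linarith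
  have *: "(\<Sum>m<n. kap m ^ 4 * (c' m - d m)^2) \<le> B^2" for n
  proof (rule LIMSEQ_le_const2)
    show "(\<lambda>j. \<Sum>m<n. kap m ^ 4 * (c j m - d m)^2) \<longlonglongrightarrow> (\<Sum>m<n. kap m ^ 4 * (c' m - d m)^2)"
      by (intro tendsto_intros assms(1))
    show "\<exists>N. \<forall>j\<ge>N. (\<Sum>m<n. kap m ^ 4 * (c j m - d m)^2) \<le> B^2"
      using order_trans[OF nrm_sum_le[OF assms(2)] power_mono[OF assms(3) nrm_nonneg[OF assms(2)]]] by auto
  qed
  show "Hs (\<lambda>m. c' m - d m)" "nrmd c' d \<le> B"
    using nrm_leI[of "\<lambda>m. c' m - d m" B] * B by auto
qed

lemma Hs_diffD: "Hs (\<lambda>m. c m - d m) \<Longrightarrow> Hs d \<Longrightarrow> Hs c"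
  using Hs_add(1)[of "\<lambda>m. c m - d m" d] by simp

section \<open>Joint measurability in time and sample point\<close>

lemma nrm_meas:
  assumes [measurable]: "\<And>k. (\<lambda>\<omega>. c \<omega> k) \<in> borel_measurable N"
  shows "(\<lambda>\<omega>. nrm (c \<omega>)) \<in> borel_measurable N"
  unfolding nrm_def by measurable

lemma eb_meas_torus: "eb m \<in> borel_measurable torus" "deb m \<in> borel_measurable torus"
  by (auto intro!: torus_meas_borel)

lemma ser_meas2:
  assumes [measurable]: "\<And>k. (\<lambda>\<omega>. c \<omega> k) \<in> borel_measurable N"
  shows "(\<lambda>p. ser (c (fst p)) (snd p)) \<in> borel_measurable (N \<Otimes>\<^sub>M torus)"
proof -
  note [measurable] = eb_meas_torus
  show ?thesis unfolding ser_def by measurable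
qed

lemma ser_meas1:
  assumes [measurable]: "\<And>k. (\<lambda>\<omega>. c \<omega> k) \<in> borel_measurable N"
  shows "(\<lambda>\<omega>. ser (c \<omega>) x) \<in> borel_measurable N"
  unfolding ser_def by measurable

text \<open>Joint measurability of each mode on \<open>J\<close> times the sample space. With
  \<open>J = {0..t}\<close> and \<open>N\<close> the sigma-algebra at time \<open>t\<close> it
  expresses progressive measurability; the indicator leaves values outside \<open>J\<close>
  free.\<close>

definition pm :: "real set \<Rightarrow> 'w measure \<Rightarrow> ('w \<Rightarrow> real \<Rightarrow> seq) \<Rightarrow> bool" where
  "pm J N y \<longleftrightarrow> (\<forall>m. (\<lambda>p. indicator J (fst p) * y (snd p) (fst p) m) \<in> borel_measurable (borel \<Otimes>\<^sub>M N))"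

definition initial :: "real set \<Rightarrow> bool" where
  "initial J \<longleftrightarrow> J \<in> sets borel \<and> (\<forall>t\<in>J. 0 \<le> t \<and> {0..t} \<subseteq> J)"

lemma initial_Icc [simp]: "initial {0..T}" and initial_Ici [simp]: "initial {0..}"
  by (auto simp: initial_def)

definition adm :: "real set \<Rightarrow> (real \<Rightarrow> seq) \<Rightarrow> bool" where
  "adm J y \<longleftrightarrow> initial J \<and> (\<forall>m. (\<lambda>s. indicator J s * y s m) \<in> borel_measurable borel) \<and> (\<forall>t\<in>J. Hs (y t))"

lemma pm_path: assumes "pm J N y" "\<omega> \<in> space N"
  shows "(\<lambda>s. indicator J s * y \<omega> s m) \<in> borel_measurable borel"
proof -
  have "(\<lambda>p. indicator J (fst p) * y (snd p) (fst p) m) \<in> borel_measurable (borel \<Otimes>\<^sub>M N)"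
    using assms(1) by (simp add: pm_def)
  moreover have "(\<lambda>s. (s, \<omega>)) \<in> measurable borel (borel \<Otimes>\<^sub>M N)"
    using assms(2) by simp
  ultimately have "(\<lambda>p. indicator J (fst p) * y (snd p) (fst p) m) \<circ> (\<lambda>s. (s, \<omega>)) \<in> borel_measurable borel"
    by (rule measurable_comp[rotated])
  then show ?thesis by (simp add: o_def)
qed

lemma pm_section: assumes "pm J N y" "t \<in> J"
  shows "(\<lambda>\<omega>. y \<omega> t m) \<in> borel_measurable N"
proof -
  have "(\<lambda>p. indicator J (fst p) * y (snd p) (fst p) m) \<in> borel_measurable (borel \<Otimes>\<^sub>M N)"
    using assms(1) by (simp add: pm_def)
  moreover have "(\<lambda>\<omega>. (t, \<omega>)) \<in> measurable N (borel \<Otimes>\<^sub>M N)" by simp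
  ultimately have "(\<lambda>p. indicator J (fst p) * y (snd p) (fst p) m) \<circ> (\<lambda>\<omega>. (t, \<omega>)) \<in> borel_measurable N"
    by (rule measurable_comp[rotated])
  then show ?thesis using assms(2) by (simp add: o_def)
qed

text \<open>An indicator moves the integral from the variable interval \<open>{0..t}\<close> to the
  whole line with \<open>lborel\<close>, where the measurability of parameter integrals
  applies.\<close>

lemma conv_pm:
  assumes J: "initial J"
    and f: "(\<lambda>p. indicator J (fst p) * f (snd p) (fst p)) \<in> borel_measurable (borel \<Otimes>\<^sub>M N)"
  shows "(\<lambda>p. indicator J (fst p) * conv \<mu> (f (snd p)) (fst p)) \<in> borel_measurable (borel \<Otimes>\<^sub>M N)"
proof -
  let ?G = "\<lambda>p::real \<times> 'a. \<integral>s. indicator {0..fst p} s * (exp (- \<mu> * (fst p - s)) * (indicator J s * f (snd p) s)) \<partial>lborel"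
  have [measurable]: "J \<in> sets borel" using J by (simp add: initial_def)
  have eq: "indicator J (fst p) * conv \<mu> (f (snd p)) (fst p) = indicator J (fst p) * ?G p" if "snd p \<in> space N" for p
  proof (cases "fst p \<in> J")
    case True
    then have sub: "{0..fst p} \<subseteq> J" using J by (simp add: initial_def)
    have [measurable]: "(\<lambda>s. indicator J s * f (snd p) s) \<in> borel_measurable borel"
      using pm_path[of J N "\<lambda>\<omega> s m. f \<omega> s" "snd p"] f that by (simp add: pm_def)
    have "conv \<mu> (f (snd p)) (fst p) = conv \<mu> (\<lambda>s. indicator J s * f (snd p) s) (fst p)"
      by (rule conv_cong) (use sub in \<open>auto simp: indicator_def\<close>)
    also have "\<dots> = ?G p" unfolding conv_def by (rule ton_lborel) measurable
    finally show ?thesis by simp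
  qed simp
  have "?G \<in> borel_measurable (borel \<Otimes>\<^sub>M N)"
  proof (rule lborel.borel_measurable_lebesgue_integral)
    have [measurable]: "(\<lambda>q. indicator J (snd q) * f (snd (fst q)) (snd q)) \<in> borel_measurable ((borel \<Otimes>\<^sub>M N) \<Otimes>\<^sub>M lborel)"
    proof -
      have "(\<lambda>q. (snd q, snd (fst q))) \<in> measurable ((borel \<Otimes>\<^sub>M N) \<Otimes>\<^sub>M lborel) (borel \<Otimes>\<^sub>M N)"
        by measurable
      from measurable_compose[OF this f] show ?thesis by simp
    qed
    have [measurable]: "(\<lambda>q. indicator {0..fst (fst q)} (snd q) :: real) \<in> borel_measurable ((borel \<Otimes>\<^sub>M N) \<Otimes>\<^sub>M (lborel :: real measure))"
    proof -
      have [measurable]: "(\<lambda>q. fst (fst q)) \<in> borel_measurable ((borel \<Otimes>\<^sub>M N) \<Otimes>\<^sub>M (lborel :: real measure))"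
        "snd \<in> borel_measurable ((borel \<Otimes>\<^sub>M N) \<Otimes>\<^sub>M (lborel :: real measure))" by measurable
      let ?P = "(borel \<Otimes>\<^sub>M N) \<Otimes>\<^sub>M (lborel :: real measure)"
      have "{q \<in> space ?P. 0 \<le> snd q} \<inter> {q \<in> space ?P. snd q \<le> fst (fst q)} \<in> sets ?P"
        by (intro sets.Int borel_measurable_le) measurable
      then have "(\<lambda>q. indicator ({q \<in> space ?P. 0 \<le> snd q} \<inter> {q \<in> space ?P. snd q \<le> fst (fst q)}) q :: real) \<in> borel_measurable ?P"
        by (rule borel_measurable_indicator)
      moreover have "indicator ({q \<in> space ?P. 0 \<le> snd q} \<inter> {q \<in> space ?P. snd q \<le> fst (fst q)}) q = (indicator {0..fst (fst q)} (snd q) :: real)"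
        if "q \<in> space ?P" for q
        using that by (auto simp: indicator_def)
      ultimately show ?thesis by (rule measurable_cong[THEN iffD1, rotated])
    qed
    show "(\<lambda>(p, s). indicator {0..fst p} s * (exp (- \<mu> * (fst p - s)) * (indicator J s * f (snd p) s)))
        \<in> borel_measurable ((borel \<Otimes>\<^sub>M N) \<Otimes>\<^sub>M lborel)"
      unfolding split_beta by measurable
  qed
  then have "(\<lambda>p. indicator J (fst p) * ?G p) \<in> borel_measurable (borel \<Otimes>\<^sub>M N)" by measurable
  also have "?this \<longleftrightarrow> ?thesis"
    by (rule measurable_cong[symmetric], rule eq) (auto simp: space_pair_measure)
  finally show ?thesis .
qed

section \<open>Retraction, Picard iteration and stability of the retracted equation\<close>

context flux begin

definition rho :: "real \<Rightarrow> seq \<Rightarrow> seq" where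
  "rho R c m = (if nrm c \<le> R then 1 else R / nrm c) * c m"

lemma rho_Hs: "Hs c \<Longrightarrow> Hs (rho R c)"
  unfolding rho_def[abs_def] by (rule Hs_scale)

lemma rho_id: "nrm c \<le> R \<Longrightarrow> rho R c = c"
  by (rule ext) (simp add: rho_def)

lemma rho_nrm_le: assumes "Hs c" "0 \<le> R" shows "nrm (rho R c) \<le> R"
proof (cases "nrm c \<le> R")
  case False
  then have "nrm c > 0" using assms by linarith
  have "nrm (rho R c) = \<bar>R / nrm c\<bar> * nrm c"
    unfolding rho_def[abs_def] by (simp only: False if_False nrm_scale[OF assms(1)])
  then show ?thesis using \<open>nrm c > 0\<close> assms by simp
qed (simp add: rho_id)

text \<open>With \<open>rho\<close> acting as scalars \<open>a\<close> and \<open>b\<close>, the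
  difference is \<open>a (c - d) + (a - b) d\<close>. Each part is at most the distance of
  \<open>c\<close> and \<open>d\<close>, whence the factor 2.\<close>

lemma rho_lip: assumes "Hs c" "Hs d" "0 \<le> R"
  shows "nrmd (rho R c) (rho R d) \<le> 2 * nrmd c d"
proof -
  define a b where "a = (if nrm c \<le> R then 1 else R / nrm c)" and "b = (if nrm d \<le> R then 1 else R / nrm d)"
  have n: "0 \<le> nrm c" "0 \<le> nrm d" using assms by auto
  have a: "\<bar>a\<bar> \<le> 1" using n assms(3) by (auto simp: a_def abs_mult)
  have ab: "\<bar>a - b\<bar> * nrm d \<le> \<bar>nrm c - nrm d\<bar>"
  proof -
    consider "nrm c \<le> R" "nrm d \<le> R" | "nrm c \<le> R" "nrm d > R" | "nrm c > R" "nrm d \<le> R" | "nrm c > R" "nrm d > R" by linarith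
    then show ?thesis
    proof cases
      case 1 then show ?thesis by (simp add: a_def b_def)
    next
      case 2
      then have "\<bar>a - b\<bar> * nrm d = nrm d - R" using assms(3) by (simp add: a_def b_def abs_if field_simps)
      then show ?thesis using 2 by simp
    next
      case 3
      then have "\<bar>a - b\<bar> * nrm d = (nrm c - R) * (nrm d / nrm c)"
        using assms(3) n by (simp add: a_def b_def abs_if field_simps)
      also have "\<dots> \<le> (nrm c - R) * 1" using 3 n by (intro mult_left_mono) (auto simp: divide_le_eq)
      finally show ?thesis using 3 by simp
    next
      case 4
      then have pos: "nrm c > 0" "nrm d > 0" using assms(3) by linarith+
      have "a - b = (R / (nrm c * nrm d)) * (nrm d - nrm c)" using 4 pos by (simp add: a_def b_def field_simps)
      then have "\<bar>a - b\<bar> * nrm d = (R / nrm c) * \<bar>nrm d - nrm c\<bar>"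
        using pos assms(3) by (simp add: abs_mult)
      also have "\<dots> \<le> 1 * \<bar>nrm d - nrm c\<bar>" using 4 pos by (intro mult_right_mono) auto
      finally show ?thesis by simp
    qed
  qed
  have eq: "(\<lambda>m. rho R c m - rho R d m) = (\<lambda>m. a * (c m - d m) + (a - b) * d m)"
    by (rule ext) (simp add: rho_def a_def b_def algebra_simps)
  have "nrmd (rho R c) (rho R d) \<le> nrm (\<lambda>m. a * (c m - d m)) + nrm (\<lambda>m. (a - b) * d m)"
    unfolding eq by (intro Hs_add Hs_scale Hs_diff assms)
  also have "\<dots> = \<bar>a\<bar> * nrmd c d + \<bar>a - b\<bar> * nrm d"
    using nrm_scale[OF Hs_diff(1)[OF assms(1,2)]] nrm_scale[OF assms(2)] by simp
  also have "\<dots> \<le> 1 * nrmd c d + \<bar>nrm c - nrm d\<bar>"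
    using a ab Hs_diff(1)[OF assms(1,2)] by (intro add_mono mult_right_mono) auto
  also have "\<dots> \<le> 2 * nrmd c d" using nrm_diff_ge[OF assms(1,2)] by simp
  finally show ?thesis .
qed

definition FR :: "real \<Rightarrow> seq \<Rightarrow> seq" where "FR R c = Fm (rho R c)"

abbreviation duh :: "real \<Rightarrow> (real \<Rightarrow> seq) \<Rightarrow> real \<Rightarrow> seq" where "duh R c t m \<equiv> conv (mu m) (\<lambda>s. FR R (c s) m) t"
abbreviation duF :: "(real \<Rightarrow> seq) \<Rightarrow> real \<Rightarrow> seq" where "duF c t m \<equiv> conv (mu m) (\<lambda>s. Fm (c s) m) t"

lemma FR_Fm: "nrm c \<le> R \<Longrightarrow> FR R c = Fm c"
  by (simp add: FR_def rho_id)

text \<open>One constant serves both as squared Lipschitz constant and as bound of the retracted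
  flux term in \<open>H^1\<close>; choosing it by \<open>SOME\<close> makes it a fixed function of
  \<open>R\<close>, the same for all paths and times.\<close>

definition KR :: "real \<Rightarrow> real" where
  "KR R = (SOME K. K > 0 \<and> (\<forall>c d S. Hs c \<longrightarrow> Hs d \<longrightarrow> finite S \<longrightarrow>
      (\<Sum>m\<in>S. (kap m)^2 * (FR R c m - FR R d m)^2) \<le> K * (nrmd c d)^2)
    \<and> (\<forall>c S. Hs c \<longrightarrow> finite S \<longrightarrow> (\<Sum>m\<in>S. (kap m)^2 * (FR R c m)^2) \<le> K))"

lemma KR: assumes "0 \<le> R"
  shows KR_pos: "KR R > 0"
    and FR_lip: "\<And>c d S. Hs c \<Longrightarrow> Hs d \<Longrightarrow> finite S \<Longrightarrow>
      (\<Sum>m\<in>S. (kap m)^2 * (FR R c m - FR R d m)^2) \<le> KR R * (nrmd c d)^2"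
    and FR_bound: "\<And>c S. Hs c \<Longrightarrow> finite S \<Longrightarrow> (\<Sum>m\<in>S. (kap m)^2 * (FR R c m)^2) \<le> KR R"
proof -
  obtain K where K: "K \<ge> 0" "\<And>c d S. \<lbrakk>Hs c; Hs d; nrm c \<le> R; nrm d \<le> R; finite S\<rbrakk> \<Longrightarrow>
    (\<Sum>m\<in>S. (kap m)^2 * (Fm c m - Fm d m)^2) \<le> K * (nrmd c d)^2"
    using Fm_lipschitz[of R] by blast
  let ?K = "4 * K + K * R^2 + 1"
  have 1: "(\<Sum>m\<in>S. (kap m)^2 * (FR R c m - FR R d m)^2) \<le> ?K * (nrmd c d)^2"
    if "Hs c" "Hs d" "finite S" for c d S
  proof -
    have "(\<Sum>m\<in>S. (kap m)^2 * (FR R c m - FR R d m)^2) \<le> K * (nrmd (rho R c) (rho R d))^2"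
      unfolding FR_def by (intro K rho_Hs rho_nrm_le that assms)
    also have "\<dots> \<le> K * (2 * nrmd c d)^2"
      using that by (intro mult_left_mono power_mono rho_lip assms K nrm_nonneg Hs_diff rho_Hs)
    also have "\<dots> = 4 * K * (nrmd c d)^2" by simp
    also have "\<dots> \<le> ?K * (nrmd c d)^2" using K(1) by (intro mult_right_mono) auto
    finally show ?thesis .
  qed
  have 2: "(\<Sum>m\<in>S. (kap m)^2 * (FR R c m)^2) \<le> ?K" if "Hs c" "finite S" for c S
  proof -
    have "(\<Sum>m\<in>S. (kap m)^2 * (FR R c m - Fm (\<lambda>_. 0) m)^2) \<le> K * (nrm (\<lambda>m. rho R c m - 0))^2"
      unfolding FR_def by (intro K rho_Hs rho_nrm_le that assms) (use assms in auto)
    also have "\<dots> \<le> K * R^2"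
      using that rho_nrm_le[OF that(1) assms] rho_Hs[OF that(1)] by (intro mult_left_mono power_mono K) auto
    finally show ?thesis using K(1) by (simp add: Fm_zero)
  qed
  have "?K > 0" using K(1) by (simp add: add_nonneg_pos)
  with 1 2 have "\<exists>K. K > 0 \<and> (\<forall>c d S. Hs c \<longrightarrow> Hs d \<longrightarrow> finite S \<longrightarrow>
      (\<Sum>m\<in>S. (kap m)^2 * (FR R c m - FR R d m)^2) \<le> K * (nrmd c d)^2)
    \<and> (\<forall>c S. Hs c \<longrightarrow> finite S \<longrightarrow> (\<Sum>m\<in>S. (kap m)^2 * (FR R c m)^2) \<le> K)"
    by (intro exI[of _ ?K]) blast
  from someI_ex[OF this, folded KR_def]
  show "KR R > 0" "\<And>c d S. Hs c \<Longrightarrow> Hs d \<Longrightarrow> finite S \<Longrightarrow>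
      (\<Sum>m\<in>S. (kap m)^2 * (FR R c m - FR R d m)^2) \<le> KR R * (nrmd c d)^2"
    "\<And>c S. Hs c \<Longrightarrow> finite S \<Longrightarrow> (\<Sum>m\<in>S. (kap m)^2 * (FR R c m)^2) \<le> KR R"
    by blast+
qed

lemma FR_abs_le: assumes "0 \<le> R" "Hs c" shows "\<bar>FR R c m\<bar> \<le> sqrt (KR R)"
proof -
  have "1 * (FR R c m)^2 \<le> (kap m)^2 * (FR R c m)^2"
    using kap_ge1[of m] by (intro mult_right_mono one_le_power) auto
  also have "\<dots> \<le> KR R" using FR_bound[OF assms(1,2), of "{m}"] by simp
  finally show ?thesis by (simp add: real_le_rsqrt)
qed

lemma Fm_meas:
  assumes "\<And>k. (\<lambda>\<omega>. c \<omega> k) \<in> borel_measurable N"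
  shows "(\<lambda>\<omega>. Fm (c \<omega>) m) \<in> borel_measurable N"
proof -
  note [measurable] = ser_meas2[OF assms] eb_meas_torus
  have "(\<lambda>(\<omega>, x). A (ser (c \<omega>) x) * deb m x) \<in> borel_measurable (N \<Otimes>\<^sub>M torus)"
    unfolding split_beta by measurable
  then show ?thesis unfolding Fm_def by (rule torus.borel_measurable_lebesgue_integral)
qed

lemma FR_meas:
  assumes [measurable]: "\<And>k. (\<lambda>\<omega>. c \<omega> k) \<in> borel_measurable N"
  shows "(\<lambda>\<omega>. FR R (c \<omega>) m) \<in> borel_measurable N"
proof -
  have [measurable]: "(\<lambda>\<omega>. nrm (c \<omega>)) \<in> borel_measurable N" by (rule nrm_meas) measurable
  show ?thesis unfolding FR_def by (rule Fm_meas) (unfold rho_def, measurable)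
qed

lemma FR_pm:
  assumes J: "initial J" and y: "pm J N y"
  shows "(\<lambda>p. indicator J (fst p) * FR R (y (snd p) (fst p)) m) \<in> borel_measurable (borel \<Otimes>\<^sub>M N)"
proof -
  have [measurable]: "J \<in> sets borel" using J by (simp add: initial_def)
  have [measurable]: "(\<lambda>p. FR R (\<lambda>k. indicator J (fst p) * y (snd p) (fst p) k) m) \<in> borel_measurable (borel \<Otimes>\<^sub>M N)"
    by (rule FR_meas) (use y in \<open>simp add: pm_def\<close>)
  have "(\<lambda>p. indicator J (fst p) * FR R (y (snd p) (fst p)) m)
    = (\<lambda>p. indicator J (fst p) * FR R (\<lambda>k. indicator J (fst p) * y (snd p) (fst p) k) m)"
    by (rule ext) (simp split: split_indicator)
  also have "\<dots> \<in> borel_measurable (borel \<Otimes>\<^sub>M N)" by measurable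
  finally show ?thesis .
qed

lemma pm_adm: "pm J N y \<Longrightarrow> \<omega> \<in> space N \<Longrightarrow> initial J \<Longrightarrow> (\<And>t. t \<in> J \<Longrightarrow> Hs (y \<omega> t)) \<Longrightarrow> adm J (y \<omega>)"
  by (auto simp: adm_def intro: pm_path)

text \<open>A deterministic path is a process over a one-point sample space, so the measurability
  facts about \<open>pm\<close> specialise to \<open>adm\<close>.\<close>

lemma adm_pm: "adm J y \<Longrightarrow> pm J (count_space (UNIV::unit set)) (\<lambda>_. y)"
proof -
  assume "adm J y"
  then have *: "(\<lambda>s. indicator J s * y s m) \<in> borel_measurable borel" for m by (simp add: adm_def)
  show ?thesis unfolding pm_def using measurable_compose[OF measurable_fst *] by blast
qed

lemma adm_FR_meas: assumes "adm J c" "t \<in> J" shows "(\<lambda>s. FR R (c s) m) \<in> borel_measurable (ton t)"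
proof -
  have J: "initial J" using assms by (simp add: adm_def)
  have "(\<lambda>s. indicator J s * FR R (c s) m) \<in> borel_measurable borel"
    using pm_path[of J "count_space (UNIV::unit set)" "\<lambda>_ s m. FR R (c s) m" "()"] FR_pm[OF J adm_pm[OF assms(1)]]
    by (simp add: pm_def)
  then show ?thesis using J assms(2) by (intro ton_meas_ind) (auto simp: initial_def)
qed

text \<open>The exponential weight for which \<open>conv_energy\<close>, used with rate
  \<open>2 * kt R\<close>, makes the Duhamel map a contraction with factor 1/2.\<close>

definition kt :: "real \<Rightarrow> real" where "kt R = KR R / \<nu>"

lemma kt_pos: "0 \<le> R \<Longrightarrow> kt R > 0"
  using KR_pos nu by (simp add: kt_def)

lemma duhamel_lip:
  assumes R: "0 \<le> R" and c: "adm J c" and d: "adm J d" and t: "t \<in> J" and S: "0 \<le> S"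
    and le: "\<And>s. s \<in> {0..t} \<Longrightarrow> nrmd (c s) (d s) \<le> S * exp (kt R * s)"
  shows "Hs (\<lambda>m. duh R c t m - duh R d t m)" (is "Hs ?v")
    and "nrm (\<lambda>m. duh R c t m - duh R d t m) \<le> S * exp (kt R * t) / 2"
proof -
  have J: "0 \<le> t" "{0..t} \<subseteq> J" using c t by (auto simp: adm_def initial_def)
  then have H: "Hs (c s)" "Hs (d s)" if "s \<in> {0..t}" for s using that c d by (auto simp: adm_def)
  have veq: "?v m = conv (mu m) (\<lambda>s. FR R (c s) m - FR R (d s) m) t" for m
    by (rule conv_diff[of _ _ "sqrt (KR R)" _ "sqrt (KR R)"]) (use FR_abs_le[OF R] H nu adm_FR_meas[OF c t] adm_FR_meas[OF d t] in auto)
  have "(\<Sum>m<n. kap m ^ 4 * (?v m)^2) \<le> (S * exp (kt R * t) / 2)^2" for n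
  proof -
    have "(\<Sum>m<n. kap m ^ 4 * (?v m)^2) = (\<Sum>m<n. (kap m)^2 * (kap m)^2 * (conv (mu m) (\<lambda>s. FR R (c s) m - FR R (d s) m) t)^2)"
      unfolding veq by (simp flip: power_add)
    also have "\<dots> \<le> (KR R * S^2) * exp (2 * kt R * t) / (2 * \<nu> * (2 * kt R))"
    proof (rule conv_energy[where B="\<lambda>_. 2 * sqrt (KR R)"])
      fix s assume s: "s \<in> {0..t}"
      show "\<bar>FR R (c s) m - FR R (d s) m\<bar> \<le> 2 * sqrt (KR R)" for m
        using FR_abs_le[OF R H(1)[OF s], of m] FR_abs_le[OF R H(2)[OF s], of m] by linarith
      have "(\<Sum>m<n. (kap m)^2 * (FR R (c s) m - FR R (d s) m)^2) \<le> KR R * (nrmd (c s) (d s))^2"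
        by (rule FR_lip[OF R H(1)[OF s] H(2)[OF s]]) simp
      also have "\<dots> \<le> KR R * (S * exp (kt R * s))^2"
        using KR_pos[OF R] by (intro mult_left_mono power_mono le s nrm_nonneg Hs_diff H) auto
      also have "\<dots> = (KR R * S^2) * exp (2 * kt R * s)" by (simp add: power_mult_distrib exp_double[symmetric] mult.assoc)
      finally show "(\<Sum>m<n. (kap m)^2 * (FR R (c s) m - FR R (d s) m)^2) \<le> (KR R * S^2) * exp (2 * kt R * s)" .
    qed (use nu J KR_pos[OF R] kt_pos[OF R] adm_FR_meas[OF c t] adm_FR_meas[OF d t] in auto)
    also have "\<dots> = (S * exp (kt R * t) / 2)^2"
      using nu KR_pos[OF R] by (simp add: kt_def power_mult_distrib power_divide exp_double[symmetric] field_simps)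
    finally show ?thesis .
  qed
  from nrm_leI[OF this] S show "Hs ?v" "nrm ?v \<le> S * exp (kt R * t) / 2" by auto
qed

lemma duhamel_bound:
  assumes R: "0 \<le> R" and c: "adm J c" and t: "t \<in> J"
  shows "Hs (\<lambda>m. duh R c t m)" (is "Hs ?v")
    and "nrm (\<lambda>m. duh R c t m) \<le> exp (kt R * t) / 2"
proof -
  have J: "0 \<le> t" "{0..t} \<subseteq> J" using c t by (auto simp: adm_def initial_def)
  then have H: "Hs (c s)" if "s \<in> {0..t}" for s using that c by (auto simp: adm_def)
  have "(\<Sum>m<n. kap m ^ 4 * (?v m)^2) \<le> (exp (kt R * t) / 2)^2" for n
  proof -
    have "(\<Sum>m<n. kap m ^ 4 * (?v m)^2) = (\<Sum>m<n. (kap m)^2 * (kap m)^2 * (duh R c t m)^2)"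
      by (simp flip: power_add)
    also have "\<dots> \<le> KR R * exp (2 * kt R * t) / (2 * \<nu> * (2 * kt R))"
    proof (rule conv_energy[where B="\<lambda>_. sqrt (KR R)"])
      fix s assume s: "s \<in> {0..t}"
      show "\<bar>FR R (c s) m\<bar> \<le> sqrt (KR R)" for m by (rule FR_abs_le[OF R H[OF s]])
      have "(\<Sum>m<n. (kap m)^2 * (FR R (c s) m)^2) \<le> KR R * 1"
        using FR_bound[OF R H[OF s], of "{..<n}"] by simp
      also have "\<dots> \<le> KR R * exp (2 * kt R * s)" using KR_pos[OF R] kt_pos[OF R] s by (intro mult_left_mono) auto
      finally show "(\<Sum>m<n. (kap m)^2 * (FR R (c s) m)^2) \<le> KR R * exp (2 * kt R * s)" .
    qed (use nu J KR_pos[OF R] kt_pos[OF R] adm_FR_meas[OF c t] in auto)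
    also have "\<dots> = (exp (kt R * t) / 2)^2"
      using nu KR_pos[OF R] by (simp add: kt_def power_divide exp_double[symmetric] field_simps)
    finally show ?thesis .
  qed
  from nrm_leI[OF this] show "Hs ?v" "nrm ?v \<le> exp (kt R * t) / 2" by auto
qed

primrec pic :: "real \<Rightarrow> (real \<Rightarrow> seq) \<Rightarrow> nat \<Rightarrow> real \<Rightarrow> seq" where
  "pic R y 0 = y"
| "pic R y (Suc i) = (\<lambda>t m. y t m + duh R (pic R y i) t m)"

text \<open>Defined mode by mode as a limit, so that joint measurability is inherited from the
  iterates; convergence is a separate fact (\<open>sol_props\<close>).\<close>

definition sol :: "real \<Rightarrow> (real \<Rightarrow> seq) \<Rightarrow> real \<Rightarrow> seq" where
  "sol R y t m = lim (\<lambda>i. pic R y i t m)"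

lemma pic_pm: assumes "initial J" "pm J N y" shows "pm J N (\<lambda>\<omega>. pic R (y \<omega>) i)"
proof (induction i)
  case 0 then show ?case using assms by simp
next
  case (Suc i)
  have "(\<lambda>p. indicator J (fst p) * y (snd p) (fst p) m + indicator J (fst p) * conv (mu m) (\<lambda>s. FR R (pic R (y (snd p)) i s) m) (fst p)) \<in> borel_measurable (borel \<Otimes>\<^sub>M N)" for m
    using assms(2) conv_pm[OF assms(1) FR_pm[OF assms(1) Suc]]
    by (intro borel_measurable_add) (auto simp: pm_def)
  then show ?case by (simp add: pm_def distrib_left)
qed

lemma sol_pm: assumes "initial J" "pm J N y" shows "pm J N (\<lambda>\<omega>. sol R (y \<omega>))"
proof -
  have "(\<lambda>p. indicator J (fst p) * sol R (y (snd p)) (fst p) m) \<in> borel_measurable (borel \<Otimes>\<^sub>M N)" for m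
  proof -
    have [measurable]: "J \<in> sets borel" using assms by (simp add: initial_def)
    have *[measurable]: "(\<lambda>p. indicator J (fst p) * pic R (y (snd p)) i (fst p) m) \<in> borel_measurable (borel \<Otimes>\<^sub>M N)" for i
      using pic_pm[OF assms] by (simp add: pm_def)
    have "(\<lambda>p. indicator J (fst p) * sol R (y (snd p)) (fst p) m)
      = (\<lambda>p. indicator J (fst p) * lim (\<lambda>i. indicator J (fst p) * pic R (y (snd p)) i (fst p) m))"
      by (rule ext) (simp add: sol_def split: split_indicator)
    also have "\<dots> \<in> borel_measurable (borel \<Otimes>\<^sub>M N)" by measurable
    finally show ?thesis .
  qed
  then show ?thesis by (simp add: pm_def)
qed

lemma pm_admI: "pm J (count_space (UNIV::unit set)) (\<lambda>_. c) \<Longrightarrow> initial J \<Longrightarrow> (\<And>t. t \<in> J \<Longrightarrow> Hs (c t)) \<Longrightarrow> adm J c"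
  using pm_adm[of J "count_space (UNIV::unit set)" "\<lambda>_. c" "()"] by simp

lemma pic_adm: assumes "adm J y" "0 \<le> R" shows "adm J (pic R y i)"
proof (induction i)
  case 0 then show ?case using assms by simp
next
  case (Suc i)
  have J: "initial J" using assms by (simp add: adm_def)
  show ?case
  proof (rule pm_admI[OF pic_pm[OF J adm_pm[OF assms(1)]] J])
    fix t assume t: "t \<in> J"
    show "Hs (pic R y (Suc i) t)" unfolding pic.simps
      by (intro Hs_add duhamel_bound[OF assms(2) Suc t]) (use assms t in \<open>simp add: adm_def\<close>)
  qed
qed

lemma pic_step: assumes y: "adm J y" "0 \<le> R" "t \<in> J"
  shows "nrmd (pic R y (Suc i) t) (pic R y i t) \<le> (1/2) ^ i * exp (kt R * t)"
  using y(3)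
proof (induction i arbitrary: t)
  case 0
  have "nrmd (pic R y (Suc 0) t) (pic R y 0 t) \<le> exp (kt R * t) / 2"
    using duhamel_bound(2)[OF y(2,1) 0] by simp
  also have "\<dots> \<le> exp (kt R * t)" by simp
  finally show ?case by simp
next
  case (Suc i)
  have sub: "{0..t} \<subseteq> J" using Suc.prems y by (auto simp: adm_def initial_def)
  have "nrm (\<lambda>m. pic R y (Suc (Suc i)) t m - pic R y (Suc i) t m) =
     nrm (\<lambda>m. duh R (pic R y (Suc i)) t m - duh R (pic R y i) t m)"
    by (simp only: pic.simps add_diff_cancel_left)
  also have "\<dots> \<le> (1/2) ^ i * exp (kt R * t) / 2"
    by (rule duhamel_lip(2)[OF y(2) pic_adm[OF y(1,2)] pic_adm[OF y(1,2)] Suc.prems]) (use Suc.IH sub in auto)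
  finally show ?case by simp
qed

text \<open>Successive iterates differ by at most \<open>(1/2) ^ i * exp (kt R * t)\<close>, so each
  mode converges; \<open>nrm_limit\<close> then upgrades the geometric tail estimate from modes to
  the norm.\<close>

lemma sol_props: assumes y: "adm J y" "0 \<le> R" "t \<in> J"
  shows sol_lim: "(\<lambda>i. pic R y i t m) \<longlonglongrightarrow> sol R y t m"
    and sol_Hs: "Hs (sol R y t)"
    and sol_dist: "nrmd (sol R y t) (pic R y i t) \<le> 2 * (1/2) ^ i * exp (kt R * t)"
proof -
  have H: "Hs (pic R y i t)" for i using pic_adm[OF y(1,2)] y(3) by (simp add: adm_def)
  have c: "\<bar>pic R y (Suc i) t m - pic R y i t m\<bar> \<le> (1/2) ^ i * exp (kt R * t)" for i m
    using nrm_comp(2)[OF Hs_diff(1)[OF H[of "Suc i"] H[of i]], of m] pic_step[OF y, of i] by linarith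
  have lim: "(\<lambda>i. pic R y i t m) \<longlonglongrightarrow> sol R y t m" for m
  proof -
    have "summable (\<lambda>i. pic R y (Suc i) t m - pic R y i t m)"
      by (rule summable_comparison_test_ev[OF _ summable_mult2[of "\<lambda>i. (1/2::real) ^ i" "exp (kt R * t)"]])
         (use c in \<open>auto intro!: always_eventually summable_geometric\<close>)
    from summable_LIMSEQ[OF this] have "convergent (\<lambda>n. pic R y n t m - pic R y 0 t m)"
      unfolding sum_lessThan_telescope[of "\<lambda>i. pic R y i t m"] by (rule convergentI)
    then have "convergent (\<lambda>n. pic R y n t m)"
      using convergent_add_const_right_iff[of "\<lambda>n. pic R y n t m" "- pic R y 0 t m"] by simp
    then show ?thesis by (simp add: convergent_LIMSEQ_iff sol_def)
  qed
  show "(\<lambda>i. pic R y i t m) \<longlonglongrightarrow> sol R y t m" by (rule lim)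
  have tail: "nrm (\<lambda>m. pic R y (j + i) t m - pic R y i t m) \<le> (2 * (1/2) ^ i - 2 * (1/2) ^ (j + i)) * exp (kt R * t)" for i j
  proof (induction j)
    case (Suc j)
    have "nrm (\<lambda>m. pic R y (Suc j + i) t m - pic R y i t m) \<le> nrm (\<lambda>m. pic R y (Suc (j + i)) t m - pic R y (j + i) t m) + nrm (\<lambda>m. pic R y (j + i) t m - pic R y i t m)"
      using nrm_diff_triangle[OF H[of "Suc (j + i)"] H[of "j + i"] H[of i]] by simp
    also have "\<dots> \<le> (1/2) ^ (j + i) * exp (kt R * t) + (2 * (1/2) ^ i - 2 * (1/2) ^ (j + i)) * exp (kt R * t)"
      by (intro add_mono Suc pic_step[OF y])
    also have "\<dots> = (2 * (1/2) ^ i - 2 * (1/2) ^ (Suc j + i)) * exp (kt R * t)" by (simp add: algebra_simps)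
    finally show ?case .
  qed simp
  have "nrm (\<lambda>m. pic R y (j + i) t m - pic R y i t m) \<le> 2 * (1/2) ^ i * exp (kt R * t)" for i j
    by (rule order_trans[OF tail]) (intro mult_right_mono, auto)
  from nrm_limit[OF LIMSEQ_ignore_initial_segment[OF lim] Hs_diff(1)[OF H H] this]
  have *: "Hs (\<lambda>m. sol R y t m - pic R y i t m)" "nrmd (sol R y t) (pic R y i t) \<le> 2 * (1/2) ^ i * exp (kt R * t)" for i
    by blast+
  show "nrmd (sol R y t) (pic R y i t) \<le> 2 * (1/2) ^ i * exp (kt R * t)" by (rule *(2))
  show "Hs (sol R y t)" by (rule Hs_diffD[OF *(1) H])
qed

lemma sol_adm: assumes "adm J y" "0 \<le> R" shows "adm J (sol R y)"
proof -
  have J: "initial J" using assms by (simp add: adm_def)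
  show ?thesis by (rule pm_admI[OF sol_pm[OF J adm_pm[OF assms(1)]] J sol_Hs[OF assms]])
qed

lemma sol_eq: assumes y: "adm J y" "0 \<le> R" "t \<in> J"
  shows "sol R y t m = y t m + duh R (sol R y) t m"
proof -
  let ?c = "\<lambda>f. conv (mu m) f t"
  have sub: "{0..t} \<subseteq> J" using y by (auto simp: adm_def initial_def)
  have b: "\<bar>?c (\<lambda>s. FR R (sol R y s) m) - ?c (\<lambda>s. FR R (pic R y i s) m)\<bar> \<le> (2 * (1/2) ^ i) * exp (kt R * t) / 2" for i
  proof -
    have le: "nrmd (sol R y s) (pic R y i s) \<le> 2 * (1/2) ^ i * exp (kt R * s)" if "s \<in> {0..t}" for s
      using sol_dist[OF y(1,2)] sub that by blast
    have "0 \<le> 2 * (1/2::real) ^ i" by simp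
    note d = duhamel_lip[OF y(2) sol_adm[OF y(1,2)] pic_adm[OF y(1,2)] y(3) this le]
    show ?thesis using order_trans[OF nrm_comp(2)[OF d(1), of m] d(2)] by simp
  qed
  have "(\<lambda>i. ?c (\<lambda>s. FR R (sol R y s) m) - ?c (\<lambda>s. FR R (pic R y i s) m)) \<longlonglongrightarrow> 0"
  proof (rule Lim_null_comparison)
    show "\<forall>\<^sub>F i in sequentially. norm (?c (\<lambda>s. FR R (sol R y s) m) - ?c (\<lambda>s. FR R (pic R y i s) m)) \<le> (2 * (1/2) ^ i) * exp (kt R * t) / 2"
      using b by simp
    show "(\<lambda>i. (2 * (1/2) ^ i) * exp (kt R * t) / 2) \<longlonglongrightarrow> 0"
      by (auto intro!: tendsto_eq_intros LIMSEQ_realpow_zero)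
  qed
  from tendsto_diff[OF tendsto_const this, of "y t m + ?c (\<lambda>s. FR R (sol R y s) m)"]
  have "(\<lambda>i. pic R y (Suc i) t m) \<longlonglongrightarrow> y t m + ?c (\<lambda>s. FR R (sol R y s) m)"
    by (simp add: algebra_simps)
  from LIMSEQ_unique[OF LIMSEQ_Suc[OF sol_lim[OF y]] this] show ?thesis .
qed

text \<open>The common source of stability: the contraction factor 1/2 leaves at most twice the size
  of the remainder \<open>r\<close>, up to the weight. Uniqueness, causality, agreement for
  different radii and approximation by frozen noise all rest on it.\<close>

lemma duhamel_stable:
  assumes R: "0 \<le> R" and c: "adm J c" and d: "adm J d" and t: "t \<in> J" and a: "0 \<le> a"
    and eq: "\<And>s m. s \<in> {0..t} \<Longrightarrow> c s m - d s m = r s m + (duh R c s m - duh R d s m)"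
    and r: "\<And>s. s \<in> {0..t} \<Longrightarrow> Hs (r s)" "\<And>s. s \<in> {0..t} \<Longrightarrow> nrm (r s) \<le> a"
  shows "nrmd (c t) (d t) \<le> 2 * a * exp (kt R * t)"
proof (rule gronwall_weighted[where T=t and B="a + (exp (kt R * t) / 2 + exp (kt R * t) / 2)" and \<phi>="\<lambda>t. nrmd (c t) (d t)"])
  have J: "0 \<le> t" "{0..t} \<subseteq> J" using c t by (auto simp: adm_def initial_def)
  show "0 \<le> kt R" using kt_pos[OF R] by simp
  show "0 \<le> a" by fact
  show "t \<in> {0..t}" using J by simp
  fix s assume s: "s \<in> {0..t}"
  then have sJ: "s \<in> J" using J by auto
  have H: "Hs (c s)" "Hs (d s)" using sJ c d by (auto simp: adm_def)
  show "0 \<le> nrmd (c s) (d s)" by (intro nrm_nonneg Hs_diff H)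
  have e: "exp (kt R * s) \<le> exp (kt R * t)" using s kt_pos[OF R] by simp
  have "nrmd (c s) (d s) \<le> nrm (r s) + nrm (\<lambda>m. duh R c s m - duh R d s m)"
    unfolding eq[OF s] by (intro Hs_add Hs_diff duhamel_bound[OF R _ sJ] c d r s)
  moreover have "nrm (\<lambda>m. duh R c s m - duh R d s m) \<le> exp (kt R * s) / 2 + exp (kt R * s) / 2"
    by (rule order_trans[OF Hs_diff(2)[OF duhamel_bound(1)[OF R c sJ] duhamel_bound(1)[OF R d sJ]]])
       (intro add_mono duhamel_bound[OF R _ sJ] c d)
  ultimately show "nrmd (c s) (d s) \<le> a + (exp (kt R * t) / 2 + exp (kt R * t) / 2)"
    using r(2)[OF s] e by linarith
  fix S assume S: "0 \<le> S" "\<And>s'. s' \<in> {0..s} \<Longrightarrow> nrmd (c s') (d s') \<le> S * exp (kt R * s')"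
  have "nrmd (c s) (d s) \<le> nrm (r s) + nrm (\<lambda>m. duh R c s m - duh R d s m)"
    by fact
  also have "\<dots> \<le> a + S * exp (kt R * s) / 2"
    by (intro add_mono r s duhamel_lip[OF R c d sJ S])
  finally show "nrmd (c s) (d s) \<le> a + S * exp (kt R * s) / 2" .
qed

end

subsection \<open>Continuous paths and the mild formulation\<close>

definition ncont :: "real set \<Rightarrow> (real \<Rightarrow> seq) \<Rightarrow> bool" where
  "ncont J c \<longleftrightarrow> (\<forall>t\<in>J. Hs (c t)) \<and> (\<forall>t\<in>J. ((\<lambda>s. nrmd (c s) (c t)) \<longlongrightarrow> 0) (at t within J))"

lemma ev_within: "(\<And>s. s \<in> J \<Longrightarrow> P s) \<Longrightarrow> \<forall>\<^sub>F s in at t within J. P s"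
  by (simp add: eventually_at_filter)

lemma ncont_Hs: "ncont J c \<Longrightarrow> t \<in> J \<Longrightarrow> Hs (c t)"
  by (simp add: ncont_def)

lemma ncont_subset: "ncont J c \<Longrightarrow> I \<subseteq> J \<Longrightarrow> ncont I c"
  unfolding ncont_def by (meson subsetD tendsto_within_subset)

lemma ncont_cong: assumes "ncont J c" "\<And>t. t \<in> J \<Longrightarrow> c t = d t" shows "ncont J d"
  unfolding ncont_def
proof (intro conjI ballI)
  fix t assume t: "t \<in> J"
  then show "Hs (d t)" using assms by (metis ncont_Hs)
  have "((\<lambda>s. nrmd (c s) (c t)) \<longlongrightarrow> 0) (at t within J)" using assms t by (simp add: ncont_def)
  then show "((\<lambda>s. nrmd (d s) (d t)) \<longlongrightarrow> 0) (at t within J)"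
    by (rule Lim_transform_eventually) (rule ev_within, use assms t in auto)
qed

lemma ncont_comp: assumes "ncont J c" shows "continuous_on J (\<lambda>t. c t m)"
  unfolding continuous_on_def
proof
  fix t assume t: "t \<in> J"
  have "((\<lambda>s. c s m - c t m) \<longlongrightarrow> 0) (at t within J)"
  proof (rule Lim_null_comparison)
    show "\<forall>\<^sub>F s in at t within J. norm (c s m - c t m) \<le> nrmd (c s) (c t)"
      using nrm_comp(2)[OF Hs_diff(1)[OF ncont_Hs[OF assms] ncont_Hs[OF assms t]]] by (intro ev_within) auto
    show "((\<lambda>s. nrmd (c s) (c t)) \<longlongrightarrow> 0) (at t within J)" using assms t by (simp add: ncont_def)
  qed
  then show "((\<lambda>s. c s m) \<longlongrightarrow> c t m) (at t within J)" by (simp add: LIM_zero_iff)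
qed

lemma ncont_diff_nrm: assumes c: "ncont J c" and d: "ncont J d"
  shows "continuous_on J (\<lambda>t. nrmd (c t) (d t))"
  unfolding continuous_on_def
proof
  fix t assume t: "t \<in> J"
  have "((\<lambda>s. nrmd (c s) (d s) - nrmd (c t) (d t)) \<longlongrightarrow> 0) (at t within J)"
  proof (rule Lim_null_comparison)
    show "((\<lambda>s. nrmd (c s) (c t) + nrmd (d s) (d t)) \<longlongrightarrow> 0) (at t within J)"
      using c d t tendsto_add[of _ 0 _ _ 0] by (fastforce simp: ncont_def)
    show "\<forall>\<^sub>F s in at t within J. norm (nrmd (c s) (d s) - nrmd (c t) (d t)) \<le> nrmd (c s) (c t) + nrmd (d s) (d t)"
    proof (rule ev_within)
      fix s assume s: "s \<in> J"
      note H = ncont_Hs[OF c s] ncont_Hs[OF d s] ncont_Hs[OF c t] ncont_Hs[OF d t]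
      have "\<bar>nrmd (c s) (d s) - nrmd (c t) (d t)\<bar> \<le> nrm (\<lambda>m. (c s m - d s m) - (c t m - d t m))"
        by (intro nrm_diff_ge Hs_diff H)
      also have "(\<lambda>m. (c s m - d s m) - (c t m - d t m)) = (\<lambda>m. (c s m - c t m) - (d s m - d t m))" by auto
      also have "nrm \<dots> \<le> nrmd (c s) (c t) + nrmd (d s) (d t)" by (intro Hs_diff H)
      finally show "norm (nrmd (c s) (d s) - nrmd (c t) (d t)) \<le> nrmd (c s) (c t) + nrmd (d s) (d t)"
        by simp
    qed
  qed
  then show "((\<lambda>s. nrmd (c s) (d s)) \<longlongrightarrow> nrmd (c t) (d t)) (at t within J)" by (simp add: LIM_zero_iff)
qed

lemma ncont_nrm: "ncont J c \<Longrightarrow> continuous_on J (\<lambda>t. nrm (c t))"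
  using ncont_diff_nrm[of J c "\<lambda>_ _. 0"] by (simp add: ncont_def)

lemma ncont_add: assumes c: "ncont J c" and d: "ncont J d" shows "ncont J (\<lambda>t m. c t m + d t m)"
  unfolding ncont_def
proof (intro conjI ballI)
  fix t assume t: "t \<in> J"
  show "Hs (\<lambda>m. c t m + d t m)" by (intro Hs_add ncont_Hs[OF c t] ncont_Hs[OF d t])
  show "((\<lambda>s. nrm (\<lambda>m. c s m + d s m - (c t m + d t m))) \<longlongrightarrow> 0) (at t within J)"
  proof (rule Lim_null_comparison)
    show "((\<lambda>s. nrmd (c s) (c t) + nrmd (d s) (d t)) \<longlongrightarrow> 0) (at t within J)"
      using c d t tendsto_add[of _ 0 _ _ 0] by (fastforce simp: ncont_def)
    show "\<forall>\<^sub>F s in at t within J. norm (nrm (\<lambda>m. c s m + d s m - (c t m + d t m))) \<le> nrmd (c s) (c t) + nrmd (d s) (d t)"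
    proof (rule ev_within)
      fix s assume s: "s \<in> J"
      note H = Hs_diff(1)[OF ncont_Hs[OF c s] ncont_Hs[OF c t]] Hs_diff(1)[OF ncont_Hs[OF d s] ncont_Hs[OF d t]]
      have "(\<lambda>m. c s m + d s m - (c t m + d t m)) = (\<lambda>m. (c s m - c t m) + (d s m - d t m))" by auto
      then show "norm (nrm (\<lambda>m. c s m + d s m - (c t m + d t m))) \<le> nrmd (c s) (c t) + nrmd (d s) (d t)"
        using Hs_add[OF H] by simp
    qed
  qed
qed

lemma ncont_bdd: assumes "ncont {0..T} c" obtains B where "0 \<le> B" "\<And>t. t \<in> {0..T} \<Longrightarrow> nrm (c t) \<le> B"
proof -
  obtain B where "\<And>t. t \<in> {0..T} \<Longrightarrow> \<bar>nrm (c t)\<bar> \<le> B"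
    using compact_imp_bounded[OF compact_continuous_image[OF ncont_nrm[OF assms] compact_Icc]] by (fastforce simp: bounded_iff)
  then have "\<And>t. t \<in> {0..T} \<Longrightarrow> nrm (c t) \<le> \<bar>B\<bar>" by fastforce
  then show ?thesis using that[of "\<bar>B\<bar>"] by auto
qed

text \<open>The Weierstrass M-test for the series of the squared distance: continuous modes and one
  summable dominating sequence give continuity in \<open>H^2\<close>. This is why dominating
  sequences accompany the noise paths.\<close>

lemma ncont_M:
  assumes c: "\<And>m. continuous_on J (\<lambda>t. c t m)" and M: "\<And>t m. t \<in> J \<Longrightarrow> kap m ^ 4 * (c t m)^2 \<le> M m" "summable M"
  shows "ncont J c"
  unfolding ncont_def
proof (intro conjI ballI)
  fix t assume t: "t \<in> J"
  have H: "Hs (c s)" if "s \<in> J" for s unfolding Hs_def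
    by (rule summable_comparison_test_ev[OF _ M(2)]) (use M(1)[OF that] in \<open>auto intro!: always_eventually\<close>)
  then show "Hs (c t)" using t by simp
  have "uniform_limit J (\<lambda>n s. \<Sum>m<n. kap m ^ 4 * (c s m - c t m)^2) (\<lambda>s. \<Sum>m. kap m ^ 4 * (c s m - c t m)^2) sequentially"
  proof (rule Weierstrass_m_test)
    show "summable (\<lambda>m. 4 * M m)" using M(2) by simp
    fix m s assume s: "s \<in> J"
    have "(c s m - c t m)^2 \<le> 2 * (c s m)^2 + 2 * (c t m)^2"
      using sum_squares_bound[of "c s m" "- c t m"] by (simp add: power2_diff)
    then have "kap m ^ 4 * (c s m - c t m)^2 \<le> kap m ^ 4 * (2 * (c s m)^2 + 2 * (c t m)^2)" by (intro mult_left_mono) auto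
    also have "\<dots> \<le> 4 * M m" using M(1)[OF s, of m] M(1)[OF t, of m] by (simp add: algebra_simps)
    finally show "norm (kap m ^ 4 * (c s m - c t m)^2) \<le> 4 * M m" by simp
  qed
  then have "continuous_on J (\<lambda>s. \<Sum>m. kap m ^ 4 * (c s m - c t m)^2)"
    by (rule uniform_limit_theorem[rotated]) (auto intro!: always_eventually continuous_intros c)
  then have "((\<lambda>s. \<Sum>m. kap m ^ 4 * (c s m - c t m)^2) \<longlongrightarrow> 0) (at t within J)"
    using t unfolding continuous_on_def by fastforce
  from tendsto_real_sqrt[OF this] show "((\<lambda>s. nrmd (c s) (c t)) \<longlongrightarrow> 0) (at t within J)"
    by (simp add: nrm_def)
qed

lemma ncont_adm: assumes "ncont J c" "initial J" shows "adm J c"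
  unfolding adm_def
proof (intro conjI allI ballI assms(2))
  fix m
  have "(\<lambda>s. indicator J s *\<^sub>R c s m) \<in> borel_measurable borel"
    by (rule borel_measurable_continuous_on_indicator) (use ncont_comp[OF assms(1)] assms(2) in \<open>auto simp: initial_def\<close>)
  then show "(\<lambda>s. indicator J s * c s m) \<in> borel_measurable borel" by simp
qed (rule ncont_Hs[OF assms(1)])

lemma ton_mono_dom:
  fixes f :: "real \<Rightarrow> real"
  assumes "integrable (ton T) f" "\<And>s. s \<in> {0..T} \<Longrightarrow> 0 \<le> f s" "t \<le> T"
  shows "integrable (ton t) f" "sint t f \<le> sint T f"
proof -
  have sub: "{0..t} \<subseteq> {0..T}" using assms(3) by auto
  show i: "integrable (ton t) f"
    using integrable_subinterval[of 0 T f 0 t] assms(1) sub by (cases "0 \<le> t") auto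
  have i1: "integrable lebesgue (\<lambda>s. indicator {0..T} s *\<^sub>R f s)" "integrable lebesgue (\<lambda>s. indicator {0..t} s *\<^sub>R f s)"
    using assms(1) i by (simp_all add: integrable_restrict_space)
  have "sint t f = (\<integral>s. indicator {0..t} s *\<^sub>R f s \<partial>lebesgue)"
    by (rule integral_restrict_space) simp
  also have "\<dots> \<le> (\<integral>s. indicator {0..T} s *\<^sub>R f s \<partial>lebesgue)"
    by (intro integral_mono i1) (use assms(2) sub in \<open>auto simp: indicator_def\<close>)
  also have "\<dots> = sint T f"
    by (rule integral_restrict_space[symmetric]) simp
  finally show "sint t f \<le> sint T f" .
qed

lemma conv_zero: "continuous_on {0..0} f \<Longrightarrow> conv \<mu> f 0 = 0"
proof -
  have "sint 0 g = g 0 - g 0" for g :: "real \<Rightarrow> real"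
  proof -
    have "AE s in ton 0. g s = 0"
    proof -
      have "AE s in lebesgue. s \<noteq> (0::real)" by (simp add: AE_completion AE_lborel_singleton)
      then have "AE s in lebesgue. s \<in> {0..0} \<longrightarrow> g s = 0" by eventually_elim auto
      then show ?thesis by (subst AE_restrict_space_iff) simp_all
    qed
    then show ?thesis using integral_eq_zero_AE by fastforce
  qed
  then show ?thesis by (simp add: conv_def)
qed

text \<open>The path minus the noise is differentiable, with derivative
  \<open>f s - \<mu> * c s\<close>, even though \<open>w\<close> is only continuous; integrating it
  gives the claim.\<close>

lemma mild_imp_int:
  fixes f w :: "real \<Rightarrow> real"
  assumes f: "continuous_on {0..T} f" and w: "continuous_on {0..T} w" and \<mu>: "0 \<le> \<mu>"
    and c: "\<And>t. t \<in> {0..T} \<Longrightarrow> c t = exp (- \<mu> * t) * a + (w t - \<mu> * conv \<mu> w t) + conv \<mu> f t"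
    and t: "t \<in> {0..T}"
  shows "c t = a + sint t (\<lambda>s. f s - \<mu> * c s) + w t"
proof -
  let ?\<phi> = "\<lambda>t. exp (- \<mu> * t) * a - \<mu> * conv \<mu> w t + conv \<mu> f t"
  have \<phi>: "?\<phi> s = c s - w s" if "s \<in> {0..T}" for s using c[OF that] by simp
  have D: "(?\<phi> has_real_derivative f s - \<mu> * c s) (at s within {0..T})" if s: "s \<in> {0..T}" for s
  proof -
    note d = conv_ODE[OF w \<mu> s] conv_ODE[OF f \<mu> s]
    have "(?\<phi> has_real_derivative exp (- \<mu> * s) * (- \<mu>) * a - \<mu> * (w s - \<mu> * conv \<mu> w s) + (f s - \<mu> * conv \<mu> f s)) (at s within {0..T})"
      using d by (auto intro!: derivative_eq_intros)
    also have "exp (- \<mu> * s) * (- \<mu>) * a - \<mu> * (w s - \<mu> * conv \<mu> w s) + (f s - \<mu> * conv \<mu> f s) = f s - \<mu> * c s"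
      unfolding c[OF s] by (simp add: algebra_simps)
    finally show ?thesis .
  qed
  have sub: "{0..t} \<subseteq> {0..T}" using t by auto
  have cc: "continuous_on {0..T} c"
  proof -
    have "continuous_on {0..T} ?\<phi>" using D by (meson DERIV_continuous continuous_on_eq_continuous_within)
    then have "continuous_on {0..T} (\<lambda>s. ?\<phi> s + w s)" by (rule continuous_on_add[OF _ w])
    then show ?thesis by (subst continuous_on_cong[OF refl, of _ _ "\<lambda>s. ?\<phi> s + w s"]) (use \<phi> in auto)
  qed
  have "sint t (\<lambda>s. f s - \<mu> * c s) = ?\<phi> t - ?\<phi> 0"
  proof (rule ton_FTC)
    show "(?\<phi> has_real_derivative f s - \<mu> * c s) (at s within {0..t})" if "s \<in> {0..t}" for s
      by (rule has_field_derivative_subset[OF D sub]) (use that sub in auto)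
    show "continuous_on {0..t} (\<lambda>s. f s - \<mu> * c s)"
      by (intro continuous_intros continuous_on_subset[OF f sub] continuous_on_subset[OF cc sub])
  qed (use t in auto)
  moreover have "?\<phi> 0 = a" by (simp add: conv_zero)
  ultimately show ?thesis using \<phi>[OF t] by simp
qed

text \<open>Variation of constants: \<open>exp (\<mu> * t) * (r t - conv \<mu> f t)\<close> has zero
  derivative. It is applied to the difference of two solutions, from which the noise has
  cancelled.\<close>

lemma int_imp_mild:
  fixes f r :: "real \<Rightarrow> real"
  assumes f: "continuous_on {0..T} f" and r: "continuous_on {0..T} r" and \<mu>: "0 \<le> \<mu>"
    and eq: "\<And>t. t \<in> {0..T} \<Longrightarrow> r t = a + sint t (\<lambda>s. f s - \<mu> * r s)"
    and t: "t \<in> {0..T}"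
  shows "r t = exp (- \<mu> * t) * a + conv \<mu> f t"
proof -
  have g: "continuous_on {0..T} (\<lambda>s. f s - \<mu> * r s)" by (intro continuous_intros f r)
  have r': "r s = a + integral {0..s} (\<lambda>s. f s - \<mu> * r s)" if "s \<in> {0..T}" for s
  proof -
    have "continuous_on {0..s} (\<lambda>s. f s - \<mu> * r s)" by (rule continuous_on_subset[OF g]) (use that in auto)
    then show ?thesis
      using eq[OF that] lebesgue_integral_eq_integral[OF continuous_imp_integrable_real] by simp
  qed
  have Dr: "(r has_real_derivative f s - \<mu> * r s) (at s within {0..T})" if s: "s \<in> {0..T}" for s
  proof -
    have "((\<lambda>s. a + integral {0..s} (\<lambda>s. f s - \<mu> * r s)) has_real_derivative f s - \<mu> * r s) (at s within {0..T})"
      using integral_has_real_derivative[OF g s] by (auto intro!: derivative_eq_intros)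
    then show ?thesis
      by (rule has_field_derivative_transform_within[OF _ zero_less_one s]) (use r' in auto)
  qed
  let ?d = "\<lambda>t. exp (\<mu> * t) * (r t - conv \<mu> f t)"
  have sub: "{0..t} \<subseteq> {0..T}" using t by auto
  have "sint t (\<lambda>s. 0::real) = ?d t - ?d 0"
  proof (rule ton_FTC)
    show "(?d has_real_derivative 0) (at s within {0..t})" if "s \<in> {0..t}" for s
    proof -
      have s: "s \<in> {0..T}" using that sub by auto
      have "(?d has_real_derivative exp (\<mu> * s) * \<mu> * (r s - conv \<mu> f s) + exp (\<mu> * s) * ((f s - \<mu> * r s) - (f s - \<mu> * conv \<mu> f s))) (at s within {0..T})"
        using Dr[OF s] conv_ODE[OF f \<mu> s] by (auto intro!: derivative_eq_intros)
      moreover have "exp (\<mu> * s) * \<mu> * (r s - conv \<mu> f s) + exp (\<mu> * s) * ((f s - \<mu> * r s) - (f s - \<mu> * conv \<mu> f s)) = 0"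
        by (simp add: algebra_simps)
      ultimately show ?thesis using has_field_derivative_subset[OF _ sub] by metis
    qed
  qed (use t in auto)
  moreover have "r 0 = a" using r'[of 0] t by simp
  ultimately have "exp (\<mu> * t) * (r t - conv \<mu> f t) = a" by (simp add: conv_zero)
  then have "exp (- \<mu> * t) * a = (exp (- \<mu> * t) * exp (\<mu> * t)) * (r t - conv \<mu> f t)" by simp
  then show ?thesis by (simp flip: exp_add)
qed

text \<open>The infimum of the closed set where the level is reached belongs to that set, and the
  intermediate value theorem shows that the level is attained there exactly.\<close>

lemma first_hit:
  fixes \<phi> :: "real \<Rightarrow> real"
  assumes c: "continuous_on {0..T} \<phi>" and 0: "\<phi> 0 < b" and t: "t1 \<in> {0..T}" "b \<le> \<phi> t1"
  obtains t0 where "0 < t0" "t0 \<le> t1" "\<phi> t0 = b" "\<And>s. 0 \<le> s \<Longrightarrow> s < t0 \<Longrightarrow> \<phi> s < b"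
proof -
  have sub: "{0..t1} \<subseteq> {0..T}" using t by auto
  let ?Z = "{0..t1} \<inter> \<phi> -` {b..}"
  have cl: "closed ?Z" by (rule continuous_closed_preimage[OF continuous_on_subset[OF c sub]]) auto
  have ne: "t1 \<in> ?Z" using t by auto
  have bdd: "bdd_below ?Z" by (auto intro: bdd_belowI[of _ 0])
  define t0 where "t0 = Inf ?Z"
  have t0: "t0 \<in> ?Z" unfolding t0_def using cl ne bdd by (intro closed_contains_Inf) auto
  have less: "\<phi> s < b" if "0 \<le> s" "s < t0" for s
  proof (rule ccontr)
    assume "\<not> \<phi> s < b"
    then have "s \<in> ?Z" using that t0 by auto
    then have "t0 \<le> s" unfolding t0_def using bdd by (rule cInf_lower)
    then show False using that by simp
  qed
  have "\<exists>s\<ge>0. s \<le> t0 \<and> \<phi> s = b"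
    by (rule IVT') (use t0 0 sub in \<open>auto intro!: continuous_on_subset[OF c]\<close>)
  then obtain s where "0 \<le> s" "s \<le> t0" "\<phi> s = b" by blast
  with less[of s] have "\<phi> t0 = b" by (cases "s = t0") auto
  moreover have "t0 \<noteq> 0" using calculation 0 by auto
  ultimately show ?thesis using that[of t0] t0 less by auto
qed

context flux begin

lemma ncont_Fm: assumes "ncont J c" shows "continuous_on J (\<lambda>t. Fm (c t) m)"
  unfolding continuous_on_def
proof
  fix t assume t: "t \<in> J"
  define R where "R = nrm (c t) + 1"
  have Ht: "Hs (c t)" by (rule ncont_Hs[OF assms t])
  obtain K where K: "K \<ge> 0" "\<And>c d S. \<lbrakk>Hs c; Hs d; nrm c \<le> R; nrm d \<le> R; finite S\<rbrakk> \<Longrightarrow>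
    (\<Sum>m\<in>S. (kap m)^2 * (Fm c m - Fm d m)^2) \<le> K * (nrmd c d)^2"
    using Fm_lipschitz[of R] by blast
  have lim: "((\<lambda>s. nrmd (c s) (c t)) \<longlongrightarrow> 0) (at t within J)" using assms t by (simp add: ncont_def)
  have "((\<lambda>s. Fm (c s) m - Fm (c t) m) \<longlongrightarrow> 0) (at t within J)"
  proof (rule Lim_null_comparison)
    show "((\<lambda>s. sqrt K * nrmd (c s) (c t)) \<longlongrightarrow> 0) (at t within J)"
      using tendsto_mult[OF tendsto_const lim] by simp
    have "\<forall>\<^sub>F s in at t within J. nrmd (c s) (c t) < 1"
      using order_tendstoD(2)[OF lim, of 1] by simp
    moreover have "\<forall>\<^sub>F s in at t within J. Hs (c s)" by (rule ev_within) (rule ncont_Hs[OF assms])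
    ultimately show "\<forall>\<^sub>F s in at t within J. norm (Fm (c s) m - Fm (c t) m) \<le> sqrt K * nrmd (c s) (c t)"
    proof eventually_elim
      case (elim s)
      have n: "nrm (c s) \<le> R" using nrm_diff_ge[OF elim(2) Ht] elim(1) by (simp add: R_def)
      have "1 * (Fm (c s) m - Fm (c t) m)^2 \<le> (kap m)^2 * (Fm (c s) m - Fm (c t) m)^2"
        using kap_ge1[of m] by (intro mult_right_mono one_le_power) auto
      also have "\<dots> \<le> K * (nrmd (c s) (c t))^2"
        using K(2)[OF elim(2) Ht n, of "{m}"] by (simp add: R_def)
      also have "\<dots> = (sqrt K * nrmd (c s) (c t))^2" using K(1) by (simp add: power_mult_distrib)
      finally have "(Fm (c s) m - Fm (c t) m)^2 \<le> (sqrt K * nrmd (c s) (c t))^2" by simp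
      moreover have "0 \<le> sqrt K * nrmd (c s) (c t)" using K(1) Hs_diff(1)[OF elim(2) Ht] by simp
      ultimately show ?case by (simp add: power2_le_iff_abs_le)
    qed
  qed
  then show "((\<lambda>s. Fm (c s) m) \<longlongrightarrow> Fm (c t) m) (at t within J)" by (simp add: LIM_zero_iff)
qed

text \<open>The dominating sequence for \<open>ncont_M\<close> is the time-integrated
  \<open>H^1\<close> energy of the retracted flux in each mode; it is summable because
  \<open>FR_bound\<close> holds for all finite sets of modes.\<close>

lemma conv_FR_ncont:
  assumes R: "0 \<le> R" and c: "adm J c" and T: "T \<in> J"
  shows "ncont {0..T} (\<lambda>t m. duh R c t m)"
proof -
  have J: "0 \<le> T" "{0..T} \<subseteq> J" using c T by (auto simp: adm_def initial_def)
  then have H: "Hs (c s)" if "s \<in> {0..T}" for s using that c by (auto simp: adm_def)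
  have m0: "(\<lambda>s. FR R (c s) m) \<in> borel_measurable (ton t)" if "t \<in> {0..T}" for m t
    by (rule adm_FR_meas[OF c]) (use that J in auto)
  have b: "\<bar>FR R (c s) m\<bar> \<le> sqrt (KR R)" if "s \<in> {0..T}" for s m by (rule FR_abs_le[OF R H[OF that]])
  define M where "M m = 1 / (2 * \<nu>) * sint T (\<lambda>s. (kap m)^2 * (FR R (c s) m)^2)" for m
  have i: "integrable (ton T) (\<lambda>s. (kap m)^2 * (FR R (c s) m)^2)" for m
  proof (rule ton_int[of _ _ _ "(kap m)^2 * KR R"])
    show "(\<lambda>s. (kap m)^2 * (FR R (c s) m)^2) \<in> borel_measurable (ton T)"
      by (intro borel_measurable_times borel_measurable_power m0 borel_measurable_const) (use J in auto)
    fix s assume s: "s \<in> {0..T}"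
    have "\<bar>FR R (c s) m\<bar>\<^sup>2 \<le> (sqrt (KR R))^2" by (rule power_mono[OF b[OF s]]) simp
    then have "(FR R (c s) m)^2 \<le> KR R" using KR_pos[OF R] by simp
    then show "\<bar>(kap m)\<^sup>2 * (FR R (c s) m)^2\<bar> \<le> (kap m)^2 * KR R" by (simp add: abs_mult mult_left_mono)
  qed
  show ?thesis
  proof (rule ncont_M[of _ _ M])
    show "continuous_on {0..T} (conv (mu m) (\<lambda>s. FR R (c s) m))" for m
      by (rule conv_cont[of _ _ "sqrt (KR R)"]) (use m0 b J nu in auto)
    show "kap m ^ 4 * (duh R c t m)^2 \<le> M m" if t: "t \<in> {0..T}" for t m
    proof -
      have "(\<Sum>m\<in>{m}. (kap m)^2 * (kap m)^2 * (duh R c t m)^2)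
        \<le> 1 / (2 * \<nu>) * sint t (\<lambda>s. \<Sum>m\<in>{m}. (kap m)^2 * (FR R (c s) m)^2)"
        by (rule conv_energy_int[where B="\<lambda>_. sqrt (KR R)"]) (use t b m0 nu in auto)
      also have "\<dots> = 1 / (2 * \<nu>) * sint t (\<lambda>s. (kap m)^2 * (FR R (c s) m)^2)" by simp
      also have "\<dots> \<le> M m" unfolding M_def
        using t nu by (intro mult_left_mono ton_mono_dom(2)[OF i]) auto
      finally show ?thesis by (simp flip: power_add)
    qed
    show "summable M"
    proof (rule summableI_nonneg_bounded[of _ "1 / (2 * \<nu>) * (T * KR R)"])
      show "0 \<le> M m" for m unfolding M_def using nu by (intro mult_nonneg_nonneg integral_nonneg_AE) auto
      have "(\<Sum>m<n. M m) = 1 / (2 * \<nu>) * sint T (\<lambda>s. \<Sum>m<n. (kap m)^2 * (FR R (c s) m)^2)" for n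
        unfolding M_def sum_distrib_left[symmetric] by (subst Bochner_Integration.integral_sum) (use i in auto)
      also have "\<dots> n \<le> 1 / (2 * \<nu>) * sint T (\<lambda>s. KR R)" for n
      proof (intro mult_left_mono integral_mono)
        show "integrable (ton T) (\<lambda>s. \<Sum>m<n. (kap m)^2 * (FR R (c s) m)^2)"
          by (rule Bochner_Integration.integrable_sum[OF i])
        show "integrable (ton T) (\<lambda>s. KR R)" by (intro ton_int_cont continuous_intros)
        show "(\<Sum>m<n. (kap m)^2 * (FR R (c s) m)^2) \<le> KR R" if "s \<in> space (ton T)" for s
          using FR_bound[OF R H] that by simp
      qed (use nu in auto)
      also have "\<dots> = 1 / (2 * \<nu>) * (T * KR R)" using J by (simp add: measure_restrict_space)
      finally show "(\<Sum>m<n. M m) \<le> 1 / (2 * \<nu>) * (T * KR R)" for n .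
    qed
  qed
qed

lemma sol_ncont:
  assumes R: "0 \<le> R" and y: "ncont {0..T} y" and T: "0 \<le> T"
  shows "ncont {0..T} (sol R y)"
proof -
  have a: "adm {0..T} y" by (rule ncont_adm[OF y]) simp
  have "ncont {0..T} (\<lambda>t m. y t m + duh R (sol R y) t m)"
    by (rule ncont_add[OF y conv_FR_ncont[OF R sol_adm[OF a R]]]) (use T in auto)
  then show ?thesis by (rule ncont_cong) (use sol_eq[OF a R] in auto)
qed

text \<open>The strong solution along one fixed noise path, read in coefficients: here
  \<open>w\<close> is deterministic data.\<close>

definition issol :: "real \<Rightarrow> seq \<Rightarrow> (real \<Rightarrow> seq) \<Rightarrow> (real \<Rightarrow> seq) \<Rightarrow> bool" where
  "issol T a w c \<longleftrightarrow> ncont {0..T} c \<and> (\<forall>t\<in>{0..T}. \<forall>m. c t m = a m + sint t (\<lambda>s. Fm (c s) m - mu m * c s m) + w t m)"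

lemma issol_mono: "issol T a w c \<Longrightarrow> T' \<le> T \<Longrightarrow> issol T' a w c"
  unfolding issol_def by (auto intro: ncont_subset)

text \<open>In the difference the noise cancels, and \<open>int_imp_mild\<close> gives its mild
  form. Inside the ball of radius \<open>R\<close> the retracted and original flux terms agree, so
  the only forcing left is the decaying difference of the initial data.\<close>

lemma issol_stable:
  assumes c: "issol T a w c" and d: "issol T b w d" and H: "Hs a" "Hs b" and t: "t \<in> {0..T}"
    and R: "\<And>s. s \<in> {0..T} \<Longrightarrow> nrm (c s) \<le> R" "\<And>s. s \<in> {0..T} \<Longrightarrow> nrm (d s) \<le> R"
  shows "nrmd (c t) (d t) \<le> 2 * nrmd a b * exp (kt R * t)"
proof -
  have nc: "ncont {0..T} c" "ncont {0..T} d" using c d by (auto simp: issol_def)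
  have R0: "0 \<le> R" using R(1)[OF t] nrm_nonneg[OF ncont_Hs[OF nc(1) t]] by linarith
  note ad = ncont_adm[OF nc(1) initial_Icc] ncont_adm[OF nc(2) initial_Icc]
  have FR: "FR R (c s) = Fm (c s)" "FR R (d s) = Fm (d s)" if "s \<in> {0..T}" for s using R that by (auto intro: FR_Fm)
  show ?thesis
  proof (rule duhamel_stable[OF R0 ad t, where r="\<lambda>s m. exp (- (mu m) * s) * (a m - b m)"])
    show "0 \<le> nrmd a b" by (intro nrm_nonneg Hs_diff H)
    fix s assume s: "s \<in> {0..t}"
    then have sT: "s \<in> {0..T}" using t by auto
    have sq: "(\<Sum>m<n. kap m ^ 4 * (exp (- (mu m) * s) * (a m - b m))^2) \<le> (nrmd a b)^2" for n
    proof (rule order_trans[OF sum_mono nrm_sum_le[OF Hs_diff(1)[OF H]]])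
      fix m
      have "exp (- (mu m) * s) \<le> 1" using s nu by auto
      then have "(exp (- (mu m) * s))^2 \<le> 1" by (intro power_le_one) auto
      then have "(exp (- (mu m) * s))^2 * (a m - b m)^2 \<le> 1 * (a m - b m)^2" by (intro mult_right_mono) auto
      then show "kap m ^ 4 * (exp (- (mu m) * s) * (a m - b m))^2 \<le> kap m ^ 4 * (a m - b m)^2"
        unfolding power_mult_distrib by (intro mult_left_mono) auto
    qed simp
    show "Hs (\<lambda>m. exp (- (mu m) * s) * (a m - b m))" "nrm (\<lambda>m. exp (- (mu m) * s) * (a m - b m)) \<le> nrmd a b"
      using nrm_leI[OF sq nrm_nonneg[OF Hs_diff(1)[OF H]]] by auto
    fix m
    let ?\<mu> = "mu m"
    have mu: "0 \<le> ?\<mu>" using nu by simp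
    have cc: "continuous_on {0..T} (\<lambda>s. c s m)" "continuous_on {0..T} (\<lambda>s. d s m)" by (intro ncont_comp nc)+
    have cf: "continuous_on {0..T} (\<lambda>s. Fm (c s) m)" "continuous_on {0..T} (\<lambda>s. Fm (d s) m)" by (intro ncont_Fm nc)+
    have "c s m - d s m = exp (- ?\<mu> * s) * (a m - b m) + conv ?\<mu> (\<lambda>s. Fm (c s) m - Fm (d s) m) s"
    proof (rule int_imp_mild[where T=T and r="\<lambda>s. c s m - d s m"])
      fix r assume r: "r \<in> {0..T}"
      have sub: "{0..r} \<subseteq> {0..T}" using r by auto
      have i: "integrable (ton r) (\<lambda>s. Fm (c s) m - ?\<mu> * c s m)" "integrable (ton r) (\<lambda>s. Fm (d s) m - ?\<mu> * d s m)"
        by (intro ton_int_cont continuous_intros continuous_on_subset[OF cc(1) sub] continuous_on_subset[OF cc(2) sub]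
            continuous_on_subset[OF cf(1) sub] continuous_on_subset[OF cf(2) sub])+
      have "c r m - d r m = (a m - b m) + (sint r (\<lambda>s. Fm (c s) m - ?\<mu> * c s m) - sint r (\<lambda>s. Fm (d s) m - ?\<mu> * d s m))"
        using c d r unfolding issol_def by fastforce
      also have "\<dots> = (a m - b m) + sint r (\<lambda>s. (Fm (c s) m - ?\<mu> * c s m) - (Fm (d s) m - ?\<mu> * d s m))"
        using i by simp
      also have "(\<lambda>s. (Fm (c s) m - ?\<mu> * c s m) - (Fm (d s) m - ?\<mu> * d s m)) = (\<lambda>s. Fm (c s) m - Fm (d s) m - ?\<mu> * (c s m - d s m))"
        by (rule ext) (simp add: algebra_simps)
      finally show "c r m - d r m = (a m - b m) + sint r (\<lambda>s. Fm (c s) m - Fm (d s) m - ?\<mu> * (c s m - d s m))" .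
    qed (use sT mu in \<open>auto intro!: continuous_intros cc cf\<close>)
    also have "conv ?\<mu> (\<lambda>s. Fm (c s) m - Fm (d s) m) s = conv ?\<mu> (\<lambda>s. FR R (c s) m - FR R (d s) m) s"
      by (rule conv_cong) (use FR sT in auto)
    also have "\<dots> = conv ?\<mu> (\<lambda>s. FR R (c s) m) s - conv ?\<mu> (\<lambda>s. FR R (d s) m) s"
      by (rule conv_diff[symmetric, of _ _ "sqrt (KR R)" _ "sqrt (KR R)"])
         (use FR_abs_le[OF R0] ncont_Hs[OF nc(1)] ncont_Hs[OF nc(2)] sT adm_FR_meas[OF ad(1) sT] adm_FR_meas[OF ad(2) sT] mu in auto)
    finally show "c s m - d s m = exp (- ?\<mu> * s) * (a m - b m) + (conv ?\<mu> (\<lambda>s. FR R (c s) m) s - conv ?\<mu> (\<lambda>s. FR R (d s) m) s)" .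
  qed
qed

lemma issol_zero: assumes "issol T a w c" "0 \<le> T" shows "c 0 m = a m + w 0 m"
proof -
  have "sint 0 (\<lambda>s. Fm (c s) m - mu m * c s m) = conv 0 (\<lambda>s. Fm (c s) m - mu m * c s m) 0"
    by (simp add: conv_def)
  also have "\<dots> = 0" by (rule conv_zero) simp
  finally show ?thesis using assms unfolding issol_def by fastforce
qed

text \<open>Only the first path has an a priori bound; a continuity argument supplies one for the
  second. Until the distance first reaches 1 the second path lies in the ball of radius
  \<open>R + 1\<close>, where stability keeps the distance below 1.\<close>

lemma issol_dependence:
  assumes c: "issol T a w c" and d: "issol T b w d" and H: "Hs a" "Hs b"
    and R: "\<And>s. s \<in> {0..T} \<Longrightarrow> nrm (c s) \<le> R" and R0: "0 \<le> R"
    and small: "2 * nrmd a b * exp (kt (R + 1) * T) < 1" and t: "t \<in> {0..T}"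
  shows "nrmd (c t) (d t) \<le> 2 * nrmd a b * exp (kt (R + 1) * T)"
proof -
  let ?\<phi> = "\<lambda>t. nrmd (c t) (d t)" and ?\<delta> = "nrmd a b"
  have T: "0 \<le> T" using t by auto
  have kt: "0 < kt (R + 1)" using R0 by (intro kt_pos) simp
  have d0: "0 \<le> ?\<delta>" by (intro nrm_nonneg Hs_diff H)
  have nc: "ncont {0..T} c" "ncont {0..T} d" using c d by (auto simp: issol_def)
  have est: "?\<phi> s \<le> 2 * ?\<delta> * exp (kt (R + 1) * T)" if s: "s \<in> {0..T}" and le: "\<And>r. r \<in> {0..s} \<Longrightarrow> ?\<phi> r \<le> 1" for s
  proof -
    have "?\<phi> s \<le> 2 * ?\<delta> * exp (kt (R + 1) * s)"
    proof (rule issol_stable[OF issol_mono[OF c] issol_mono[OF d] H])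
      fix r assume r: "r \<in> {0..s}"
      then have rT: "r \<in> {0..T}" using s by auto
      show "nrm (c r) \<le> R + 1" using R[OF rT] by simp
      show "nrm (d r) \<le> R + 1"
        using R[OF rT] nrm_diff_ge[OF ncont_Hs[OF nc(1) rT] ncont_Hs[OF nc(2) rT]] le[OF r] by linarith
    qed (use s in auto)
    also have "\<dots> \<le> 2 * ?\<delta> * exp (kt (R + 1) * T)" using s kt d0 by (intro mult_left_mono) auto
    finally show ?thesis .
  qed
  have "2 * ?\<delta> * 1 \<le> 2 * ?\<delta> * exp (kt (R + 1) * T)" using kt T d0 by (intro mult_left_mono) auto
  then have "?\<delta> < 1" using small d0 by linarith
  then have 0: "?\<phi> 0 < 1" using issol_zero[OF c T] issol_zero[OF d T] by simp
  have lt: "?\<phi> s < 1" if s: "s \<in> {0..T}" for s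
  proof (rule ccontr)
    assume "\<not> ?\<phi> s < 1"
    then have "1 \<le> ?\<phi> s" by simp
    from first_hit[OF ncont_diff_nrm[OF nc] 0 s this] obtain t0 where
      t0: "0 < t0" "t0 \<le> s" "?\<phi> t0 = 1" "\<And>s. 0 \<le> s \<Longrightarrow> s < t0 \<Longrightarrow> ?\<phi> s < 1" by metis
    have "?\<phi> t0 \<le> 2 * ?\<delta> * exp (kt (R + 1) * T)"
    proof (rule est)
      show "?\<phi> r \<le> 1" if "r \<in> {0..t0}" for r using that t0(3) t0(4)[of r] by (cases "r = t0") auto
    qed (use t0 s in auto)
    then show False using small t0(3) by linarith
  qed
  show ?thesis by (rule est[OF t]) (use lt t in \<open>auto intro!: less_imp_le\<close>)
qed

end

section \<open>Contraction of even L^p norms by the noise-free flow\<close>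

lemma ncont_tr: assumes "ncont J c" shows "ncont J (\<lambda>t. tr N (c t))"
  unfolding ncont_def
proof (intro conjI ballI tr_Hs)
  fix t assume t: "t \<in> J"
  show "((\<lambda>s. nrmd (tr N (c s)) (tr N (c t))) \<longlongrightarrow> 0) (at t within J)"
  proof (rule Lim_null_comparison)
    show "((\<lambda>s. nrmd (c s) (c t)) \<longlongrightarrow> 0) (at t within J)" using assms t by (simp add: ncont_def)
    show "\<forall>\<^sub>F s in at t within J. norm (nrmd (tr N (c s)) (tr N (c t))) \<le> nrmd (c s) (c t)"
      using tr_nrm_le[OF Hs_diff(1)[OF ncont_Hs[OF assms] ncont_Hs[OF assms t]]]
      by (intro ev_within) (simp add: tr_diff)
  qed
qed

lemma torus_L1_le_L2:
  fixes X :: "real \<Rightarrow> real"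
  assumes "continuous_on {0..1} X"
  shows "tint (\<lambda>x. \<bar>X x\<bar>) \<le> sqrt (tint (\<lambda>x. (X x)^2))"
proof (rule real_le_rsqrt)
  have "(tint (\<lambda>x. \<bar>X x\<bar> * 1))^2 \<le> tint (\<lambda>x. \<bar>X x\<bar>\<^sup>2) * tint (\<lambda>x. 1^2)"
    by (rule int_CS) (use assms in \<open>auto intro!: torus_int_cont continuous_intros\<close>)
  then show "(tint (\<lambda>x. \<bar>X x\<bar>))^2 \<le> tint (\<lambda>x. (X x)^2)" by simp
qed

lemma torus_prod_le:
  fixes X Y :: "real \<Rightarrow> real"
  assumes X: "continuous_on {0..1} X" and Y: "continuous_on {0..1} Y" and B: "\<And>x. \<bar>Y x\<bar> \<le> B"
  shows "tint (\<lambda>x. Y x * X x) \<le> B * tint (\<lambda>x. \<bar>X x\<bar>)"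
proof -
  have "tint (\<lambda>x. Y x * X x) \<le> tint (\<lambda>x. B * \<bar>X x\<bar>)"
  proof (intro integral_mono torus_int_cont continuous_intros X Y)
    fix x
    have "Y x * X x \<le> \<bar>Y x\<bar> * \<bar>X x\<bar>" by (metis abs_ge_self abs_mult)
    also have "\<dots> \<le> B * \<bar>X x\<bar>" by (intro mult_right_mono B) auto
    finally show "Y x * X x \<le> B * \<bar>X x\<bar>" .
  qed
  then show ?thesis by simp
qed

context flux begin

text \<open>With \<open>Q\<close> an antiderivative of \<open>s ^ k * deriv A s\<close>, the
  integrand is the derivative of \<open>Q\<close> composed with a periodic function.\<close>

lemma transport_zero:
  assumes B: "\<And>x. \<bar>tp N c x\<bar> \<le> B"
  shows "tint (\<lambda>x. tp N c x ^ k * (deriv A (tp N c x) * tp1 N c x)) = 0"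
proof -
  have "continuous_on {-B..B} (\<lambda>s. s ^ k * deriv A s)" by (intro continuous_intros A1_cont)
  from antiderivative_continuous[OF this] obtain Q where
    Q: "\<And>s. s \<in> {-B..B} \<Longrightarrow> (Q has_real_derivative s ^ k * deriv A s) (at s within {-B..B})"
    by (auto simp: has_real_derivative_iff_has_vector_derivative)
  have img: "tp N c ` {0..1} \<subseteq> {-B..B}" using B by (auto simp: abs_le_iff) (meson B abs_le_D2 minus_le_iff)
  have "tint (\<lambda>x. tp N c x ^ k * (deriv A (tp N c x) * tp1 N c x)) = (Q \<circ> tp N c) 1 - (Q \<circ> tp N c) 0"
  proof (rule torus_FTC)
    fix x :: real assume x: "x \<in> {0..1}"
    have "(Q has_real_derivative tp N c x ^ k * deriv A (tp N c x)) (at (tp N c x) within tp N c ` {0..1})"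
      by (rule has_field_derivative_subset[OF Q img]) (use B[of x] in \<open>auto simp: abs_le_iff\<close>)
    from DERIV_image_chain[OF this tp_deriv]
    show "(Q \<circ> tp N c has_real_derivative tp N c x ^ k * (deriv A (tp N c x) * tp1 N c x)) (at x within {0..1})"
      by (simp add: mult.assoc)
  qed (intro continuous_intros)
  then show ?thesis by (simp add: tp_per)
qed

text \<open>Integration by parts gives \<open>-(j + 1)\<close> times the integral of
  \<open>u^j\<close> times the squared derivative of \<open>u\<close>, and an even power
  \<open>u^j\<close> is nonnegative.\<close>

lemma diffusion_nonpos:
  assumes "even j"
  shows "tint (\<lambda>x. tp N c x ^ Suc j * tp2 N c x) \<le> 0"
proof -
  have "tint (\<lambda>x. tp N c x ^ Suc j * tp2 N c x)
     = - tint (\<lambda>x. (real (Suc j) * (tp1 N c x * tp N c x ^ j)) * tp1 N c x)"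
  proof (rule torus_IBP)
    show "((\<lambda>x. tp N c x ^ Suc j) has_real_derivative real (Suc j) * (tp1 N c x * tp N c x ^ j)) (at x within {0..1})" for x
      using DERIV_power[OF tp_deriv[of N c x "{0..1}"], of "Suc j"] by simp
  qed (auto intro!: continuous_intros tp1_deriv simp: tp_per)
  moreover have "0 \<le> tint (\<lambda>x. (real (Suc j) * (tp1 N c x * tp N c x ^ j)) * tp1 N c x)"
  proof (rule integral_nonneg_AE, rule AE_I2)
    fix x
    have "0 \<le> real (Suc j) * (tp N c x ^ j * (tp1 N c x)^2)"
      using assms by (intro mult_nonneg_nonneg) (auto simp: zero_le_even_power)
    then show "0 \<le> (real (Suc j) * (tp1 N c x * tp N c x ^ j)) * tp1 N c x" by (simp add: power2_eq_square mult_ac)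
  qed
  ultimately show ?thesis by simp
qed

text \<open>Galerkin truncation nearly commutes with the transport term, with an error controlled in \<open>H\<^sup>2\<close>.\<close>

lemma galerkin_rate:
  assumes R: "0 \<le> R"
  obtains K where "0 \<le> K" "\<And>N c j. \<lbrakk>Hs c; nrm c \<le> R; even j\<rbrakk> \<Longrightarrow>
    tint (\<lambda>x. tp N c x ^ Suc j * (\<Sum>m<N. (Fm c m - mu m * c m) * eb m x))
     \<le> (C0 * R) ^ Suc j * (K * (nrmd c (tr N c) + kinv N))"
proof -
  obtain K where K: "K \<ge> 0" "\<And>c d S. \<lbrakk>Hs c; Hs d; nrm c \<le> R; nrm d \<le> R; finite S\<rbrakk> \<Longrightarrow>
    (\<Sum>m\<in>S. (kap m)^2 * (Fm c m - Fm d m)^2) \<le> K * (nrmd c d)^2"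
    using Fm_lipschitz[of R] by blast
  define K' where "K' = sqrt K + sqrt 2 * (sqrt K * R)"
  have K': "sqrt K \<le> K'" "sqrt 2 * (sqrt K * R) \<le> K'" "0 \<le> K'" using K(1) R by (auto simp: K'_def)
  show ?thesis
  proof (rule that[OF K'(3)])
    fix N c and j :: nat assume H: "Hs c" "nrm c \<le> R" "even j"
    define B where "B = C0 * R"
    have B: "\<bar>tp N c x\<bar> \<le> B" for x using tp_bound[OF H(1), of N x] mult_left_mono[OF H(2) C0_nonneg] by (simp add: B_def)
    then have B0: "0 \<le> B" using abs_ge_zero order_trans by blast
    let ?P = "\<lambda>x. tp N c x ^ Suc j"
    have Pb: "\<bar>?P x\<bar> \<le> B ^ Suc j" for x unfolding power_abs by (rule power_mono[OF B]) simp
    have Pc: "continuous_on {0..1} ?P" by (intro continuous_intros)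
    let ?g = "Fm (tr N c)"
    let ?h = "\<lambda>x. deriv A (tp N c x) * tp1 N c x"
    have nt: "nrm (tr N c) \<le> R" using tr_nrm_le[OF H(1), of N] H(2) by linarith
    have gS: "(\<Sum>m\<in>S. (kap m)^2 * (?g m)^2) \<le> (sqrt K * R)^2" if "finite S" for S
    proof -
      have "(\<Sum>m\<in>S. (kap m)^2 * (?g m - Fm (\<lambda>_. 0) m)^2) \<le> K * (nrm (\<lambda>m. tr N c m - 0))^2"
        by (rule K(2)) (use nt R that in auto)
      also have "\<dots> \<le> K * R^2" using nt K(1) by (intro mult_left_mono power_mono) (auto simp: nrm_nonneg)
      finally show ?thesis using K(1) by (simp add: Fm_zero power_mult_distrib)
    qed
    have s0: "0 \<le> sqrt K * R" using K(1) R by simp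
    have gsum: "summable (\<lambda>m. \<bar>?g m\<bar>)"
      by (rule summableI_nonneg_bounded[of _ "kinv 0 * (sqrt K * R)"]) (use sum_kap_le_gen[OF _ _ gS s0] in auto)
    have hcoef: "tint (\<lambda>x. - ?h x * eb m x) = ?g m" for m
      unfolding Fm_def ser_tr_tp
      by (subst deriv_coef1[OF Atp_deriv]) (auto intro!: continuous_intros simp: tp_per)
    \<comment> \<open>Summable coefficients identify the exact transport term with its trigonometric
      series, which makes \<open>Z\<close> below minus the tail of that series beyond
      \<open>N\<close>.\<close>
    have hext: "AE x in torus. - ?h x = ser ?g x"
    proof -
      have "tint (\<lambda>x. - ?h x) = 0"
        using transport_zero[OF B, of 0] by simp
      moreover have "integrable torus (\<lambda>x. - ?h x)" by (intro torus_int_cont continuous_intros)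
      ultimately show ?thesis using trig_ext[of "\<lambda>x. - ?h x", unfolded hcoef] gsum by blast
    qed
    define X where "X x = (\<Sum>m<N. (Fm c m - ?g m) * eb m x)" for x
    define Z where "Z x = ?h x + (\<Sum>m<N. ?g m * eb m x)" for x
    have XZc: "continuous_on {0..1} X" "continuous_on {0..1} Z" unfolding X_def Z_def by (intro continuous_intros)+
    \<comment> \<open>Four contributions: \<open>X\<close> from evaluating the flux at the full path
      instead of its truncation, \<open>Z\<close> from the discarded modes, the exact transport
      term, which integrates to zero against the power, and diffusion, which has the favourable
      sign.\<close>
    have split: "(\<Sum>m<N. (Fm c m - mu m * c m) * eb m x) = X x + Z x - ?h x + \<nu> * tp2 N c x" for x
      by (simp add: X_def Z_def tp2_def sum_distrib_left sum.distrib[symmetric] algebra_simps sum_subtractf[symmetric] sum_negf[symmetric])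
    have IX: "tint (\<lambda>x. \<bar>X x\<bar>) \<le> sqrt K * nrmd c (tr N c)"
    proof -
      have "tint (\<lambda>x. (X x)^2) = (\<Sum>m<N. (Fm c m - ?g m)^2)"
        unfolding X_def by (rule trig_sum_L2) simp
      also have "\<dots> \<le> (\<Sum>m<N. (kap m)^2 * (Fm c m - ?g m)^2)"
        using mult_right_mono[OF one_le_power[OF kap_ge1]] by (intro sum_mono) fastforce
      also have "\<dots> \<le> K * (nrmd c (tr N c))^2" by (rule K(2)) (use H nt in auto)
      finally have "sqrt (tint (\<lambda>x. (X x)^2)) \<le> sqrt (K * (nrmd c (tr N c))^2)" by simp
      also have "\<dots> = sqrt K * nrmd c (tr N c)"
        using Hs_diff(1)[OF H(1) tr_Hs] by (simp add: real_sqrt_mult)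
      finally show ?thesis using torus_L1_le_L2[OF XZc(1)] by linarith
    qed
    have IZ: "tint (\<lambda>x. \<bar>Z x\<bar>) \<le> sqrt 2 * (sqrt K * R) * kinv N"
    proof (rule torus.integral_le_const)
      show "integrable torus (\<lambda>x. \<bar>Z x\<bar>)" by (intro torus_int_cont continuous_intros XZc)
      show "AE x in torus. \<bar>Z x\<bar> \<le> sqrt 2 * (sqrt K * R) * kinv N"
        using hext
      proof eventually_elim
        case (elim x)
        define gt where "gt m = (if m < N then 0 else ?g m)" for m
        have gt: "summable (\<lambda>m. \<bar>gt m\<bar>)"
          by (rule summable_comparison_test_ev[OF _ gsum]) (auto simp: gt_def)
        have "ser ?g x = (\<Sum>m. ?g (m + N) * eb (m + N) x) + (\<Sum>m<N. ?g m * eb m x)"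
          unfolding ser_def by (rule suminf_split_initial_segment[OF ser_summable_gen[OF gsum]])
        moreover have "ser gt x = (\<Sum>m. gt (m + N) * eb (m + N) x) + (\<Sum>m<N. gt m * eb m x)"
          unfolding ser_def by (rule suminf_split_initial_segment[OF ser_summable_gen[OF gt]])
        ultimately have "Z x = - ser gt x" using elim by (simp add: Z_def gt_def)
        then have "\<bar>Z x\<bar> \<le> sqrt 2 * (\<Sum>m. \<bar>gt m\<bar>)" using ser_abs_le[OF gt, of x] by simp
        also have "(\<Sum>m. \<bar>gt m\<bar>) \<le> kinv N * (sqrt K * R)"
        proof (rule suminf_le_const[OF gt])
          fix n
          have "(\<Sum>m<n. \<bar>gt m\<bar>) = (\<Sum>m\<in>{N..<n}. \<bar>?g m\<bar>)"
            by (rule sum.mono_neutral_cong_right) (auto simp: gt_def)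
          also have "\<dots> \<le> kinv N * (sqrt K * R)" by (rule sum_kap_le_gen[OF _ _ gS s0]) auto
          finally show "(\<Sum>m<n. \<bar>gt m\<bar>) \<le> kinv N * (sqrt K * R)" .
        qed
        finally show ?case by (simp add: mult_ac)
      qed
    qed
    have i: "integrable torus (\<lambda>x. ?P x * X x)" "integrable torus (\<lambda>x. ?P x * Z x)" "integrable torus (\<lambda>x. ?P x * ?h x)"
      "integrable torus (\<lambda>x. ?P x * tp2 N c x)"
      by (intro torus_int_cont continuous_intros XZc)+
    have "tint (\<lambda>x. ?P x * (\<Sum>m<N. (Fm c m - mu m * c m) * eb m x))
       = tint (\<lambda>x. ?P x * X x + ?P x * Z x - ?P x * ?h x + \<nu> * (?P x * tp2 N c x))"
      unfolding split by (rule Bochner_Integration.integral_cong) (simp_all add: algebra_simps del: power_Suc)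
    also have "\<dots> = tint (\<lambda>x. ?P x * X x) + tint (\<lambda>x. ?P x * Z x) - tint (\<lambda>x. ?P x * ?h x)
       + \<nu> * tint (\<lambda>x. ?P x * tp2 N c x)"
      using i by (simp del: power_Suc)
    also have "tint (\<lambda>x. ?P x * ?h x) = 0" by (rule transport_zero[OF B])
    also have "\<nu> * tint (\<lambda>x. ?P x * tp2 N c x) \<le> 0"
      using diffusion_nonpos[OF H(3), of N c] nu by (simp add: mult_nonneg_nonpos del: power_Suc)
    also have "tint (\<lambda>x. ?P x * X x) \<le> B ^ Suc j * (sqrt K * nrmd c (tr N c))"
      using torus_prod_le[OF XZc(1) Pc Pb] mult_left_mono[OF IX, of "B ^ Suc j"] B0 by (simp del: power_Suc)
    also have "tint (\<lambda>x. ?P x * Z x) \<le> B ^ Suc j * (sqrt 2 * (sqrt K * R) * kinv N)"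
      using torus_prod_le[OF XZc(2) Pc Pb] mult_left_mono[OF IZ, of "B ^ Suc j"] B0 by (simp del: power_Suc)
    also have "B ^ Suc j * (sqrt K * nrmd c (tr N c)) + B ^ Suc j * (sqrt 2 * (sqrt K * R) * kinv N) - 0 + 0
       = B ^ Suc j * (sqrt K * nrmd c (tr N c) + (sqrt 2 * (sqrt K * R)) * kinv N)" by (simp add: distrib_left)
    also have "\<dots> \<le> B ^ Suc j * (K' * nrmd c (tr N c) + K' * kinv N)"
      using B0 K' Hs_diff(1)[OF H(1) tr_Hs, of N] by (intro mult_left_mono add_mono mult_right_mono) auto
    finally show "tint (\<lambda>x. ?P x * (\<Sum>m<N. (Fm c m - mu m * c m) * eb m x))
       \<le> (C0 * R) ^ Suc j * (K' * (nrmd c (tr N c) + kinv N))" by (simp add: B_def distrib_left)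
  qed
qed

text \<open>For finitely many modes the power integral can be differentiated under the integral
  sign. \<open>galerkin_rate\<close> bounds its derivative by an error that is uniformly bounded and
  vanishes at each time as the truncation level grows, so the limit of the increments is
  nonpositive.\<close>

lemma Lp_contraction:
  assumes c: "ncont {0..h} c" and h: "0 \<le> h" and j: "even j"
    and mild: "\<And>t m. t \<in> {0..h} \<Longrightarrow> c t m = exp (- (mu m) * t) * a m + duF c t m"
  shows "tint (\<lambda>x. ser (c h) x ^ Suc (Suc j)) \<le> tint (\<lambda>x. ser (c 0) x ^ Suc (Suc j))"
proof -
  let ?p = "Suc (Suc j)"
  obtain R where R: "0 \<le> R" "\<And>t. t \<in> {0..h} \<Longrightarrow> nrm (c t) \<le> R" using ncont_bdd[OF c] by blast
  obtain K where K: "0 \<le> K" "\<And>N c j. \<lbrakk>Hs c; nrm c \<le> R; even j\<rbrakk> \<Longrightarrow>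
    tint (\<lambda>x. tp N c x ^ Suc j * (\<Sum>m<N. (Fm c m - mu m * c m) * eb m x))
     \<le> (C0 * R) ^ Suc j * (K * (nrmd c (tr N c) + kinv N))"
    using galerkin_rate[OF R(1)] by blast
  note H = ncont_Hs[OF c]
  define g where "g m t = Fm (c t) m - mu m * c t m" for m t
  have gc: "continuous_on {0..h} (g m)" for m
    unfolding g_def by (intro continuous_intros ncont_Fm ncont_comp c)
  have D: "((\<lambda>t. c t m) has_real_derivative g m t) (at t within {0..h})" if t: "t \<in> {0..h}" for t m
  proof -
    let ?\<mu> = "mu m"
    have "((\<lambda>t. exp (- ?\<mu> * t) * a m + conv ?\<mu> (\<lambda>s. Fm (c s) m) t) has_real_derivative
       exp (- ?\<mu> * t) * (- ?\<mu>) * a m + (Fm (c t) m - ?\<mu> * conv ?\<mu> (\<lambda>s. Fm (c s) m) t)) (at t within {0..h})"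
      using conv_ODE[OF ncont_Fm[OF c], of ?\<mu> t m] t nu by (auto intro!: derivative_eq_intros)
    also have "exp (- ?\<mu> * t) * (- ?\<mu>) * a m + (Fm (c t) m - ?\<mu> * conv ?\<mu> (\<lambda>s. Fm (c s) m) t) = g m t"
      unfolding g_def mild[OF t] by (simp add: algebra_simps)
    finally show ?thesis
      by (rule has_field_derivative_transform_within[OF _ zero_less_one t]) (use mild in auto)
  qed
  define E where "E N t = integral {0..1} (\<lambda>x. tp N (c t) x ^ ?p)" for N t
  define E' where "E' N t = integral {0..1} (\<lambda>x. real ?p * (tp N (c t) x ^ Suc j * (\<Sum>m<N. g m t * eb m x)))" for N t
  have tpc: "continuous_on ({0..h} \<times> {0..1}) (\<lambda>p. tp N (c (fst p)) (snd p))" for N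
    unfolding tp_def
    by (intro continuous_on_sum continuous_on_mult continuous_on_compose2[OF ncont_comp[OF c] continuous_on_fst[OF continuous_on_id]]
        continuous_on_compose2[OF eb_cont continuous_on_snd[OF continuous_on_id]]) auto
  have gec: "continuous_on ({0..h} \<times> {0..1}) (\<lambda>p. \<Sum>m<N. g m (fst p) * eb m (snd p))" for N
    by (intro continuous_on_sum continuous_on_mult continuous_on_compose2[OF gc continuous_on_fst[OF continuous_on_id]]
        continuous_on_compose2[OF eb_cont continuous_on_snd[OF continuous_on_id]]) auto
  have DE: "(E N has_real_derivative E' N t) (at t within {0..h})" if t: "t \<in> {0..h}" for t N
    unfolding E_def[abs_def] E'_def interval_cbox[of 0 1]
  proof (rule leibniz_rule_field_derivative)
    fix t x assume t: "t \<in> {0..h}"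
    have "((\<lambda>t. tp N (c t) x) has_real_derivative (\<Sum>m<N. g m t * eb m x)) (at t within {0..h})"
      unfolding tp_def by (intro DERIV_sum) (auto intro!: derivative_eq_intros D t)
    from DERIV_power[OF this, of ?p]
    show "((\<lambda>t. tp N (c t) x ^ ?p) has_real_derivative real ?p * (tp N (c t) x ^ Suc j * (\<Sum>m<N. g m t * eb m x))) (at t within {0..h})"
      by (simp add: mult_ac)
  next
    show "(\<lambda>x. tp N (c t) x ^ ?p) integrable_on cbox 0 1" for t
      by (intro integrable_continuous continuous_intros)
    show "continuous_on ({0..h} \<times> cbox 0 1) (\<lambda>(t, x). real ?p * (tp N (c t) x ^ Suc j * (\<Sum>m<N. g m t * eb m x)))"
      unfolding split_beta interval_cbox[symmetric] by (intro continuous_intros tpc gec)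
  qed (use t in auto)
  define err where "err N t = real ?p * ((C0 * R) ^ Suc j * (K * (nrmd (c t) (tr N (c t)) + kinv N)))" for N t
  have ec: "continuous_on {0..h} (err N)" for N
    unfolding err_def by (intro continuous_intros ncont_diff_nrm c ncont_tr)
  have le: "E' N t \<le> err N t" if t: "t \<in> {0..h}" for N t
  proof -
    have "E' N t = tint (\<lambda>x. real ?p * (tp N (c t) x ^ Suc j * (\<Sum>m<N. g m t * eb m x)))"
      unfolding E'_def by (rule torus_eq_integral[symmetric]) (intro continuous_intros)
    also have "\<dots> = real ?p * tint (\<lambda>x. tp N (c t) x ^ Suc j * (\<Sum>m<N. g m t * eb m x))"
      by (rule integral_mult_right_zero)
    also have "\<dots> \<le> err N t" unfolding err_def g_def
      by (intro mult_left_mono K(2)) (use H[OF t] R(2)[OF t] j in auto)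
    finally show ?thesis .
  qed
  have EN: "E N h - E N 0 \<le> sint h (err N)" for N
  proof -
    have "(E' N has_integral E N h - E N 0) {0..h}"
      by (rule fundamental_theorem_of_calculus[OF h])
         (use DE in \<open>auto simp: has_real_derivative_iff_has_vector_derivative\<close>)
    moreover have "(err N has_integral integral {0..h} (err N)) {0..h}"
      by (rule integrable_integral[OF integrable_continuous_real[OF ec]])
    ultimately have "E N h - E N 0 \<le> integral {0..h} (err N)"
      by (rule has_integral_le) (use le in auto)
    then show ?thesis
      using lebesgue_integral_eq_integral[OF continuous_imp_integrable_real[OF ec], of N] by simp
  qed
  have lim0: "(\<lambda>N. sint h (err N)) \<longlonglongrightarrow> sint h (\<lambda>t. 0)"
  proof (rule integral_dominated_convergence[where w="\<lambda>t. real ?p * ((C0 * R) ^ Suc j * (K * (2 * R + kinv 0)))"])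
    show "err N \<in> borel_measurable (ton h)" for N by (rule ton_meas_cont[OF ec])
    show "integrable (ton h) (\<lambda>t. real ?p * ((C0 * R) ^ Suc j * (K * (2 * R + kinv 0))))"
      by (intro ton_int_cont continuous_intros)
    show "AE t in ton h. (\<lambda>N. err N t) \<longlonglongrightarrow> 0"
    proof (rule AE_I2)
      fix t assume "t \<in> space (ton h)"
      then have "(\<lambda>N. real ?p * ((C0 * R) ^ Suc j * (K * (nrmd (c t) (tr N (c t)) + kinv N))))
         \<longlonglongrightarrow> real ?p * ((C0 * R) ^ Suc j * (K * (0 + 0)))"
        by (intro tendsto_intros tr_tendsto H kinv_tendsto) simp
      then show "(\<lambda>N. err N t) \<longlonglongrightarrow> 0" by (simp add: err_def)
    qed
    show "AE t in ton h. norm (err N t) \<le> real ?p * ((C0 * R) ^ Suc j * (K * (2 * R + kinv 0)))" for N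
    proof (rule AE_I2)
      fix t assume "t \<in> space (ton h)"
      then have t: "t \<in> {0..h}" by simp
      have "nrmd (c t) (tr N (c t)) \<le> 2 * R"
        using Hs_diff(2)[OF H[OF t] tr_Hs[of N "c t"]] tr_nrm_le[OF H[OF t], of N] R(2)[OF t] by linarith
      moreover have "kinv N \<le> kinv 0"
      proof -
        have "(\<Sum>m. 1 / (kap (m + N))^2) \<le> (kinv 0)^2"
        proof (rule suminf_le_const[OF summable_ignore_initial_segment[OF kap_inv_summable]])
          fix n
          have "(\<Sum>m<n. 1 / (kap (m + N))^2) = (\<Sum>m\<in>(\<lambda>m. m + N) ` {..<n}. 1 / (kap m)^2)"
            by (subst sum.reindex) auto
          also have "\<dots> \<le> (kinv 0)^2" by (rule kinv_sum_le) auto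
          finally show "(\<Sum>m<n. 1 / (kap (m + N))^2) \<le> (kinv 0)^2" .
        qed
        then show ?thesis unfolding kinv_def[of N] by (intro real_le_lsqrt) (auto intro!: suminf_nonneg summable_ignore_initial_segment[OF kap_inv_summable])
      qed
      ultimately have "err N t \<le> real ?p * ((C0 * R) ^ Suc j * (K * (2 * R + kinv 0)))"
        unfolding err_def using R(1) K(1) by (intro mult_left_mono add_mono mult_nonneg_nonneg zero_le_power) auto
      moreover have "0 \<le> err N t" unfolding err_def
        using R(1) K(1) Hs_diff(1)[OF H[OF t] tr_Hs, of N] by (intro mult_nonneg_nonneg zero_le_power add_nonneg_nonneg) auto
      ultimately show "norm (err N t) \<le> real ?p * ((C0 * R) ^ Suc j * (K * (2 * R + kinv 0)))"
        by (simp only: real_norm_def abs_of_nonneg)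
    qed
  qed simp
  have limE: "(\<lambda>N. E N t) \<longlonglongrightarrow> tint (\<lambda>x. ser (c t) x ^ ?p)" if t: "t \<in> {0..h}" for t
  proof -
    have "(\<lambda>N. tint (\<lambda>x. tp N (c t) x ^ ?p)) \<longlonglongrightarrow> tint (\<lambda>x. ser (c t) x ^ ?p)"
    proof (rule integral_dominated_convergence[where w="\<lambda>x. (C0 * R) ^ ?p"])
      show "(\<lambda>x. ser (c t) x ^ ?p) \<in> borel_measurable torus" "(\<lambda>x. tp N (c t) x ^ ?p) \<in> borel_measurable torus" for N
        by (intro torus_meas_cont continuous_intros ser_cont H t)+
      show "AE x in torus. (\<lambda>N. tp N (c t) x ^ ?p) \<longlonglongrightarrow> ser (c t) x ^ ?p"
        using ser_tr_tendsto[OF H[OF t]] by (intro AE_I2 tendsto_power) (simp add: ser_tr_tp)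
      show "AE x in torus. norm (tp N (c t) x ^ ?p) \<le> (C0 * R) ^ ?p" for N
      proof (rule AE_I2)
        fix x
        have "\<bar>tp N (c t) x\<bar> \<le> C0 * R" using tp_bound[OF H[OF t], of N x] mult_left_mono[OF R(2)[OF t] C0_nonneg] by simp
        from power_mono[OF this, of ?p] show "norm (tp N (c t) x ^ ?p) \<le> (C0 * R) ^ ?p" by (simp only: real_norm_def power_abs abs_ge_zero)
      qed
    qed simp
    moreover have "E N t = tint (\<lambda>x. tp N (c t) x ^ ?p)" for N
      unfolding E_def by (rule torus_eq_integral[symmetric]) (intro continuous_intros)
    ultimately show ?thesis by simp
  qed
  have "tint (\<lambda>x. ser (c h) x ^ ?p) - tint (\<lambda>x. ser (c 0) x ^ ?p) \<le> 0"
    using tendsto_le[OF sequentially_bot lim0 tendsto_diff[OF limE[of h] limE[of 0]]] EN h by simp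
  then show ?thesis by simp
qed

end

section \<open>Parabolic smoothing and the bound in H^2\<close>

definition kinv32 :: real where "kinv32 = (\<Sum>m. kap m powr (-3/2))"

lemma kinv32_summable: "summable (\<lambda>m. kap m powr (-3/2))"
proof (rule summable_comparison_test_ev)
  show "summable (\<lambda>n. real (Suc n) powr (-3/2))"
    using summable_real_powr_iff[of "-3/2"] summable_Suc_iff[of "\<lambda>n. real n powr (-3/2)"] by simp
  show "\<forall>\<^sub>F n in sequentially. norm (kap n powr (-3/2)) \<le> real (Suc n) powr (-3/2)"
  proof (intro always_eventually allI)
    fix n
    show "norm (kap n powr (-3/2)) \<le> real (Suc n) powr (-3/2)"
      using kap_gt[of n] powr_mono2'[of "-3/2" "real (Suc n)" "kap n"] by simp
  qed
qed

text \<open>Cauchy-Schwarz with \<open>kap m powr (3/4)\<close> and its inverse: coefficients in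
  \<open>H^{3/4}\<close> are absolutely summable because the remaining series has exponent 3/2 >
  1.\<close>

lemma sum_abs_le32:
  assumes "finite S" "(\<Sum>m\<in>S. kap m powr (3/2) * (a m)^2) \<le> Z"
  shows "(\<Sum>m\<in>S. \<bar>a m\<bar>) \<le> sqrt kinv32 * sqrt Z"
proof -
  have p: "kap m powr (3/4) * kap m powr (-3/4) = 1" for m by (simp flip: powr_add)
  have "(\<Sum>m\<in>S. \<bar>a m\<bar>) = (\<Sum>m\<in>S. \<bar>kap m powr (-3/4)\<bar> * \<bar>kap m powr (3/4) * a m\<bar>)"
  proof (rule sum.cong[OF refl])
    fix m
    have "\<bar>kap m powr (-3/4)\<bar> * \<bar>kap m powr (3/4) * a m\<bar> = (kap m powr (3/4) * kap m powr (-3/4)) * \<bar>a m\<bar>"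
      by (simp add: abs_mult mult_ac)
    then show "\<bar>a m\<bar> = \<bar>kap m powr (-3/4)\<bar> * \<bar>kap m powr (3/4) * a m\<bar>" unfolding p by simp
  qed
  also have "\<dots> \<le> L2_set (\<lambda>m. kap m powr (-3/4)) S * L2_set (\<lambda>m. kap m powr (3/4) * a m) S"
    by (rule L2_set_mult_ineq)
  also have "\<dots> = sqrt (\<Sum>m\<in>S. kap m powr (-3/2)) * sqrt (\<Sum>m\<in>S. kap m powr (3/2) * (a m)^2)"
    unfolding L2_set_def power_mult_distrib by (simp add: power2_eq_square flip: powr_add)
  also have "\<dots> \<le> sqrt kinv32 * sqrt Z"
    using assms sum_le_suminf[OF kinv32_summable assms(1)] suminf_nonneg[OF kinv32_summable]
    by (intro mult_mono) (auto simp: kinv32_def intro!: sum_nonneg)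
  finally show ?thesis .
qed

lemma powr_exp_le: assumes "x > 0" shows "x powr (3/4) * exp (- x) \<le> (1::real)"
proof -
  have "x powr (3/4) \<le> exp x"
  proof (cases "x \<le> 1")
    case True
    then have "x powr (3/4) \<le> 1" using assms by (intro powr_le1) auto
    then show ?thesis using assms by (smt (verit) one_le_exp_iff)
  next
    case False
    then have "x powr (3/4) \<le> x powr 1" by (intro powr_mono) auto
    moreover have "x powr 1 = x" using assms by simp
    ultimately show ?thesis using exp_ge_add_one_self[of x] by linarith
  qed
  then have "x powr (3/4) * exp (- x) \<le> exp x * exp (- x)" by (intro mult_right_mono) auto
  then show ?thesis by (simp flip: exp_add)
qed

text \<open>The exponents 5/4 and 5 are conjugate; comparing \<open>b\<close> with
  \<open>a powr (1/4)\<close> decides which summand alone already bounds the product.\<close>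

lemma young5:
  fixes a b :: real
  assumes "0 \<le> a" "0 \<le> b"
  shows "a * b \<le> a powr (5/4) + b ^ 5"
proof (cases "b \<le> a powr (1/4)")
  case True
  then have "a * b \<le> a * a powr (1/4)" using assms by (intro mult_left_mono) auto
  also have "\<dots> = a powr (5/4)" using assms by (cases "a = 0") (simp_all add: powr_mult_base)
  finally show ?thesis using assms by (simp add: add_increasing2)
next
  case False
  have "a = (a powr (1/4)) ^ 4" using assms by (cases "a = 0") (simp_all flip: powr_realpow add: powr_powr)
  also have "\<dots> \<le> b ^ 4" using False by (intro power_mono) auto
  finally have "a * b \<le> b ^ 4 * b" using assms by (intro mult_right_mono) auto
  then show ?thesis using assms by (simp add: add_increasing eval_nat_numeral mult_ac)
qed

text \<open>The exponent 15/16 is 3/4 times 5/4, still below 1; an antiderivative is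
  \<open>-16 (t - s)^{1/16}\<close>.\<close>

lemma int_singular:
  fixes t :: real
  assumes t: "0 \<le> t"
  shows "integrable (ton t) (\<lambda>s. (t - s) powr (-15/16))"
    and "sint t (\<lambda>s. (t - s) powr (-15/16)) \<le> 16 * (t + 1)"
proof -
  have "((\<lambda>s. (t - s) powr (-15/16)) has_integral (- 16 * (t - t) powr (1/16)) - (- 16 * (t - 0) powr (1/16))) {0..t}"
  proof (rule fundamental_theorem_of_calculus_interior[OF t])
    show "continuous_on {0..t} (\<lambda>s. - 16 * (t - s) powr (1/16))"
      by (intro continuous_intros continuous_on_powr') auto
    fix s assume "s \<in> {0<..<t}"
    then have "((\<lambda>s. - 16 * (t - s) powr (1/16)) has_real_derivative (t - s) powr (-15/16)) (at s)"
      by (auto intro!: derivative_eq_intros)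
    then show "((\<lambda>s. - 16 * (t - s) powr (1/16)) has_vector_derivative (t - s) powr (-15/16)) (at s)"
      by (simp add: has_real_derivative_iff_has_vector_derivative)
  qed
  then have hi: "((\<lambda>s. (t - s) powr (-15/16)) has_integral 16 * t powr (1/16)) {0..t}" by simp
  then have "(\<lambda>s. (t - s) powr (-15/16)) absolutely_integrable_on {0..t}"
    by (intro nonnegative_absolutely_integrable_1) auto
  then show i: "integrable (ton t) (\<lambda>s. (t - s) powr (-15/16))"
    by (simp add: integrable_restrict_space set_integrable_def)
  have "sint t (\<lambda>s. (t - s) powr (-15/16)) = 16 * t powr (1/16)"
    using lebesgue_integral_eq_integral[OF i] integral_unique[OF hi] by simp
  also have "t powr (1/16) \<le> t + 1"
  proof (cases "t \<le> 1")
    case True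
    then have "t powr (1/16) \<le> 1" using t by (intro powr_le1) auto
    then show ?thesis using t by simp
  next
    case False
    then have "t powr (1/16) \<le> t powr 1" by (intro powr_mono) auto
    then show ?thesis using t by simp
  qed
  finally show "sint t (\<lambda>s. (t - s) powr (-15/16)) \<le> 16 * (t + 1)" by simp
qed

context flux begin

text \<open>Continuity in \<open>H^2\<close> makes the series converge at every point, and the
  integrands have a common constant bound, so dominated convergence applies.\<close>

lemma A10_meas:
  assumes c: "ncont {0..T} c"
  shows "continuous_on {0..T} (\<lambda>s. tint (\<lambda>x. A (ser (c s) x) ^ k))"
  unfolding continuous_on_def
proof
  fix t assume t: "t \<in> {0..T}"
  obtain R where R: "0 \<le> R" "\<And>t. t \<in> {0..T} \<Longrightarrow> nrm (c t) \<le> R" using ncont_bdd[OF c] by blast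
  have sb: "\<bar>ser (c s) x\<bar> \<le> C0 * R" if "s \<in> {0..T}" for s x
    using ser_bound[OF ncont_Hs[OF c that], of x] mult_left_mono[OF R(2)[OF that] C0_nonneg] by simp
  obtain M where M: "M \<ge> 0" "\<And>x. \<bar>x\<bar> \<le> C0 * R \<Longrightarrow> \<bar>A x\<bar> \<le> M" using A_bounds[of "C0 * R"] by blast
  show "((\<lambda>s. tint (\<lambda>x. A (ser (c s) x) ^ k)) \<longlongrightarrow> tint (\<lambda>x. A (ser (c t) x) ^ k)) (at t within {0..T})"
  proof (unfold tendsto_at_iff_sequentially, intro allI impI)
    fix X :: seq assume X: "\<forall>i. X i \<in> {0..T} - {t}" "X \<longlonglongrightarrow> t"
    have "(\<lambda>n. tint (\<lambda>x. A (ser (c (X n)) x) ^ k)) \<longlonglongrightarrow> tint (\<lambda>x. A (ser (c t) x) ^ k)"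
    proof (rule integral_dominated_convergence[where w="\<lambda>x. M ^ k"])
      show "(\<lambda>x. A (ser (c t) x) ^ k) \<in> borel_measurable torus"
        by (intro torus_meas_cont continuous_on_power Aser_cont ncont_Hs[OF c t])
      show "(\<lambda>x. A (ser (c (X n)) x) ^ k) \<in> borel_measurable torus" for n
        by (intro torus_meas_cont continuous_on_power Aser_cont ncont_Hs[OF c]) (use X in auto)
      show "AE x in torus. norm (A (ser (c (X n)) x) ^ k) \<le> M ^ k" for n
        using X(1) sb M(2) by (intro AE_I2) (auto simp: power_abs intro!: power_mono)
      show "AE x in torus. (\<lambda>n. A (ser (c (X n)) x) ^ k) \<longlonglongrightarrow> A (ser (c t) x) ^ k"
      proof (rule AE_I2)
        fix x
        have l: "((\<lambda>s. nrmd (c s) (c t)) \<longlongrightarrow> 0) (at t within {0..T})" using c t by (simp add: ncont_def)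
        have lX: "(\<lambda>n. nrmd (c (X n)) (c t)) \<longlonglongrightarrow> 0"
          using l[unfolded tendsto_at_iff_sequentially, rule_format, of X] X by (simp add: o_def)
        have "(\<lambda>n. ser (c (X n)) x - ser (c t) x) \<longlonglongrightarrow> 0"
        proof (rule Lim_null_comparison)
          show "(\<lambda>n. C0 * nrmd (c (X n)) (c t)) \<longlonglongrightarrow> 0" using tendsto_mult[OF tendsto_const lX] by simp
          show "\<forall>\<^sub>F n in sequentially. norm (ser (c (X n)) x - ser (c t) x) \<le> C0 * nrmd (c (X n)) (c t)"
            using ser_diff_bound[OF ncont_Hs[OF c] ncont_Hs[OF c t]] X(1) by (intro always_eventually allI) auto
        qed
        then have "(\<lambda>n. ser (c (X n)) x) \<longlonglongrightarrow> ser (c t) x" by (simp add: LIM_zero_iff)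
        moreover have "isCont A (ser (c t) x)" using A_cont[of UNIV] by (simp add: continuous_on_eq_continuous_at)
        ultimately show "(\<lambda>n. A (ser (c (X n)) x) ^ k) \<longlonglongrightarrow> A (ser (c t) x) ^ k"
          by (intro tendsto_power isCont_tendsto_compose[of _ A])
      qed
    qed simp
    then show "((\<lambda>s. tint (\<lambda>x. A (ser (c s) x) ^ k)) \<circ> X) \<longlonglongrightarrow> tint (\<lambda>x. A (ser (c t) x) ^ k)"
      by (simp add: o_def)
  qed
qed

text \<open>Parabolic smoothing in the scale \<open>H\<^sup>3\<^sup>/\<^sup>4\<close>, which embeds into \<open>L\<^sup>\<infinity>\<close>; the exponent 5 leaves an integrable singularity after Young's inequality.\<close>

lemma smoothing_bound:
  assumes c: "ncont {0..T} c" and t: "t \<in> {0..T}" and S: "finite S"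
    and B: "sint T (\<lambda>s. A10 (c s)) \<le> B"
  shows "(\<Sum>m\<in>S. kap m powr (3/2) * (duF c t m)^2)
    \<le> 1 / \<nu> * (\<nu> powr (-15/16) * (16 * (T + 1)) + B)"
proof -
  let ?q = "\<lambda>m s. kap m powr (3/2) * exp (- (mu m) * (t - s)) * ((Fm (c s) m)^2 / (kap m)^2)"
  have sub: "{0..t} \<subseteq> {0..T}" and t0: "0 \<le> t" using t by auto
  note H = ncont_Hs[OF c]
  have fc: "continuous_on {0..t} (\<lambda>s. Fm (c s) m)" for m by (rule continuous_on_subset[OF ncont_Fm[OF c] sub])
  let ?e = "\<lambda>m s. exp (- (mu m) * (t - s))"
  have mode: "kap m powr (3/2) * (duF c t m)^2
    \<le> 1 / \<nu> * sint t (\<lambda>s. ?q m s)" for m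
  proof -
    let ?\<mu> = "mu m"
    have mu: "0 < ?\<mu>" using nu by simp
    \<comment> \<open>Splitting the kernel into two half-exponents leaves, after Cauchy-Schwarz, one
      full kernel next to the squared flux term; its decay pays for the weight
      \<open>kap m powr (3/2)\<close>.\<close>
    let ?h = "\<lambda>s. exp (- (?\<mu> / 2) * (t - s))"
    have hh: "?h s * ?h s = ?e m s" for s unfolding exp_add[symmetric] by (rule arg_cong[of _ _ exp]) (simp add: field_simps)
    have "(sint t (\<lambda>s. ?h s * (?h s * Fm (c s) m)))^2
       \<le> sint t (\<lambda>s. (?h s)^2) * sint t (\<lambda>s. (?h s * Fm (c s) m)^2)"
      by (intro int_CS ton_int_cont continuous_intros fc)
    also have "(\<lambda>s. ?h s * (?h s * Fm (c s) m)) = (\<lambda>s. ?e m s * Fm (c s) m)"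
      by (rule ext) (simp only: mult.assoc[symmetric] hh)
    also have "(\<lambda>s. (?h s)^2) = ?e m" by (rule ext) (simp only: power2_eq_square[of "?h _"] hh)
    also have "(\<lambda>s. (?h s * Fm (c s) m)^2) = (\<lambda>s. ?e m s * (Fm (c s) m)^2)"
      by (rule ext) (simp only: power_mult_distrib power2_eq_square[of "?h _"] hh)
    also have "sint t (?e m) = (1 - exp (- ?\<mu> * t)) / ?\<mu>" by (rule int_exp_kernel[OF mu t0])
    also have "(1 - exp (- ?\<mu> * t)) / ?\<mu> * sint t (\<lambda>s. ?e m s * (Fm (c s) m)^2)
       \<le> 1 / ?\<mu> * sint t (\<lambda>s. ?e m s * (Fm (c s) m)^2)"
      using mu by (intro mult_right_mono divide_right_mono integral_nonneg_AE AE_I2) auto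
    finally have "(conv ?\<mu> (\<lambda>s. Fm (c s) m) t)^2 \<le> 1 / ?\<mu> * sint t (\<lambda>s. ?e m s * (Fm (c s) m)^2)"
      by (simp add: conv_def)
    then have "kap m powr (3/2) * (conv ?\<mu> (\<lambda>s. Fm (c s) m) t)^2
       \<le> kap m powr (3/2) * (1 / ?\<mu> * sint t (\<lambda>s. ?e m s * (Fm (c s) m)^2))" by (intro mult_left_mono) auto
    also have "\<dots> = 1 / \<nu> * ((kap m powr (3/2) / (kap m)^2) * sint t (\<lambda>s. ?e m s * (Fm (c s) m)^2))"
      by simp
    also have "(kap m powr (3/2) / (kap m)^2) * sint t (\<lambda>s. ?e m s * (Fm (c s) m)^2)
      = sint t (\<lambda>s. ?q m s)"
      unfolding integral_mult_right_zero[symmetric] by (simp add: mult_ac)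
    finally show ?thesis .
  qed
  have i: "integrable (ton t) (\<lambda>s. ?q m s)" for m
    by (intro ton_int_cont continuous_intros fc) auto
  have gc: "continuous_on {0..T} (\<lambda>s. A10 (c s))" by (rule A10_meas[OF c])
  note gi = ton_int_cont[OF gc]
  have g0: "0 \<le> A10 (c s)" for s
    by (intro integral_nonneg_AE AE_I2) (simp add: zero_le_even_power)
  have pt: "(\<Sum>m\<in>S. ?q m s)
      \<le> \<nu> powr (-15/16) * (t - s) powr (-15/16) + A10 (c s)"
    if s: "s \<in> {0..t}" "s \<noteq> t" for s
  proof -
    have sT: "s \<in> {0..T}" using s sub by auto
    define \<tau> where "\<tau> = \<nu> * (t - s)"
    have tau: "0 < \<tau>" using s nu by (simp add: \<tau>_def)
    \<comment> \<open>The weight is the power 3/4 of \<open>(kap m)^2\<close>, so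
      \<open>powr_exp_le\<close> trades it for \<open>\<tau> powr (-3/4)\<close>, uniformly in
      \<open>m\<close>.\<close>
    have ke: "kap m powr (3/2) * ?e m s \<le> \<tau> powr (-3/4)" for m
    proof -
      have "((kap m)^2 * \<tau>) powr (3/4) * exp (- ((kap m)^2 * \<tau>)) \<le> 1" by (rule powr_exp_le) (use tau in simp)
      moreover have "((kap m)^2 * \<tau>) powr (3/4) = kap m powr (3/2) * \<tau> powr (3/4)"
        using tau by (simp add: powr_mult powr_powr flip: powr_numeral)
      moreover have "exp (- ((kap m)^2 * \<tau>)) = ?e m s" by (simp add: \<tau>_def algebra_simps)
      ultimately have "(kap m powr (3/2) * ?e m s) * \<tau> powr (3/4) \<le> 1" by (simp add: mult_ac)
      then have "(kap m powr (3/2) * ?e m s) * \<tau> powr (3/4) * \<tau> powr (-3/4) \<le> 1 * \<tau> powr (-3/4)" by (intro mult_right_mono) auto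
      then show ?thesis using tau by (simp add: mult.assoc flip: powr_add)
    qed
    have "(\<Sum>m\<in>S. ?q m s) \<le> (\<Sum>m\<in>S. \<tau> powr (-3/4) * ((Fm (c s) m)^2 / (kap m)^2))"
      by (intro sum_mono mult_right_mono ke) auto
    also have "\<dots> = \<tau> powr (-3/4) * (\<Sum>m\<in>S. (Fm (c s) m)^2 / (kap m)^2)" by (rule sum_distrib_left[symmetric])
    also have "\<dots> \<le> \<tau> powr (-3/4) * tint (\<lambda>x. (A (ser (c s) x))^2)"
      by (intro mult_left_mono Fm_L2_bound H[OF sT] S) auto
    also have "\<dots> = tint (\<lambda>x. \<tau> powr (-3/4) * (A (ser (c s) x))^2)" by simp
    also have "\<dots> \<le> tint (\<lambda>x. \<tau> powr (-15/16) + A (ser (c s) x) ^ 10)"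
    proof (intro integral_mono torus_int_cont continuous_intros Aser_cont H[OF sT])
      fix x
      show "\<tau> powr (-3/4) * (A (ser (c s) x))^2 \<le> \<tau> powr (-15/16) + A (ser (c s) x) ^ 10"
        using young5[of "\<tau> powr (-3/4)" "(A (ser (c s) x))^2"] by (simp add: powr_powr flip: power_mult)
    qed
    also have "\<dots> = \<tau> powr (-15/16) + A10 (c s)"
    proof -
      have "integrable torus (\<lambda>x. A (ser (c s) x) ^ 10)" by (intro torus_int_cont continuous_on_power Aser_cont H[OF sT])
      then show ?thesis by simp
    qed
    also have "\<tau> powr (-15/16) = \<nu> powr (-15/16) * (t - s) powr (-15/16)"
      unfolding \<tau>_def using nu s by (simp add: powr_mult)
    finally show ?thesis .
  qed
  have "(\<Sum>m\<in>S. kap m powr (3/2) * (duF c t m)^2)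
    \<le> (\<Sum>m\<in>S. 1 / \<nu> * sint t (\<lambda>s. ?q m s))"
    by (intro sum_mono mode)
  also have "\<dots> = 1 / \<nu> * sint t (\<lambda>s. \<Sum>m\<in>S. ?q m s)"
    unfolding sum_distrib_left[symmetric] by (subst Bochner_Integration.integral_sum[OF i]) simp
  also have "\<dots> \<le> 1 / \<nu> * sint t (\<lambda>s. \<nu> powr (-15/16) * (t - s) powr (-15/16) + A10 (c s))"
  proof (rule mult_left_mono)
    show "sint t (\<lambda>s. \<Sum>m\<in>S. ?q m s)
      \<le> sint t (\<lambda>s. \<nu> powr (-15/16) * (t - s) powr (-15/16) + A10 (c s))"
    proof (rule integral_mono_AE)
      show "integrable (ton t) (\<lambda>s. \<Sum>m\<in>S. ?q m s)"
        by (rule Bochner_Integration.integrable_sum[OF i])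
      show "integrable (ton t) (\<lambda>s. \<nu> powr (-15/16) * (t - s) powr (-15/16) + A10 (c s))"
        by (intro Bochner_Integration.integrable_add integrable_mult_right int_singular(1)[OF t0] ton_mono_dom(1)[OF gi g0]) (use t in auto)
      show "AE s in ton t. (\<Sum>m\<in>S. ?q m s)
         \<le> \<nu> powr (-15/16) * (t - s) powr (-15/16) + A10 (c s)"
        using ae_ne_Icc[where a=0 and b=t and c=t] AE_space by eventually_elim (rule pt, auto)
    qed
  qed (use nu in simp)
  also have "sint t (\<lambda>s. \<nu> powr (-15/16) * (t - s) powr (-15/16) + A10 (c s))
    = \<nu> powr (-15/16) * sint t (\<lambda>s. (t - s) powr (-15/16)) + sint t (\<lambda>s. A10 (c s))"
    using int_singular(1)[OF t0] ton_mono_dom(1)[OF gi g0, of t] t by simp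
  also have "1 / \<nu> * \<dots> \<le> 1 / \<nu> * (\<nu> powr (-15/16) * (16 * (T + 1)) + B)"
  proof (intro mult_left_mono add_mono)
    show "sint t (\<lambda>s. (t - s) powr (-15/16)) \<le> 16 * (T + 1)"
      using int_singular(2)[OF t0] t by simp
    show "sint t (\<lambda>s. A10 (c s)) \<le> B"
      using ton_mono_dom(2)[OF gi g0, of t] t B by simp
  qed (use nu in auto)
  finally show ?thesis .
qed

text \<open>Here \<psi> is the squared norm of the Duhamel part in the scale given by \<omega>, and
  the flux grows at most linearly in it. The weight 1 gives the \<open>H^1\<close> stage of
  \<open>bootstrap\<close>, the weight \<open>(kap m)^2\<close> its \<open>H^2\<close>
  stage.\<close>

lemma energy_gronwall:
  assumes f: "\<And>m. continuous_on {0..T} (f m)" and om: "\<And>m. 0 \<le> \<omega> m" and K: "0 < K" and Y: "0 \<le> Y" and T: "0 \<le> T"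
    and \<psi>: "\<And>t S. t \<in> {0..T} \<Longrightarrow> finite S \<Longrightarrow> (\<Sum>m\<in>S. \<omega> m * (f m t)^2) \<le> K * (\<psi> t + Y)"
    and bd: "\<And>t. t \<in> {0..T} \<Longrightarrow> \<psi> t \<le> Bd"
    and sup: "\<And>t. t \<in> {0..T} \<Longrightarrow> (\<lambda>m. \<omega> m * (kap m)^2 * (conv (mu m) (f m) t)^2) sums \<psi> t"
    and t: "t \<in> {0..T}"
  shows "\<psi> t \<le> Y * exp (2 * (K / \<nu>) * T)"
proof -
  define \<theta> where "\<theta> = K / \<nu>"
  have th: "0 < \<theta>" using K nu by (simp add: \<theta>_def)
  have pos: "0 \<le> \<psi> s" if "s \<in> {0..T}" for s
    by (rule sums_le[OF _ sums_zero sup[OF that]]) (use om in auto)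
  have "\<psi> t \<le> 2 * (Y * exp (\<theta> * T) / 2) * exp (\<theta> * t)"
  proof (rule gronwall_weighted[where T=T and B=Bd])
    fix s S assume s: "s \<in> {0..T}" and S: "0 \<le> S" and le: "\<And>r. r \<in> {0..s} \<Longrightarrow> \<psi> r \<le> S * exp (\<theta> * r)"
    have sub: "{0..s} \<subseteq> {0..T}" using s by auto
    have "(\<Sum>m<n. \<omega> m * (kap m)^2 * (conv (mu m) (f m) s)^2) \<le> (K * (S + Y)) * exp (\<theta> * s) / (2 * \<nu> * \<theta>)" for n
    proof -
      have "\<exists>B. \<forall>r\<in>{0..s}. \<bar>f m r\<bar> \<le> B" for m
        using compact_imp_bounded[OF compact_continuous_image[OF continuous_on_subset[OF f sub] compact_Icc]]
        by (fastforce simp: bounded_iff)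
      then obtain B where B: "\<And>m r. r \<in> {0..s} \<Longrightarrow> \<bar>f m r\<bar> \<le> B m" by metis
      show ?thesis
      proof (rule conv_energy[where B=B])
        show "f m \<in> borel_measurable (ton s)" for m by (rule ton_meas_cont[OF continuous_on_subset[OF f sub]])
        fix r assume r: "r \<in> {0..s}"
        have "(\<Sum>m<n. \<omega> m * (f m r)^2) \<le> K * (\<psi> r + Y)" by (rule \<psi>) (use r sub in auto)
        also have "\<dots> \<le> K * (S * exp (\<theta> * r) + Y * exp (\<theta> * r))"
          using le[OF r] K Y th r by (intro mult_left_mono add_mono) (auto simp: mult_le_cancel_left1)
        finally show "(\<Sum>m<n. \<omega> m * (f m r)^2) \<le> K * (S + Y) * exp (\<theta> * r)" by (simp add: algebra_simps)
      qed (use B nu th s om K S Y in auto)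
    qed
    then have "\<psi> s \<le> (K * (S + Y)) * exp (\<theta> * s) / (2 * \<nu> * \<theta>)"
      using suminf_le_const[OF sums_summable[OF sup[OF s]]] sums_unique[OF sup[OF s]] by simp
    also have "\<dots> = (S + Y) * exp (\<theta> * s) / 2" using K nu by (simp add: \<theta>_def)
    also have "\<dots> \<le> Y * exp (\<theta> * T) / 2 + S * exp (\<theta> * s) / 2"
      using s th Y by (simp add: distrib_right mult_left_mono add_divide_distrib)
    finally show "\<psi> s \<le> Y * exp (\<theta> * T) / 2 + S * exp (\<theta> * s) / 2" .
  qed (use th Y pos bd t in auto)
  also have "\<dots> = Y * (exp (\<theta> * T) * exp (\<theta> * t))" by simp
  also have "\<dots> \<le> Y * (exp (\<theta> * T) * exp (\<theta> * T))" using t th Y by (intro mult_left_mono) auto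
  also have "\<dots> = Y * exp (2 * (K / \<nu>) * T)" by (simp add: \<theta>_def flip: exp_add)
  finally show ?thesis .
qed

text \<open>Three stages: \<open>smoothing_bound\<close> yields a sup bound, then
  \<open>energy_gronwall\<close> bounds the Duhamel part in \<open>H^1\<close> and after that in
  \<open>H^2\<close>. The constants are built from \<open>T\<close>, \<open>Y\<close> and
  \<open>B\<close> alone, hence know no retraction radius. The horizon \<open>t'\<close> varies
  because the bound is applied up to a first hitting time.\<close>

lemma bootstrap:
  assumes T: "0 \<le> T" and Y: "0 \<le> Y" and B: "0 \<le> B"
  obtains Rb where "0 \<le> Rb" "\<And>c y t' t. \<lbrakk>t' \<le> T; ncont {0..t'} c; \<And>s. s \<in> {0..t'} \<Longrightarrow> Hs (y s) \<and> nrm (y s) \<le> Y;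
      \<And>s m. s \<in> {0..t'} \<Longrightarrow> c s m = y s m + duF c s m;
      sint t' (\<lambda>s. A10 (c s)) \<le> B; t \<in> {0..t'}\<rbrakk> \<Longrightarrow> nrm (c t) \<le> Rb"
proof -
  define Z where "Z = 1 / \<nu> * (\<nu> powr (-15/16) * (16 * (T + 1)) + B)"
  define B0 where "B0 = C0 * Y + sqrt 2 * (sqrt kinv32 * sqrt Z)"
  obtain K where K: "K \<ge> 0" "\<And>c S. \<lbrakk>Hs c; \<And>x. \<bar>ser c x\<bar> \<le> B0; finite S\<rbrakk> \<Longrightarrow> (\<Sum>m\<in>S. (Fm c m)^2) \<le> K * h1sq c"
    "\<And>c S. \<lbrakk>Hs c; \<And>x. \<bar>ser c x\<bar> \<le> B0; finite S\<rbrakk> \<Longrightarrow> (\<Sum>m\<in>S. (kap m)^2 * (Fm c m)^2) \<le> K * (h1sq c + 1) * (nrm c)^2"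
    by (rule Fm_h1_bound[of B0]) (rule that; assumption | blast)
  define K1 where "K1 = 2 * (K + 1)"
  have K1: "0 < K1" "2 * K \<le> K1" using K(1) by (auto simp: K1_def)
  define H1 where "H1 = Y^2 * exp (2 * (K1 / \<nu>) * T)"
  define K2 where "K2 = K1 * (2 * H1 + 2 * Y^2 + 1)"
  have H1: "0 \<le> H1" using Y by (simp add: H1_def)
  have K2: "0 < K2" using K1 H1 Y by (simp add: K2_def add_nonneg_pos)
  define Rb where "Rb = sqrt (Y^2 * exp (2 * (K2 / \<nu>) * T)) + Y"
  show ?thesis
  proof (rule that[of Rb])
    show "0 \<le> Rb" using Y by (simp add: Rb_def)
    fix c :: "real \<Rightarrow> seq" and y :: "real \<Rightarrow> seq" and t' t
    assume t': "t' \<le> T" and c: "ncont {0..t'} c" and y: "\<And>s. s \<in> {0..t'} \<Longrightarrow> Hs (y s) \<and> nrm (y s) \<le> Y"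
      and mild: "\<And>s m. s \<in> {0..t'} \<Longrightarrow> c s m = y s m + duF c s m"
      and int: "sint t' (\<lambda>s. A10 (c s)) \<le> B" and t: "t \<in> {0..t'}"
    have t'0: "0 \<le> t'" using t by auto
    define v where "v s m = duF c s m" for s m
    have cv: "c s = (\<lambda>m. y s m + v s m)" if "s \<in> {0..t'}" for s using mild[OF that] by (auto simp: v_def)
    have Hc: "Hs (c s)" if "s \<in> {0..t'}" for s by (rule ncont_Hs[OF c that])
    have vd: "v s = (\<lambda>m. c s m - y s m)" if "s \<in> {0..t'}" for s using cv[OF that] by auto
    have Hv: "Hs (v s)" if "s \<in> {0..t'}" for s unfolding vd[OF that] using Hs_diff(1) Hc[OF that] y[OF that] by blast
    obtain R where R: "0 \<le> R" "\<And>s. s \<in> {0..t'} \<Longrightarrow> nrm (c s) \<le> R" using ncont_bdd[OF c] by blast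
    have nv: "nrm (v s) \<le> R + Y" if "s \<in> {0..t'}" for s
      using Hs_diff(2)[OF Hc[OF that], of "y s"] y[OF that] R(2)[OF that] vd[OF that] by simp
    have sb: "\<bar>ser (c s) x\<bar> \<le> B0" if s: "s \<in> {0..t'}" for s x
    proof -
      have "(\<Sum>m<n. \<bar>v s m\<bar>) \<le> sqrt kinv32 * sqrt Z" for n
      proof (rule sum_abs_le32)
        have "(\<Sum>m<n. kap m powr (3/2) * (v s m)^2) \<le> 1 / \<nu> * (\<nu> powr (-15/16) * (16 * (t' + 1)) + B)"
          unfolding v_def by (rule smoothing_bound[OF c s _ int]) simp
        also have "\<dots> \<le> Z" unfolding Z_def using t' nu by (intro mult_left_mono add_mono) auto
        finally show "(\<Sum>m<n. kap m powr (3/2) * (v s m)^2) \<le> Z" .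
      qed simp
      then have "(\<Sum>m. \<bar>v s m\<bar>) \<le> sqrt kinv32 * sqrt Z" by (intro suminf_le_const Hs_summable Hv[OF s])
      then have "\<bar>ser (v s) x\<bar> \<le> sqrt 2 * (sqrt kinv32 * sqrt Z)"
        by (rule order_trans[OF ser_abs_le[OF Hs_summable[OF Hv[OF s]]] mult_left_mono]) simp
      moreover have "\<bar>ser (y s) x\<bar> \<le> C0 * Y"
        using ser_bound[of "y s" x] y[OF s] mult_left_mono[of "nrm (y s)" Y C0] by auto
      moreover have "ser (c s) x = ser (y s) x + ser (v s) x"
        unfolding cv[OF s] using y[OF s] Hv[OF s] by (simp add: ser_add)
      ultimately show ?thesis unfolding B0_def by linarith
    qed
    have sqadd: "(a + b)^2 \<le> 2 * b^2 + 2 * a^2" for a b :: real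
      using sum_squares_bound[of a b] by (simp add: power2_sum)
    have Fc: "continuous_on {0..t'} (\<lambda>s. Fm (c s) m)" for m by (rule ncont_Fm[OF c])
    have y1: "h1sq (y s) \<le> Y^2" "(nrm (y s))^2 \<le> Y^2" if "s \<in> {0..t'}" for s
      using h1sq_le[of "y s"] y[OF that] power_mono[of "nrm (y s)" Y 2] by auto
    have h1c: "h1sq (c s) \<le> 2 * h1sq (v s) + 2 * Y^2" if s: "s \<in> {0..t'}" for s
    proof -
      have sm: "summable (\<lambda>m. (kap m)^2 * (v s m)^2)" "summable (\<lambda>m. (kap m)^2 * (y s m)^2)"
        using h1_summable Hv[OF s] y[OF s] by auto
      have "h1sq (c s) \<le> (\<Sum>m. 2 * ((kap m)^2 * (v s m)^2) + 2 * ((kap m)^2 * (y s m)^2))"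
        unfolding h1sq_def
      proof (rule suminf_le[OF _ h1_summable[OF Hc[OF s]]])
        show "summable (\<lambda>m. 2 * ((kap m)^2 * (v s m)^2) + 2 * ((kap m)^2 * (y s m)^2))"
          using sm by (intro summable_add summable_mult)
        fix m
        have "(kap m)^2 * (c s m)^2 \<le> (kap m)^2 * (2 * (v s m)^2 + 2 * (y s m)^2)"
          unfolding cv[OF s] by (intro mult_left_mono sqadd) auto
        then show "(kap m)^2 * (c s m)^2 \<le> 2 * ((kap m)^2 * (v s m)^2) + 2 * ((kap m)^2 * (y s m)^2)" by (simp add: algebra_simps)
      qed
      also have "\<dots> = 2 * h1sq (v s) + 2 * h1sq (y s)"
        unfolding h1sq_def using sm by (simp add: suminf_add[symmetric] suminf_mult summable_mult)
      finally show ?thesis using y1[OF s] by simp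
    qed
    have nc: "(nrm (c s))^2 \<le> 2 * (nrm (v s))^2 + 2 * Y^2" if s: "s \<in> {0..t'}" for s
    proof -
      have "nrm (c s) \<le> nrm (y s) + nrm (v s)" unfolding cv[OF s] using y[OF s] Hv[OF s] by (intro Hs_add) auto
      then have "(nrm (c s))^2 \<le> (nrm (y s) + nrm (v s))^2" using Hc[OF s] by (intro power_mono) auto
      also have "\<dots> \<le> 2 * (nrm (v s))^2 + 2 * (nrm (y s))^2" by (rule sqadd)
      finally show ?thesis using y1[OF s] by simp
    qed
    have h1v: "h1sq (v s) \<le> H1" if s: "s \<in> {0..t'}" for s
    proof -
      have "h1sq (v s) \<le> Y^2 * exp (2 * (K1 / \<nu>) * t')"
      proof (rule energy_gronwall[where f="\<lambda>m s. Fm (c s) m" and \<omega>="\<lambda>_. 1" and Bd="(R + Y)^2" and T=t' and K=K1 and Y="Y^2" and \<psi>="\<lambda>s. h1sq (v s)"])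
        show "(\<Sum>m\<in>S. 1 * (Fm (c r) m)^2) \<le> K1 * (h1sq (v r) + Y^2)" if r: "r \<in> {0..t'}" and S: "finite S" for r S
        proof -
          have "(\<Sum>m\<in>S. 1 * (Fm (c r) m)^2) \<le> K * h1sq (c r)" using K(2)[OF Hc[OF r] sb[OF r] S] by simp
          also have "\<dots> \<le> K * (2 * h1sq (v r) + 2 * Y^2)" by (intro mult_left_mono h1c r K)
          also have "\<dots> = (2 * K) * (h1sq (v r) + Y^2)" by (simp add: algebra_simps)
          also have "\<dots> \<le> K1 * (h1sq (v r) + Y^2)" using K1 h1sq_nonneg[OF Hv[OF r]] by (intro mult_right_mono) auto
          finally show ?thesis .
        qed
        show "h1sq (v r) \<le> (R + Y)^2" if r: "r \<in> {0..t'}" for r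
          using h1sq_le[OF Hv[OF r]] power_mono[OF nv[OF r] nrm_nonneg[OF Hv[OF r]], of 2] by linarith
        show "(\<lambda>m. 1 * (kap m)^2 * (duF c r m)^2) sums h1sq (v r)" if r: "r \<in> {0..t'}" for r
          using summable_sums[OF h1_summable[OF Hv[OF r]]] by (simp add: h1sq_def v_def)
      qed (rule Fc t'0 s K1 | simp)+
      also have "\<dots> \<le> H1" unfolding H1_def
        by (rule mult_left_mono, subst exp_le_cancel_iff, rule mult_left_mono[OF t']) (use K1 nu in auto)
      finally show ?thesis .
    qed
    have "(nrm (v t))^2 \<le> Y^2 * exp (2 * (K2 / \<nu>) * t')"
    proof (rule energy_gronwall[where f="\<lambda>m s. Fm (c s) m" and \<omega>="\<lambda>m. (kap m)^2" and Bd="(R + Y)^2" and T=t' and K=K2 and Y="Y^2" and \<psi>="\<lambda>s. (nrm (v s))^2"])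
      show "(\<Sum>m\<in>S. (kap m)^2 * (Fm (c r) m)^2) \<le> K2 * ((nrm (v r))^2 + Y^2)" if r: "r \<in> {0..t'}" and S: "finite S" for r S
      proof -
        have h: "h1sq (c r) + 1 \<le> 2 * H1 + 2 * Y^2 + 1" using h1c[OF r] h1v[OF r] by simp
        have "(\<Sum>m\<in>S. (kap m)^2 * (Fm (c r) m)^2) \<le> K * (h1sq (c r) + 1) * (nrm (c r))^2" by (rule K(3)[OF Hc[OF r] sb[OF r] S])
        also have "\<dots> \<le> K * (2 * H1 + 2 * Y^2 + 1) * (2 * (nrm (v r))^2 + 2 * Y^2)"
          using K(1) h H1 Y h1sq_nonneg[OF Hc[OF r]] by (intro mult_mono mult_left_mono nc r) (auto intro!: mult_nonneg_nonneg)
        also have "\<dots> = (2 * K) * ((2 * H1 + 2 * Y^2 + 1) * ((nrm (v r))^2 + Y^2))" by (simp add: algebra_simps)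
        also have "\<dots> \<le> K1 * ((2 * H1 + 2 * Y^2 + 1) * ((nrm (v r))^2 + Y^2))"
          using K1 H1 by (intro mult_right_mono mult_nonneg_nonneg add_nonneg_nonneg) auto
        finally show ?thesis by (simp add: K2_def mult.assoc)
      qed
      show "(nrm (v r))^2 \<le> (R + Y)^2" if r: "r \<in> {0..t'}" for r
        using power_mono[OF nv[OF r] nrm_nonneg[OF Hv[OF r]], of 2] by linarith
      show "(\<lambda>m. (kap m)^2 * (kap m)^2 * (duF c r m)^2) sums (nrm (v r))\<^sup>2" if r: "r \<in> {0..t'}" for r
        using summable_sums[OF Hv[OF r, unfolded Hs_def]] unfolding nrm_sq[OF Hv[OF r]] by (simp add: v_def flip: power_add)
    qed (rule Fc t'0 t K2 | simp)+
    also have "\<dots> \<le> Y^2 * exp (2 * (K2 / \<nu>) * T)"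
      by (rule mult_left_mono, subst exp_le_cancel_iff, rule mult_left_mono[OF t']) (use K2 nu in auto)
    finally have "nrm (v t) \<le> sqrt (Y^2 * exp (2 * (K2 / \<nu>) * T))" by (rule real_le_rsqrt)
    moreover have "nrm (c t) \<le> nrm (y t) + nrm (v t)" unfolding cv[OF t] using y[OF t] Hv[OF t] by (intro Hs_add) auto
    ultimately show "nrm (c t) \<le> Rb" using y[OF t] unfolding Rb_def by linarith
  qed
qed

end

subsection \<open>Frozen noise\<close>

text \<open>Noise paths with a summable dominating sequence on each bounded interval. This asks for
  more than continuity in \<open>H^2\<close>, since the supremum over time stands inside the sum
  over modes.\<close>

definition gp :: "(real \<Rightarrow> seq) \<Rightarrow> bool" where
  "gp w \<longleftrightarrow> (\<forall>m. continuous_on {0..} (\<lambda>t. w t m)) \<and>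
     (\<forall>T. \<exists>M. summable M \<and> (\<forall>t\<in>{0..T}. \<forall>m. kap m ^ 4 * (w t m)^2 \<le> M m))"

text \<open>The noise held at the last grid point up to \<open>s\<close>, and held for good from
  \<open>i / n\<close> on; on nonnegative times it depends only on the values at
  \<open>k / n\<close> with \<open>k \<le> i\<close>.\<close>

definition stp :: "nat \<Rightarrow> nat \<Rightarrow> (real \<Rightarrow> seq) \<Rightarrow> real \<Rightarrow> seq" where
  "stp n i w s = w (real (min (nat \<lfloor>real n * s\<rfloor>) i) / real n)"

lemma conv_const:
  assumes "0 < \<mu>" "0 \<le> t" shows "\<mu> * conv \<mu> (\<lambda>_. a) t = a * (1 - exp (- \<mu> * t))"
proof -
  have "conv \<mu> (\<lambda>_. a) t = a * sint t (\<lambda>s. exp (- \<mu> * (t - s)))"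
    unfolding conv_def integral_mult_right_zero[symmetric] by (simp add: mult.commute)
  then show ?thesis using int_exp_kernel[OF assms] assms by simp
qed

lemma conv_cong_ae:
  fixes f g :: "real \<Rightarrow> real"
  assumes "\<And>s. 0 \<le> s \<Longrightarrow> s < t \<Longrightarrow> f s = g s"
    "f \<in> borel_measurable (ton t)" "g \<in> borel_measurable (ton t)"
  shows "conv \<mu> f t = conv \<mu> g t"
  unfolding conv_def
proof (rule integral_cong_AE)
  show "AE s in ton t. exp (- \<mu> * (t - s)) * f s = exp (- \<mu> * (t - s)) * g s"
    using ae_ne_Icc[where a=0 and b=t and c=t] AE_space[of "ton t"] by eventually_elim (use assms(1) in auto)
qed (intro borel_measurable_times assms ton_meas_cont continuous_intros)+

lemma ton_split:
  fixes f :: "real \<Rightarrow> real"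
  assumes f: "f \<in> borel_measurable (ton (a + \<tau>))" "\<And>s. s \<in> {0..a + \<tau>} \<Longrightarrow> \<bar>f s\<bar> \<le> B" and a: "0 \<le> a" "0 \<le> \<tau>"
  shows "sint (a + \<tau>) f = sint a f + integral\<^sup>L (ton \<tau>) (\<lambda>s. f (a + s))"
    and "(\<lambda>s. f (a + s)) \<in> borel_measurable (ton \<tau>)"
proof -
  have i: "integrable (ton (a + \<tau>)) f" by (rule ton_int[OF f])
  have i1: "integrable (ton a) f" "integrable (lebesgue_on {a..a + \<tau>}) f"
    by (rule integrable_subinterval[OF i], use a in auto)+
  have L: "integrable lebesgue (\<lambda>s. indicator {0..a + \<tau>} s *\<^sub>R f s)" "integrable lebesgue (\<lambda>s. indicator {0..a} s *\<^sub>R f s)"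
    "integrable lebesgue (\<lambda>s. indicator {a..a + \<tau>} s *\<^sub>R f s)"
    using i i1 by (simp_all add: integrable_restrict_space)
  have sh: "indicator {a..a + \<tau>} (a + 1 * s) *\<^sub>R f (a + 1 * s) = indicator {0..\<tau>} s *\<^sub>R f (a + s)" for s
    by (simp add: indicator_def)
  have i2: "integrable lebesgue (\<lambda>s. indicator {0..\<tau>} s *\<^sub>R f (a + s))"
    using lebesgue_integrable_real_affine[OF L(3), of 1 a] unfolding sh by simp
  then have i3: "integrable (ton \<tau>) (\<lambda>s. f (a + s))" by (simp add: integrable_restrict_space)
  then show "(\<lambda>s. f (a + s)) \<in> borel_measurable (ton \<tau>)" by simp
  have "sint (a + \<tau>) f = (\<integral>s. indicator {0..a + \<tau>} s *\<^sub>R f s \<partial>lebesgue)"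
    by (rule integral_restrict_space) simp
  also have "\<dots> = (\<integral>s. indicator {0..a} s *\<^sub>R f s + indicator {a..a + \<tau>} s *\<^sub>R f s \<partial>lebesgue)"
  proof (rule integral_cong_AE)
    have "AE s in lebesgue. s \<noteq> a" by (simp add: AE_completion AE_lborel_singleton)
    then show "AE s in lebesgue. indicator {0..a + \<tau>} s *\<^sub>R f s = indicator {0..a} s *\<^sub>R f s + indicator {a..a + \<tau>} s *\<^sub>R f s"
      by eventually_elim (use a in \<open>auto simp: indicator_def\<close>)
  qed (use L in auto)
  also have "\<dots> = (\<integral>s. indicator {0..a} s *\<^sub>R f s \<partial>lebesgue) + (\<integral>s. indicator {a..a + \<tau>} s *\<^sub>R f s \<partial>lebesgue)"
    by (rule Bochner_Integration.integral_add[OF L(2,3)])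
  also have "(\<integral>s. indicator {0..a} s *\<^sub>R f s \<partial>lebesgue) = sint a f"
    by (rule integral_restrict_space[symmetric]) simp
  also have "(\<integral>s. indicator {a..a + \<tau>} s *\<^sub>R f s \<partial>lebesgue) = (\<integral>s. indicator {0..\<tau>} s *\<^sub>R f (a + s) \<partial>lebesgue)"
    using lebesgue_integral_real_affine[of 1 "\<lambda>s. indicator {a..a + \<tau>} s *\<^sub>R f s" a] unfolding sh by simp
  also have "\<dots> = integral\<^sup>L (ton \<tau>) (\<lambda>s. f (a + s))"
    by (rule integral_restrict_space[symmetric]) simp
  finally show "sint (a + \<tau>) f = sint a f + integral\<^sup>L (ton \<tau>) (\<lambda>s. f (a + s))" .
qed

lemma conv_split:
  fixes f :: "real \<Rightarrow> real"
  assumes f: "f \<in> borel_measurable (ton (a + \<tau>))" "\<And>s. s \<in> {0..a + \<tau>} \<Longrightarrow> \<bar>f s\<bar> \<le> B" and a: "0 \<le> a" "0 \<le> \<tau>" "0 \<le> \<mu>"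
  shows "conv \<mu> f (a + \<tau>) = exp (- \<mu> * \<tau>) * conv \<mu> f a + conv \<mu> (\<lambda>s. f (a + s)) \<tau>"
proof -
  let ?g = "\<lambda>s. exp (- \<mu> * (a + \<tau> - s)) * f s"
  have "conv \<mu> f (a + \<tau>) = sint a ?g + integral\<^sup>L (ton \<tau>) (\<lambda>s. ?g (a + s))"
    unfolding conv_def
  proof (rule ton_split(1)[where B=B])
    show "?g \<in> borel_measurable (ton (a + \<tau>))"
      by (intro borel_measurable_times f ton_meas_cont continuous_intros)
    fix s assume s: "s \<in> {0..a + \<tau>}"
    then have "exp (- \<mu> * (a + \<tau> - s)) \<le> 1" using a by (auto intro!: mult_nonneg_nonneg)
    then have "\<bar>?g s\<bar> \<le> 1 * B" unfolding abs_mult using f(2)[OF s] by (intro mult_mono) auto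
    then show "\<bar>?g s\<bar> \<le> B" by simp
  qed (use a in auto)
  also have "sint a ?g = sint a (\<lambda>s. exp (- \<mu> * \<tau>) * (exp (- \<mu> * (a - s)) * f s))"
  proof (rule Bochner_Integration.integral_cong[OF refl])
    fix s
    have "exp (- \<mu> * (a + \<tau> - s)) = exp (- \<mu> * \<tau>) * exp (- \<mu> * (a - s))" unfolding exp_add[symmetric] by (rule arg_cong[of _ _ exp]) (simp add: algebra_simps)
    then show "?g s = exp (- \<mu> * \<tau>) * (exp (- \<mu> * (a - s)) * f s)" by simp
  qed
  finally show ?thesis by (simp add: conv_def)
qed

definition gb :: "(real \<Rightarrow> seq) \<Rightarrow> bool" where
  "gb w \<longleftrightarrow> (\<forall>m. (\<lambda>s. indicator {0..} s * w s m) \<in> borel_measurable borel) \<and>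
     (\<forall>T. \<exists>M. summable M \<and> (\<forall>t\<in>{0..T}. \<forall>m. kap m ^ 4 * (w t m)^2 \<le> M m))"

lemma gp_gb: assumes "gp w" shows "gb w"
proof -
  have "(\<lambda>s. indicator {0..} s *\<^sub>R w s m) \<in> borel_measurable borel" for m
    by (rule borel_measurable_continuous_on_indicator) (use assms in \<open>auto simp: gp_def\<close>)
  then show ?thesis using assms by (auto simp: gp_def gb_def)
qed

lemma stp_range: assumes "0 \<le> s" "0 < n" shows "real (min (nat \<lfloor>real n * s\<rfloor>) i) / real n \<in> {0..s}"
proof -
  have "real (min (nat \<lfloor>real n * s\<rfloor>) i) \<le> real (nat \<lfloor>real n * s\<rfloor>)" by simp
  also have "\<dots> \<le> real n * s" using assms by (simp add: of_nat_nat)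
  finally show ?thesis using assms by (simp add: divide_le_eq mult.commute)
qed

lemma gb_stp: assumes "gb w" "0 < n" shows "gb (stp n i w)"
  unfolding gb_def
proof (intro conjI allI)
  fix m
  have [measurable]: "(\<lambda>s. nat \<lfloor>real n * s\<rfloor>) \<in> measurable borel (count_space UNIV)" by measurable
  have [measurable]: "(\<lambda>s::real. w (real (min (nat \<lfloor>real n * s\<rfloor>) i) / real n) m) \<in> borel_measurable borel"
    by (rule measurable_compose_countable[where f="\<lambda>k s. w (real (min k i) / real n) m"]) measurable
  show "(\<lambda>s. indicator {0..} s * stp n i w s m) \<in> borel_measurable borel"
    unfolding stp_def by measurable
next
  fix T
  obtain M where M: "summable M" "\<And>t m. t \<in> {0..T} \<Longrightarrow> kap m ^ 4 * (w t m)^2 \<le> M m"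
    using assms(1) unfolding gb_def by meson
  show "\<exists>M. summable M \<and> (\<forall>t\<in>{0..T}. \<forall>m. kap m ^ 4 * (stp n i w t m)^2 \<le> M m)"
  proof (intro exI[of _ M] conjI M(1) ballI allI)
    fix t m assume "t \<in> {0..T}"
    then show "kap m ^ 4 * (stp n i w t m)^2 \<le> M m"
      unfolding stp_def using stp_range[of t n i] assms(2) by (intro M(2)) auto
  qed
qed

lemma gb_meas: assumes "gb w" shows "(\<lambda>s. w s m) \<in> borel_measurable (ton t)"
  using assms by (intro ton_meas_ind[of "{0..}"]) (auto simp: gb_def)

lemma mode_abs_le: assumes "kap m ^ 4 * a^2 \<le> M" shows "\<bar>a\<bar> \<le> sqrt M / (kap m)^2"
proof -
  have "((kap m)^2 * \<bar>a\<bar>)^2 \<le> M" using assms by (simp add: power_mult_distrib flip: power_mult)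
  then have "(kap m)^2 * \<bar>a\<bar> \<le> sqrt M" by (rule real_le_rsqrt)
  then show ?thesis by (simp add: le_divide_eq mult.commute)
qed

text \<open>The kernel \<open>\<mu> * exp (- \<mu> * (t - s))\<close> has mass at most 1, so both
  terms are bounded by the supremum of \<open>w\<close>; squaring the sum gives the factor
  4.\<close>

lemma z_bound:
  assumes w: "w \<in> borel_measurable (ton t)" and b: "\<And>s. s \<in> {0..t} \<Longrightarrow> kap m ^ 4 * (w s)^2 \<le> M" and "0 < \<mu>" "0 \<le> t"
  shows "kap m ^ 4 * (w t - \<mu> * conv \<mu> w t)^2 \<le> 4 * M"
proof -
  have M: "0 \<le> M" using b[of t] assms(4) by (auto intro: order_trans[rotated])
  let ?b = "sqrt M / (kap m)^2"
  have le: "\<bar>w s\<bar> \<le> ?b" if "s \<in> {0..t}" for s by (rule mode_abs_le[OF b[OF that]])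
  have "\<mu> * \<bar>conv \<mu> w t\<bar> \<le> ?b" by (rule conv_abs_le[OF w le assms(3,4)]) (use M in auto)
  then have "\<bar>\<mu> * conv \<mu> w t\<bar> \<le> ?b" using assms(3) by (simp add: abs_mult)
  then have "\<bar>w t - \<mu> * conv \<mu> w t\<bar> \<le> 2 * ?b" using le[of t] assms(4) by simp
  then have "\<bar>w t - \<mu> * conv \<mu> w t\<bar>\<^sup>2 \<le> (2 * ?b)^2" by (intro power_mono) auto
  then have "(w t - \<mu> * conv \<mu> w t)^2 \<le> 4 * (M / kap m ^ 4)" using M by (simp add: power_mult_distrib power_divide flip: power_mult)
  then have "kap m ^ 4 * (w t - \<mu> * conv \<mu> w t)^2 \<le> kap m ^ 4 * (4 * (M / kap m ^ 4))" by (intro mult_left_mono) auto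
  then show ?thesis by simp
qed

lemma nonneg_int_zero:
  fixes \<phi> :: "real \<Rightarrow> real"
  assumes "continuous_on {a..b} \<phi>" "a < b" "\<And>s. s \<in> {a..b} \<Longrightarrow> 0 \<le> \<phi> s" "integral\<^sup>L (lebesgue_on {a..b}) \<phi> = 0" "s \<in> {a..b}"
  shows "\<phi> s = (0::real)"
proof -
  have "integral {a..b} \<phi> = 0"
    using assms(4) lebesgue_integral_eq_integral[OF continuous_imp_integrable_real[OF assms(1)]] by simp
  then show ?thesis using integral_eq_0_iff[of a b \<phi>] assms by auto
qed

section \<open>Stochastic convolution, freezing and restarting\<close>

context flux begin

text \<open>Free evolution of the initial value plus, for a path starting at 0, the stochastic
  convolution after integration by parts in time.\<close>

definition Yp :: "seq \<Rightarrow> (real \<Rightarrow> seq) \<Rightarrow> real \<Rightarrow> seq" where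
  "Yp u0 w t m = exp (- (mu m) * t) * u0 m + (w t m - mu m * conv (mu m) (\<lambda>s. w s m) t)"

lemma mu_pos: "0 < mu m" using nu by simp

lemma Yp_bound:
  assumes w: "gb w" and t: "t \<in> {0..T}" and M: "\<And>t m. t \<in> {0..T} \<Longrightarrow> kap m ^ 4 * (w t m)^2 \<le> M m"
  shows "kap m ^ 4 * (Yp u0 w t m)^2 \<le> 2 * (kap m ^ 4 * (u0 m)^2) + 8 * M m"
proof -
  let ?z = "w t m - mu m * conv (mu m) (\<lambda>s. w s m) t" and ?e = "exp (- (mu m) * t)"
  have z: "kap m ^ 4 * ?z^2 \<le> 4 * M m"
    by (rule z_bound[OF gb_meas[OF w] _ mu_pos]) (use t M in auto)
  have "?e \<le> 1" using t mu_pos[of m] by (auto intro: mult_nonneg_nonneg)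
  then have "\<bar>?e * u0 m\<bar> \<le> \<bar>u0 m\<bar>" by (simp add: abs_mult mult_left_le_one_le)
  then have e: "(?e * u0 m)^2 \<le> (u0 m)^2" by (simp add: abs_le_square_iff)
  have "(Yp u0 w t m)^2 \<le> 2 * (?e * u0 m)^2 + 2 * ?z^2"
    unfolding Yp_def using sum_squares_bound[of "?e * u0 m" ?z] by (simp add: power2_sum)
  also have "\<dots> \<le> 2 * (u0 m)^2 + 2 * ?z^2" using e by simp
  finally have "kap m ^ 4 * (Yp u0 w t m)^2 \<le> kap m ^ 4 * (2 * (u0 m)^2 + 2 * ?z^2)" by (intro mult_left_mono) auto
  also have "\<dots> \<le> 2 * (kap m ^ 4 * (u0 m)^2) + 8 * M m" using z by (simp add: distrib_left)
  finally show ?thesis .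
qed

lemma Yp_pm: assumes J: "initial J" and w: "pm J N w" shows "pm J N (\<lambda>\<omega>. Yp u0 (w \<omega>))"
proof -
  have "(\<lambda>p. indicator J (fst p) * Yp u0 (w (snd p)) (fst p) m) \<in> borel_measurable (borel \<Otimes>\<^sub>M N)" for m
  proof -
    have [measurable]: "J \<in> sets borel" using J by (simp add: initial_def)
    have [measurable]: "(\<lambda>p. indicator J (fst p) * w (snd p) (fst p) m) \<in> borel_measurable (borel \<Otimes>\<^sub>M N)"
      using w by (simp add: pm_def)
    have [measurable]: "(\<lambda>p. indicator J (fst p) * conv (mu m) (\<lambda>s. w (snd p) s m) (fst p)) \<in> borel_measurable (borel \<Otimes>\<^sub>M N)"
      by (rule conv_pm[OF J]) measurable
    have "(\<lambda>p. indicator J (fst p) * (exp (- (mu m) * fst p) * u0 m) + (indicator J (fst p) * w (snd p) (fst p) m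
       - mu m * (indicator J (fst p) * conv (mu m) (\<lambda>s. w (snd p) s m) (fst p)))) \<in> borel_measurable (borel \<Otimes>\<^sub>M N)"
      by measurable
    also have "(\<lambda>p. indicator J (fst p) * (exp (- (mu m) * fst p) * u0 m) + (indicator J (fst p) * w (snd p) (fst p) m
       - mu m * (indicator J (fst p) * conv (mu m) (\<lambda>s. w (snd p) s m) (fst p))))
       = (\<lambda>p. indicator J (fst p) * Yp u0 (w (snd p)) (fst p) m)"
      by (rule ext) (simp add: Yp_def algebra_simps)
    finally show ?thesis .
  qed
  then show ?thesis by (simp add: pm_def)
qed

lemma gb_pm: "gb w \<Longrightarrow> pm {0..} (count_space (UNIV::unit set)) (\<lambda>_. w)"
  unfolding gb_def pm_def using measurable_compose[OF measurable_fst] by blast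

lemma Yp_Hs: assumes "gb w" "Hs u0" "0 \<le> t" shows "Hs (Yp u0 w t)"
proof -
  obtain M where M: "summable M" "\<And>s m. s \<in> {0..t} \<Longrightarrow> kap m ^ 4 * (w s m)^2 \<le> M m"
    using assms(1) unfolding gb_def by meson
  show ?thesis unfolding Hs_def
  proof (rule summable_comparison_test_ev)
    show "summable (\<lambda>m. 2 * (kap m ^ 4 * (u0 m)^2) + 8 * M m)"
      using assms(2) M(1) unfolding Hs_def by (intro summable_add summable_mult)
    show "\<forall>\<^sub>F m in sequentially. norm (kap m ^ 4 * (Yp u0 w t m)^2) \<le> 2 * (kap m ^ 4 * (u0 m)^2) + 8 * M m"
      using Yp_bound[OF assms(1) _ M(2), of t] assms(3) by (intro always_eventually allI) auto
  qed
qed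

lemma Yp_adm: assumes "gb w" "Hs u0" shows "adm {0..} (Yp u0 w)"
  by (rule pm_admI[OF Yp_pm[OF initial_Ici gb_pm[OF assms(1)]] initial_Ici]) (use Yp_Hs[OF assms] in auto)

lemma Yp_ncont: assumes "gp w" "Hs u0" shows "ncont {0..T} (Yp u0 w)"
proof -
  obtain M where M: "summable M" "\<And>s m. s \<in> {0..T} \<Longrightarrow> kap m ^ 4 * (w s m)^2 \<le> M m"
    using assms(1) unfolding gp_def by meson
  show ?thesis
  proof (rule ncont_M[of _ _ "\<lambda>m. 2 * (kap m ^ 4 * (u0 m)^2) + 8 * M m"])
    fix m
    have wc: "continuous_on {0..T} (\<lambda>s. w s m)" using assms(1) by (auto simp: gp_def intro: continuous_on_subset)
    have "continuous_on {0..T} (conv (mu m) (\<lambda>s. w s m))"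
      by (rule conv_cont[OF ton_meas_cont[OF wc] mode_abs_le[OF M(2)]]) (use nu in auto)
    then show "continuous_on {0..T} (\<lambda>t. Yp u0 w t m)" unfolding Yp_def by (intro continuous_intros wc)
  next
    show "kap m ^ 4 * (Yp u0 w t m)^2 \<le> 2 * (kap m ^ 4 * (u0 m)^2) + 8 * M m" if "t \<in> {0..T}" for t m
      by (rule Yp_bound[OF gp_gb[OF assms(1)] that M(2)])
    show "summable (\<lambda>m. 2 * (kap m ^ 4 * (u0 m)^2) + 8 * M m)"
      using assms(2) M(1) unfolding Hs_def by (intro summable_add summable_mult)
  qed
qed

lemma Yp_diff:
  assumes w: "gb w" "gb w'" and t: "t \<in> {0..T}" and e: "summable e" "\<And>t m. t \<in> {0..T} \<Longrightarrow> kap m ^ 4 * (w t m - w' t m)^2 \<le> e m"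
  shows "Hs (\<lambda>m. Yp u0 w t m - Yp u0 w' t m)" "nrmd (Yp u0 w t) (Yp u0 w' t) \<le> 2 * sqrt (suminf e)"
proof -
  have e0: "0 \<le> e m" for m using e(2)[OF t, of m] by (auto intro: order_trans[rotated])
  have mode: "kap m ^ 4 * (Yp u0 w t m - Yp u0 w' t m)^2 \<le> 4 * e m" for m
  proof -
    obtain M M' where M: "\<And>s m. s \<in> {0..t} \<Longrightarrow> kap m ^ 4 * (w s m)^2 \<le> M m" "\<And>s m. s \<in> {0..t} \<Longrightarrow> kap m ^ 4 * (w' s m)^2 \<le> M' m"
      using w unfolding gb_def by meson
    have "conv (mu m) (\<lambda>s. w s m) t - conv (mu m) (\<lambda>s. w' s m) t = conv (mu m) (\<lambda>s. w s m - w' s m) t"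
      by (rule conv_diff[OF gb_meas[OF w(1)] mode_abs_le[OF M(1)] gb_meas[OF w(2)] mode_abs_le[OF M(2)]]) (use nu in auto)
    then have eq: "Yp u0 w t m - Yp u0 w' t m = (w t m - w' t m) - mu m * conv (mu m) (\<lambda>s. w s m - w' s m) t"
      by (simp add: Yp_def algebra_simps)
    show ?thesis unfolding eq
      by (rule z_bound[where w="\<lambda>s. w s m - w' s m", OF borel_measurable_diff[OF gb_meas[OF w(1)] gb_meas[OF w(2)]] _ mu_pos]) (use t e(2) in auto)
  qed
  have "(\<Sum>m<n. kap m ^ 4 * (Yp u0 w t m - Yp u0 w' t m)^2) \<le> (2 * sqrt (suminf e))^2" for n
  proof -
    have "(\<Sum>m<n. kap m ^ 4 * (Yp u0 w t m - Yp u0 w' t m)^2) \<le> (\<Sum>m<n. 4 * e m)" by (intro sum_mono mode)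
    also have "\<dots> \<le> 4 * suminf e" unfolding sum_distrib_left[symmetric] by (intro mult_left_mono sum_le_suminf e(1)) (use e0 in auto)
    finally show ?thesis using suminf_nonneg[OF e(1) e0] by (simp add: power_mult_distrib)
  qed
  from nrm_leI[OF this] show "Hs (\<lambda>m. Yp u0 w t m - Yp u0 w' t m)" "nrmd (Yp u0 w t) (Yp u0 w' t) \<le> 2 * sqrt (suminf e)"
    using suminf_nonneg[OF e(1) e0] by auto
qed

text \<open>In each mode uniform continuity makes the grid error vanish, and \<open>4 * M m\<close>
  dominates it; Tannery's theorem sums over the modes. The premise on \<open>L\<close> says that the
  path is not frozen for good before \<open>T\<close>.\<close>

lemma stp_approx:
  assumes w: "gp w" and T: "0 \<le> T"
  obtains a where "a \<longlonglongrightarrow> 0" "\<And>n L t. \<lbrakk>0 < n; real n * T \<le> real L; t \<in> {0..T}\<rbrakk> \<Longrightarrow>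
     Hs (\<lambda>m. Yp u0 w t m - Yp u0 (stp n L w) t m) \<and> nrmd (Yp u0 w t) (Yp u0 (stp n L w) t) \<le> a n"
proof -
  obtain M where M: "summable M" "\<And>s m. s \<in> {0..T} \<Longrightarrow> kap m ^ 4 * (w s m)^2 \<le> M m"
    using w unfolding gp_def by meson
  define q where "q n t = real (nat \<lfloor>real n * t\<rfloor>) / real n" for n t
  have q: "q n t \<in> {0..T}" "\<bar>t - q n t\<bar> \<le> 1 / real n" if "0 < n" "t \<in> {0..T}" for n t
  proof -
    have r: "real (nat \<lfloor>real n * t\<rfloor>) \<le> real n * t" "real n * t < real (nat \<lfloor>real n * t\<rfloor>) + 1"
      using that by (simp_all add: of_nat_nat)
    have "q n t \<le> t" using r(1) that by (simp add: q_def divide_le_eq mult.commute)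
    then show "q n t \<in> {0..T}" using that by (auto simp: q_def)
    have "t \<le> q n t + 1 / real n"
    proof -
      have "t = real n * t / real n" using that by simp
      also have "\<dots> \<le> (real (nat \<lfloor>real n * t\<rfloor>) + 1) / real n" using r(2) by (intro divide_right_mono) auto
      finally show ?thesis by (simp add: q_def add_divide_distrib)
    qed
    then show "\<bar>t - q n t\<bar> \<le> 1 / real n" using \<open>q n t \<le> t\<close> by simp
  qed
  \<comment> \<open>Indexed by \<open>Suc n\<close> to exclude the degenerate grid
    \<open>n = 0\<close>; the definition of \<open>a\<close> undoes the shift.\<close>
  define e where "e m n = (SUP t\<in>{0..T}. kap m ^ 4 * (w t m - w (q (Suc n) t) m)^2)" for m n
  have ub: "kap m ^ 4 * (w t m - w (q (Suc n) t) m)^2 \<le> 4 * M m" if "t \<in> {0..T}" for t n m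
  proof -
    have "(w t m - w (q (Suc n) t) m)^2 \<le> 2 * (w t m)^2 + 2 * (w (q (Suc n) t) m)^2"
      using sum_squares_bound[of "w t m" "- w (q (Suc n) t) m"] by (simp add: power2_diff)
    then have "kap m ^ 4 * (w t m - w (q (Suc n) t) m)^2 \<le> kap m ^ 4 * (2 * (w t m)^2 + 2 * (w (q (Suc n) t) m)^2)" by (intro mult_left_mono) auto
    then show ?thesis using M(2)[OF that, of m] M(2)[OF q(1)[of "Suc n", OF _ that], of m] by (simp add: algebra_simps)
  qed
  have bdd: "bdd_above ((\<lambda>t. kap m ^ 4 * (w t m - w (q (Suc n) t) m)^2) ` {0..T})" for m n
    by (intro bdd_aboveI2[of _ _ "4 * M m"] ub)
  have le: "kap m ^ 4 * (w t m - w (q (Suc n) t) m)^2 \<le> e m n" if "t \<in> {0..T}" for t m n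
    unfolding e_def by (rule cSUP_upper[OF that bdd])
  have ne: "{0..T} \<noteq> {}" using T by simp
  have e_le: "e m n \<le> 4 * M m" for m n unfolding e_def by (rule cSUP_least[OF ne ub])
  have e0: "0 \<le> e m n" for m n using le[of 0 m n] T by (auto intro: order_trans[rotated])
  have esum: "summable (\<lambda>m. e m n)" for n
    by (rule summable_comparison_test_ev[OF _ summable_mult[OF M(1), of 4]]) (use e_le e0 in auto)
  have elim0: "(\<lambda>n. e m n) \<longlonglongrightarrow> 0" for m
  proof (rule LIMSEQ_I)
    fix r :: real assume r: "0 < r"
    define \<epsilon> where "\<epsilon> = sqrt (r / 2 / kap m ^ 4)"
    have eps: "0 < \<epsilon>" using r by (simp add: \<epsilon>_def)
    have "uniformly_continuous_on {0..T} (\<lambda>t. w t m)"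
      by (rule compact_uniformly_continuous) (use w in \<open>auto simp: gp_def intro: continuous_on_subset\<close>)
    then obtain d where d: "d > 0" "\<And>s t. s \<in> {0..T} \<Longrightarrow> t \<in> {0..T} \<Longrightarrow> \<bar>t - s\<bar> < d \<Longrightarrow> \<bar>w t m - w s m\<bar> < \<epsilon>"
      using eps unfolding uniformly_continuous_on_def dist_real_def by metis
    obtain N where N: "1 / real (Suc N) < d" using d(1) nat_approx_posE by metis
    show "\<exists>N. \<forall>n\<ge>N. norm (e m n - 0) < r"
    proof (intro exI[of _ N] allI impI)
      fix n assume n: "N \<le> n"
      have "e m n \<le> r / 2" unfolding e_def
      proof (rule cSUP_least[OF ne])
        fix t assume t: "t \<in> {0..T}"
        have "1 / real (Suc n) \<le> 1 / real (Suc N)" using n by (intro divide_left_mono) auto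
        then have "\<bar>w t m - w (q (Suc n) t) m\<bar> < \<epsilon>" using q[of "Suc n" t] t N by (intro d(2)) auto
        then have "\<bar>w t m - w (q (Suc n) t) m\<bar>\<^sup>2 \<le> \<epsilon>\<^sup>2" by (intro power_mono) auto
        then have "(w t m - w (q (Suc n) t) m)^2 \<le> r / 2 / kap m ^ 4" using r by (simp add: \<epsilon>_def)
        then show "kap m ^ 4 * (w t m - w (q (Suc n) t) m)^2 \<le> r / 2" by (simp add: le_divide_eq mult.commute)
      qed
      then show "norm (e m n - 0) < r" using r e0[of m n] by simp
    qed
  qed
  have lim: "(\<lambda>n. \<Sum>m. e m n) \<longlonglongrightarrow> (\<Sum>m::nat. 0)"
  proof (rule tannerys_theorem[THEN conjunct2, THEN conjunct2])
    show "(\<lambda>n. e k n) \<longlonglongrightarrow> 0" for k by (rule elim0)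
    show "\<forall>\<^sub>F (k, n) in at_top \<times>\<^sub>F sequentially. norm (e k n) \<le> 4 * M k"
      using e_le e0 by (intro always_eventually) auto
  qed (use summable_mult[OF M(1), of 4] in auto)
  define a where "a n = 2 * sqrt (\<Sum>m. e m (n - 1))" for n
  have "(\<lambda>n. a (Suc n)) \<longlonglongrightarrow> 2 * sqrt 0"
    unfolding a_def using lim by (intro tendsto_intros) simp
  then have alim: "a \<longlonglongrightarrow> 0" by (simp add: LIMSEQ_imp_Suc)
  show ?thesis
  proof (rule that[OF alim])
    fix n L :: nat and t assume n: "0 < n" and L: "real n * T \<le> real L" and t: "t \<in> {0..T}"
    have st: "stp n L w s m = w (q n s) m" if "s \<in> {0..T}" for s m
    proof -
      have "real n * s \<le> real L" using L that n by (meson atLeastAtMost_iff mult_left_mono of_nat_0_le_iff order_trans)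
      then have "nat \<lfloor>real n * s\<rfloor> \<le> L" by (simp add: floor_le_iff nat_le_iff)
      then show ?thesis by (simp add: stp_def q_def min_def)
    qed
    have "kap m ^ 4 * (w s m - stp n L w s m)^2 \<le> e m (n - 1)" if "s \<in> {0..T}" for s m
      unfolding st[OF that] using le[OF that, of m "n - 1"] n by simp
    from Yp_diff[OF gp_gb[OF w] gb_stp[OF gp_gb[OF w] n] t esum this]
    show "Hs (\<lambda>m. Yp u0 w t m - Yp u0 (stp n L w) t m) \<and> nrmd (Yp u0 w t) (Yp u0 (stp n L w) t) \<le> a n"
      unfolding a_def by blast
  qed
qed

text \<open>Before \<open>t\<close> this is \<open>duhamel_stable\<close> with zero remainder. At
  \<open>t\<close> itself the Duhamel integral does not see a single time, so a jump of the forcing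
  at \<open>t\<close> reappears unchanged in the solution.\<close>

lemma sol_causal:
  assumes R: "0 \<le> R" and y: "adm J y" "adm J y'" and t: "t \<in> J" and eq: "\<And>s. 0 \<le> s \<Longrightarrow> s < t \<Longrightarrow> y s = y' s"
  shows "\<And>s. 0 \<le> s \<Longrightarrow> s < t \<Longrightarrow> sol R y s = sol R y' s" "sol R y t m - sol R y' t m = y t m - y' t m"
proof -
  have J: "0 \<le> t" "{0..t} \<subseteq> J" using y t by (auto simp: adm_def initial_def)
  note ad = sol_adm[OF y(1) R] sol_adm[OF y(2) R]
  show same: "sol R y s = sol R y' s" if s: "0 \<le> s" "s < t" for s
  proof
    fix m
    have sJ: "s \<in> J" using s J by auto
    have H: "Hs (\<lambda>m. sol R y s m - sol R y' s m)" by (intro Hs_diff sol_Hs[OF y(1) R sJ] sol_Hs[OF y(2) R sJ])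
    have "nrmd (sol R y s) (sol R y' s) \<le> 2 * 0 * exp (kt R * s)"
    proof (rule duhamel_stable[OF R ad sJ, where r="\<lambda>_ _. 0"])
      fix r m assume r: "r \<in> {0..s}"
      then have "r \<in> J" using s J by auto
      then show "sol R y r m - sol R y' r m = 0 + (duh R (sol R y) r m - duh R (sol R y') r m)"
        using sol_eq[OF y(1) R, of r m] sol_eq[OF y(2) R, of r m] eq[of r] r s by simp
    qed auto
    then show "sol R y s m = sol R y' s m" using nrm_eq_0[OF H, of m] nrm_nonneg[OF H] by simp
  qed
  have "duh R (sol R y) t m = duh R (sol R y') t m"
    by (rule conv_cong_ae) (use same adm_FR_meas[OF ad(1) t] adm_FR_meas[OF ad(2) t] in auto)
  then show "sol R y t m - sol R y' t m = y t m - y' t m"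
    using sol_eq[OF y(1) R t, of m] sol_eq[OF y(2) R t, of m] by simp
qed

definition vst :: "real \<Rightarrow> seq \<Rightarrow> nat \<Rightarrow> nat \<Rightarrow> (real \<Rightarrow> seq) \<Rightarrow> real \<Rightarrow> seq" where
  "vst R u0 n i w = sol R (Yp u0 (stp n i w))"

lemma stp_agree:
  assumes "0 < n" "i \<le> L" "0 \<le> s" "s < real (Suc i) / real n"
  shows "stp n L w s = stp n i w s"
proof -
  have "real n * s < real (Suc i)" using assms by (simp add: less_divide_eq mult.commute)
  then have "nat \<lfloor>real n * s\<rfloor> < Suc i" by (simp add: less_Suc_eq_le nat_le_iff floor_le_iff)
  then show ?thesis using assms(2) by (simp add: stp_def min_def)
qed

lemma stp_late: "0 < n \<Longrightarrow> 0 \<le> \<sigma> \<Longrightarrow> stp n i w (real i / real n + \<sigma>) = w (real i / real n)"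
proof -
  assume n: "0 < n" "0 \<le> \<sigma>"
  have "real i \<le> real n * (real i / real n + \<sigma>)" using n by (simp add: distrib_left)
  then have "i \<le> nat \<lfloor>real n * (real i / real n + \<sigma>)\<rfloor>" by (simp add: le_nat_floor)
  then show ?thesis by (simp add: stp_def min_def)
qed

lemma Yp_cong:
  assumes "\<And>s. 0 \<le> s \<Longrightarrow> s < t \<Longrightarrow> w s = w' s" "gb w" "gb w'" "0 \<le> t"
  shows "Yp u0 w t m - Yp u0 w' t m = w t m - w' t m"
proof -
  have "conv (mu m) (\<lambda>s. w s m) t = conv (mu m) (\<lambda>s. w' s m) t"
    by (rule conv_cong_ae) (use assms gb_meas in auto)
  then show ?thesis by (simp add: Yp_def)
qed

lemma vst_agree:
  assumes "gb w" "Hs u0" "0 \<le> R" "0 < n" "i \<le> L" "0 \<le> s" "s < real (Suc i) / real n"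
  shows "vst R u0 n L w s = vst R u0 n i w s"
proof -
  note g = gb_stp[OF assms(1) assms(4)]
  show ?thesis unfolding vst_def
  proof (rule sol_causal(1)[OF assms(3) Yp_adm[OF g assms(2)] Yp_adm[OF g assms(2)], of "real (Suc i) / real n"])
    fix r assume r: "0 \<le> r" "r < real (Suc i) / real n"
    show "Yp u0 (stp n L w) r = Yp u0 (stp n i w) r"
    proof
      fix m
      have "Yp u0 (stp n L w) r m - Yp u0 (stp n i w) r m = stp n L w r m - stp n i w r m"
        by (rule Yp_cong[OF _ g g]) (use r stp_agree[OF assms(4,5)] in auto)
      then show "Yp u0 (stp n L w) r m = Yp u0 (stp n i w) r m" using stp_agree[OF assms(4,5) r] by simp
    qed
  qed (use assms in auto)
qed

text \<open>Advancing the freezing index alters the forcing for the first time at the grid point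
  \<open>Suc i / n\<close>, by the noise increment over the cell; \<open>sol_causal\<close> carries
  this jump over to the solution.\<close>

lemma vst_Suc:
  assumes "gb w" "Hs u0" "0 \<le> R" "0 < n"
  shows "vst R u0 n (Suc i) w (real (Suc i) / real n) m
     = vst R u0 n i w (real (Suc i) / real n) m + (w (real (Suc i) / real n) m - w (real i / real n) m)"
proof -
  note g = gb_stp[OF assms(1) assms(4)]
  let ?t = "real (Suc i) / real n"
  have st: "stp n (Suc i) w s = stp n i w s" if "0 \<le> s" "s < ?t" for s by (rule stp_agree[OF assms(4) _ that]) simp
  have "vst R u0 n (Suc i) w ?t m - vst R u0 n i w ?t m = Yp u0 (stp n (Suc i) w) ?t m - Yp u0 (stp n i w) ?t m"
    unfolding vst_def
  proof (rule sol_causal(2)[OF assms(3) Yp_adm[OF g assms(2)] Yp_adm[OF g assms(2)]])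
    fix r assume r: "0 \<le> r" "r < ?t"
    show "Yp u0 (stp n (Suc i) w) r = Yp u0 (stp n i w) r"
    proof
      fix m
      have "Yp u0 (stp n (Suc i) w) r m - Yp u0 (stp n i w) r m = stp n (Suc i) w r m - stp n i w r m"
        by (rule Yp_cong[OF _ g g]) (use r st in auto)
      then show "Yp u0 (stp n (Suc i) w) r m = Yp u0 (stp n i w) r m" using st[OF r] by simp
    qed
  qed auto
  also have "\<dots> = stp n (Suc i) w ?t m - stp n i w ?t m"
    by (rule Yp_cong[OF _ g g]) (use st in auto)
  also have "stp n (Suc i) w ?t = w ?t" using stp_late[OF assms(4), of 0 "Suc i"] by simp
  also have "stp n i w ?t = w (real i / real n)"
    using stp_late[OF assms(4), of "1 / real n" i] by (simp add: add_divide_distrib add.commute)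
  finally show ?thesis by simp
qed

lemma vst_flow:
  assumes w: "gb w" and u0: "Hs u0" and R: "0 \<le> R" and n: "0 < n" and tau: "0 \<le> \<tau>"
  shows "vst R u0 n i w (real i / real n + \<tau>) m = exp (- (mu m) * \<tau>) * vst R u0 n i w (real i / real n) m
     + conv (mu m) (\<lambda>s. FR R (vst R u0 n i w (real i / real n + s)) m) \<tau>"
proof -
  note g = gb_stp[OF w n]
  let ?a = "real i / real n" and ?\<mu> = "mu m" and ?v = "vst R u0 n i w" and ?w = "stp n i w"
  have a: "0 \<le> ?a" by simp
  have ad: "adm {0..} (Yp u0 ?w)" by (rule Yp_adm[OF g u0])
  have adv: "adm {0..} ?v" unfolding vst_def by (rule sol_adm[OF ad R])
  have Hv: "Hs (?v s)" if "0 \<le> s" for s using adv that by (simp add: adm_def)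
  have eq: "?v s m = Yp u0 ?w s m + conv ?\<mu> (\<lambda>s. FR R (?v s) m) s" if "0 \<le> s" for s
    using sol_eq[OF ad R] that by (simp add: vst_def)
  obtain M where M: "\<And>s m. s \<in> {0..?a + \<tau>} \<Longrightarrow> kap m ^ 4 * (?w s m)^2 \<le> M m"
    using g unfolding gb_def by meson
  have s1: "conv ?\<mu> (\<lambda>s. FR R (?v s) m) (?a + \<tau>) = exp (- ?\<mu> * \<tau>) * conv ?\<mu> (\<lambda>s. FR R (?v s) m) ?a + conv ?\<mu> (\<lambda>s. FR R (?v (?a + s)) m) \<tau>"
    by (rule conv_split[OF adm_FR_meas[OF adv] FR_abs_le[OF R Hv]]) (use a tau nu in auto)
  have s2: "conv ?\<mu> (\<lambda>s. ?w s m) (?a + \<tau>) = exp (- ?\<mu> * \<tau>) * conv ?\<mu> (\<lambda>s. ?w s m) ?a + conv ?\<mu> (\<lambda>s. ?w (?a + s) m) \<tau>"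
    by (rule conv_split[OF gb_meas[OF g] mode_abs_le[OF M]]) (use a tau nu in auto)
  have "conv ?\<mu> (\<lambda>s. ?w (?a + s) m) \<tau> = conv ?\<mu> (\<lambda>_. w ?a m) \<tau>"
    by (rule conv_cong) (use stp_late[OF n, of _ i w] in auto)
  then have s3: "?\<mu> * conv ?\<mu> (\<lambda>s. ?w (?a + s) m) \<tau> = w ?a m * (1 - exp (- ?\<mu> * \<tau>))"
    using conv_const[OF mu_pos tau] by simp
  have wa: "?w (?a + \<tau>) m = w ?a m" "?w ?a m = w ?a m" using stp_late[OF n tau, of i w] stp_late[OF n, of 0 i w] by auto
  have e: "exp (- ?\<mu> * (?a + \<tau>)) = exp (- ?\<mu> * \<tau>) * exp (- ?\<mu> * ?a)"
    unfolding exp_add[symmetric] by (rule arg_cong[of _ _ exp]) (simp add: algebra_simps)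
  define E C D X where "E = exp (- ?\<mu> * \<tau>)" and "C = conv ?\<mu> (\<lambda>s. ?w s m) ?a" and "D = conv ?\<mu> (\<lambda>s. ?w (?a + s) m) \<tau>" and "X = exp (- ?\<mu> * ?a)"
  have "Yp u0 ?w (?a + \<tau>) m = E * X * u0 m + (w ?a m - ?\<mu> * (E * C + D))"
    unfolding Yp_def s2 wa e E_def C_def D_def X_def ..
  also have "\<dots> = E * X * u0 m + (w ?a m - E * (?\<mu> * C) - ?\<mu> * D)" by (simp add: algebra_simps)
  also have "?\<mu> * D = w ?a m * (1 - E)" unfolding D_def E_def by (rule s3)
  also have "E * X * u0 m + (w ?a m - E * (?\<mu> * C) - w ?a m * (1 - E)) = E * (X * u0 m + (w ?a m - ?\<mu> * C))" by (simp add: algebra_simps)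
  also have "X * u0 m + (w ?a m - ?\<mu> * C) = Yp u0 ?w ?a m" unfolding Yp_def wa X_def C_def ..
  finally have Y: "Yp u0 ?w (?a + \<tau>) m = E * Yp u0 ?w ?a m" .
  have "?v (?a + \<tau>) m = E * Yp u0 ?w ?a m + (E * conv ?\<mu> (\<lambda>s. FR R (?v s) m) ?a + conv ?\<mu> (\<lambda>s. FR R (?v (?a + s)) m) \<tau>)"
    using eq[of "?a + \<tau>"] tau a unfolding Y s1 E_def by simp
  also have "\<dots> = E * (Yp u0 ?w ?a m + conv ?\<mu> (\<lambda>s. FR R (?v s) m) ?a) + conv ?\<mu> (\<lambda>s. FR R (?v (?a + s)) m) \<tau>" by (simp add: algebra_simps)
  finally show ?thesis using eq[OF a] by (simp add: E_def)
qed

text \<open>Excess of the norm over \<open>R\<close>, integrated in time. Its vanishing says that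
  the path was in the ball at almost every time up to \<open>t\<close>. As a time integral it is
  measurable in the sample point, and it takes the role of a stopping time.\<close>

definition Dex :: "real \<Rightarrow> (real \<Rightarrow> seq) \<Rightarrow> real \<Rightarrow> real" where
  "Dex R v t = conv 0 (\<lambda>s. max 0 (nrm (v s) - R)) t"

lemma vst_shift_adm:
  assumes w: "gb w" and u0: "Hs u0" and R: "0 \<le> R" and n: "0 < n"
  shows "adm {0..} (\<lambda>s. vst R u0 n i w (real i / real n + s))"
proof -
  have adv: "adm {0..} (vst R u0 n i w)" unfolding vst_def by (rule sol_adm[OF Yp_adm[OF gb_stp[OF w n] u0] R])
  have "(\<lambda>s. indicator {0..} s * vst R u0 n i w (real i / real n + s) m) \<in> borel_measurable borel" for m
  proof -
    have [measurable]: "(\<lambda>s. indicator {0..} s * vst R u0 n i w s m) \<in> borel_measurable borel" using adv by (simp add: adm_def)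
    have "(\<lambda>s. indicator {0..} s * (indicator {0..} (real i / real n + s) * vst R u0 n i w (real i / real n + s) m)) \<in> borel_measurable borel"
    proof (rule borel_measurable_times)
      have "(\<lambda>s. real i / real n + s) \<in> measurable borel borel" by simp
      from measurable_compose[OF this \<open>(\<lambda>s. indicator {0..} s * vst R u0 n i w s m) \<in> borel_measurable borel\<close>]
      show "(\<lambda>s. indicator {0..} (real i / real n + s) * vst R u0 n i w (real i / real n + s) m) \<in> borel_measurable borel" .
    qed simp
    also have "(\<lambda>s. indicator {0..} s * (indicator {0..} (real i / real n + s) * vst R u0 n i w (real i / real n + s) m))
      = (\<lambda>s. indicator {0..} s * vst R u0 n i w (real i / real n + s) m)"
      by (rule ext) (auto simp: indicator_def)
    finally show ?thesis .
  qed
  then show ?thesis using adv unfolding adm_def by (simp add: initial_Ici)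
qed

lemma Dex_integrand: assumes "adm {0..} v" shows "(\<lambda>s. max 0 (nrm (v s) - R)) \<in> borel_measurable (ton t)"
proof -
  have [measurable]: "(\<lambda>s. v s m) \<in> borel_measurable (ton t)" for m
    by (rule ton_meas_ind[of "{0..}"]) (use assms in \<open>auto simp: adm_def\<close>)
  have [measurable]: "(\<lambda>s. nrm (v s)) \<in> borel_measurable (ton t)" by (rule nrm_meas) measurable
  show ?thesis by measurable
qed

text \<open>The parts of \<open>Dex\<close> before and after \<open>i / n\<close> are nonnegative,
  so both vanish. After \<open>i / n\<close> the path is continuous, so almost every time becomes
  every time there; the retraction is then inactive and \<open>Lp_contraction\<close>
  applies.\<close>

lemma vst_step:
  assumes w: "gb w" and u0: "Hs u0" and R: "0 \<le> R" and n: "0 < n" and tau: "0 < \<tau>" and j: "even j"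
    and D: "Dex R (vst R u0 n i w) (real i / real n + \<tau>) = 0"
  shows "nrm (vst R u0 n i w (real i / real n + \<tau>)) \<le> R" and "Dex R (vst R u0 n i w) (real i / real n) = 0"
    and "tint (\<lambda>x. ser (vst R u0 n i w (real i / real n + \<tau>)) x ^ Suc (Suc j))
      \<le> tint (\<lambda>x. ser (vst R u0 n i w (real i / real n)) x ^ Suc (Suc j))"
proof -
  let ?a = "real i / real n" and ?v = "vst R u0 n i w"
  have a: "0 \<le> ?a" by simp
  have adv: "adm {0..} ?v" unfolding vst_def by (rule sol_adm[OF Yp_adm[OF gb_stp[OF w n] u0] R])
  have Hv: "Hs (?v s)" if "0 \<le> s" for s using adv that by (simp add: adm_def)
  have ads: "adm {0..} (\<lambda>s. ?v (?a + s))" by (rule vst_shift_adm[OF w u0 R n])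
  let ?c = "\<lambda>\<sigma> m. exp (- (mu m) * \<sigma>) * ?v ?a m + conv (mu m) (\<lambda>s. FR R (?v (?a + s)) m) \<sigma>"
  have flow: "?v (?a + \<sigma>) = ?c \<sigma>" if "0 \<le> \<sigma>" for \<sigma>
    using vst_flow[OF w u0 R n that, of i] by (intro ext)
  have nc1: "ncont {0..\<tau>} (\<lambda>\<sigma> m. exp (- (mu m) * \<sigma>) * ?v ?a m)"
  proof (rule ncont_M[of _ _ "\<lambda>m. kap m ^ 4 * (?v ?a m)^2"])
    show "continuous_on {0..\<tau>} (\<lambda>t. exp (- (mu m) * t) * ?v ?a m)" for m by (intro continuous_intros)
    show "summable (\<lambda>m. kap m ^ 4 * (?v ?a m)^2)" using Hv[OF a] by (simp add: Hs_def)
    fix t m assume "t \<in> {0..\<tau>}"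
    then have "exp (- (mu m) * t) \<le> 1" using mu_pos[of m] by (auto intro: mult_nonneg_nonneg)
    then have "\<bar>exp (- (mu m) * t) * ?v ?a m\<bar> \<le> \<bar>?v ?a m\<bar>" by (simp add: abs_mult mult_left_le_one_le)
    then show "kap m ^ 4 * (exp (- (mu m) * t) * ?v ?a m)^2 \<le> kap m ^ 4 * (?v ?a m)^2"
      by (intro mult_left_mono) (auto simp: abs_le_square_iff)
  qed
  have nc: "ncont {0..\<tau>} (\<lambda>\<sigma>. ?v (?a + \<sigma>))"
    by (rule ncont_cong[OF ncont_add[OF nc1 conv_FR_ncont[OF R ads]]]) (use tau flow in auto)
  let ?\<phi> = "\<lambda>s. max 0 (nrm (?v s) - R)"
  have nb: "\<bar>?\<phi> s\<bar> \<le> B" if "s \<in> {0..?a + \<tau>}" "\<And>s. s \<in> {0..?a + \<tau>} \<Longrightarrow> nrm (?v s) \<le> B" "0 \<le> B" for s B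
    using that(2)[OF that(1)] that(3) R by auto
  obtain M where M: "summable M" "\<And>s m. s \<in> {0..?a + \<tau>} \<Longrightarrow> kap m ^ 4 * (stp n i w s m)^2 \<le> M m"
    using gb_stp[OF w n] unfolding gb_def by meson
  \<comment> \<open>A crude bound on the path, which supplies the boundedness required for splitting
    \<open>Dex\<close> at \<open>i / n\<close>.\<close>
  define BY where "BY = sqrt (\<Sum>m. 2 * (kap m ^ 4 * (u0 m)^2) + 8 * M m) + exp (kt R * (?a + \<tau>)) / 2"
  have sumY: "summable (\<lambda>m. 2 * (kap m ^ 4 * (u0 m)^2) + 8 * M m)"
    using u0 M(1) unfolding Hs_def by (intro summable_add summable_mult)
  have vb: "nrm (?v s) \<le> BY" if s: "s \<in> {0..?a + \<tau>}" for s
  proof -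
    have HY: "Hs (Yp u0 (stp n i w) s)" by (rule Yp_Hs[OF gb_stp[OF w n] u0]) (use s in auto)
    have nY: "nrm (Yp u0 (stp n i w) s) \<le> sqrt (\<Sum>m. 2 * (kap m ^ 4 * (u0 m)^2) + 8 * M m)"
      unfolding nrm_def
      by (intro real_sqrt_le_mono suminf_le sumY HY[unfolded Hs_def] allI Yp_bound[OF gb_stp[OF w n] s M(2)])
    have s0: "s \<in> {0..}" using s by simp
    have "?v s = (\<lambda>m. Yp u0 (stp n i w) s m + duh R ?v s m)"
      using sol_eq[OF Yp_adm[OF gb_stp[OF w n] u0] R s0] by (auto simp: vst_def)
    then have "nrm (?v s) \<le> nrm (Yp u0 (stp n i w) s) + nrm (\<lambda>m. duh R ?v s m)"
      using Hs_add(2)[OF HY duhamel_bound(1)[OF R adv s0]] by simp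
    also have "nrm (\<lambda>m. duh R ?v s m) \<le> exp (kt R * s) / 2" by (rule duhamel_bound(2)[OF R adv s0])
    also have "\<dots> \<le> exp (kt R * (?a + \<tau>)) / 2" using s kt_pos[OF R] by simp
    finally show ?thesis using nY by (simp add: BY_def)
  qed
  have BY0: "0 \<le> BY" using vb[of ?a] nrm_nonneg[OF Hv[OF a]] tau by force
  note \<phi>m = Dex_integrand[OF adv, of R "?a + \<tau>"]
  have split: "Dex R ?v (?a + \<tau>) = Dex R ?v ?a + conv 0 (\<lambda>s. ?\<phi> (?a + s)) \<tau>"
    unfolding Dex_def using conv_split[OF \<phi>m nb[OF _ vb BY0] a, of 0] tau by simp
  have cz: "conv 0 f t = sint t f" for f t by (simp add: conv_def)
  have "0 \<le> Dex R ?v ?a" unfolding Dex_def cz by (intro integral_nonneg_AE AE_I2) auto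
  moreover have "0 \<le> conv 0 (\<lambda>s. ?\<phi> (?a + s)) \<tau>" unfolding cz by (intro integral_nonneg_AE AE_I2) auto
  ultimately have z: "Dex R ?v ?a = 0" "conv 0 (\<lambda>s. ?\<phi> (?a + s)) \<tau> = 0" using split D by auto
  show "Dex R ?v ?a = 0" by (rule z(1))
  have le: "nrm (?v (?a + s)) \<le> R" if s: "s \<in> {0..\<tau>}" for s
  proof -
    have "?\<phi> (?a + s) = 0"
      by (rule nonneg_int_zero[where a=0 and b=\<tau> and \<phi>="\<lambda>s. ?\<phi> (?a + s)"])
         (use z(2) tau s in \<open>auto simp: cz intro!: continuous_intros ncont_nrm[OF nc]\<close>)
    then show ?thesis by simp
  qed
  show "nrm (?v (?a + \<tau>)) \<le> R" using le[of \<tau>] tau by simp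
  have "tint (\<lambda>x. ser (?v (?a + \<tau>)) x ^ Suc (Suc j)) \<le> tint (\<lambda>x. ser (?v (?a + 0)) x ^ Suc (Suc j))"
  proof (rule Lp_contraction[OF nc _ j, where a="?v ?a"])
    fix t m assume t: "t \<in> {0..\<tau>}"
    have "conv (mu m) (\<lambda>s. FR R (?v (?a + s)) m) t = conv (mu m) (\<lambda>s. Fm (?v (?a + s)) m) t"
      by (rule conv_cong) (use t le in \<open>auto simp: FR_Fm\<close>)
    then show "?v (?a + t) m = exp (- (mu m) * t) * ?v ?a m + conv (mu m) (\<lambda>s. Fm (?v (?a + s)) m) t"
      using flow[of t] t by simp
  qed (use tau in simp)
  then show "tint (\<lambda>x. ser (?v (?a + \<tau>)) x ^ Suc (Suc j)) \<le> tint (\<lambda>x. ser (?v ?a) x ^ Suc (Suc j))" by simp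
qed

end

subsection \<open>Brownian increments\<close>

primrec rmx :: "seq \<Rightarrow> seq" where
  "rmx x 0 = \<bar>x 0\<bar>"
| "rmx x (Suc i) = max (rmx x i) \<bar>x (Suc i)\<bar>"

lemma rmx_ge: "j \<le> i \<Longrightarrow> \<bar>x j\<bar> \<le> rmx x i"
  by (induction i) (auto simp: le_Suc_eq)

lemma rmx_nonneg: "0 \<le> rmx x i"
  using rmx_ge[of 0 i x] abs_ge_zero[of "x 0"] by linarith

lemma rmx_sq_le: "(rmx x i)^2 \<le> (\<Sum>j\<le>i. (x j)^2)"
proof (induction i)
  case (Suc i)
  have "(rmx x (Suc i))^2 \<le> (rmx x i)^2 + (x (Suc i))^2"
    by (auto simp: max_def)
  then show ?case using Suc by simp
qed simp

text \<open>A pathwise form of Doob's \<open>L\<^sup>2\<close> inequality: for a martingale the last sum has mean zero.\<close>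

lemma doob_pathwise:
  "(rmx x n)^2 \<le> 4 * (x n)^2 - 4 * (\<Sum>i<n. rmx x i * sgn (x i) * (x (Suc i) - x i))"
proof -
  \<comment> \<open>Discrete integration of the running maximum; at a step where the maximum rises
    from \<open>b\<close> to \<open>y\<close> the inequality has slack
    \<open>(y - b)^2 / 2\<close>.\<close>
  have inv: "(\<Sum>i<n. rmx x i * (\<bar>x (Suc i)\<bar> - \<bar>x i\<bar>)) \<le> rmx x n * \<bar>x n\<bar> - (rmx x n)\<^sup>2 / 2"
  proof (induction n)
    case 0 then show ?case by (simp add: power2_eq_square)
  next
    case (Suc n)
    define b y where "b = rmx x n" and "y = \<bar>x (Suc n)\<bar>"
    have "(\<Sum>i<Suc n. rmx x i * (\<bar>x (Suc i)\<bar> - \<bar>x i\<bar>)) \<le> b * y - b\<^sup>2 / 2"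
      using Suc by (simp add: b_def y_def algebra_simps)
    also have "\<dots> \<le> max b y * y - (max b y)\<^sup>2 / 2"
    proof (cases "y \<le> b")
      case False
      have "0 \<le> (y - b)^2" by simp
      then have "b * y - b\<^sup>2 / 2 \<le> y * y - y\<^sup>2 / 2" by (simp add: power2_eq_square algebra_simps)
      then show ?thesis using False by (simp add: max_def)
    qed (simp add: max_def)
    finally show ?case by (simp add: b_def y_def)
  qed
  have "(\<Sum>i<n. rmx x i * sgn (x i) * (x (Suc i) - x i)) \<le> (\<Sum>i<n. rmx x i * (\<bar>x (Suc i)\<bar> - \<bar>x i\<bar>))"
  proof (rule sum_mono)
    fix i
    have "sgn (x i) * (x (Suc i) - x i) \<le> \<bar>x (Suc i)\<bar> - \<bar>x i\<bar>"
      by (cases "x i" "0::real" rule: linorder_cases) auto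
    from mult_left_mono[OF this rmx_nonneg] show "rmx x i * sgn (x i) * (x (Suc i) - x i) \<le> rmx x i * (\<bar>x (Suc i)\<bar> - \<bar>x i\<bar>)"
      by (simp add: mult.assoc)
  qed
  also note inv
  finally have *: "(\<Sum>i<n. rmx x i * sgn (x i) * (x (Suc i) - x i)) \<le> rmx x n * \<bar>x n\<bar> - (rmx x n)\<^sup>2 / 2" .
  have "0 \<le> (rmx x n - 2 * \<bar>x n\<bar>)^2" by simp
  then have "4 * (rmx x n * \<bar>x n\<bar>) \<le> (rmx x n)^2 + 4 * (x n)^2" by (simp add: power2_diff)
  then show ?thesis using * by linarith
qed

text \<open>The even moment \<open>(2q - 1)!!\<close> of a standard normal variable.\<close>

definition gmom :: seq where "gmom q = fact (2 * q) / (2 ^ q * fact q)"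

lemma gmom_nonneg [simp]: "0 \<le> gmom q" and gmom_1 [simp]: "gmom 1 = 1" "gmom (Suc 0) = 1"
  by (simp_all add: gmom_def)

locale noise = prob_space M for M :: "'a measure" +
  fixes F :: "real \<Rightarrow> 'a set set" and W :: "nat \<Rightarrow> 'a \<Rightarrow> real \<Rightarrow> real"
  assumes filt: "normal_filtration M F"
    and bm: "\<And>k. F_brownian M F (W k)"
    and ind: "indep_vars (\<lambda>_. Pi\<^sub>M UNIV (\<lambda>_. borel)) W UNIV"
begin

abbreviation Fs :: "real \<Rightarrow> 'a measure" where "Fs t \<equiv> sigma (space M) (F t)"

lemmas filt_unfolded = filt[unfolded normal_filtration_def]

lemma F_alg: "0 \<le> t \<Longrightarrow> sigma_algebra (space M) (F t)" "0 \<le> t \<Longrightarrow> F t \<subseteq> sets M"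
  using conjunct1[OF filt_unfolded] by simp_all

lemma Fs_sets: "0 \<le> t \<Longrightarrow> sets (Fs t) = F t"
  using F_alg[of t] by (simp add: sigma_algebra.sets_measure_of_eq)

lemma Fs_space [simp]: "space (Fs t) = space M"
  by (simp add: space_measure_of_conv)

lemma Fs_mono: assumes "0 \<le> s" "s \<le> t" shows "sets (Fs s) \<subseteq> sets (Fs t)"
proof -
  have "F s \<subseteq> F t" using conjunct1[OF conjunct2[OF filt_unfolded]] assms by simp
  then show ?thesis using assms by (simp add: Fs_sets)
qed

lemma meas_up:
  assumes "f \<in> measurable (Fs s) N" "0 \<le> s" "s \<le> t" shows "f \<in> measurable (Fs t) N"
  using assms Fs_mono[OF assms(2,3)] by (auto simp: measurable_def)

lemma meas_M:
  assumes "f \<in> measurable (Fs s) N" "0 \<le> s" shows "f \<in> measurable M N"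
  using assms F_alg(2)[of s] Fs_sets[of s] by (auto simp: measurable_def)

lemma null_Fs: assumes "N \<in> null_sets M" "0 \<le> t" shows "N \<in> sets (Fs t)"
proof -
  have "N \<in> F 0" using conjunct2[OF conjunct2[OF conjunct2[OF filt_unfolded]]] assms(1) by blast
  then show ?thesis using Fs_mono[OF order_refl assms(2)] Fs_sets[OF order_refl] by blast
qed

lemma W_meas: "0 \<le> t \<Longrightarrow> (\<lambda>\<omega>. W k \<omega> t) \<in> borel_measurable (Fs t)"
  using bm[of k] by (simp add: F_brownian_def)

lemma W_meas_M: "0 \<le> t \<Longrightarrow> (\<lambda>\<omega>. W k \<omega> t) \<in> borel_measurable M"
  by (rule meas_M[OF W_meas])

lemma W_start: "AE \<omega> in M. W k \<omega> 0 = 0" and W_cont: "AE \<omega> in M. continuous_on {0..} (W k \<omega>)"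
  using bm[of k] by (auto simp: F_brownian_def elim: eventually_mono)

lemma W_normal: "0 \<le> s \<Longrightarrow> s < t \<Longrightarrow>
    distributed M lborel (\<lambda>\<omega>. W k \<omega> t - W k \<omega> s) (\<lambda>x. ennreal (normal_density 0 (sqrt (t - s)) x))"
  using bm[of k] by (simp add: F_brownian_def)

text \<open>\<open>F_brownian\<close> gives the product rule for events of \<open>F s\<close> and of
  the increment; since \<open>Z\<close> generates a sub-sigma-algebra of \<open>F s\<close>, this is
  independence of the two random variables.\<close>

lemma incr_indep:
  assumes st: "0 \<le> s" "s < t" and Z: "Z \<in> borel_measurable (Fs s)"
  shows "indep_var borel Z borel (\<lambda>\<omega>. W k \<omega> t - W k \<omega> s)"
proof -
  let ?S = "\<lambda>f. sigma_sets (space M) {f -` A \<inter> space M | A. A \<in> sets borel}"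
  let ?Y = "\<lambda>\<omega>. W k \<omega> t - W k \<omega> s"
  have Zm: "Z \<in> borel_measurable M" by (rule meas_M[OF Z st(1)])
  have Ym: "?Y \<in> borel_measurable M" using W_meas_M st by (intro borel_measurable_diff) auto
  have 1: "?S Z \<subseteq> F s"
  proof -
    interpret S: sigma_algebra "space M" "F s" by (rule F_alg(1)[OF st(1)])
    show ?thesis
    proof (rule S.sigma_sets_subset, safe)
      fix A :: "real set" assume "A \<in> sets borel"
      then show "Z -` A \<inter> space M \<in> F s" using measurable_sets[OF Z, of A] Fs_sets[OF st(1)] by simp
    qed
  qed
  have 2: "?S ?Y = {?Y -` A \<inter> space M | A. A \<in> sets borel}"
  proof -
    have "sets (vimage_algebra (space M) ?Y borel) = {?Y -` A \<inter> space M | A. A \<in> sets borel}"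
      by (rule sets_vimage_algebra2) auto
    then show ?thesis using sets.sigma_sets_eq[of "vimage_algebra (space M) ?Y borel"] by simp
  qed
  have "indep_set (?S Z) (?S ?Y)"
    unfolding 2
  proof (rule indep_setI)
    show "?S Z \<subseteq> events" using 1 F_alg(2)[OF st(1)] by auto
    show "{?Y -` A \<inter> space M | A. A \<in> sets borel} \<subseteq> events" using measurable_sets[OF Ym] by auto
    fix a b assume a: "a \<in> ?S Z" and b: "b \<in> {?Y -` A \<inter> space M | A. A \<in> sets borel}"
    obtain C where C: "C \<in> sets borel" "b = ?Y -` C \<inter> space M" using b by auto
    have "b = {\<omega> \<in> space M. W k \<omega> t - W k \<omega> s \<in> C}" using C(2) by auto
    moreover have "a \<in> F s" using a 1 by auto
    moreover have "\<forall>E\<in>F s. \<forall>C\<in>sets borel. measure M (E \<inter> {\<omega>\<in>space M. W k \<omega> t - W k \<omega> s \<in> C})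
           = measure M E * measure M {\<omega>\<in>space M. W k \<omega> t - W k \<omega> s \<in> C}"
      using bm[of k] st unfolding F_brownian_def by blast
    ultimately show "prob (a \<inter> b) = prob a * prob b" using C(1) by auto
  qed
  then show ?thesis using Zm Ym by (simp add: indep_var_eq)
qed

lemma incr_moments:
  assumes st: "0 \<le> s" "s < t"
  shows "integrable M (\<lambda>\<omega>. W k \<omega> t - W k \<omega> s)" "expectation (\<lambda>\<omega>. W k \<omega> t - W k \<omega> s) = 0"
proof -
  have sd: "0 < sqrt (t - s)" using st by simp
  show "expectation (\<lambda>\<omega>. W k \<omega> t - W k \<omega> s) = 0" by (rule normal_distributed_expectation[OF sd W_normal[OF st]])
  have "integrable lborel (\<lambda>x. normal_density 0 (sqrt (t - s)) x * x)"
    using integrable_normal_moment_nz_1[OF sd, of 0] by simp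
  then show "integrable M (\<lambda>\<omega>. W k \<omega> t - W k \<omega> s)"
    by (rule distributed_integrable_var[OF W_normal[OF st], rotated]) simp
qed

lemma mart_zero:
  assumes st: "0 \<le> s" "s < t" and Z: "Z \<in> borel_measurable (Fs s)" "integrable M Z"
  shows "integrable M (\<lambda>\<omega>. Z \<omega> * (W k \<omega> t - W k \<omega> s))" "expectation (\<lambda>\<omega>. Z \<omega> * (W k \<omega> t - W k \<omega> s)) = 0"
  using indep_var_integrable[OF incr_indep[OF st Z(1)] Z(2) incr_moments(1)[OF st]]
    indep_var_lebesgue_integral[OF incr_indep[OF st Z(1)] Z(2) incr_moments(1)[OF st]] incr_moments(2)[OF st]
  by auto

text \<open>Independence of the Brownian motions makes the sum centred normal with variance
  \<open>(t - s)\<close> times the sum of squares. Zero coefficients are removed first, because a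
  degenerate summand has no normal density.\<close>

lemma gauss_moment:
  assumes S: "finite S" and st: "0 \<le> s" "s < t" and q: "0 < q"
  shows "integrable M (\<lambda>\<omega>. (\<Sum>k\<in>S. a k * (W k \<omega> t - W k \<omega> s)) ^ (2 * q))"
    and "expectation (\<lambda>\<omega>. (\<Sum>k\<in>S. a k * (W k \<omega> t - W k \<omega> s)) ^ (2 * q)) = gmom q * ((t - s) * (\<Sum>k\<in>S. (a k)^2)) ^ q"
proof -
  define S' where "S' = {k\<in>S. a k \<noteq> 0}"
  have fin: "finite S'" using S by (simp add: S'_def)
  have eq: "(\<Sum>k\<in>S. a k * (W k \<omega> t - W k \<omega> s)) = (\<Sum>k\<in>S'. a k * (W k \<omega> t - W k \<omega> s))" for \<omega>
    unfolding S'_def using S by (intro sum.mono_neutral_right) auto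
  have eq2: "(\<Sum>k\<in>S. (a k)^2) = (\<Sum>k\<in>S'. (a k)^2)"
    unfolding S'_def using S by (intro sum.mono_neutral_right) auto
  have "integrable M (\<lambda>\<omega>. (\<Sum>k\<in>S. a k * (W k \<omega> t - W k \<omega> s)) ^ (2 * q)) \<and>
    expectation (\<lambda>\<omega>. (\<Sum>k\<in>S. a k * (W k \<omega> t - W k \<omega> s)) ^ (2 * q)) = gmom q * ((t - s) * (\<Sum>k\<in>S. (a k)^2)) ^ q"
  proof (cases "S' = {}")
    case True
    then show ?thesis unfolding eq eq2 using q by (simp add: zero_power)
  next
    case False
    let ?X = "\<lambda>k \<omega>. a k * (W k \<omega> t - W k \<omega> s)"
    have iv: "indep_vars (\<lambda>_. borel) ?X S'"
    proof (rule indep_vars_compose2[where Y="\<lambda>k f. a k * (f t - f s)"])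
      show "indep_vars (\<lambda>_. Pi\<^sub>M UNIV (\<lambda>_. borel)) W S'" by (rule indep_vars_subset[OF ind]) simp
      show "(\<lambda>f. a k * (f t - f s)) \<in> borel_measurable (Pi\<^sub>M UNIV (\<lambda>_. borel))" for k by measurable
    qed
    have d: "distributed M lborel (?X k) (normal_density 0 (\<bar>a k\<bar> * sqrt (t - s)))" if "k \<in> S'" for k
      using normal_density_affine[OF W_normal[OF st], of "a k" 0] st that by (simp add: S'_def)
    have "distributed M lborel (\<lambda>\<omega>. \<Sum>k\<in>S'. ?X k \<omega>) (normal_density (\<Sum>k\<in>S'. 0) (sqrt (\<Sum>k\<in>S'. (\<bar>a k\<bar> * sqrt (t - s))^2)))"
      by (rule sum_indep_normal[OF fin False iv _ d]) (use st in \<open>auto simp: S'_def\<close>)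
    moreover define \<sigma> where "\<sigma> = sqrt (\<Sum>k\<in>S'. (\<bar>a k\<bar> * sqrt (t - s))^2)"
    ultimately have D: "distributed M lborel (\<lambda>\<omega>. \<Sum>k\<in>S'. ?X k \<omega>) (normal_density 0 \<sigma>)" by simp
    have s2: "(\<Sum>k\<in>S'. (\<bar>a k\<bar> * sqrt (t - s))^2) = (t - s) * (\<Sum>k\<in>S'. (a k)^2)"
      using st by (simp add: power_mult_distrib sum_distrib_left mult.commute)
    have "0 < (\<Sum>k\<in>S'. (a k)^2)" by (rule sum_pos[OF fin False]) (simp add: S'_def)
    then have pos: "0 < (t - s) * (\<Sum>k\<in>S'. (a k)^2)" using st by simp
    have sig: "0 < \<sigma>" "\<sigma>\<^sup>2 = (t - s) * (\<Sum>k\<in>S'. (a k)^2)" unfolding \<sigma>_def s2 using pos by simp_all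
    have g: "(\<lambda>x::real. x ^ (2 * q)) \<in> borel_measurable lborel" by measurable
    have i: "integrable lborel (\<lambda>x. normal_density 0 \<sigma> x * x ^ (2 * q))"
      using normal_moment_even[OF sig(1), of 0 q] by (auto simp: has_bochner_integral_iff)
    have I: "(\<integral>x. normal_density 0 \<sigma> x * x ^ (2 * q) \<partial>lborel) = fact (2 * q) / ((2 / \<sigma>\<^sup>2) ^ q * fact q)"
      using integral_normal_moment_even[OF sig(1), of 0 q] by simp
    have "fact (2 * q) / ((2 / \<sigma>\<^sup>2) ^ q * fact q) = gmom q * (\<sigma>\<^sup>2) ^ q"
      using sig by (simp add: gmom_def power_divide)
    then show ?thesis
      unfolding eq eq2 using distributed_integrable[OF D g] distributed_integral[OF D g] i I sig by simp
  qed
  then show "integrable M (\<lambda>\<omega>. (\<Sum>k\<in>S. a k * (W k \<omega> t - W k \<omega> s)) ^ (2 * q))"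
    "expectation (\<lambda>\<omega>. (\<Sum>k\<in>S. a k * (W k \<omega> t - W k \<omega> s)) ^ (2 * q)) = gmom q * ((t - s) * (\<Sum>k\<in>S. (a k)^2)) ^ q"
    by auto
qed

lemma W_sq:
  assumes "finite S" "0 \<le> t"
  shows "integrable M (\<lambda>\<omega>. (\<Sum>k\<in>S. a k * W k \<omega> t)^2)" "expectation (\<lambda>\<omega>. (\<Sum>k\<in>S. a k * W k \<omega> t)^2) = t * (\<Sum>k\<in>S. (a k)^2)"
proof -
  have m: "(\<lambda>\<omega>. (\<Sum>k\<in>S. a k * W k \<omega> t)^2) \<in> borel_measurable M"
    "(\<lambda>\<omega>. (\<Sum>k\<in>S. a k * (W k \<omega> t - W k \<omega> 0))^2) \<in> borel_measurable M"
    using W_meas_M assms by measurable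
  have ae: "AE \<omega> in M. (\<Sum>k\<in>S. a k * (W k \<omega> t - W k \<omega> 0))^2 = (\<Sum>k\<in>S. a k * W k \<omega> t)^2"
  proof -
    have "AE \<omega> in M. \<forall>k\<in>S. W k \<omega> 0 = 0" using assms(1) W_start by (intro AE_finite_allI) auto
    then show ?thesis by eventually_elim simp
  qed
  have "integrable M (\<lambda>\<omega>. (\<Sum>k\<in>S. a k * (W k \<omega> t - W k \<omega> 0))^2) \<and> expectation (\<lambda>\<omega>. (\<Sum>k\<in>S. a k * (W k \<omega> t - W k \<omega> 0))^2) = t * (\<Sum>k\<in>S. (a k)^2)"
  proof (cases "t = 0")
    case False
    then show ?thesis using gauss_moment[OF assms(1), of 0 t 1 a] assms by simp
  qed simp
  then show "integrable M (\<lambda>\<omega>. (\<Sum>k\<in>S. a k * W k \<omega> t)^2)" "expectation (\<lambda>\<omega>. (\<Sum>k\<in>S. a k * W k \<omega> t)^2) = t * (\<Sum>k\<in>S. (a k)^2)"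
    using integrable_cong_AE[OF m(2,1) ae] integral_cong_AE[OF m(2,1) ae] by auto
qed

text \<open>In the correction sum of \<open>doob_pathwise\<close> each increment is multiplied by an
  integrable factor known at the left grid point, so \<open>mart_zero\<close> removes it in
  expectation.\<close>

lemma doob:
  fixes a :: seq
  assumes S: "finite S" and h: "0 < h"
  defines "\<xi> \<equiv> \<lambda>\<omega> i. \<Sum>k\<in>S. a k * W k \<omega> (real i * h)"
  shows "integrable M (\<lambda>\<omega>. (rmx (\<xi> \<omega>) p)^2)" "expectation (\<lambda>\<omega>. (rmx (\<xi> \<omega>) p)^2) \<le> 4 * (real p * h * (\<Sum>k\<in>S. (a k)^2))"
proof -
  have nn: "0 \<le> real i * h" for i using h by simp
  have \<xi>m: "(\<lambda>\<omega>. \<xi> \<omega> i) \<in> borel_measurable (Fs (real j * h))" if "i \<le> j" for i j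
    unfolding \<xi>_def
    by (intro borel_measurable_sum borel_measurable_times borel_measurable_const meas_up[OF W_meas[OF nn] nn])
       (use that h in \<open>simp add: mult_right_mono\<close>)
  have rm: "(\<lambda>\<omega>. rmx (\<xi> \<omega>) i) \<in> borel_measurable (Fs (real j * h))" if "i \<le> j" for i j
    using that
  proof (induction i)
    case 0 then show ?case using \<xi>m[of 0 j] by simp
  next
    case (Suc i) then show ?case using \<xi>m[of "Suc i" j] by simp
  qed
  have sq: "integrable M (\<lambda>\<omega>. (\<xi> \<omega> i)^2)" "expectation (\<lambda>\<omega>. (\<xi> \<omega> i)^2) = real i * h * (\<Sum>k\<in>S. (a k)^2)" for i
    unfolding \<xi>_def by (rule W_sq[OF S nn])+
  show ri: "integrable M (\<lambda>\<omega>. (rmx (\<xi> \<omega>) i)^2)" for i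
  proof (rule Bochner_Integration.integrable_bound)
    show "integrable M (\<lambda>\<omega>. \<Sum>j\<le>i. (\<xi> \<omega> j)^2)" using sq(1) by simp
    show "(\<lambda>\<omega>. (rmx (\<xi> \<omega>) i)^2) \<in> borel_measurable M" using meas_M[OF rm[OF order_refl] nn] by measurable
    show "AE \<omega> in M. norm ((rmx (\<xi> \<omega>) i)^2) \<le> norm (\<Sum>j\<le>i. (\<xi> \<omega> j)^2)"
      using rmx_sq_le by (intro AE_I2) (simp add: sum_nonneg)
  qed
  define Z where "Z i \<omega> = rmx (\<xi> \<omega>) i * sgn (\<xi> \<omega> i)" for i \<omega>
  have Zm: "Z i \<in> borel_measurable (Fs (real i * h))" for i
    unfolding Z_def using rm[of i i] \<xi>m[of i i] by (intro borel_measurable_times borel_measurable_sgn) auto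
  have Zi: "integrable M (Z i)" for i
  proof (rule Bochner_Integration.integrable_bound)
    show "integrable M (\<lambda>\<omega>. 1 + (rmx (\<xi> \<omega>) i)^2)" using ri by simp
    show "Z i \<in> borel_measurable M" by (rule meas_M[OF Zm nn])
    show "AE \<omega> in M. norm (Z i \<omega>) \<le> norm (1 + (rmx (\<xi> \<omega>) i)^2)"
    proof (rule AE_I2)
      fix \<omega>
      let ?r = "rmx (\<xi> \<omega>) i"
      have "\<bar>Z i \<omega>\<bar> \<le> ?r * 1" unfolding Z_def abs_mult using rmx_nonneg[of "\<xi> \<omega>" i] by (intro mult_mono) (auto simp: sgn_if)
      moreover have "0 \<le> (?r - 1)^2" by simp
      then have "2 * ?r \<le> 1 + ?r^2" by (simp add: power2_diff)
      ultimately show "norm (Z i \<omega>) \<le> norm (1 + ?r^2)" using rmx_nonneg[of "\<xi> \<omega>" i] by simp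
    qed
  qed
  have mz: "integrable M (\<lambda>\<omega>. Z i \<omega> * (\<xi> \<omega> (Suc i) - \<xi> \<omega> i)) \<and> expectation (\<lambda>\<omega>. Z i \<omega> * (\<xi> \<omega> (Suc i) - \<xi> \<omega> i)) = 0" for i
  proof -
    have lt: "real i * h < real (Suc i) * h" using h by (intro mult_strict_right_mono) auto
    have eq: "Z i \<omega> * (\<xi> \<omega> (Suc i) - \<xi> \<omega> i) = (\<Sum>k\<in>S. a k * (Z i \<omega> * (W k \<omega> (real (Suc i) * h) - W k \<omega> (real i * h))))" for \<omega>
      unfolding \<xi>_def sum_subtractf[symmetric] sum_distrib_left by (intro sum.cong refl) (simp add: algebra_simps)
    note mm = mart_zero[OF nn lt Zm Zi]
    show ?thesis unfolding eq using mm by (simp add: Bochner_Integration.integral_sum)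
  qed
  have "expectation (\<lambda>\<omega>. (rmx (\<xi> \<omega>) p)^2) \<le> expectation (\<lambda>\<omega>. 4 * (\<xi> \<omega> p)^2 - 4 * (\<Sum>i<p. Z i \<omega> * (\<xi> \<omega> (Suc i) - \<xi> \<omega> i)))"
    by (intro integral_mono ri) (use sq mz doob_pathwise in \<open>auto simp: Z_def\<close>)
  also have "\<dots> = 4 * (real p * h * (\<Sum>k\<in>S. (a k)^2))"
    using sq mz by (simp add: Bochner_Integration.integral_sum)
  finally show "expectation (\<lambda>\<omega>. (rmx (\<xi> \<omega>) p)^2) \<le> 4 * (real p * h * (\<Sum>k\<in>S. (a k)^2))" .
qed

end

subsection \<open>The noise\<close>

text \<open>The form in which Fatou's lemma is exploited: a finite liminf gives a bound along
  infinitely many indices.\<close>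

lemma frequently_le_of_liminf:
  fixes f :: "nat \<Rightarrow> ennreal"
  assumes "liminf f \<noteq> \<infinity>" shows "\<exists>b. \<exists>\<^sub>F n in sequentially. f n \<le> ennreal b"
proof -
  obtain b where b: "0 \<le> b" "liminf f = ennreal b" using assms by (metis ennreal_cases infinity_ennreal_def)
  have "\<exists>\<^sub>F n in sequentially. f n \<le> ennreal (b + 1)"
  proof (rule ccontr)
    assume "\<not> ?thesis"
    then have "\<forall>\<^sub>F n in sequentially. ennreal (b + 1) \<le> f n"
      unfolding not_frequently by eventually_elim auto
    from Liminf_bounded[OF this] have "ennreal (b + 1) \<le> ennreal b" using b by simp
    then show False using b(1) by simp
  qed
  then show ?thesis by blast
qed

lemma AE_null_cover: "AE x in M. P x \<Longrightarrow> \<exists>N. N \<in> null_sets M \<and> {x \<in> space M. \<not> P x} \<subseteq> N"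
  unfolding eventually_ae_filter by auto

text \<open>For each mode a maximising time is approached by grid points, where the discrete maxima
  dominate the approximating paths. If a partial sum at the maximising times exceeded
  \<open>b\<close>, the discrete sums would exceed \<open>b\<close> for all large \<open>p\<close>,
  against the bound for infinitely many \<open>p\<close>.\<close>

lemma grid_limit:
  fixes w :: "real \<Rightarrow> seq" and c :: "nat \<Rightarrow> real \<Rightarrow> seq"
  assumes N: "0 < N" and w: "\<And>m. continuous_on {0..N} (\<lambda>t. w t m)"
    and cw: "\<And>p t m. t \<in> {0..N} \<Longrightarrow> \<bar>c p t m - w t m\<bar> \<le> \<epsilon> p" and eps: "\<epsilon> \<longlonglongrightarrow> 0"
    and fr: "\<exists>\<^sub>F p in sequentially. (\<Sum>m<p. kap m ^ 4 * (rmx (\<lambda>i. c p (real i * (N / real (Suc p))) m) (Suc p))^2) \<le> b"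
  shows "\<exists>M. summable M \<and> (\<forall>t\<in>{0..N}. \<forall>m. kap m ^ 4 * (w t m)^2 \<le> M m)"
proof -
  let ?r = "\<lambda>p m. rmx (\<lambda>i. c p (real i * (N / real (Suc p))) m) (Suc p)"
  have "\<exists>s\<in>{0..N}. \<forall>t\<in>{0..N}. kap m ^ 4 * (w t m)^2 \<le> kap m ^ 4 * (w s m)^2" for m
    by (rule continuous_attains_sup) (use N in \<open>auto intro!: continuous_intros w\<close>)
  then obtain s where s: "\<And>m. s m \<in> {0..N}" "\<And>m t. t \<in> {0..N} \<Longrightarrow> kap m ^ 4 * (w t m)^2 \<le> kap m ^ 4 * (w (s m) m)^2"
    by metis
  define i where "i p m = nat \<lfloor>s m / (N / real (Suc p))\<rfloor>" for p m
  define sp where "sp p m = real (i p m) * (N / real (Suc p))" for p m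
  have sp: "i p m \<le> Suc p" "sp p m \<in> {0..N}" "\<bar>sp p m - s m\<bar> \<le> N / real (Suc p)" for p m
  proof -
    let ?h = "N / real (Suc p)"
    have h: "0 < ?h" using N by simp
    have q: "0 \<le> s m / ?h" using s(1)[of m] h by auto
    have r: "real (i p m) \<le> s m / ?h" "s m / ?h < real (i p m) + 1" using q by (auto simp: i_def of_nat_nat)
    have "s m / ?h \<le> N / ?h" using s(1)[of m] h by (intro divide_right_mono) auto
    also have "N / ?h = real (Suc p)" using N by simp
    finally have "real (i p m) \<le> real (Suc p)" using r(1) by linarith
    then show "i p m \<le> Suc p" by linarith
    have le: "sp p m \<le> s m" unfolding sp_def using r(1) h by (simp only: le_divide_eq if_True)
    then show "sp p m \<in> {0..N}" using s(1)[of m] h by (auto simp: sp_def)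
    have "s m < (real (i p m) + 1) * ?h" using r(2) h by (simp only: divide_less_eq if_True)
    then have "s m < sp p m + ?h" by (simp only: sp_def distrib_right mult_1)
    then show "\<bar>sp p m - s m\<bar> \<le> ?h" using le unfolding abs_le_iff by simp
  qed
  have spl: "(\<lambda>p. sp p m) \<longlonglongrightarrow> s m" for m
  proof (rule LIM_zero_cancel, rule Lim_null_comparison)
    show "\<forall>\<^sub>F p in sequentially. norm (sp p m - s m) \<le> N * inverse (real (Suc p))"
      using sp(3) by (simp add: divide_inverse)
    show "(\<lambda>p. N * inverse (real (Suc p))) \<longlonglongrightarrow> 0"
      using tendsto_mult[OF tendsto_const LIMSEQ_inverse_real_of_nat, of N] by simp
  qed
  have cl: "(\<lambda>p. c p (sp p m) m) \<longlonglongrightarrow> w (s m) m" for m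
  proof -
    have "(\<lambda>p. w (sp p m) m) \<longlonglongrightarrow> w (s m) m"
      by (rule continuous_on_tendsto_compose[OF w spl s(1)]) (use sp(2) in auto)
    moreover have "(\<lambda>p. c p (sp p m) m - w (sp p m) m) \<longlonglongrightarrow> 0"
      by (rule Lim_null_comparison[OF _ eps]) (use cw sp(2) in auto)
    ultimately show ?thesis using tendsto_add by fastforce
  qed
  have le: "(\<Sum>m<q. kap m ^ 4 * (w (s m) m)^2) \<le> b" for q
  proof (rule ccontr)
    assume "\<not> ?thesis"
    then have less: "b < (\<Sum>m<q. kap m ^ 4 * (w (s m) m)^2)" by simp
    have "(\<lambda>p. \<Sum>m<q. kap m ^ 4 * (c p (sp p m) m)^2) \<longlonglongrightarrow> (\<Sum>m<q. kap m ^ 4 * (w (s m) m)^2)"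
      by (intro tendsto_intros cl)
    from order_tendstoD(1)[OF this less]
    have "\<forall>\<^sub>F p in sequentially. b < (\<Sum>m<q. kap m ^ 4 * (c p (sp p m) m)^2)" .
    then have "\<forall>\<^sub>F p in sequentially. \<not> (\<Sum>m<p. kap m ^ 4 * (?r p m)^2) \<le> b"
      using eventually_ge_at_top[of q]
    proof eventually_elim
      case (elim p)
      have "(\<Sum>m<q. kap m ^ 4 * (c p (sp p m) m)^2) \<le> (\<Sum>m<q. kap m ^ 4 * (?r p m)^2)"
      proof (intro sum_mono mult_left_mono)
        fix m
        have "\<bar>c p (sp p m) m\<bar> \<le> ?r p m"
          unfolding sp_def by (rule rmx_ge[OF sp(1)])
        then have "\<bar>c p (sp p m) m\<bar>\<^sup>2 \<le> (?r p m)^2" by (intro power_mono) auto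
        then show "(c p (sp p m) m)^2 \<le> (?r p m)^2" by simp
      qed auto
      also have "\<dots> \<le> (\<Sum>m<p. kap m ^ 4 * (?r p m)^2)"
        using elim(2) by (intro sum_mono2) auto
      finally show ?case using elim(1) by linarith
    qed
    then show False using fr by (simp add: frequently_def)
  qed
  show ?thesis
  proof (intro exI conjI ballI allI)
    show "summable (\<lambda>m. kap m ^ 4 * (w (s m) m)^2)"
      by (rule summableI_nonneg_bounded[of _ b]) (use le in auto)
  qed (rule s(2))
qed

lemma ncont_scale: assumes "Hs a" "continuous_on {0..T} \<phi>" shows "ncont {0..T} (\<lambda>t m. a m * \<phi> t)"
proof -
  obtain B where B: "\<And>t. t \<in> {0..T} \<Longrightarrow> \<bar>\<phi> t\<bar> \<le> B"
    using compact_imp_bounded[OF compact_continuous_image[OF assms(2) compact_Icc]] by (fastforce simp: bounded_iff)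
  show ?thesis
  proof (rule ncont_M[of _ _ "\<lambda>m. B^2 * (kap m ^ 4 * (a m)^2)"])
    show "continuous_on {0..T} (\<lambda>t. a m * \<phi> t)" for m by (intro continuous_intros assms)
    show "summable (\<lambda>m. B^2 * (kap m ^ 4 * (a m)^2))" using assms(1) unfolding Hs_def by (rule summable_mult)
    fix t m assume "t \<in> {0..T}"
    then have "\<bar>\<phi> t\<bar>\<^sup>2 \<le> B^2" using B by (intro power_mono) auto
    then show "kap m ^ 4 * (a m * \<phi> t)^2 \<le> B^2 * (kap m ^ 4 * (a m)^2)"
      using mult_right_mono[of "(\<phi> t)^2" "B^2" "kap m ^ 4 * (a m)^2"] by (simp add: power_mult_distrib mult_ac)
  qed
qed

section \<open>Pathwise regularity and increments of the noise\<close>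

locale noisew = noise M F W for M :: "'a measure" and F W +
  fixes g :: "nat \<Rightarrow> real \<Rightarrow> real" and WQ :: "'a \<Rightarrow> real \<Rightarrow> real \<Rightarrow> real"
  assumes gH: "\<And>k. H20 (g k)" and gsum: "summable (\<lambda>k. (H2norm (g k))^2)" and WQ: "noise_WQ M W g WQ"
begin

definition G :: "nat \<Rightarrow> seq" where "G k m = coef (g k) (Suc m)"
definition D0 :: real where "D0 = (\<Sum>k. (nrm (G k))^2)"
definition wn :: "nat \<Rightarrow> 'a \<Rightarrow> real \<Rightarrow> seq" where "wn n \<omega> t m = (\<Sum>k<n. G k m * W k \<omega> t)"
definition wq :: "'a \<Rightarrow> real \<Rightarrow> seq" where "wq \<omega> t m = coef (WQ \<omega> t) (Suc m)"
text \<open>The error of a partial sum exactly as it occurs in \<open>noise_WQ\<close>, which makes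
  the square of this supremum integrable and thereby measurable.\<close>

definition SX :: "nat \<Rightarrow> real \<Rightarrow> 'a \<Rightarrow> real" where
  "SX n T \<omega> = (SUP t\<in>{0..T}. H2norm (WQ \<omega> t - (\<lambda>x. \<Sum>k<n. W k \<omega> t * g k x)))"

lemma HG: "Hs (G k)" and nrm_G: "nrm (G k) = H2norm (g k)"
  using gH[of k] by (simp_all add: G_def[abs_def] H20_iff H2norm_eq)

lemma D0_summable: "summable (\<lambda>k. (nrm (G k))^2)" and D0_sum_le: "finite S \<Longrightarrow> (\<Sum>k\<in>S. (nrm (G k))^2) \<le> D0" and D0_nonneg: "0 \<le> D0"
proof -
  show s: "summable (\<lambda>k. (nrm (G k))^2)" using gsum by (simp add: nrm_G)
  show "finite S \<Longrightarrow> (\<Sum>k\<in>S. (nrm (G k))^2) \<le> D0" unfolding D0_def by (rule sum_le_suminf[OF s]) auto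
  show "0 \<le> D0" unfolding D0_def by (rule suminf_nonneg[OF s]) simp
qed

lemma SX_int: "0 \<le> T \<Longrightarrow> integrable M (\<lambda>\<omega>. (SX n T \<omega>)^2)"
  and SX_lim: "0 \<le> T \<Longrightarrow> (\<lambda>n. expectation (\<lambda>\<omega>. (SX n T \<omega>)^2)) \<longlonglongrightarrow> 0"
  using WQ unfolding noise_WQ_def SX_def by simp_all

lemma H2diff: assumes "L20 (WQ \<omega> t)"
  shows "H2norm (WQ \<omega> t - (\<lambda>x. \<Sum>k<n. W k \<omega> t * g k x)) = nrmd (wq \<omega> t) (wn n \<omega> t)"
proof -
  have L: "L20 (g k)" for k using gH[of k] by (simp add: H20_iff)
  let ?s = "\<lambda>x. \<Sum>k<n. W k \<omega> t * g k x"
  have i: "integrable torus ?s" using L20_integrable[OF L] by simp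
  have 1: "coef (WQ \<omega> t - ?s) (Suc m) = coef (WQ \<omega> t) (Suc m) - coef ?s (Suc m)" for m
    using eb_int_prod[OF L20_integrable[OF assms], of m] eb_int_prod[OF i, of m]
    by (simp add: coef_Suc left_diff_distrib)
  have 2: "coef ?s (Suc m) = wn n \<omega> t m" for m
    using L20_lincomb[of "{..<n}" g "\<lambda>k. W k \<omega> t" m] L by (simp add: wn_def G_def mult.commute)
  have "coef (WQ \<omega> t - ?s) (Suc m) = wq \<omega> t m - wn n \<omega> t m" for m unfolding 1 2 wq_def ..
  then show ?thesis by (simp add: H2norm_eq wq_def)
qed

definition good0 :: "'a \<Rightarrow> bool" where
  "good0 \<omega> \<longleftrightarrow> (\<forall>t\<ge>0. H20 (WQ \<omega> t)) \<and> ncont {0..} (wq \<omega>) \<and> (\<forall>k. continuous_on {0..} (W k \<omega>))"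

lemma good0_AE: "AE \<omega> in M. good0 \<omega>"
proof -
  have "AE \<omega> in M. \<forall>k. continuous_on {0..} (W k \<omega>)" using W_cont by (simp add: AE_all_countable)
  moreover have "AE \<omega> in M. (\<forall>t\<ge>0. H20 (WQ \<omega> t)) \<and> (\<forall>t\<ge>0. ((\<lambda>s. H2norm (WQ \<omega> s - WQ \<omega> t)) \<longlongrightarrow> 0) (at t within {0..}))"
    using WQ unfolding noise_WQ_def by blast
  ultimately show ?thesis
  proof eventually_elim
    case (elim \<omega>)
    have L: "L20 (WQ \<omega> t)" "Hs (wq \<omega> t)" if "0 \<le> t" for t using elim(2) that by (simp_all add: H20_iff wq_def[abs_def])
    have eq: "H2norm (WQ \<omega> s - WQ \<omega> t) = nrmd (wq \<omega> s) (wq \<omega> t)" if "0 \<le> s" "0 \<le> t" for s t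
      using coef_diff[OF L(1)[OF that(1)] L(1)[OF that(2)]] by (simp add: H2norm_eq wq_def)
    have "ncont {0..} (wq \<omega>)" unfolding ncont_def
    proof (intro conjI ballI)
      fix t :: real assume t: "t \<in> {0..}"
      then show "Hs (wq \<omega> t)" using L by simp
      have "((\<lambda>s. H2norm (WQ \<omega> s - WQ \<omega> t)) \<longlongrightarrow> 0) (at t within {0..})" using elim(2) t by simp
      then show "((\<lambda>s. nrmd (wq \<omega> s) (wq \<omega> t)) \<longlongrightarrow> 0) (at t within {0..})"
        by (rule Lim_transform_eventually) (rule ev_within, use eq t in auto)
    qed
    then show ?case using elim by (simp add: good0_def)
  qed
qed

lemma wn_ncont: assumes "good0 \<omega>" shows "ncont {0..T} (wn n \<omega>)"
proof (induction n)
  case 0 show ?case by (simp add: wn_def ncont_def)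
next
  case (Suc n)
  have "continuous_on {0..T} (W n \<omega>)" using assms by (auto simp: good0_def intro: continuous_on_subset)
  from ncont_add[OF Suc ncont_scale[OF HG this, of n]] show ?case by (simp add: wn_def)
qed

lemma SX_ge: assumes "good0 \<omega>" "t \<in> {0..T}"
  shows "nrmd (wq \<omega> t) (wn n \<omega> t) \<le> SX n T \<omega>" "0 \<le> SX n T \<omega>"
proof -
  have nq: "ncont {0..T} (wq \<omega>)" using assms(1) by (auto simp: good0_def intro: ncont_subset)
  have eq: "H2norm (WQ \<omega> s - (\<lambda>x. \<Sum>k<n. W k \<omega> s * g k x)) = nrmd (wq \<omega> s) (wn n \<omega> s)" if "s \<in> {0..T}" for s
    by (rule H2diff) (use assms(1) that in \<open>simp add: good0_def H20_iff\<close>)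
  have "bdd_above ((\<lambda>s. nrmd (wq \<omega> s) (wn n \<omega> s)) ` {0..T})"
    by (intro bounded_imp_bdd_above compact_imp_bounded compact_continuous_image ncont_diff_nrm nq wn_ncont assms compact_Icc)
  moreover have "(\<lambda>s. H2norm (WQ \<omega> s - (\<lambda>x. \<Sum>k<n. W k \<omega> s * g k x))) ` {0..T} = (\<lambda>s. nrmd (wq \<omega> s) (wn n \<omega> s)) ` {0..T}"
    by (rule image_cong[OF refl]) (rule eq)
  ultimately have bdd: "bdd_above ((\<lambda>s. H2norm (WQ \<omega> s - (\<lambda>x. \<Sum>k<n. W k \<omega> s * g k x))) ` {0..T})" by simp
  show *: "nrmd (wq \<omega> t) (wn n \<omega> t) \<le> SX n T \<omega>"
    unfolding SX_def eq[OF assms(2), symmetric] by (rule cSUP_upper[OF assms(2) bdd])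
  have "0 \<le> nrmd (wq \<omega> t) (wn n \<omega> t)"
    by (intro nrm_nonneg Hs_diff ncont_Hs[OF nq assms(2)] ncont_Hs[OF wn_ncont[OF assms(1)] assms(2)])
  then show "0 \<le> SX n T \<omega>" using * by linarith
qed

text \<open>Mean-square convergence gives almost sure convergence along a subsequence, one for each
  integer horizon.\<close>

lemma subseq_ex: "\<exists>r. \<forall>N::nat. strict_mono (r N) \<and> (AE \<omega> in M. (\<lambda>n. SX (r N n) (real N) \<omega>) \<longlonglongrightarrow> 0)"
proof -
  have "\<exists>r. strict_mono r \<and> (AE \<omega> in M. (\<lambda>n. SX (r n) (real N) \<omega>) \<longlonglongrightarrow> 0)" for N :: nat
  proof -
    obtain r :: "nat \<Rightarrow> nat" where r: "strict_mono r" "AE \<omega> in M. (\<lambda>n. (SX (r n) (real N) \<omega>)^2) \<longlonglongrightarrow> 0"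
    proof -
      have "integrable M (\<lambda>\<omega>. (SX n (real N) \<omega>)^2)" for n by (rule SX_int) simp
      moreover have "(\<lambda>n. expectation (\<lambda>\<omega>. norm ((SX n (real N) \<omega>)^2))) \<longlonglongrightarrow> 0" using SX_lim[of "real N"] by simp
      ultimately have "\<exists>r::nat\<Rightarrow>nat. strict_mono r \<and> (AE \<omega> in M. (\<lambda>n. (SX (r n) (real N) \<omega>)^2) \<longlonglongrightarrow> 0)"
        by (rule tendsto_L1_AE_subseq)
      then show ?thesis using that by blast
    qed
    from r(2) have "AE \<omega> in M. (\<lambda>n. SX (r n) (real N) \<omega>) \<longlonglongrightarrow> 0"
    proof eventually_elim
      case (elim \<omega>)
      from tendsto_real_sqrt[OF elim] show ?case by (simp add: tendsto_rabs_zero_iff)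
    qed
    with r(1) show ?thesis by blast
  qed
  then show ?thesis by metis
qed

definition rs :: "nat \<Rightarrow> nat \<Rightarrow> nat" where
  "rs = (SOME r. \<forall>N::nat. strict_mono (r N) \<and> (AE \<omega> in M. (\<lambda>n. SX (r N n) (real N) \<omega>) \<longlonglongrightarrow> 0))"

lemma rs: "strict_mono (rs N)" "AE \<omega> in M. (\<lambda>n. SX (rs N n) (real N) \<omega>) \<longlonglongrightarrow> 0"
  using someI_ex[OF subseq_ex, folded rs_def] by auto

lemma wn_meas: "0 \<le> t \<Longrightarrow> (\<lambda>\<omega>. wn n \<omega> t m) \<in> borel_measurable (Fs t)"
  unfolding wn_def by (intro borel_measurable_sum borel_measurable_times W_meas) auto

text \<open>Doob's inequality in each mode, summed over modes, bounds the expected weighted grid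
  maxima by \<open>4 * N * D0\<close>. Fatou's lemma yields a pathwise bound for infinitely many
  grids, and \<open>grid_limit\<close> turns it into a dominating sequence.\<close>

lemma gp_AE: "AE \<omega> in M. gp (wq \<omega>)"
proof -
  \<comment> \<open>Everything grows with \<open>p\<close> at once: \<open>p\<close> modes,
    \<open>p + 1\<close> grid cells on \<open>[0, N]\<close> and \<open>rs N p\<close> noise
    terms.\<close>
  define Q where "Q N p \<omega> = (\<Sum>m<p. kap m ^ 4 * (rmx (\<lambda>i. wn (rs N p) \<omega> (real i * (real N / real (Suc p))) m) (Suc p))^2)" for N p \<omega>
  have fr: "AE \<omega> in M. \<exists>b. \<exists>\<^sub>F p in sequentially. Q N p \<omega> \<le> b" if N: "0 < N" for N
  proof -
    have h: "0 < real N / real (Suc p)" for p using N by simp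
    note db = doob[OF finite_lessThan h, where p="Suc p" and a="\<lambda>k. G k m" for p m]
    have Qi: "integrable M (Q N p)" for p
      unfolding Q_def wn_def using db(1) by (intro Bochner_Integration.integrable_sum integrable_mult_right)
    have Q0: "0 \<le> Q N p \<omega>" for p \<omega> unfolding Q_def by (intro sum_nonneg) auto
    have QE: "expectation (Q N p) \<le> 4 * (real N * D0)" for p
    proof -
      have "expectation (Q N p) = (\<Sum>m<p. kap m ^ 4 * expectation (\<lambda>\<omega>. (rmx (\<lambda>i. wn (rs N p) \<omega> (real i * (real N / real (Suc p))) m) (Suc p))^2))"
        unfolding Q_def wn_def using db(1) by (subst Bochner_Integration.integral_sum) (auto simp del: rmx.simps of_nat_Suc)
      also have "\<dots> \<le> (\<Sum>m<p. kap m ^ 4 * (4 * (real N * (\<Sum>k<rs N p. (G k m)^2))))"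
      proof (intro sum_mono mult_left_mono)
        fix m
        have "real (Suc p) * (real N / real (Suc p)) = real N" by (simp del: of_nat_Suc)
        then show "expectation (\<lambda>\<omega>. (rmx (\<lambda>i. wn (rs N p) \<omega> (real i * (real N / real (Suc p))) m) (Suc p))^2) \<le> 4 * (real N * (\<Sum>k<rs N p. (G k m)^2))"
          using doob(2)[OF finite_lessThan[of "rs N p"] h[of p], where p="Suc p" and a="\<lambda>k. G k m"] by (simp add: wn_def del: of_nat_Suc rmx.simps)
      qed simp
      also have "\<dots> = 4 * (real N * (\<Sum>m<p. \<Sum>k<rs N p. kap m ^ 4 * (G k m)^2))"
        by (simp add: sum_distrib_left mult_ac)
      also have "(\<Sum>m<p. \<Sum>k<rs N p. kap m ^ 4 * (G k m)^2) = (\<Sum>k<rs N p. \<Sum>m<p. kap m ^ 4 * (G k m)^2)" by (rule sum.swap)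
      also have "\<dots> \<le> (\<Sum>k<rs N p. (nrm (G k))^2)" by (intro sum_mono nrm_sum_le HG) simp
      also have "\<dots> \<le> D0" by (rule D0_sum_le) simp
      finally show ?thesis by (simp add: mult_left_mono)
    qed
    have [measurable]: "Q N p \<in> borel_measurable M" for p using Qi by simp
    have "(\<integral>\<^sup>+\<omega>. liminf (\<lambda>p. ennreal (Q N p \<omega>)) \<partial>M) \<le> liminf (\<lambda>p. \<integral>\<^sup>+\<omega>. ennreal (Q N p \<omega>) \<partial>M)"
      by (rule nn_integral_liminf) measurable
    also have "\<dots> \<le> ennreal (4 * (real N * D0))"
    proof (rule Liminf_le)
      show "\<forall>\<^sub>F p in sequentially. (\<integral>\<^sup>+\<omega>. ennreal (Q N p \<omega>) \<partial>M) \<le> ennreal (4 * (real N * D0))"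
        using nn_integral_eq_integral[OF Qi] Q0 QE by (intro always_eventually allI) (simp add: ennreal_leI)
    qed simp
    finally have "(\<integral>\<^sup>+\<omega>. liminf (\<lambda>p. ennreal (Q N p \<omega>)) \<partial>M) \<noteq> \<infinity>"
      by (metis ennreal_less_top infinity_ennreal_def leD top.not_eq_extremum)
    then have "AE \<omega> in M. liminf (\<lambda>p. ennreal (Q N p \<omega>)) \<noteq> \<infinity>"
      by (rule nn_integral_PInf_AE[rotated]) measurable
    then show ?thesis
    proof eventually_elim
      case (elim \<omega>)
      then obtain b where b: "\<exists>\<^sub>F p in sequentially. ennreal (Q N p \<omega>) \<le> ennreal b" using frequently_le_of_liminf by blast
      then have "\<exists>\<^sub>F p in sequentially. Q N p \<omega> \<le> max 0 b"
        by (rule frequently_elim1) (use Q0 in \<open>auto simp: ennreal_le_iff2 le_max_iff_disj\<close>)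
      then show ?case by blast
    qed
  qed
  have "AE \<omega> in M. \<forall>N. (0 < N \<longrightarrow> (\<exists>b. \<exists>\<^sub>F p in sequentially. Q N p \<omega> \<le> b)) \<and> (\<lambda>n. SX (rs N n) (real N) \<omega>) \<longlonglongrightarrow> 0"
    unfolding AE_all_countable using fr rs(2) by (auto elim: AE_mp)
  with good0_AE show ?thesis
  proof eventually_elim
    case (elim \<omega>)
    have nq: "ncont {0..} (wq \<omega>)" using elim(1) by (simp add: good0_def)
    show ?case unfolding gp_def
    proof (intro conjI allI)
      show "continuous_on {0..} (\<lambda>t. wq \<omega> t m)" for m by (rule ncont_comp[OF nq])
      fix T :: real
      obtain N :: nat where N: "T \<le> real N" "0 < N"
      proof -
        obtain n :: nat where "T \<le> real n" using real_arch_simple by blast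
        then show ?thesis using that[of "Suc n"] by simp
      qed
      obtain b where b: "\<exists>\<^sub>F p in sequentially. Q N p \<omega> \<le> b" using elim(2) N(2) by blast
      have "\<exists>M. summable M \<and> (\<forall>t\<in>{0..real N}. \<forall>m. kap m ^ 4 * (wq \<omega> t m)^2 \<le> M m)"
      proof (rule grid_limit[where c="\<lambda>p. wn (rs N p) \<omega>" and \<epsilon>="\<lambda>p. SX (rs N p) (real N) \<omega>" and b=b])
        show "continuous_on {0..real N} (\<lambda>t. wq \<omega> t m)" for m
          by (rule continuous_on_subset[OF ncont_comp[OF nq]]) auto
        show "\<bar>wn (rs N p) \<omega> t m - wq \<omega> t m\<bar> \<le> SX (rs N p) (real N) \<omega>" if t: "t \<in> {0..real N}" for p t m
        proof -
          have "Hs (\<lambda>m. wq \<omega> t m - wn (rs N p) \<omega> t m)"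
            by (intro Hs_diff ncont_Hs[OF nq] ncont_Hs[OF wn_ncont[OF elim(1)] t]) (use t in auto)
          from nrm_comp(2)[OF this, of m] SX_ge(1)[OF elim(1) t, of "rs N p"] show ?thesis by linarith
        qed
        show "\<exists>\<^sub>F p in sequentially. (\<Sum>m<p. kap m ^ 4 * (rmx (\<lambda>i. wn (rs N p) \<omega> (real i * (real N / real (Suc p))) m) (Suc p))^2) \<le> b"
          using b by (simp only: Q_def)
      qed (use N elim(2) in auto)
      then show "\<exists>M. summable M \<and> (\<forall>t\<in>{0..T}. \<forall>m. kap m ^ 4 * (wq \<omega> t m)^2 \<le> M m)"
        using N(1) by (meson atLeastAtMost_iff order_trans)
    qed
  qed
qed

definition good :: "'a \<Rightarrow> bool" where
  "good \<omega> \<longleftrightarrow> good0 \<omega> \<and> gp (wq \<omega>) \<and> (\<forall>N. (\<lambda>n. SX (rs N n) (real N) \<omega>) \<longlonglongrightarrow> 0) \<and> (\<forall>k. W k \<omega> 0 = 0)"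

lemma good_AE: "AE \<omega> in M. good \<omega>"
proof -
  have "AE \<omega> in M. \<forall>N. (\<lambda>n. SX (rs N n) (real N) \<omega>) \<longlonglongrightarrow> 0" using rs(2) by (simp add: AE_all_countable)
  moreover have "AE \<omega> in M. \<forall>k. W k \<omega> 0 = 0" using W_start by (simp add: AE_all_countable)
  ultimately show ?thesis using good0_AE gp_AE by eventually_elim (simp add: good_def)
qed

definition N0 :: "'a set" where "N0 = (SOME N. N \<in> null_sets M \<and> {\<omega> \<in> space M. \<not> good \<omega>} \<subseteq> N)"

lemma N0: "N0 \<in> null_sets M" "\<omega> \<in> space M \<Longrightarrow> \<omega> \<notin> N0 \<Longrightarrow> good \<omega>"
proof -
  from someI_ex[OF AE_null_cover[OF good_AE], folded N0_def] show "N0 \<in> null_sets M" "\<omega> \<in> space M \<Longrightarrow> \<omega> \<notin> N0 \<Longrightarrow> good \<omega>" by auto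
qed

text \<open>The exceptional null set is fixed once and the noise set to zero on it, so that path
  properties hold at every sample point; as null sets belong to \<open>F 0\<close>, adaptedness
  survives.\<close>

definition w :: "'a \<Rightarrow> real \<Rightarrow> seq" where "w \<omega> t m = (if \<omega> \<in> N0 then 0 else wq \<omega> t m)"

lemma w_AE: "AE \<omega> in M. \<omega> \<notin> N0"
  using N0(1) by (rule AE_not_in)

lemma w_gp: assumes "\<omega> \<in> space M" shows "gp (w \<omega>)"
proof (cases "\<omega> \<in> N0")
  case True
  then have "w \<omega> = (\<lambda>_ _. 0)" by (intro ext) (simp add: w_def)
  then show ?thesis by (auto simp: gp_def intro!: exI[of _ "\<lambda>_. 0"])
next
  case False
  then have "w \<omega> = wq \<omega>" by (intro ext) (simp add: w_def)
  then show ?thesis using N0(2)[OF assms False] by (simp add: good_def)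
qed

lemma wn_wq_lim: assumes "good \<omega>" "t \<in> {0..real N}" shows "(\<lambda>n. wn (rs N n) \<omega> t m) \<longlonglongrightarrow> wq \<omega> t m"
proof -
  have g0: "good0 \<omega>" using assms by (simp add: good_def)
  have "(\<lambda>n. wn (rs N n) \<omega> t m - wq \<omega> t m) \<longlonglongrightarrow> 0"
  proof (rule Lim_null_comparison)
    show "(\<lambda>n. SX (rs N n) (real N) \<omega>) \<longlonglongrightarrow> 0" using assms by (simp add: good_def)
    show "\<forall>\<^sub>F n in sequentially. norm (wn (rs N n) \<omega> t m - wq \<omega> t m) \<le> SX (rs N n) (real N) \<omega>"
    proof (intro always_eventually allI)
      fix n
      have "Hs (\<lambda>m. wq \<omega> t m - wn (rs N n) \<omega> t m)"
        by (intro Hs_diff ncont_Hs[OF wn_ncont[OF g0] assms(2)] ncont_Hs[of "{0..}" "wq \<omega>"]) (use g0 assms(2) in \<open>auto simp: good0_def\<close>)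
      from nrm_comp(2)[OF this, of m] SX_ge(1)[OF g0 assms(2), of "rs N n"]
      show "norm (wn (rs N n) \<omega> t m - wq \<omega> t m) \<le> SX (rs N n) (real N) \<omega>" by simp
    qed
  qed
  then show ?thesis by (simp add: LIM_zero_iff)
qed

text \<open>Off the null set the noise is the limit of partial sums of adapted Brownian motions
  along the chosen subsequence; this is where adaptedness of \<open>w\<close> comes from.\<close>

lemma w_meas: assumes "0 \<le> t" shows "(\<lambda>\<omega>. w \<omega> t m) \<in> borel_measurable (Fs t)"
proof -
  obtain N :: nat where N: "t \<le> real N" using real_arch_simple by blast
  have [measurable]: "N0 \<in> sets (Fs t)" by (rule null_Fs[OF N0(1) assms])
  have [measurable]: "(\<lambda>\<omega>. wn n \<omega> t m) \<in> borel_measurable (Fs t)" for n by (rule wn_meas[OF assms])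
  have "(\<lambda>\<omega>. if \<omega> \<in> N0 then 0 else lim (\<lambda>n. wn (rs N n) \<omega> t m)) \<in> borel_measurable (Fs t)" by measurable
  also have "?this \<longleftrightarrow> ?thesis"
    by (rule measurable_cong) (use wn_wq_lim[of _ t N m] N0(2) N assms in \<open>auto simp: w_def dest!: limI\<close>)
  finally show ?thesis .
qed

lemma w_zero: "\<omega> \<in> space M \<Longrightarrow> w \<omega> 0 m = 0"
proof (cases "\<omega> \<in> N0")
  case False
  assume "\<omega> \<in> space M"
  then have g: "good \<omega>" using False N0(2) by simp
  have "(\<lambda>n. wn (rs 0 n) \<omega> 0 m) \<longlonglongrightarrow> wq \<omega> 0 m" by (rule wn_wq_lim[OF g]) simp
  moreover have "wn n \<omega> 0 m = 0" for n using g by (simp add: wn_def good_def)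
  ultimately have "wq \<omega> 0 m = 0" by (simp add: LIMSEQ_const_iff)
  then show ?thesis by (simp add: w_def)
qed (simp add: w_def)

text \<open>The noise increment at a fixed space point: moments are estimated for each
  \<open>x\<close> and integrated over the torus afterwards.\<close>

definition bx :: "real \<Rightarrow> real \<Rightarrow> real \<Rightarrow> 'a \<Rightarrow> real" where
  "bx s t x \<omega> = ser (\<lambda>m. w \<omega> t m - w \<omega> s m) x"

lemma w_Hs: assumes "\<omega> \<in> space M" "0 \<le> t" shows "Hs (w \<omega> t)"
proof -
  obtain M where "summable M" "\<And>m. kap m ^ 4 * (w \<omega> t m)^2 \<le> M m"
    using w_gp[OF assms(1)] assms(2) unfolding gp_def by (meson atLeastAtMost_iff order_refl)
  then show ?thesis unfolding Hs_def
    by (intro summable_comparison_test_ev[OF _ \<open>summable M\<close>]) auto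
qed

lemma bx_meas: assumes "0 \<le> s" "s \<le> t" shows "bx s t x \<in> borel_measurable (Fs t)"
  unfolding bx_def[abs_def]
  by (intro ser_meas1 borel_measurable_diff w_meas meas_up[OF w_meas]) (use assms in auto)

lemma bx_approx:
  assumes st: "0 \<le> s" "s \<le> t" "t \<le> T" and g: "\<omega> \<in> space M" "\<omega> \<notin> N0"
  shows "\<bar>bx s t x \<omega> - (\<Sum>k<n. ser (G k) x * (W k \<omega> t - W k \<omega> s))\<bar> \<le> 2 * C0 * SX n T \<omega>"
proof -
  have good: "good0 \<omega>" using N0(2)[OF g] by (simp add: good_def)
  have tT: "t \<in> {0..T}" "s \<in> {0..T}" using st by auto
  have Hq: "Hs (wq \<omega> r)" if "r \<in> {0..T}" for r using good that by (auto simp: good0_def ncont_def)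
  have Hn: "Hs (wn n \<omega> r)" if "r \<in> {0..T}" for r by (rule ncont_Hs[OF wn_ncont[OF good] that])
  have sern: "ser (wn n \<omega> r) x = (\<Sum>k<n. ser (G k) x * W k \<omega> r)" for r
  proof -
    have "ser (wn n \<omega> r) x = (\<Sum>m. \<Sum>k<n. W k \<omega> r * (G k m * eb m x))"
      unfolding ser_def wn_def sum_distrib_right by (intro suminf_cong sum.cong refl) simp
    also have "\<dots> = (\<Sum>k<n. \<Sum>m. W k \<omega> r * (G k m * eb m x))"
      by (rule suminf_sum) (intro summable_mult ser_summable HG)
    also have "\<dots> = (\<Sum>k<n. ser (G k) x * W k \<omega> r)"
    proof (intro sum.cong refl)
      fix k
      have "(\<Sum>m. W k \<omega> r * (G k m * eb m x)) = W k \<omega> r * ser (G k) x"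
        unfolding ser_def by (rule suminf_mult[OF ser_summable[OF HG]])
      then show "(\<Sum>m. W k \<omega> r * (G k m * eb m x)) = ser (G k) x * W k \<omega> r" by simp
    qed
    finally show ?thesis .
  qed
  have d: "\<bar>ser (wq \<omega> r) x - ser (wn n \<omega> r) x\<bar> \<le> C0 * SX n T \<omega>" if "r \<in> {0..T}" for r
    using ser_diff_bound[OF Hq[OF that] Hn[OF that], of x] mult_left_mono[OF SX_ge(1)[OF good that, of n] C0_nonneg] by linarith
  have "bx s t x \<omega> = ser (wq \<omega> t) x - ser (wq \<omega> s) x"
    unfolding bx_def w_def using g ser_diff[OF Hq[OF tT(1)] Hq[OF tT(2)]] by simp
  moreover have "(\<Sum>k<n. ser (G k) x * (W k \<omega> t - W k \<omega> s)) = ser (wn n \<omega> t) x - ser (wn n \<omega> s) x"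
    unfolding sern by (simp add: sum_subtractf right_diff_distrib)
  ultimately show ?thesis using d[OF tT(1)] d[OF tT(2)] by linarith
qed

lemma serG_sum: "(\<Sum>k<n. (ser (G k) x)^2) \<le> C0^2 * D0"
proof -
  have "(\<Sum>k<n. (ser (G k) x)^2) \<le> (\<Sum>k<n. C0^2 * (nrm (G k))^2)"
  proof (rule sum_mono)
    fix k
    have "\<bar>ser (G k) x\<bar>\<^sup>2 \<le> (C0 * nrm (G k))^2" by (rule power_mono[OF ser_bound[OF HG]]) simp
    then show "(ser (G k) x)^2 \<le> C0^2 * (nrm (G k))^2" by (simp add: power_mult_distrib)
  qed
  also have "\<dots> \<le> C0^2 * D0" unfolding sum_distrib_left[symmetric] by (intro mult_left_mono D0_sum_le) auto
  finally show ?thesis .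
qed

text \<open>The partial sums are Gaussian with variance at most \<open>(t - s) * (C0^2 * D0)\<close>
  by \<open>serG_sum\<close>; Fatou's lemma along the subsequence transfers the bound.\<close>

lemma bx_moment:
  assumes st: "0 \<le> s" "s < t" and q: "0 < q"
  shows "integrable M (\<lambda>\<omega>. bx s t x \<omega> ^ (2 * q))"
    and "expectation (\<lambda>\<omega>. bx s t x \<omega> ^ (2 * q)) \<le> gmom q * ((t - s) * (C0^2 * D0)) ^ q"
proof -
  let ?B = "gmom q * ((t - s) * (C0^2 * D0)) ^ q"
  obtain N :: nat where N: "t \<le> real N" using real_arch_simple by blast
  let ?b = "\<lambda>n \<omega>. \<Sum>k<rs N n. ser (G k) x * (W k \<omega> t - W k \<omega> s)"
  have B0: "0 \<le> ?B" using st D0_nonneg by (intro mult_nonneg_nonneg zero_le_power) auto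
  have [measurable]: "bx s t x \<in> borel_measurable M" using bx_meas[of s t] st by (intro meas_M[of _ t]) auto
  have bi: "integrable M (\<lambda>\<omega>. ?b n \<omega> ^ (2 * q))" for n by (rule gauss_moment(1)[OF _ st q]) simp
  have bE: "expectation (\<lambda>\<omega>. ?b n \<omega> ^ (2 * q)) \<le> ?B" for n
    unfolding gauss_moment(2)[OF finite_lessThan st q] using st serG_sum
    by (intro mult_left_mono power_mono) (auto intro!: mult_nonneg_nonneg sum_nonneg)
  have ev: "0 \<le> z ^ (2 * q)" for z :: real by (simp add: zero_le_even_power)
  have lim: "AE \<omega> in M. (\<lambda>n. ?b n \<omega>) \<longlonglongrightarrow> bx s t x \<omega>"
    using w_AE AE_space
  proof eventually_elim
    case (elim \<omega>)
    have "(\<lambda>n. bx s t x \<omega> - ?b n \<omega>) \<longlonglongrightarrow> 0"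
    proof (rule Lim_null_comparison)
      show "\<forall>\<^sub>F n in sequentially. norm (bx s t x \<omega> - ?b n \<omega>) \<le> 2 * C0 * SX (rs N n) (real N) \<omega>"
        using bx_approx[OF st(1) less_imp_le[OF st(2)] N elim(2,1)] by (intro always_eventually allI) simp
      have "(\<lambda>n. SX (rs N n) (real N) \<omega>) \<longlonglongrightarrow> 0" using N0(2)[OF elim(2,1)] by (simp add: good_def)
      from tendsto_mult[OF tendsto_const this] show "(\<lambda>n. 2 * C0 * SX (rs N n) (real N) \<omega>) \<longlonglongrightarrow> 0" by simp
    qed
    from tendsto_diff[OF tendsto_const this, of "bx s t x \<omega>"] show ?case by simp
  qed
  have "(\<integral>\<^sup>+\<omega>. ennreal (bx s t x \<omega> ^ (2 * q)) \<partial>M) = (\<integral>\<^sup>+\<omega>. liminf (\<lambda>n. ennreal (?b n \<omega> ^ (2 * q))) \<partial>M)"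
  proof (rule nn_integral_cong_AE, use lim in eventually_elim)
    case (elim \<omega>)
    have "(\<lambda>n. ennreal (?b n \<omega> ^ (2 * q))) \<longlonglongrightarrow> ennreal (bx s t x \<omega> ^ (2 * q))"
      by (intro tendsto_ennrealI tendsto_power elim)
    from lim_imp_Liminf[OF _ this] show ?case by simp
  qed
  also have "\<dots> \<le> liminf (\<lambda>n. \<integral>\<^sup>+\<omega>. ennreal (?b n \<omega> ^ (2 * q)) \<partial>M)"
    by (intro nn_integral_liminf measurable_compose[OF borel_measurable_integrable[OF bi] measurable_ennreal])
  also have "\<dots> \<le> ennreal ?B"
  proof (rule Liminf_le)
    show "\<forall>\<^sub>F n in sequentially. (\<integral>\<^sup>+\<omega>. ennreal (?b n \<omega> ^ (2 * q)) \<partial>M) \<le> ennreal ?B"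
      using nn_integral_eq_integral[OF bi] ev bE by (intro always_eventually allI) (simp add: ennreal_leI)
  qed simp
  finally have le: "(\<integral>\<^sup>+\<omega>. ennreal (bx s t x \<omega> ^ (2 * q)) \<partial>M) \<le> ennreal ?B" .
  show i: "integrable M (\<lambda>\<omega>. bx s t x \<omega> ^ (2 * q))"
  proof (rule integrableI_nonneg)
    show "(\<integral>\<^sup>+\<omega>. ennreal (bx s t x \<omega> ^ (2 * q)) \<partial>M) < \<infinity>" using le by (simp add: order_le_less_trans)
  qed (use ev in auto)
  have "ennreal (expectation (\<lambda>\<omega>. bx s t x \<omega> ^ (2 * q))) \<le> ennreal ?B"
    using le nn_integral_eq_integral[OF i] ev by simp
  then show "expectation (\<lambda>\<omega>. bx s t x \<omega> ^ (2 * q)) \<le> ?B" using B0 by simp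
qed

text \<open>The expectation vanishes for partial sums by \<open>mart_zero\<close>, and the error is
  at most a multiple of the mean of \<open>\<bar>SX n t \<omega>\<bar>\<close>, which Cauchy-Schwarz
  sends to zero.\<close>

lemma bx_mart:
  assumes st: "0 \<le> s" "s < t" and Z: "Z \<in> borel_measurable (Fs s)" "\<And>\<omega>. \<omega> \<in> space M \<Longrightarrow> \<bar>Z \<omega>\<bar> \<le> B"
  shows "integrable M (\<lambda>\<omega>. Z \<omega> * bx s t x \<omega>)" "expectation (\<lambda>\<omega>. Z \<omega> * bx s t x \<omega>) = 0"
proof -
  obtain x0 where "x0 \<in> space M" using not_empty by blast
  then have B: "0 \<le> B" using Z(2) by (meson abs_ge_zero order_trans)
  have Zm [measurable]: "Z \<in> borel_measurable M" by (rule meas_M[OF Z(1) st(1)])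
  have Zi: "integrable M Z" by (rule integrable_const_bound[of _ B]) (use Z(2) in auto)
  have bm [measurable]: "bx s t x \<in> borel_measurable M" using bx_meas[of s t] st by (intro meas_M[of _ t]) auto
  have b2: "integrable M (\<lambda>\<omega>. (bx s t x \<omega>)^2)" using bx_moment(1)[OF st, of 1] by simp
  have bi: "integrable M (bx s t x)" by (rule square_integrable_imp_integrable[OF bm b2])
  show Zb: "integrable M (\<lambda>\<omega>. Z \<omega> * bx s t x \<omega>)"
    by (rule Bochner_Integration.integrable_bound[of _ "\<lambda>\<omega>. B * bx s t x \<omega>"])
       (use bi Z(2) B in \<open>auto simp: abs_mult intro!: mult_right_mono AE_I2\<close>)
  let ?b = "\<lambda>n \<omega>. \<Sum>k<n. ser (G k) x * (W k \<omega> t - W k \<omega> s)"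
  have Zbn: "integrable M (\<lambda>\<omega>. Z \<omega> * ?b n \<omega>)" "expectation (\<lambda>\<omega>. Z \<omega> * ?b n \<omega>) = 0" for n
  proof -
    have eq: "Z \<omega> * ?b n \<omega> = (\<Sum>k<n. ser (G k) x * (Z \<omega> * (W k \<omega> t - W k \<omega> s)))" for \<omega>
      unfolding sum_distrib_left by (intro sum.cong) auto
    show "integrable M (\<lambda>\<omega>. Z \<omega> * ?b n \<omega>)" "expectation (\<lambda>\<omega>. Z \<omega> * ?b n \<omega>) = 0"
      unfolding eq using mart_zero[OF st Z(1) Zi] by (simp_all add: Bochner_Integration.integral_sum)
  qed
  have est: "\<bar>expectation (\<lambda>\<omega>. Z \<omega> * bx s t x \<omega>)\<bar> \<le> B * (2 * C0) * sqrt (expectation (\<lambda>\<omega>. (SX n t \<omega>)^2))" for n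
  proof -
    have t0: "0 \<le> t" using st by simp
    have S2: "integrable M (\<lambda>\<omega>. (SX n t \<omega>)^2)" by (rule SX_int[OF t0])
    \<comment> \<open>\<open>SX\<close> is a supremum over uncountably many times; its absolute
      value is measurable as the square root of the integrable square.\<close>
    have Sm [measurable]: "(\<lambda>\<omega>. \<bar>SX n t \<omega>\<bar>) \<in> borel_measurable M"
      using measurable_compose[OF borel_measurable_integrable[OF S2] borel_measurable_sqrt] by simp
    have Si: "integrable M (\<lambda>\<omega>. \<bar>SX n t \<omega>\<bar>)"
      by (rule square_integrable_imp_integrable[OF Sm]) (use S2 in simp)
    have "expectation (\<lambda>\<omega>. Z \<omega> * bx s t x \<omega>) = expectation (\<lambda>\<omega>. Z \<omega> * bx s t x \<omega> - Z \<omega> * ?b n \<omega>)"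
      using Zb Zbn[of n] by simp
    then have "\<bar>expectation (\<lambda>\<omega>. Z \<omega> * bx s t x \<omega>)\<bar> = \<bar>expectation (\<lambda>\<omega>. Z \<omega> * bx s t x \<omega> - Z \<omega> * ?b n \<omega>)\<bar>"
      by (rule arg_cong)
    also have "\<dots> \<le> expectation (\<lambda>\<omega>. \<bar>Z \<omega> * bx s t x \<omega> - Z \<omega> * ?b n \<omega>\<bar>)" by (rule integral_abs_bound)
    also have "\<dots> \<le> expectation (\<lambda>\<omega>. B * (2 * C0) * \<bar>SX n t \<omega>\<bar>)"
    proof (rule integral_mono_AE)
      show "AE \<omega> in M. \<bar>Z \<omega> * bx s t x \<omega> - Z \<omega> * ?b n \<omega>\<bar> \<le> B * (2 * C0) * \<bar>SX n t \<omega>\<bar>"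
        using w_AE AE_space
      proof eventually_elim
        case (elim \<omega>)
        have "\<bar>Z \<omega> * (bx s t x \<omega> - ?b n \<omega>)\<bar> \<le> B * (2 * C0 * \<bar>SX n t \<omega>\<bar>)"
          unfolding abs_mult
        proof (intro mult_mono Z(2)[OF elim(2)] B)
          have "2 * C0 * SX n t \<omega> \<le> 2 * C0 * \<bar>SX n t \<omega>\<bar>" using C0_nonneg by (intro mult_left_mono) auto
          then show "\<bar>bx s t x \<omega> - ?b n \<omega>\<bar> \<le> 2 * C0 * \<bar>SX n t \<omega>\<bar>"
            using bx_approx[OF st(1) less_imp_le[OF st(2)] order_refl elim(2,1), of x n] by linarith
        qed simp
        then show ?case by (simp only: right_diff_distrib mult.assoc)
      qed
      show "integrable M (\<lambda>\<omega>. \<bar>Z \<omega> * bx s t x \<omega> - Z \<omega> * ?b n \<omega>\<bar>)"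
        by (intro integrable_abs Bochner_Integration.integrable_diff Zb Zbn(1))
      show "integrable M (\<lambda>\<omega>. B * (2 * C0) * \<bar>SX n t \<omega>\<bar>)" by (intro integrable_mult_right Si)
    qed
    also have "\<dots> = B * (2 * C0) * expectation (\<lambda>\<omega>. \<bar>SX n t \<omega>\<bar>)" by simp
    also have "\<dots> \<le> B * (2 * C0) * sqrt (expectation (\<lambda>\<omega>. (SX n t \<omega>)^2))"
    proof (intro mult_left_mono real_le_rsqrt)
      have "(expectation (\<lambda>\<omega>. \<bar>SX n t \<omega>\<bar> * 1))^2 \<le> expectation (\<lambda>\<omega>. \<bar>SX n t \<omega>\<bar>\<^sup>2) * expectation (\<lambda>\<omega>. 1^2)"
        by (rule int_CS) (use S2 Si in auto)
      then show "(expectation (\<lambda>\<omega>. \<bar>SX n t \<omega>\<bar>))^2 \<le> expectation (\<lambda>\<omega>. (SX n t \<omega>)^2)" by (simp add: prob_space)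
    qed (use B in auto)
    finally show ?thesis .
  qed
  have "(\<lambda>n. B * (2 * C0) * sqrt (expectation (\<lambda>\<omega>. (SX n t \<omega>)^2))) \<longlonglongrightarrow> B * (2 * C0) * sqrt 0"
    by (intro tendsto_intros SX_lim) (use st in simp)
  then have "\<bar>expectation (\<lambda>\<omega>. Z \<omega> * bx s t x \<omega>)\<bar> \<le> 0"
    using est by (intro LIMSEQ_le_const[of _ "0::real"]) auto
  then show "expectation (\<lambda>\<omega>. Z \<omega> * bx s t x \<omega>) = 0" by simp
qed

end

subsection \<open>Moment bounds and non-explosion\<close>

text \<open>In \<open>(x + y)\<^bsup>2q\<^esup>\<close> all terms of degree at least two in \<open>y\<close> carry a factor \<open>h\<close> when \<open>y = \<surd>h \<beta>\<close>.\<close>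

lemma young_step:
  fixes x y h :: real
  assumes h: "0 < h" "h \<le> 1" and q: "0 < q"
  shows "(x + y) ^ (2 * q) \<le> (1 + 4 ^ q * h) * x ^ (2 * q) + 2 * real q * (x ^ (2 * q - 1) * y) + 4 ^ q * h * (y ^ (2 * q) / h ^ q)"
proof -
  obtain j where j: "2 * q = Suc (Suc j)" using q by (cases q) auto
  have ev: "even (Suc (Suc j))" using j by (metis dvd_triv_left)
  define s \<beta> where "s = sqrt h" and "\<beta> = y / s"
  have s: "0 < s" "s \<le> 1" "s^2 = h" and y: "y = \<beta> * s" using h by (auto simp: s_def \<beta>_def)
  let ?n = "Suc (Suc j)"
  have \<beta>: "\<beta> ^ ?n = y ^ ?n / h ^ q" unfolding y j[symmetric] power_mult_distrib using h s by (simp add: power_mult)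
  have tm: "real (?n choose Suc (Suc k)) * y ^ Suc (Suc k) * x ^ (?n - Suc (Suc k)) \<le> real (?n choose Suc (Suc k)) * (h * (x ^ ?n + \<beta> ^ ?n))"
    if "k \<le> j" for k
  proof -
    let ?M = "max \<bar>\<beta>\<bar> \<bar>x\<bar>"
    have "\<bar>\<beta>\<bar> ^ Suc (Suc k) * \<bar>x\<bar> ^ (?n - Suc (Suc k)) \<le> ?M ^ Suc (Suc k) * ?M ^ (?n - Suc (Suc k))"
      by (intro mult_mono power_mono) auto
    also have "\<dots> = ?M ^ ?n" unfolding power_add[symmetric] using that by simp
    also have "\<dots> \<le> \<bar>x\<bar> ^ ?n + \<bar>\<beta>\<bar> ^ ?n" by (cases "\<bar>\<beta>\<bar> \<le> \<bar>x\<bar>") (simp_all add: max_def del: power_Suc)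
    finally have 1: "\<bar>\<beta>\<bar> ^ Suc (Suc k) * \<bar>x\<bar> ^ (?n - Suc (Suc k)) \<le> x ^ ?n + \<beta> ^ ?n"
      by (simp only: power_even_abs[OF ev])
    have "s ^ Suc (Suc k) = s^2 * s ^ k" by (simp add: power2_eq_square)
    also have "\<dots> \<le> h" using s h by (simp add: mult_left_le power_le_one)
    finally have 2: "s ^ Suc (Suc k) \<le> h" .
    have "y ^ Suc (Suc k) * x ^ (?n - Suc (Suc k)) \<le> \<bar>y ^ Suc (Suc k) * x ^ (?n - Suc (Suc k))\<bar>" by simp
    also have "\<dots> = s ^ Suc (Suc k) * (\<bar>\<beta>\<bar> ^ Suc (Suc k) * \<bar>x\<bar> ^ (?n - Suc (Suc k)))"
      unfolding y abs_mult power_abs power_mult_distrib using s by (simp add: mult_ac)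
    also have "\<dots> \<le> h * (x ^ ?n + \<beta> ^ ?n)" using 1 2 h s by (intro mult_mono) auto
    finally show ?thesis unfolding mult.assoc by (intro mult_left_mono) auto
  qed
  \<comment> \<open>All binomial coefficients of order \<open>2q\<close> add up to
    \<open>4 ^ q\<close>, the origin of this constant in every later moment bound.\<close>
  have cs: "(\<Sum>k\<le>j. real (?n choose Suc (Suc k))) \<le> 4 ^ q"
  proof -
    have "(\<Sum>k\<le>?n. ?n choose k) = 2 ^ ?n" by (rule choose_row_sum)
    then have "(\<Sum>k\<le>j. ?n choose Suc (Suc k)) \<le> 2 ^ ?n" by (simp only: sum.atMost_Suc_shift)
    then have "(\<Sum>k\<le>j. ?n choose Suc (Suc k)) \<le> 4 ^ q" unfolding j[symmetric] by (simp add: power_mult)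
    then have "real (\<Sum>k\<le>j. ?n choose Suc (Suc k)) \<le> real (4 ^ q)" by (rule of_nat_mono)
    then show ?thesis by simp
  qed
  have "(x + y) ^ ?n = (\<Sum>k\<le>?n. real (?n choose k) * y ^ k * x ^ (?n - k))"
    by (subst add.commute) (rule binomial_ring)
  also have "\<dots> = x ^ ?n + real ?n * y * x ^ Suc j + (\<Sum>k\<le>j. real (?n choose Suc (Suc k)) * y ^ Suc (Suc k) * x ^ (?n - Suc (Suc k)))"
    by (simp only: sum.atMost_Suc_shift) simp
  also have "\<dots> \<le> x ^ ?n + real ?n * y * x ^ Suc j + (\<Sum>k\<le>j. real (?n choose Suc (Suc k)) * (h * (x ^ ?n + \<beta> ^ ?n)))"
    by (intro add_left_mono sum_mono tm) simp
  also have "(\<Sum>k\<le>j. real (?n choose Suc (Suc k)) * (h * (x ^ ?n + \<beta> ^ ?n))) \<le> 4 ^ q * (h * (x ^ ?n + \<beta> ^ ?n))"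
    unfolding sum_distrib_right[symmetric]
    using cs h ev by (intro mult_right_mono mult_nonneg_nonneg add_nonneg_nonneg zero_le_even_power) auto
  finally have "(x + y) ^ ?n \<le> x ^ ?n + real ?n * y * x ^ Suc j + 4 ^ q * (h * (x ^ ?n + \<beta> ^ ?n))" by simp
  moreover have "2 * real q = real ?n" "2 * q - 1 = Suc j" using j by linarith+
  ultimately show ?thesis unfolding j \<beta> by (simp add: distrib_left distrib_right mult_ac del: of_nat_Suc power_Suc)
qed

definition Lp :: "nat \<Rightarrow> seq \<Rightarrow> ennreal" where
  "Lp q c = (\<integral>\<^sup>+x. ennreal (ser c x ^ (2 * q)) \<partial>torus)"

lemma ser_pow_integrable: "Hs c \<Longrightarrow> integrable torus (\<lambda>x. ser c x ^ k)"
  by (intro torus_int_cont continuous_intros ser_cont)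

lemma Lp_eq: "Hs c \<Longrightarrow> Lp q c = ennreal (tint (\<lambda>x. ser c x ^ (2 * q)))"
  unfolding Lp_def by (rule nn_integral_eq_integral[OF ser_pow_integrable]) (auto simp: zero_le_even_power)

lemma Lp_meas: "(\<And>k. (\<lambda>\<omega>. c \<omega> k) \<in> borel_measurable N) \<Longrightarrow> (\<lambda>\<omega>. Lp q (c \<omega>)) \<in> borel_measurable N"
proof -
  assume "\<And>k. (\<lambda>\<omega>. c \<omega> k) \<in> borel_measurable N"
  note [measurable] = ser_meas2[OF this]
  have "case_prod (\<lambda>\<omega> x. ennreal (ser (c \<omega>) x ^ (2 * q))) \<in> borel_measurable (N \<Otimes>\<^sub>M torus)"
    by (simp add: case_prod_beta')
  from torus.borel_measurable_nn_integral[OF this] show ?thesis unfolding Lp_def .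
qed

locale spde = flux A \<nu> + noisew M F W g WQ
  for A :: "real \<Rightarrow> real" and \<nu> :: real and M :: "'a measure" and F W g WQ +
  fixes a :: seq
  assumes Ha: "Hs a"
begin

lemma pm_step:
  assumes J: "initial J" and n: "0 < n" and m: "\<And>k m. k \<le> i \<Longrightarrow> (\<lambda>\<omega>. w \<omega> (real k / real n) m) \<in> borel_measurable N"
  shows "pm J N (\<lambda>\<omega>. stp n i (w \<omega>))"
  unfolding pm_def
proof
  fix m
  have [measurable]: "J \<in> sets borel" using J by (simp add: initial_def)
  have [measurable]: "(\<lambda>p. w (snd p) (real (min k i) / real n) m) \<in> borel_measurable (borel \<Otimes>\<^sub>M N)" for k
    using m[of "min k i"] by (rule measurable_compose[OF measurable_snd]) simp
  have [measurable]: "(\<lambda>p::real \<times> 'a. nat \<lfloor>real n * fst p\<rfloor>) \<in> measurable (borel \<Otimes>\<^sub>M N) (count_space UNIV)" by measurable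
  have "(\<lambda>p. w (snd p) (real (min (nat \<lfloor>real n * fst p\<rfloor>) i) / real n) m) \<in> borel_measurable (borel \<Otimes>\<^sub>M N)"
    by (rule measurable_compose_countable[where f="\<lambda>k p. w (snd p) (real (min k i) / real n) m"]) measurable
  then show "(\<lambda>p. indicator J (fst p) * stp n i (w (snd p)) (fst p) m) \<in> borel_measurable (borel \<Otimes>\<^sub>M N)"
    unfolding stp_def by measurable
qed

text \<open>Progressive measurability as a limit of left-point grid approximations; the grid times
  are capped at \<open>t\<close>, so that only noise values known at \<open>t\<close> occur.\<close>

lemma pm_w: assumes t: "0 \<le> t" shows "pm {0..t} (Fs t) w"
  unfolding pm_def
proof
  fix m
  let ?N = "(borel :: real measure) \<Otimes>\<^sub>M Fs t" and ?\<theta> = "\<lambda>n k. min (real k / real (Suc n)) t"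
  have [measurable]: "(\<lambda>p. w (snd p) (?\<theta> n k) m) \<in> borel_measurable ?N" for n k
    by (rule measurable_compose[OF measurable_snd meas_up[OF w_meas]]) (use t in auto)
  have [measurable]: "(\<lambda>p::real \<times> 'a. nat \<lfloor>real n * fst p\<rfloor>) \<in> measurable ?N (count_space UNIV)" for n by measurable
  have [measurable]: "(\<lambda>p. w (snd p) (?\<theta> n (nat \<lfloor>real (Suc n) * fst p\<rfloor>)) m) \<in> borel_measurable ?N" for n
    by (rule measurable_compose_countable[where f="\<lambda>k p. w (snd p) (?\<theta> n k) m"]) measurable
  show "(\<lambda>p. indicator {0..t} (fst p) * w (snd p) (fst p) m) \<in> borel_measurable ?N"
  proof (rule borel_measurable_LIMSEQ_real)
    show "(\<lambda>p. indicator {0..t} (fst p) * w (snd p) (?\<theta> n (nat \<lfloor>real (Suc n) * fst p\<rfloor>)) m) \<in> borel_measurable ?N" for n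
      by measurable
    fix p assume "p \<in> space ?N"
    then have \<omega>: "snd p \<in> space M" by (auto simp: space_pair_measure)
    show "(\<lambda>n. indicator {0..t} (fst p) * w (snd p) (?\<theta> n (nat \<lfloor>real (Suc n) * fst p\<rfloor>)) m) \<longlonglongrightarrow> indicator {0..t} (fst p) * w (snd p) (fst p) m"
    proof (cases "fst p \<in> {0..t}")
      case True
      define s where "s = fst p"
      define r where "r n = ?\<theta> n (nat \<lfloor>real (Suc n) * s\<rfloor>)" for n
      have s: "0 \<le> s" "s \<le> t" using True by (auto simp: s_def)
      have r: "r n \<le> s" "0 \<le> r n" "s - 1 / real (Suc n) \<le> r n" for n
      proof -
        let ?k = "nat \<lfloor>real (Suc n) * s\<rfloor>"
        have k: "real ?k \<le> real (Suc n) * s" "real (Suc n) * s < real ?k + 1" using s by (simp_all add: of_nat_nat del: of_nat_Suc)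
        have le: "real ?k / real (Suc n) \<le> s" using k(1) by (simp add: divide_le_eq mult.commute del: of_nat_Suc)
        then have eq: "r n = real ?k / real (Suc n)" using s by (simp add: r_def)
        show "r n \<le> s" "0 \<le> r n" using le by (simp_all add: eq)
        have "s = real (Suc n) * s / real (Suc n)" by simp
        also have "\<dots> \<le> (real ?k + 1) / real (Suc n)" using k(2) by (intro divide_right_mono) auto
        finally show "s - 1 / real (Suc n) \<le> r n" by (simp add: eq add_divide_distrib del: of_nat_Suc)
      qed
      have "(\<lambda>n. s - 1 / real (Suc n)) \<longlonglongrightarrow> s - 0"
        by (intro tendsto_diff tendsto_const) (use LIMSEQ_inverse_real_of_nat in \<open>simp add: inverse_eq_divide\<close>)
      then have "r \<longlonglongrightarrow> s"
        by (intro tendsto_sandwich[of "\<lambda>n. s - 1 / real (Suc n)" r sequentially "\<lambda>_. s"] always_eventually allI r) auto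
      moreover have "continuous_on {0..} (\<lambda>t. w (snd p) t m)" using w_gp[OF \<omega>] by (simp add: gp_def)
      ultimately have "(\<lambda>n. w (snd p) (r n) m) \<longlonglongrightarrow> w (snd p) s m"
        using s r(2) by (intro continuous_on_tendsto_compose[of "{0..}" "\<lambda>t. w (snd p) t m"]) auto
      then show ?thesis using True by (simp add: r_def s_def)
    qed simp
  qed
qed

definition uR :: "real \<Rightarrow> 'a \<Rightarrow> real \<Rightarrow> seq" where "uR R \<omega> = sol R (Yp a (w \<omega>))"
definition V :: "real \<Rightarrow> nat \<Rightarrow> nat \<Rightarrow> 'a \<Rightarrow> real \<Rightarrow> seq" where "V R n i \<omega> = vst R a n i (w \<omega>)"

lemma w_gb: "\<omega> \<in> space M \<Longrightarrow> gb (w \<omega>)"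
  by (rule gp_gb[OF w_gp])

lemma uR_meas: "0 \<le> t \<Longrightarrow> (\<lambda>\<omega>. uR R \<omega> t m) \<in> borel_measurable (Fs t)"
  unfolding uR_def
  by (rule pm_section[OF sol_pm[OF initial_Icc Yp_pm[OF initial_Icc pm_w]]]) auto

lemma V_pm:
  assumes "initial J" "0 < n" "\<And>k m. k \<le> i \<Longrightarrow> (\<lambda>\<omega>. w \<omega> (real k / real n) m) \<in> borel_measurable N"
  shows "pm J N (V R n i)"
  unfolding V_def[abs_def] vst_def by (intro sol_pm Yp_pm pm_step assms)

lemma Dex_pm:
  assumes J: "initial J" and v: "pm J N v"
  shows "(\<lambda>p. indicator J (fst p) * Dex R (v (snd p)) (fst p)) \<in> borel_measurable (borel \<Otimes>\<^sub>M N)"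
  unfolding Dex_def
proof (rule conv_pm[OF J, where f="\<lambda>\<omega> s. max 0 (nrm (v \<omega> s) - R)"])
  have [measurable]: "J \<in> sets borel" using J by (simp add: initial_def)
  have [measurable]: "(\<lambda>p. nrm (\<lambda>m. indicator J (fst p) * v (snd p) (fst p) m)) \<in> borel_measurable (borel \<Otimes>\<^sub>M N)"
    by (rule nrm_meas) (use v in \<open>simp add: pm_def\<close>)
  have "(\<lambda>p. indicator J (fst p) * max 0 (nrm (\<lambda>m. indicator J (fst p) * v (snd p) (fst p) m) - R)) \<in> borel_measurable (borel \<Otimes>\<^sub>M N)"
    by measurable
  also have "(\<lambda>p. indicator J (fst p) * max 0 (nrm (\<lambda>m. indicator J (fst p) * v (snd p) (fst p) m) - R))
     = (\<lambda>p. indicator J (fst p) * max 0 (nrm (v (snd p) (fst p)) - R))"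
    by (rule ext) (simp add: indicator_def)
  finally show "(\<lambda>p. indicator J (fst p) * max 0 (nrm (v (snd p) (fst p)) - R)) \<in> borel_measurable (borel \<Otimes>\<^sub>M N)" .
qed

lemma w_grid: "0 < n \<Longrightarrow> k \<le> i \<Longrightarrow> (\<lambda>\<omega>. w \<omega> (real k / real n) m) \<in> borel_measurable (Fs (real i / real n))"
  by (rule meas_up[OF w_meas]) (auto simp: divide_right_mono)

lemma V_meas: assumes "0 < n" "0 \<le> t" shows "(\<lambda>\<omega>. V R n i \<omega> t m) \<in> borel_measurable (Fs (real i / real n))"
  by (rule pm_section[OF V_pm[OF initial_Icc assms(1) w_grid[OF assms(1)]], where t=t]) (use assms in auto)

lemma D_meas: assumes "0 < n" "0 \<le> t" shows "(\<lambda>\<omega>. Dex R (V R n i \<omega>) t) \<in> borel_measurable (Fs (real i / real n))"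
proof -
  let ?N = "Fs (real i / real n)"
  have 1: "(\<lambda>p. indicator {0..t} (fst p) * Dex R (V R n i (snd p)) (fst p)) \<in> borel_measurable (borel \<Otimes>\<^sub>M ?N)"
    by (rule Dex_pm[OF initial_Icc V_pm[OF initial_Icc assms(1) w_grid[OF assms(1)]]])
  have "(\<lambda>\<omega>. (t, \<omega>)) \<in> measurable ?N (borel \<Otimes>\<^sub>M ?N)" by simp
  from measurable_compose[OF this 1] show ?thesis using assms by simp
qed

text \<open>The bound on the moment of order \<open>2q\<close> of an increment over a time step
  \<open>h\<close>, after division by \<open>h ^ q\<close>.\<close>

definition \<Gamma> :: seq where "\<Gamma> q = gmom q * (C0^2 * D0) ^ q"

lemma \<Gamma>_nonneg: "0 \<le> \<Gamma> q"
  unfolding \<Gamma>_def using D0_nonneg by (intro mult_nonneg_nonneg zero_le_power) auto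

text \<open>Expectation of \<open>young_step\<close>: the linear term vanishes by
  \<open>bx_mart\<close>, since \<open>Z\<close> restricted to \<open>E\<close> is bounded and known
  at time \<open>s\<close>, and \<open>bx_moment\<close> controls the last term.\<close>

lemma noise_step_pt:
  assumes s: "0 \<le> s" and h: "0 < h" "h \<le> 1" and q: "0 < q"
    and Z: "Z \<in> borel_measurable (Fs s)" "\<And>\<omega>. \<omega> \<in> space M \<Longrightarrow> \<bar>Z \<omega>\<bar> \<le> B" and E: "E \<in> sets (Fs s)"
  shows "(\<integral>\<^sup>+\<omega>. indicator E \<omega> * ennreal ((Z \<omega> + bx s (s + h) x \<omega>) ^ (2 * q)) \<partial>M)
     \<le> ennreal (1 + 4 ^ q * h) * (\<integral>\<^sup>+\<omega>. indicator E \<omega> * ennreal (Z \<omega> ^ (2 * q)) \<partial>M) + ennreal (4 ^ q * h * \<Gamma> q)"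
proof -
  obtain x0 where "x0 \<in> space M" using not_empty by blast
  then have B: "0 \<le> B" using Z(2) by (meson abs_ge_zero order_trans)
  have st: "s < s + h" using h by simp
  let ?b = "bx s (s + h) x" and ?I = "\<lambda>\<omega>. indicator E \<omega> :: real"
  have ev: "0 \<le> z ^ (2 * q)" for z :: real by (simp add: zero_le_even_power)
  have [measurable]: "Z \<in> borel_measurable M" "E \<in> sets M" using meas_M[OF Z(1) s] F_alg[OF s] E Fs_sets[OF s] by auto
  have [measurable]: "?b \<in> borel_measurable M" using bx_meas[of s "s + h"] s h by (intro meas_M[of _ "s + h"]) auto
  have Zp: "integrable M (\<lambda>\<omega>. ?I \<omega> * Z \<omega> ^ (2 * q))"
  proof (rule integrable_const_bound[of _ "B ^ (2 * q)"])
    show "AE \<omega> in M. norm (?I \<omega> * Z \<omega> ^ (2 * q)) \<le> B ^ (2 * q)"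
    proof (rule AE_I2)
      fix \<omega> assume "\<omega> \<in> space M"
      then have "\<bar>Z \<omega>\<bar> ^ (2 * q) \<le> B ^ (2 * q)" using Z(2) by (intro power_mono) auto
      then show "norm (?I \<omega> * Z \<omega> ^ (2 * q)) \<le> B ^ (2 * q)" using B power_even_abs[of "2 * q" "Z \<omega>"] by (simp add: indicator_def)
    qed
  qed measurable
  have Z1: "(\<lambda>\<omega>. ?I \<omega> * Z \<omega> ^ (2 * q - 1)) \<in> borel_measurable (Fs s)"
    using Z(1) E by (intro borel_measurable_times borel_measurable_power borel_measurable_indicator)
  have Z1b: "\<bar>?I \<omega> * Z \<omega> ^ (2 * q - 1)\<bar> \<le> B ^ (2 * q - 1)" if "\<omega> \<in> space M" for \<omega>
  proof -
    have "\<bar>Z \<omega>\<bar> ^ (2 * q - 1) \<le> B ^ (2 * q - 1)" using Z(2)[OF that] by (intro power_mono) auto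
    then show ?thesis using B by (simp add: indicator_def power_abs abs_mult)
  qed
  note mart = bx_mart[OF s st Z1 Z1b, where x=x]
  note mom = bx_moment[OF s st q, where x=x]
  let ?r = "\<lambda>\<omega>. (1 + 4 ^ q * h) * (?I \<omega> * Z \<omega> ^ (2 * q)) + 2 * real q * (?I \<omega> * Z \<omega> ^ (2 * q - 1) * ?b \<omega>) + 4 ^ q * h / h ^ q * ?b \<omega> ^ (2 * q)"
  have le: "?I \<omega> * (Z \<omega> + ?b \<omega>) ^ (2 * q) \<le> ?r \<omega>" for \<omega>
  proof (cases "\<omega> \<in> E")
    case True
    then show ?thesis using young_step[OF h q, of "Z \<omega>" "?b \<omega>"] by simp
  next
    case False
    then show ?thesis using h ev by (simp add: mult_nonneg_nonneg)
  qed
  have r0: "0 \<le> ?r \<omega>" for \<omega> using le[of \<omega>] ev[of "Z \<omega> + ?b \<omega>"] by (intro order_trans[OF _ le]) (simp add: mult_nonneg_nonneg)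
  have ri: "integrable M ?r" using Zp mart(1) mom(1) by (intro Bochner_Integration.integrable_add integrable_mult_right) auto
  have "expectation ?r = (1 + 4 ^ q * h) * expectation (\<lambda>\<omega>. ?I \<omega> * Z \<omega> ^ (2 * q)) + 4 ^ q * h / h ^ q * expectation (\<lambda>\<omega>. ?b \<omega> ^ (2 * q))"
    using Zp mart mom(1) by simp
  also have "4 ^ q * h / h ^ q * expectation (\<lambda>\<omega>. ?b \<omega> ^ (2 * q)) \<le> 4 ^ q * h / h ^ q * (gmom q * ((s + h - s) * (C0^2 * D0)) ^ q)"
    using h by (intro mult_left_mono mom(2)) auto
  also have "\<dots> = 4 ^ q * h * \<Gamma> q" using h by (simp add: \<Gamma>_def power_mult_distrib)
  finally have E: "expectation ?r \<le> (1 + 4 ^ q * h) * expectation (\<lambda>\<omega>. ?I \<omega> * Z \<omega> ^ (2 * q)) + 4 ^ q * h * \<Gamma> q" by simp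
  have "(\<integral>\<^sup>+\<omega>. indicator E \<omega> * ennreal ((Z \<omega> + ?b \<omega>) ^ (2 * q)) \<partial>M) = (\<integral>\<^sup>+\<omega>. ennreal (?I \<omega> * (Z \<omega> + ?b \<omega>) ^ (2 * q)) \<partial>M)"
    by (intro nn_integral_cong) (simp add: indicator_def)
  also have "\<dots> \<le> (\<integral>\<^sup>+\<omega>. ennreal (?r \<omega>) \<partial>M)" by (intro nn_integral_mono ennreal_leI le)
  also have "\<dots> = ennreal (expectation ?r)" using nn_integral_eq_integral[OF ri] r0 by simp
  also have "\<dots> \<le> ennreal ((1 + 4 ^ q * h) * expectation (\<lambda>\<omega>. ?I \<omega> * Z \<omega> ^ (2 * q)) + 4 ^ q * h * \<Gamma> q)" by (rule ennreal_leI[OF E])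
  also have "\<dots> = ennreal (1 + 4 ^ q * h) * ennreal (expectation (\<lambda>\<omega>. ?I \<omega> * Z \<omega> ^ (2 * q))) + ennreal (4 ^ q * h * \<Gamma> q)"
    using h \<Gamma>_nonneg ev by (simp add: ennreal_plus ennreal_mult' mult_nonneg_nonneg)
  also have "ennreal (expectation (\<lambda>\<omega>. ?I \<omega> * Z \<omega> ^ (2 * q))) = (\<integral>\<^sup>+\<omega>. ennreal (?I \<omega> * Z \<omega> ^ (2 * q)) \<partial>M)"
    by (rule nn_integral_eq_integral[OF Zp, symmetric]) (use ev in \<open>simp add: mult_nonneg_nonneg\<close>)
  also have "\<dots> = (\<integral>\<^sup>+\<omega>. indicator E \<omega> * ennreal (Z \<omega> ^ (2 * q)) \<partial>M)"
    by (intro nn_integral_cong) (simp add: indicator_def)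
  finally show ?thesis .
qed

lemma swap_Lp:
  assumes [measurable]: "\<And>k. (\<lambda>\<omega>. c \<omega> k) \<in> borel_measurable M" "E \<in> sets M"
  shows "(\<integral>\<^sup>+\<omega>. indicator E \<omega> * Lp q (c \<omega>) \<partial>M) = (\<integral>\<^sup>+x. \<integral>\<^sup>+\<omega>. indicator E \<omega> * ennreal (ser (c \<omega>) x ^ (2 * q)) \<partial>M \<partial>torus)"
proof -
  interpret P: pair_sigma_finite M torus ..
  note [measurable] = ser_meas2[OF assms(1)]
  have "(\<integral>\<^sup>+\<omega>. indicator E \<omega> * Lp q (c \<omega>) \<partial>M) = (\<integral>\<^sup>+\<omega>. \<integral>\<^sup>+x. indicator E \<omega> * ennreal (ser (c \<omega>) x ^ (2 * q)) \<partial>torus \<partial>M)"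
    unfolding Lp_def
  proof (intro nn_integral_cong nn_integral_cmult[symmetric])
    fix \<omega> assume "\<omega> \<in> space M"
    then show "(\<lambda>x. ennreal (ser (c \<omega>) x ^ (2 * q))) \<in> borel_measurable torus"
      using measurable_compose[OF measurable_Pair1'[of \<omega> M torus] ser_meas2[OF assms(1)]] by simp
  qed
  also have "\<dots> = (\<integral>\<^sup>+x. \<integral>\<^sup>+\<omega>. indicator E \<omega> * ennreal (ser (c \<omega>) x ^ (2 * q)) \<partial>M \<partial>torus)"
    by (rule P.Fubini'[symmetric]) (simp add: case_prod_beta')
  finally show ?thesis .
qed

text \<open>\<open>noise_step_pt\<close> at every \<open>x\<close>, integrated over the torus by
  Tonelli; the norm bound on \<open>E\<close> provides the bound on the values at \<open>x\<close>
  that the martingale property asks for.\<close>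

lemma noise_step:
  assumes s: "0 \<le> s" and h: "0 < h" "h \<le> 1" and q: "0 < q" and E: "E \<in> sets (Fs s)"
    and c: "\<And>k. (\<lambda>\<omega>. c \<omega> k) \<in> borel_measurable (Fs s)" and cE: "\<And>\<omega>. \<omega> \<in> E \<Longrightarrow> Hs (c \<omega>) \<and> nrm (c \<omega>) \<le> R"
  shows "(\<integral>\<^sup>+\<omega>. indicator E \<omega> * Lp q (\<lambda>m. c \<omega> m + (w \<omega> (s + h) m - w \<omega> s m)) \<partial>M)
    \<le> ennreal (1 + 4 ^ q * h) * (\<integral>\<^sup>+\<omega>. indicator E \<omega> * Lp q (c \<omega>) \<partial>M) + ennreal (4 ^ q * h * \<Gamma> q)"
proof -
  let ?J = "\<lambda>x. \<integral>\<^sup>+\<omega>. indicator E \<omega> * ennreal (ser (c \<omega>) x ^ (2 * q)) \<partial>M"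
  let ?d = "\<lambda>\<omega> m. c \<omega> m + (w \<omega> (s + h) m - w \<omega> s m)"
  have EM [measurable]: "E \<in> sets M" using F_alg[OF s] E Fs_sets[OF s] by auto
  have EE: "\<omega> \<in> space M" if "\<omega> \<in> E" for \<omega> using sets.sets_into_space[OF EM] that by auto
  have cM [measurable]: "(\<lambda>\<omega>. c \<omega> k) \<in> borel_measurable M" for k by (rule meas_M[OF c s])
  have wM [measurable]: "(\<lambda>\<omega>. w \<omega> t m) \<in> borel_measurable M" if "0 \<le> t" for t m by (rule meas_M[OF w_meas[OF that] that])
  have dM: "(\<lambda>\<omega>. c \<omega> m + (w \<omega> (s + h) m - w \<omega> s m)) \<in> borel_measurable M" for m
    using s h by (intro borel_measurable_add borel_measurable_diff cM wM) auto
  interpret P: pair_sigma_finite M torus ..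
  let ?Z = "\<lambda>x \<omega>. indicator E \<omega> * ser (c \<omega>) x :: real"
  have pt: "(\<integral>\<^sup>+\<omega>. indicator E \<omega> * ennreal (ser (?d \<omega>) x ^ (2 * q)) \<partial>M)
    \<le> ennreal (1 + 4 ^ q * h) * ?J x + ennreal (4 ^ q * h * \<Gamma> q)" for x
  proof -
    have eq: "ser (?d \<omega>) x = ?Z x \<omega> + bx s (s + h) x \<omega>" if "\<omega> \<in> E" for \<omega>
    proof -
      have "Hs (\<lambda>m. w \<omega> (s + h) m - w \<omega> s m)" by (intro Hs_diff w_Hs EE that) (use s h in auto)
      then show ?thesis using ser_add[of "c \<omega>" "\<lambda>m. w \<omega> (s + h) m - w \<omega> s m" x] cE[OF that] that by (simp add: bx_def)
    qed
    have "(\<integral>\<^sup>+\<omega>. indicator E \<omega> * ennreal (ser (?d \<omega>) x ^ (2 * q)) \<partial>M)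
      = (\<integral>\<^sup>+\<omega>. indicator E \<omega> * ennreal ((?Z x \<omega> + bx s (s + h) x \<omega>) ^ (2 * q)) \<partial>M)"
      by (intro nn_integral_cong) (use eq in \<open>auto simp: indicator_def\<close>)
    also have "\<dots> \<le> ennreal (1 + 4 ^ q * h) * (\<integral>\<^sup>+\<omega>. indicator E \<omega> * ennreal (?Z x \<omega> ^ (2 * q)) \<partial>M) + ennreal (4 ^ q * h * \<Gamma> q)"
    proof (rule noise_step_pt[OF s h q _ _ E, where B="C0 * \<bar>R\<bar>"])
      show "?Z x \<in> borel_measurable (Fs s)"
        by (intro borel_measurable_times borel_measurable_indicator E ser_meas1 c)
      fix \<omega>
      show "\<bar>?Z x \<omega>\<bar> \<le> C0 * \<bar>R\<bar>"
      proof (cases "\<omega> \<in> E")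
        case True
        have "\<bar>ser (c \<omega>) x\<bar> \<le> C0 * nrm (c \<omega>)" using cE[OF True] by (intro ser_bound) simp
        also have "\<dots> \<le> C0 * \<bar>R\<bar>" using cE[OF True] by (intro mult_left_mono) auto
        finally show ?thesis using True by simp
      qed simp
    qed
    also have "(\<integral>\<^sup>+\<omega>. indicator E \<omega> * ennreal (?Z x \<omega> ^ (2 * q)) \<partial>M) = ?J x"
      by (intro nn_integral_cong) (auto simp: indicator_def)
    finally show ?thesis .
  qed
  note [measurable] = ser_meas2[OF cM]
  have im [measurable]: "(\<lambda>x. \<integral>\<^sup>+\<omega>. indicator E \<omega> * ennreal (ser (c \<omega>) x ^ (2 * q)) \<partial>M) \<in> borel_measurable torus"
  proof (rule borel_measurable_nn_integral)
    have sw: "(\<lambda>p. (snd p, fst p)) \<in> measurable (torus \<Otimes>\<^sub>M M) (M \<Otimes>\<^sub>M torus)" by measurable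
    have "(\<lambda>p. indicator E (fst p) * ennreal (ser (c (fst p)) (snd p) ^ (2 * q))) \<in> borel_measurable (M \<Otimes>\<^sub>M torus)" by measurable
    from measurable_compose[OF sw this]
    show "case_prod (\<lambda>x \<omega>. indicator E \<omega> * ennreal (ser (c \<omega>) x ^ (2 * q))) \<in> borel_measurable (torus \<Otimes>\<^sub>M M)"
      by (simp add: case_prod_beta')
  qed
  have e1: "emeasure torus {0..1} = 1" using torus.emeasure_space_1 by simp
  have "(\<integral>\<^sup>+\<omega>. indicator E \<omega> * Lp q (?d \<omega>) \<partial>M)
     \<le> (\<integral>\<^sup>+x. ennreal (1 + 4 ^ q * h) * ?J x + ennreal (4 ^ q * h * \<Gamma> q) \<partial>torus)"
    unfolding swap_Lp[OF dM EM] by (intro nn_integral_mono pt)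
  also have "\<dots> = ennreal (1 + 4 ^ q * h) * (\<integral>\<^sup>+x. \<integral>\<^sup>+\<omega>. indicator E \<omega> * ennreal (ser (c \<omega>) x ^ (2 * q)) \<partial>M \<partial>torus) + ennreal (4 ^ q * h * \<Gamma> q)"
    by (subst nn_integral_add) (simp_all add: nn_integral_cmult e1)
  finally show ?thesis unfolding swap_Lp[OF cM EM] .
qed

end

lemma conv_at_0: "conv \<mu> f 0 = 0"
proof -
  have "AE s in ton 0. exp (- \<mu> * (0 - s)) * f s = 0"
    using ae_ne_Icc[where a=0 and b=0 and c=0] AE_space[of "ton 0"] by eventually_elim auto
  then show ?thesis unfolding conv_def by (rule integral_eq_zero_AE)
qed

context flux begin

lemma V_adm: "gb w \<Longrightarrow> Hs u0 \<Longrightarrow> 0 \<le> R \<Longrightarrow> 0 < n \<Longrightarrow> adm {0..} (vst R u0 n i w)"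
  unfolding vst_def by (intro sol_adm Yp_adm gb_stp)

lemma Dex_agree:
  assumes "gb w" "Hs u0" "0 \<le> R" "0 < n" "i \<le> L" "t \<le> real (Suc i) / real n"
  shows "Dex R (vst R u0 n L w) t = Dex R (vst R u0 n i w) t"
  unfolding Dex_def
proof (rule conv_cong_ae[OF _ Dex_integrand Dex_integrand])
  fix s assume "0 \<le> s" "s < t"
  then show "max 0 (nrm (vst R u0 n L w s) - R) = max 0 (nrm (vst R u0 n i w s) - R)"
    using vst_agree[OF assms(1-5), of s] assms(6) by simp
qed (intro V_adm assms)+

text \<open>The mean value inequality turns the growth of \<open>deriv A\<close> into degree
  \<open>pA + 1\<close> for \<open>A\<close>; the tenth power then has the even degree
  \<open>2q\<close> with \<open>q = 5 (pA + 1)\<close>.\<close>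

lemma growth:
  obtains q C where "0 < q" "0 \<le> C" "\<And>v. A v ^ 10 \<le> C * (1 + v ^ (2 * q))"
proof -
  obtain C1 pA where C1: "0 < C1" "\<And>v. \<bar>deriv A v\<bar> \<le> C1 * (1 + \<bar>v\<bar> ^ pA)"
    using flux unfolding flux_assms_def by blast
  define D where "D = \<bar>A 0\<bar> + 2 * C1"
  have D: "0 \<le> D" using C1(1) by (simp add: D_def)
  have *: "A v ^ 10 \<le> D ^ 10 * (1 + v ^ (2 * (5 * Suc pA)))" for v
  proof -
    define m where "m = max 1 \<bar>v\<bar>"
    have m: "1 \<le> m" "\<bar>v\<bar> \<le> m" by (auto simp: m_def)
    have pm: "\<bar>x\<bar> ^ pA \<le> m ^ pA" "1 \<le> m ^ pA" if "\<bar>x\<bar> \<le> \<bar>v\<bar>" for x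
      using that m by (auto intro!: power_mono one_le_power)
    have "\<bar>A v - A 0\<bar> \<le> (2 * C1 * m ^ pA) * \<bar>v - 0\<bar>"
    proof -
      have "norm (A v - A 0) \<le> (2 * C1 * m ^ pA) * norm (v - 0)"
      proof (rule field_differentiable_bound[of "{-\<bar>v\<bar>..\<bar>v\<bar>}" A "deriv A"])
        fix x assume "x \<in> {-\<bar>v\<bar>..\<bar>v\<bar>}"
        then have x: "\<bar>x\<bar> \<le> \<bar>v\<bar>" by auto
        have "\<bar>deriv A x\<bar> \<le> C1 * (1 + \<bar>x\<bar> ^ pA)" by (rule C1(2))
        also have "\<dots> \<le> C1 * (m ^ pA + m ^ pA)" using C1(1) pm[OF x] by (intro mult_left_mono add_mono) auto
        finally show "norm (deriv A x) \<le> 2 * C1 * m ^ pA" by simp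
      qed (auto intro: A_deriv)
      then show ?thesis by simp
    qed
    also have "\<dots> \<le> (2 * C1 * m ^ pA) * m" using C1(1) m by (intro mult_left_mono) auto
    finally have "\<bar>A v\<bar> \<le> \<bar>A 0\<bar> * 1 + 2 * C1 * m ^ Suc pA" by (simp add: mult_ac)
    also have "\<dots> \<le> \<bar>A 0\<bar> * m ^ Suc pA + 2 * C1 * m ^ Suc pA"
      by (intro add_right_mono mult_left_mono one_le_power m) auto
    also have "\<dots> = D * m ^ Suc pA" by (simp add: D_def algebra_simps)
    finally have "\<bar>A v\<bar> ^ 10 \<le> (D * m ^ Suc pA) ^ 10" by (intro power_mono) auto
    then have "A v ^ 10 \<le> (D * m ^ Suc pA) ^ 10" by simp
    also have "\<dots> = D ^ 10 * m ^ (2 * (5 * Suc pA))" unfolding power_mult_distrib power_mult[symmetric] by (simp add: mult_ac)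
    also have "m ^ (2 * (5 * Suc pA)) \<le> 1 + v ^ (2 * (5 * Suc pA))"
    proof (cases "\<bar>v\<bar> \<le> 1")
      case True
      have "0 \<le> v ^ (2 * (5 * Suc pA))" by (rule zero_le_even_power) simp
      then show ?thesis using True by (simp add: m_def max_def del: mult_Suc_right)
    next
      case False
      have "\<bar>v\<bar> ^ (2 * (5 * Suc pA)) = v ^ (2 * (5 * Suc pA))" by (rule power_even_abs) simp
      then show ?thesis using False by (simp add: m_def max_def del: mult_Suc_right)
    qed
    finally show ?thesis using D by (simp add: mult_left_mono)
  qed
  show ?thesis by (rule that[OF _ _ *]) (use D in auto)
qed

end

context spde begin

text \<open>A killed moment: a sample point drops out for good once \<open>Dex\<close> has become
  positive. The bounds below hold uniformly in \<open>R\<close>.\<close>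

definition mI :: "nat \<Rightarrow> real \<Rightarrow> nat \<Rightarrow> nat \<Rightarrow> ennreal" where
  "mI q R n i = (\<integral>\<^sup>+\<omega>. indicator {\<omega>\<in>space M. Dex R (V R n i \<omega>) (real i / real n) = 0} \<omega> * Lp q (V R n i \<omega> (real i / real n)) \<partial>M)"

lemma V_0: assumes "\<omega> \<in> space M" "0 \<le> R" "0 < n" shows "V R n 0 \<omega> 0 m = a m"
proof -
  note g = gb_stp[OF w_gb[OF assms(1)] assms(3)]
  have "V R n 0 \<omega> 0 m = Yp a (stp n 0 (w \<omega>)) 0 m"
    unfolding V_def vst_def using sol_eq[OF Yp_adm[OF g Ha] assms(2), of 0] by (simp add: conv_at_0)
  also have "\<dots> = a m" using w_zero[OF assms(1)] by (simp add: Yp_def stp_def conv_at_0)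
  finally show ?thesis .
qed

lemma V_Hs: assumes "\<omega> \<in> space M" "0 \<le> R" "0 < n" "0 \<le> t" shows "Hs (V R n i \<omega> t)"
  using V_adm[OF w_gb[OF assms(1)] Ha assms(2,3)] assms(4) by (simp add: V_def adm_def)

lemma V_decrease:
  assumes \<omega>: "\<omega> \<in> space M" and R: "0 \<le> R" and n: "0 < n" and t: "real i / real n \<le> t" and q: "0 < q"
    and D: "Dex R (V R n i \<omega>) t = 0"
  shows "Dex R (V R n i \<omega>) (real i / real n) = 0" "Lp q (V R n i \<omega> t) \<le> Lp q (V R n i \<omega> (real i / real n))"
proof -
  have "Dex R (V R n i \<omega>) (real i / real n) = 0 \<and> Lp q (V R n i \<omega> t) \<le> Lp q (V R n i \<omega> (real i / real n))"
  proof (cases "t = real i / real n")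
    case False
    define \<tau> where "\<tau> = t - real i / real n"
    have \<tau>: "0 < \<tau>" "t = real i / real n + \<tau>" using False t by (auto simp: \<tau>_def)
    obtain j where j: "2 * q = Suc (Suc j)" using q by (cases q) auto
    have ev: "even j" using j by presburger
    note vs = vst_step[OF w_gb[OF \<omega>] Ha R n \<tau>(1) ev, folded V_def, OF D[unfolded \<tau>(2)], folded \<tau>(2)]
    have t0: "0 \<le> t" using t by (rule order_trans[rotated]) simp
    show ?thesis using vs(2,3) by (simp add: Lp_eq V_Hs[OF \<omega> R n] t0 j ennreal_leI del: power_Suc)
  qed (use D in simp)
  then show "Dex R (V R n i \<omega>) (real i / real n) = 0" "Lp q (V R n i \<omega> t) \<le> Lp q (V R n i \<omega> (real i / real n))" by auto
qed

text \<open>One cell is a noise-free flow followed by a jump: \<open>noise_step\<close> handles the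
  jump, and \<open>V_decrease\<close> carries moment and event back to the start of the
  cell.\<close>

lemma mI_Suc:
  assumes R: "0 \<le> R" and n: "0 < n" and q: "0 < q"
  shows "mI q R n (Suc i) \<le> ennreal (1 + 4 ^ q / real n) * mI q R n i + ennreal (4 ^ q / real n * \<Gamma> q)"
proof -
  let ?s = "real i / real n" and ?t = "real (Suc i) / real n" and ?h = "1 / real n"
  have st: "?s + ?h = ?t" by (simp add: add_divide_distrib)
  have s0: "0 \<le> ?s" "0 < ?h" "?h \<le> 1" "0 \<le> ?t" "?s \<le> ?t" using n by (auto simp: divide_right_mono)
  define E where "E = {\<omega>\<in>space M. Dex R (V R n i \<omega>) ?t = 0}"
  have DE: "{\<omega>\<in>space M. Dex R (V R n (Suc i) \<omega>) ?t = 0} = E"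
    unfolding E_def using Dex_agree[OF w_gb Ha R n, of _ i "Suc i" ?t] by (auto simp: V_def)
  \<comment> \<open>The event concerns times up to \<open>Suc i / n\<close>, but the solution is
    driven there by noise frozen at \<open>i / n\<close>. Hence the event is already known at
    \<open>i / n\<close>, before the next increment.\<close>
  have E: "E \<in> sets (Fs ?s)"
  proof -
    have [measurable]: "(\<lambda>\<omega>. Dex R (V R n i \<omega>) ?t) \<in> borel_measurable (Fs ?s)" by (rule D_meas[OF n s0(4)])
    have "{\<omega>\<in>space (Fs ?s). Dex R (V R n i \<omega>) ?t = 0} \<in> sets (Fs ?s)" by measurable
    then show ?thesis by (simp add: E_def)
  qed
  have cE: "Hs (V R n i \<omega> ?t) \<and> nrm (V R n i \<omega> ?t) \<le> R" if "\<omega> \<in> E" for \<omega>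
  proof -
    have \<omega>: "\<omega> \<in> space M" "Dex R (V R n i \<omega>) (?s + ?h) = 0" using that unfolding st by (auto simp: E_def)
    have "nrm (V R n i \<omega> (?s + ?h)) \<le> R"
      using vst_step(1)[OF w_gb[OF \<omega>(1)] Ha R n s0(2), of 0 i] \<omega>(2) by (simp add: V_def)
    then show ?thesis using V_Hs[OF \<omega>(1) R n s0(4)] unfolding st by simp
  qed
  have "mI q R n (Suc i) = (\<integral>\<^sup>+\<omega>. indicator E \<omega> * Lp q (\<lambda>m. V R n i \<omega> ?t m + (w \<omega> (?s + ?h) m - w \<omega> ?s m)) \<partial>M)"
    unfolding mI_def DE
  proof (rule nn_integral_cong)
    fix \<omega> assume \<omega>: "\<omega> \<in> space M"
    have "V R n (Suc i) \<omega> ?t = (\<lambda>m. V R n i \<omega> ?t m + (w \<omega> (?s + ?h) m - w \<omega> ?s m))"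
      unfolding V_def st by (rule ext) (rule vst_Suc[OF w_gb[OF \<omega>] Ha R n])
    then show "indicator E \<omega> * Lp q (V R n (Suc i) \<omega> ?t) = indicator E \<omega> * Lp q (\<lambda>m. V R n i \<omega> ?t m + (w \<omega> (?s + ?h) m - w \<omega> ?s m))" by simp
  qed
  also have "\<dots> \<le> ennreal (1 + 4 ^ q * ?h) * (\<integral>\<^sup>+\<omega>. indicator E \<omega> * Lp q (V R n i \<omega> ?t) \<partial>M) + ennreal (4 ^ q * ?h * \<Gamma> q)"
    by (rule noise_step[OF s0(1-3) q E V_meas[OF n s0(4)] cE])
  also have "(\<integral>\<^sup>+\<omega>. indicator E \<omega> * Lp q (V R n i \<omega> ?t) \<partial>M) \<le> mI q R n i"
    unfolding mI_def
  proof (rule nn_integral_mono)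
    fix \<omega> assume \<omega>: "\<omega> \<in> space M"
    show "indicator E \<omega> * Lp q (V R n i \<omega> ?t) \<le> indicator {\<omega>\<in>space M. Dex R (V R n i \<omega>) ?s = 0} \<omega> * Lp q (V R n i \<omega> ?s)"
    proof (cases "\<omega> \<in> E")
      case True
      then have "Dex R (V R n i \<omega>) ?t = 0" by (simp add: E_def)
      from V_decrease[OF \<omega> R n s0(5) q this] show ?thesis using True \<omega> by simp
    qed simp
  qed
  finally show ?thesis by (simp add: add_right_mono mult_left_mono)
qed

text \<open>Adding \<open>\<Gamma> q\<close> absorbs the inhomogeneous term: the sum grows at most
  by the factor \<open>1 + 4 ^ q / n\<close> in each step.\<close>

lemma mI_bound:
  assumes R: "0 \<le> R" and n: "0 < n" and q: "0 < q"
  shows "mI q R n i \<le> ennreal ((1 + 4 ^ q / real n) ^ i) * (Lp q a + ennreal (\<Gamma> q))"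
proof -
  let ?K = "4 ^ q / real n"
  have K: "0 \<le> ?K" by simp
  have "mI q R n i + ennreal (\<Gamma> q) \<le> ennreal ((1 + ?K) ^ i) * (Lp q a + ennreal (\<Gamma> q))"
  proof (induction i)
    case 0
    have "mI q R n 0 \<le> (\<integral>\<^sup>+\<omega>. Lp q a \<partial>M)" unfolding mI_def
    proof (rule nn_integral_mono)
      fix \<omega> assume \<omega>: "\<omega> \<in> space M"
      have "V R n 0 \<omega> 0 = a" by (rule ext) (rule V_0[OF \<omega> R n])
      then show "indicator {\<omega>\<in>space M. Dex R (V R n 0 \<omega>) (real 0 / real n) = 0} \<omega> * Lp q (V R n 0 \<omega> (real 0 / real n)) \<le> Lp q a"
        by (simp add: indicator_def)
    qed
    also have "\<dots> = Lp q a" by (simp add: emeasure_space_1)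
    finally show ?case by (simp add: add_right_mono)
  next
    case (Suc i)
    have "mI q R n (Suc i) + ennreal (\<Gamma> q) \<le> ennreal (1 + ?K) * mI q R n i + ennreal (?K * \<Gamma> q) + ennreal (\<Gamma> q)"
      by (intro add_right_mono mI_Suc assms)
    also have "\<dots> = ennreal (1 + ?K) * mI q R n i + ennreal (1 + ?K) * ennreal (\<Gamma> q)"
    proof -
      have "ennreal (?K * \<Gamma> q) + ennreal (\<Gamma> q) = ennreal (?K * \<Gamma> q + \<Gamma> q)" using \<Gamma>_nonneg K by (intro ennreal_plus[symmetric] mult_nonneg_nonneg)
      also have "?K * \<Gamma> q + \<Gamma> q = (1 + ?K) * \<Gamma> q" by (simp add: distrib_right)
      also have "ennreal ((1 + ?K) * \<Gamma> q) = ennreal (1 + ?K) * ennreal (\<Gamma> q)" using \<Gamma>_nonneg by (rule ennreal_mult'')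
      finally show ?thesis by (simp only: add.assoc)
    qed
    also have "\<dots> = ennreal (1 + ?K) * (mI q R n i + ennreal (\<Gamma> q))" by (simp only: distrib_left)
    also have "\<dots> \<le> ennreal (1 + ?K) * (ennreal ((1 + ?K) ^ i) * (Lp q a + ennreal (\<Gamma> q)))" by (intro mult_left_mono Suc) simp
    also have "\<dots> = ennreal ((1 + ?K) ^ Suc i) * (Lp q a + ennreal (\<Gamma> q))"
      using K by (simp add: ennreal_mult mult.assoc)
    finally show ?case .
  qed
  then show ?thesis by (rule order_trans[rotated]) simp
qed

text \<open>The integrand of the killed moment in continuous time, for the grid with
  \<open>Suc k\<close> cells per unit of time, whose freezing index lies at the horizon
  \<open>N\<close>.\<close>

definition jf :: "nat \<Rightarrow> nat \<Rightarrow> real \<Rightarrow> nat \<Rightarrow> 'a \<Rightarrow> real \<Rightarrow> ennreal" where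
  "jf q N R k \<omega> s = indicator {0..<real N} s *
     (if Dex R (V R (Suc k) (Suc k * N) \<omega>) s = 0 then Lp q (V R (Suc k) (Suc k * N) \<omega> s) else 0)"

definition BN :: "nat \<Rightarrow> nat \<Rightarrow> ennreal" where "BN q N = ennreal (exp (4 ^ q * real N)) * (Lp q a + ennreal (\<Gamma> q))"

lemma BN_finite: "BN q N < \<infinity>"
  unfolding BN_def using Lp_eq[OF Ha, of q] by (simp add: ennreal_mult_less_top)

text \<open>At a time in cell \<open>i\<close> the scheme coincides with the one frozen at
  \<open>i / n\<close>, so its moment is at most that at the left grid point. The inequality
  \<open>(1 + x)^i \<le> exp (i x)\<close> makes the bound independent of the mesh.\<close>

lemma jf_le:
  assumes R: "0 \<le> R" and q: "0 < q"
  shows "(\<integral>\<^sup>+\<omega>. jf q N R k \<omega> s \<partial>M) \<le> indicator {0..<real N} s * BN q N"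
proof (cases "s \<in> {0..<real N}")
  case True
  define n where "n = Suc k"
  define i where "i = nat \<lfloor>real n * s\<rfloor>"
  have n: "0 < n" by (simp add: n_def)
  have s: "0 \<le> s" "s < real N" using True by auto
  have i1: "real i \<le> real n * s" "real n * s < real i + 1" using s by (simp_all add: i_def of_nat_nat)
  have si: "real i / real n \<le> s" "s < real (Suc i) / real n"
    using i1 n by (simp_all add: divide_le_eq less_divide_eq mult.commute)
  have "real n * s \<le> real n * real N" using s by (intro mult_left_mono) auto
  then have "real i \<le> real (n * N)" using i1(1) by simp
  then have iN: "i \<le> n * N" by linarith
  have "(\<integral>\<^sup>+\<omega>. jf q N R k \<omega> s \<partial>M) \<le> mI q R n i"
    unfolding mI_def
  proof (rule nn_integral_mono)
    fix \<omega> assume \<omega>: "\<omega> \<in> space M"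
    have eq: "Dex R (V R n (n * N) \<omega>) s = Dex R (V R n i \<omega>) s" "V R n (n * N) \<omega> s = V R n i \<omega> s"
      unfolding V_def using Dex_agree[OF w_gb[OF \<omega>] Ha R n iN] vst_agree[OF w_gb[OF \<omega>] Ha R n iN s(1) si(2)] si(2) by simp_all
    show "jf q N R k \<omega> s \<le> indicator {\<omega>\<in>space M. Dex R (V R n i \<omega>) (real i / real n) = 0} \<omega> * Lp q (V R n i \<omega> (real i / real n))"
    proof (cases "Dex R (V R n i \<omega>) s = 0")
      case D: True
      from V_decrease[OF \<omega> R n si(1) q D] show ?thesis
        using True \<omega> D unfolding jf_def n_def[symmetric] eq by simp
    next
      case False
      then show ?thesis unfolding jf_def n_def[symmetric] eq by simp
    qed
  qed
  also have "\<dots> \<le> ennreal ((1 + 4 ^ q / real n) ^ i) * (Lp q a + ennreal (\<Gamma> q))" by (rule mI_bound[OF R n q])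
  also have "\<dots> \<le> BN q N" unfolding BN_def
  proof (intro mult_right_mono ennreal_leI)
    have "(1 + 4 ^ q / real n) ^ i \<le> exp (4 ^ q / real n) ^ i" by (intro power_mono exp_ge_add_one_self_aux) auto
    also have "\<dots> = exp (real i * (4 ^ q / real n))" by (rule exp_of_nat_mult[symmetric])
    also have "real i * (4 ^ q / real n) = 4 ^ q * (real i / real n)" by simp
    also have "exp \<dots> \<le> exp (4 ^ q * real N)" using si(1) s by (intro iffD2[OF exp_le_cancel_iff] mult_left_mono) auto
    finally show "(1 + 4 ^ q / real n) ^ i \<le> exp (4 ^ q * real N)" by simp
  qed simp
  finally show ?thesis using True by simp
qed (simp add: jf_def)

lemma jf_meas: "(\<lambda>p. jf q N R k (snd p) (fst p)) \<in> borel_measurable (borel \<Otimes>\<^sub>M M)"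
proof -
  let ?n = "Suc k" and ?J = "{0..real N}" and ?B = "(borel :: real measure) \<Otimes>\<^sub>M M"
  have pm: "pm ?J M (V R ?n (?n * N))"
    by (rule V_pm[OF initial_Icc _ meas_M[OF w_meas]]) auto
  have [measurable]: "(\<lambda>p. indicator ?J (fst p) * Dex R (V R ?n (?n * N) (snd p)) (fst p)) \<in> borel_measurable ?B"
    by (rule Dex_pm[OF initial_Icc pm])
  have [measurable]: "(\<lambda>p. Lp q (\<lambda>m. indicator ?J (fst p) * V R ?n (?n * N) (snd p) (fst p) m)) \<in> borel_measurable ?B"
    by (rule Lp_meas) (use pm in \<open>simp add: pm_def\<close>)
  have "(\<lambda>p. indicator {0..<real N} (fst p) *
     (if indicator ?J (fst p) * Dex R (V R ?n (?n * N) (snd p)) (fst p) = 0 then Lp q (\<lambda>m. indicator ?J (fst p) * V R ?n (?n * N) (snd p) (fst p) m) else 0)) \<in> borel_measurable ?B"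
    by measurable
  also have "(\<lambda>p. indicator {0..<real N} (fst p) *
     (if indicator ?J (fst p) * Dex R (V R ?n (?n * N) (snd p)) (fst p) = 0 then Lp q (\<lambda>m. indicator ?J (fst p) * V R ?n (?n * N) (snd p) (fst p) m) else 0))
     = (\<lambda>p. jf q N R k (snd p) (fst p))"
    by (rule ext) (auto simp: jf_def indicator_def)
  finally show ?thesis .
qed

text \<open>The liminf over the mesh stands inside the time integral: Fatou's lemma bounds its
  expectation uniformly in \<open>R\<close>, and it dominates the moment of \<open>uR\<close> at
  each time at which \<open>uR\<close> has so far stayed inside the ball.\<close>

definition XN :: "nat \<Rightarrow> nat \<Rightarrow> real \<Rightarrow> 'a \<Rightarrow> ennreal" where
  "XN q N R \<omega> = (\<integral>\<^sup>+s. liminf (\<lambda>k. jf q N R k \<omega> s) \<partial>lborel)"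

lemma XN_meas: "XN q N R \<in> borel_measurable M"
  and XN_le: "0 \<le> R \<Longrightarrow> 0 < q \<Longrightarrow> (\<integral>\<^sup>+\<omega>. XN q N R \<omega> \<partial>M) \<le> BN q N * real N"
proof -
  interpret P: pair_sigma_finite lborel M ..
  have jm: "(\<lambda>p. jf q N R k (snd p) (fst p)) \<in> borel_measurable (lborel \<Otimes>\<^sub>M M)" for k
  proof -
    have e: "sets (lborel \<Otimes>\<^sub>M M) = sets ((borel :: real measure) \<Otimes>\<^sub>M M)" by (rule sets_pair_measure_cong) simp_all
    from jf_meas show ?thesis unfolding measurable_cong_sets[OF e refl] .
  qed
  have m: "(\<lambda>p. liminf (\<lambda>k. jf q N R k (snd p) (fst p))) \<in> borel_measurable (lborel \<Otimes>\<^sub>M M)"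
    by (rule borel_measurable_liminf) (rule jm)
  show "XN q N R \<in> borel_measurable M"
    unfolding XN_def[abs_def]
  proof (rule lborel.borel_measurable_nn_integral)
    have sw: "(\<lambda>p. (snd p, fst p)) \<in> measurable (M \<Otimes>\<^sub>M lborel) (lborel \<Otimes>\<^sub>M M)" by measurable
    from measurable_compose[OF sw m]
    show "case_prod (\<lambda>\<omega> s. liminf (\<lambda>k. jf q N R k \<omega> s)) \<in> borel_measurable (M \<Otimes>\<^sub>M lborel)" by (simp add: case_prod_beta')
  qed
  assume R: "0 \<le> R" and q: "0 < q"
  have "(\<integral>\<^sup>+\<omega>. XN q N R \<omega> \<partial>M) = (\<integral>\<^sup>+s. \<integral>\<^sup>+\<omega>. liminf (\<lambda>k. jf q N R k \<omega> s) \<partial>M \<partial>lborel)"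
    unfolding XN_def by (rule P.Fubini') (use m in \<open>simp add: case_prod_beta'\<close>)
  also have "\<dots> \<le> (\<integral>\<^sup>+s. indicator {0..<real N} s * BN q N \<partial>lborel)"
  proof (rule nn_integral_mono)
    fix s :: real
    have "(\<integral>\<^sup>+\<omega>. liminf (\<lambda>k. jf q N R k \<omega> s) \<partial>M) \<le> liminf (\<lambda>k. \<integral>\<^sup>+\<omega>. jf q N R k \<omega> s \<partial>M)"
      using measurable_compose[OF measurable_Pair1'[of s lborel M] jm] by (intro nn_integral_liminf) simp
    also have "\<dots> \<le> indicator {0..<real N} s * BN q N"
      by (rule Liminf_le) (auto intro!: always_eventually jf_le R q)
    finally show "(\<integral>\<^sup>+\<omega>. liminf (\<lambda>k. jf q N R k \<omega> s) \<partial>M) \<le> indicator {0..<real N} s * BN q N" .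
  qed
  also have "\<dots> = BN q N * real N"
    by (subst nn_integral_multc) (simp_all add: mult.commute ennreal_of_nat_eq_real_of_nat)
  finally show "(\<integral>\<^sup>+\<omega>. XN q N R \<omega> \<partial>M) \<le> BN q N * real N" .
qed

lemma XN_AE: assumes q: "0 < q" shows "AE \<omega> in M. \<forall>N. \<exists>b. \<exists>\<^sub>F R in sequentially. XN q N (real R) \<omega> \<le> ennreal b"
  unfolding AE_all_countable
proof
  fix N
  note [measurable] = XN_meas
  have "(\<integral>\<^sup>+\<omega>. liminf (\<lambda>R. XN q N (real R) \<omega>) \<partial>M) \<le> liminf (\<lambda>R. \<integral>\<^sup>+\<omega>. XN q N (real R) \<omega> \<partial>M)"
    by (rule nn_integral_liminf) measurable
  also have "\<dots> \<le> BN q N * real N" by (rule Liminf_le) (auto intro!: always_eventually XN_le q)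
  also have "\<dots> < \<infinity>" using BN_finite by (simp add: ennreal_mult_less_top ennreal_of_nat_eq_real_of_nat)
  finally have "(\<integral>\<^sup>+\<omega>. liminf (\<lambda>R. XN q N (real R) \<omega>) \<partial>M) \<noteq> \<infinity>" by simp
  then have "AE \<omega> in M. liminf (\<lambda>R. XN q N (real R) \<omega>) \<noteq> \<infinity>"
    by (rule nn_integral_PInf_AE[rotated]) measurable
  then show "AE \<omega> in M. \<exists>b. \<exists>\<^sub>F R in sequentially. XN q N (real R) \<omega> \<le> ennreal b"
    by eventually_elim (rule frequently_le_of_liminf)
qed

end

section \<open>Survival of the retracted solutions\<close>

context spde begin

lemma uR_ncont: assumes "\<omega> \<in> space M" "0 \<le> R" "0 \<le> T" shows "ncont {0..T} (uR R \<omega>)"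
  unfolding uR_def by (intro sol_ncont Yp_ncont w_gp Ha assms)

lemma uR_eq: assumes "\<omega> \<in> space M" "0 \<le> R" "0 \<le> t"
  shows "uR R \<omega> t m = Yp a (w \<omega>) t m + duh R (uR R \<omega>) t m"
  unfolding uR_def by (rule sol_eq[OF Yp_adm[OF w_gb[OF assms(1)] Ha] assms(2)]) (use assms in simp)

lemma uR_adm: assumes "\<omega> \<in> space M" "0 \<le> R" shows "adm {0..} (uR R \<omega>)"
  unfolding uR_def by (intro sol_adm Yp_adm w_gb Ha assms)

lemma Lp_le_liminf:
  assumes \<omega>: "\<omega> \<in> space M" and R: "0 \<le> R" and s: "0 \<le> s" "s < real N"
    and b: "\<And>r. r \<in> {0..s} \<Longrightarrow> nrm (uR R \<omega> r) < R"
  shows "Lp q (uR R \<omega> s) \<le> liminf (\<lambda>k. jf q N R k \<omega> s)"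
proof -
  let ?Y = "\<lambda>k. Yp a (stp (Suc k) (Suc k * N) (w \<omega>))"
  let ?u = "uR R \<omega>" and ?V = "\<lambda>k. V R (Suc k) (Suc k * N) \<omega>"
  have uc: "ncont {0..s} ?u" by (rule uR_ncont[OF \<omega> R s(1)])
  have "\<exists>r\<in>{0..s}. \<forall>t\<in>{0..s}. nrm (?u t) \<le> nrm (?u r)"
    by (rule continuous_attains_sup) (use s ncont_nrm[OF uc] in auto)
  then obtain r where r: "r \<in> {0..s}" "\<And>t. t \<in> {0..s} \<Longrightarrow> nrm (?u t) \<le> nrm (?u r)" by blast
  define \<delta> where "\<delta> = R - nrm (?u r)"
  have \<delta>: "0 < \<delta>" using b[OF r(1)] by (simp add: \<delta>_def)
  have N0: "0 \<le> real N" by simp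
  obtain \<alpha> where \<alpha>: "\<alpha> \<longlonglongrightarrow> 0" "\<And>n L t. \<lbrakk>0 < n; real n * real N \<le> real L; t \<in> {0..real N}\<rbrakk> \<Longrightarrow>
     Hs (\<lambda>m. Yp a (w \<omega>) t m - Yp a (stp n L (w \<omega>)) t m) \<and> nrm (\<lambda>m. Yp a (w \<omega>) t m - Yp a (stp n L (w \<omega>)) t m) \<le> \<alpha> n"
    by (rule stp_approx[OF w_gp[OF \<omega>] N0, of a]) (rule that; assumption | blast)
  define \<epsilon> where "\<epsilon> k = 2 * \<alpha> (Suc k) * exp (kt R * real N)" for k
  have \<epsilon>0: "\<epsilon> \<longlonglongrightarrow> 0"
  proof -
    have "(\<lambda>k. 2 * \<alpha> (Suc k) * exp (kt R * real N)) \<longlonglongrightarrow> 2 * 0 * exp (kt R * real N)"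
      by (intro tendsto_intros LIMSEQ_Suc \<alpha>(1))
    then show ?thesis by (simp add: \<epsilon>_def[abs_def])
  qed
  have Vad: "adm {0..} (?V k)" for k unfolding V_def by (intro V_adm w_gb \<omega> Ha R) simp
  have HV: "Hs (?V k t)" if "0 \<le> t" for k t using Vad that by (simp add: adm_def)
  have Hu: "Hs (?u t)" if "0 \<le> t" for t using uR_adm[OF \<omega> R] that by (simp add: adm_def)
  have close: "nrmd (?u t) (?V k t) \<le> \<epsilon> k" if t: "t \<in> {0..s}" for t k
  proof -
    have Y: "Hs (\<lambda>m. Yp a (w \<omega>) t' m - ?Y k t' m)"
      "nrm (\<lambda>m. Yp a (w \<omega>) t' m - ?Y k t' m) \<le> \<alpha> (Suc k)" if "t' \<in> {0..real N}" for t'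
    proof -
      have "real (Suc k) * real N \<le> real (Suc k * N)" by (simp only: of_nat_mult order_refl)
      from \<alpha>(2)[OF zero_less_Suc this that] show
        "Hs (\<lambda>m. Yp a (w \<omega>) t' m - ?Y k t' m)"
        "nrm (\<lambda>m. Yp a (w \<omega>) t' m - ?Y k t' m) \<le> \<alpha> (Suc k)" by auto
    qed
    have z0: "0 \<in> {0..real N}" by simp
    have \<alpha>0: "0 \<le> \<alpha> (Suc k)" by (rule order_trans[OF nrm_nonneg[OF Y(1)[OF z0]] Y(2)[OF z0]])
    have t0: "t \<in> {0..}" "0 \<le> t" "t \<le> real N" using t s by auto
    have "nrmd (?u t) (?V k t) \<le> 2 * \<alpha> (Suc k) * exp (kt R * t)"
    proof (rule duhamel_stable[OF R uR_adm[OF \<omega> R] Vad t0(1) \<alpha>0])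
      fix t' assume t': "t' \<in> {0..t}"
      then have tN: "t' \<in> {0..real N}" "0 \<le> t'" using t0 by auto
      show "Hs (\<lambda>m. Yp a (w \<omega>) t' m - ?Y k t' m)" by (rule Y(1)[OF tN(1)])
      show "nrm (\<lambda>m. Yp a (w \<omega>) t' m - ?Y k t' m) \<le> \<alpha> (Suc k)" by (rule Y(2)[OF tN(1)])
      fix m
      have "?V k t' m = ?Y k t' m + duh R (?V k) t' m"
        unfolding V_def vst_def by (rule sol_eq[OF Yp_adm[OF gb_stp[OF w_gb[OF \<omega>]] Ha] R]) (use tN in auto)
      then show "?u t' m - ?V k t' m = (Yp a (w \<omega>) t' m - ?Y k t' m)
         + (duh R ?u t' m - duh R (?V k) t' m)"
        using uR_eq[OF \<omega> R tN(2), of m] by simp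
    qed
    also have "\<dots> \<le> \<epsilon> k" unfolding \<epsilon>_def using \<alpha>0 kt_pos[OF R] t0 by (intro mult_left_mono) auto
    finally show ?thesis .
  qed
  have ev: "\<forall>\<^sub>F k in sequentially. Lp q (?V k s) \<le> jf q N R k \<omega> s"
    using order_tendstoD(2)[OF \<epsilon>0 \<delta>]
  proof eventually_elim
    case (elim k)
    have nV: "nrm (?V k t) \<le> R" if t: "t \<in> {0..s}" for t
    proof -
      have t0: "0 \<le> t" using t by simp
      have "nrm (?V k t) \<le> nrm (?u t) + nrmd (?u t) (?V k t)"
        using nrm_diff_ge[OF Hu[OF t0] HV[OF t0], of k] by linarith
      then show ?thesis using close[OF t, of k] r(2)[OF t] elim by (simp add: \<delta>_def)
    qed
    have "Dex R (?V k) s = conv 0 (\<lambda>_. 0) s" unfolding Dex_def by (rule conv_cong) (use nV in auto)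
    then have "Dex R (?V k) s = 0" by (simp add: conv_def)
    then show ?case using s by (simp add: jf_def)
  qed
  have "Lp q (?u s) = (\<integral>\<^sup>+x. liminf (\<lambda>k. ennreal (ser (?V k s) x ^ (2 * q))) \<partial>torus)"
    unfolding Lp_def
  proof (rule nn_integral_cong)
    fix x
    have "(\<lambda>k. ser (?V k s) x - ser (?u s) x) \<longlonglongrightarrow> 0"
    proof (rule Lim_null_comparison)
      show "\<forall>\<^sub>F k in sequentially. norm (ser (?V k s) x - ser (?u s) x) \<le> C0 * \<epsilon> k"
      proof (intro always_eventually allI)
        fix k
        have "\<bar>ser (?u s) x - ser (?V k s) x\<bar> \<le> C0 * nrmd (?u s) (?V k s)" by (rule ser_diff_bound[OF Hu HV]) (use s in auto)
        also have "\<dots> \<le> C0 * \<epsilon> k" by (intro mult_left_mono close C0_nonneg) (use s in auto)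
        finally show "norm (ser (?V k s) x - ser (?u s) x) \<le> C0 * \<epsilon> k" by (simp add: abs_minus_commute)
      qed
      show "(\<lambda>k. C0 * \<epsilon> k) \<longlonglongrightarrow> 0" using tendsto_mult[OF tendsto_const \<epsilon>0, of C0] by simp
    qed
    then have "(\<lambda>k. ser (?V k s) x) \<longlonglongrightarrow> ser (?u s) x" by (simp only: LIM_zero_iff)
    then have "(\<lambda>k. ennreal (ser (?V k s) x ^ (2 * q))) \<longlonglongrightarrow> ennreal (ser (?u s) x ^ (2 * q))"
      by (intro tendsto_ennrealI tendsto_power)
    from lim_imp_Liminf[OF _ this] show "ennreal (ser (?u s) x ^ (2 * q)) = liminf (\<lambda>k. ennreal (ser (?V k s) x ^ (2 * q)))" by simp
  qed
  also have "\<dots> \<le> liminf (\<lambda>k. Lp q (?V k s))" unfolding Lp_def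
    by (intro nn_integral_liminf measurable_compose[OF borel_measurable_integrable[OF ser_pow_integrable[OF HV]] measurable_ennreal] s)
  also have "\<dots> \<le> liminf (\<lambda>k. jf q N R k \<omega> s)" by (rule Liminf_mono[OF ev])
  finally show ?thesis .
qed

text \<open>The endpoint \<open>t\<close>, where the sphere may be reached, has measure zero; at
  earlier times the growth bound \<open>gr\<close> and \<open>Lp_le_liminf\<close> compare the
  integrand with that of \<open>XN\<close>.\<close>

lemma A10_integral_le:
  assumes \<omega>: "\<omega> \<in> space M" and R: "0 \<le> R" and t: "0 \<le> t" "t \<le> real N"
    and b: "\<And>r. 0 \<le> r \<Longrightarrow> r < t \<Longrightarrow> nrm (uR R \<omega> r) < R"
    and gr: "0 \<le> C" "\<And>v. A v ^ 10 \<le> C * (1 + v ^ (2 * q))" and X: "XN q N R \<omega> \<le> ennreal B" and B: "0 \<le> B"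
  shows "sint t (\<lambda>s. A10 (uR R \<omega> s)) \<le> C * (real N + B)"
proof -
  let ?u = "uR R \<omega>" and ?\<phi> = "\<lambda>s. A10 (uR R \<omega> s)" and ?L = "\<lambda>s. liminf (\<lambda>k. jf q N R k \<omega> s)"
  have Hu: "Hs (?u s)" if "0 \<le> s" for s using uR_adm[OF \<omega> R] that by (simp add: adm_def)
  have pc: "continuous_on {0..t} ?\<phi>" by (rule A10_meas[OF uR_ncont[OF \<omega> R t(1)]])
  have p0: "0 \<le> ?\<phi> s" for s by (intro integral_nonneg_AE AE_I2) simp
  have pi: "integrable (ton t) ?\<phi>" by (rule continuous_imp_integrable_real[OF pc])
  have Lm: "?L \<in> borel_measurable lborel"
  proof (rule borel_measurable_liminf)
    fix k
    have "(\<lambda>s. (s, \<omega>)) \<in> measurable borel (borel \<Otimes>\<^sub>M M)" using \<omega> by simp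
    from measurable_compose[OF this jf_meas] show "(\<lambda>s. jf q N R k \<omega> s) \<in> borel_measurable lborel" by simp
  qed
  have pt: "ennreal (?\<phi> s) \<le> ennreal C * (1 + ?L s)" if s: "0 \<le> s" "s < t" for s
  proof -
    have i: "integrable torus (\<lambda>x. ser (?u s) x ^ (2 * q))" by (rule ser_pow_integrable[OF Hu[OF s(1)]])
    have "?\<phi> s \<le> tint (\<lambda>x. C * (1 + ser (?u s) x ^ (2 * q)))"
    proof (rule integral_mono)
      show "integrable torus (\<lambda>x. A (ser (?u s) x) ^ 10)"
        by (intro torus_int_cont continuous_intros Aser_cont Hu s)
      show "integrable torus (\<lambda>x. C * (1 + ser (?u s) x ^ (2 * q)))" using i by simp
    qed (rule gr)
    also have "\<dots> = C * (1 + tint (\<lambda>x. ser (?u s) x ^ (2 * q)))" using i by simp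
    finally have "ennreal (?\<phi> s) \<le> ennreal (C * (1 + tint (\<lambda>x. ser (?u s) x ^ (2 * q))))" by (rule ennreal_leI)
    also have "\<dots> = ennreal C * (1 + Lp q (?u s))"
      using gr(1) by (simp add: Lp_eq[OF Hu[OF s(1)]] ennreal_mult' ennreal_plus zero_le_even_power integral_nonneg_AE)
    also have "\<dots> \<le> ennreal C * (1 + ?L s)"
      by (intro mult_left_mono add_left_mono Lp_le_liminf[OF \<omega> R s(1)]) (use s t b in auto)
    finally show ?thesis .
  qed
  have "ennreal (sint t ?\<phi>) = (\<integral>\<^sup>+s. ennreal (?\<phi> s) \<partial>ton t)"
    by (rule nn_integral_eq_integral[OF pi, symmetric]) (use p0 in simp)
  also have "\<dots> \<le> (\<integral>\<^sup>+s. ennreal C * (1 + ?L s) \<partial>ton t)"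
  proof (rule nn_integral_mono_AE)
    show "AE s in ton t. ennreal (?\<phi> s) \<le> ennreal C * (1 + ?L s)"
      using ae_ne_Icc[where a=0 and b=t and c=t] AE_space[of "ton t"] by eventually_elim (use pt in auto)
  qed
  also have "\<dots> = (\<integral>\<^sup>+s. ennreal C * (1 + ?L s) * indicator {0..t} s \<partial>lborel)"
    by (subst nn_integral_restrict_space) (simp_all add: nn_integral_completion)
  also have "\<dots> \<le> (\<integral>\<^sup>+s. ennreal C * (indicator {0..real N} s + ?L s) \<partial>lborel)"
    using t by (intro nn_integral_mono) (auto simp: indicator_def)
  also have "\<dots> = ennreal C * ((\<integral>\<^sup>+s. indicator {0..real N} s \<partial>lborel) + XN q N R \<omega>)"
    unfolding XN_def using Lm by (subst nn_integral_cmult) (auto simp: nn_integral_add)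
  also have "\<dots> \<le> ennreal C * (ennreal (real N) + ennreal B)"
    using X by (intro mult_left_mono add_mono) auto
  also have "\<dots> = ennreal (C * (real N + B))" using gr(1) B by (simp add: ennreal_mult' ennreal_plus)
  finally show ?thesis using gr(1) B by (simp add: ennreal_le_iff)
qed

definition surv :: "'a \<Rightarrow> bool" where
  "surv \<omega> \<longleftrightarrow> (\<forall>N::nat. \<exists>R\<ge>0. \<forall>s\<in>{0..real N}. nrm (uR R \<omega> s) < R)"

lemma uR_zero: assumes "\<omega> \<in> space M" "0 \<le> R" shows "uR R \<omega> 0 = a"
proof
  fix m
  show "uR R \<omega> 0 m = a m" using uR_eq[OF assms, of 0 m] w_zero[OF assms(1)] by (simp add: conv_at_0 Yp_def)
qed

text \<open>The order of choices matters. One \<open>b\<close> bounds \<open>XN\<close> for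
  infinitely many radii; \<open>bootstrap\<close> turns \<open>b\<close> and the path into a bound
  \<open>Rb\<close> that knows no radius; only then is a radius above \<open>Rb\<close> picked among
  those infinitely many. A first hit of the sphere would force the norm to equal \<open>R\<close>
  and to be at most \<open>Rb < R\<close>.\<close>

lemma surv_AE: "AE \<omega> in M. surv \<omega>"
proof -
  obtain q C where gr: "0 < q" "0 \<le> C" "\<And>v. A v ^ 10 \<le> C * (1 + v ^ (2 * q))"
    by (rule growth) (rule that; assumption | blast)
  from XN_AE[OF gr(1)] AE_space show ?thesis
  proof eventually_elim
    case (elim \<omega>)
    show ?case unfolding surv_def
    proof
      fix N :: nat
      obtain b where b: "\<exists>\<^sub>F R in sequentially. XN q N (real R) \<omega> \<le> ennreal b" using elim(1) by blast
      define B where "B = max 0 b"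
      have bB: "ennreal b \<le> ennreal B" by (auto simp: B_def intro: ennreal_leI)
      obtain Y where Y: "0 \<le> Y" "\<And>t. t \<in> {0..real N} \<Longrightarrow> nrm (Yp a (w \<omega>) t) \<le> Y"
        by (rule ncont_bdd[OF Yp_ncont[OF w_gp[OF elim(2)] Ha]]) (rule that; assumption | blast)
      have CB: "0 \<le> C * (real N + B)" "0 \<le> real N" using gr(2) by (auto simp: B_def)
      obtain Rb where Rb: "0 \<le> Rb" "\<And>c y t' t. \<lbrakk>t' \<le> real N; ncont {0..t'} c; \<And>s. s \<in> {0..t'} \<Longrightarrow> Hs (y s) \<and> nrm (y s) \<le> Y;
          \<And>s m. s \<in> {0..t'} \<Longrightarrow> c s m = y s m + duF c s m;
          sint t' (\<lambda>s. A10 (c s)) \<le> C * (real N + B); t \<in> {0..t'}\<rbrakk> \<Longrightarrow> nrm (c t) \<le> Rb"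
        by (rule bootstrap[OF CB(2) Y(1) CB(1)]) (rule that; assumption | blast)
      have "\<exists>\<^sub>F R in sequentially. XN q N (real R) \<omega> \<le> ennreal b \<and> nat \<lceil>Rb + nrm a + 1\<rceil> \<le> R"
        using frequently_eventually_frequently[OF b eventually_ge_at_top] .
      then obtain n :: nat where n: "XN q N (real n) \<omega> \<le> ennreal b" "nat \<lceil>Rb + nrm a + 1\<rceil> \<le> n"
        using frequently_ex by blast
      define R where "R = real n"
      have "Rb + nrm a + 1 \<le> R" using n(2) unfolding R_def by linarith
      then have R: "0 \<le> R" "Rb < R" "nrm a < R" using Rb(1) nrm_nonneg[OF Ha] by auto
      have X: "XN q N R \<omega> \<le> ennreal B" using n(1) bB by (simp add: R_def)
      have "nrm (uR R \<omega> s) < R" if s: "s \<in> {0..real N}" for s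
      proof (rule ccontr)
        assume "\<not> nrm (uR R \<omega> s) < R"
        then have ns: "R \<le> nrm (uR R \<omega> s)" by simp
        have n0: "nrm (uR R \<omega> 0) < R" using uR_zero[OF elim(2) R(1)] R(3) by simp
        obtain t where t: "0 < t" "t \<le> s" "nrm (uR R \<omega> t) = R" "\<And>r. 0 \<le> r \<Longrightarrow> r < t \<Longrightarrow> nrm (uR R \<omega> r) < R"
          by (rule first_hit[OF ncont_nrm[OF uR_ncont[OF elim(2) R(1) CB(2)]] n0 s ns]) (rule that; assumption | blast)
        have tN: "t \<le> real N" "0 \<le> t" using t s by auto
        have le: "nrm (uR R \<omega> r) \<le> R" if "r \<in> {0..t}" for r using t(3) t(4)[of r] that by (cases "r = t") auto
        have "nrm (uR R \<omega> t) \<le> Rb"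
        proof (rule Rb(2)[OF tN(1) uR_ncont[OF elim(2) R(1) tN(2)]])
          show "Hs (Yp a (w \<omega>) r) \<and> nrm (Yp a (w \<omega>) r) \<le> Y" if "r \<in> {0..t}" for r
            using Y(2)[of r] Yp_Hs[OF w_gb[OF elim(2)] Ha, of r] that tN by auto
          show "uR R \<omega> r m = Yp a (w \<omega>) r m + duF (uR R \<omega>) r m" if r: "r \<in> {0..t}" for r m
          proof -
            have "duh R (uR R \<omega>) r m = duF (uR R \<omega>) r m"
              by (rule conv_cong) (use r le in \<open>auto simp: FR_Fm\<close>)
            then show ?thesis using uR_eq[OF elim(2) R(1), of r m] r by simp
          qed
          show "sint t (\<lambda>s. A10 (uR R \<omega> s)) \<le> C * (real N + B)"
            by (rule A10_integral_le[OF elim(2) R(1) tN(2,1) t(4) gr(2,3) X]) (auto simp: B_def)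
        qed (use tN in auto)
        then show False using t(3) R(2) by simp
      qed
      then show "\<exists>R\<ge>0. \<forall>s\<in>{0..real N}. nrm (uR R \<omega> s) < R" using R(1) by blast
    qed
  qed
qed

end

section \<open>The strong solution, uniqueness and continuous dependence\<close>

context spde begin

definition N1 :: "'a set" where "N1 = (SOME N. N \<in> null_sets M \<and> {\<omega> \<in> space M. \<not> surv \<omega>} \<subseteq> N)"

lemma N1: "N1 \<in> null_sets M" "\<omega> \<in> space M \<Longrightarrow> \<omega> \<notin> N1 \<Longrightarrow> surv \<omega>"
proof -
  from someI_ex[OF AE_null_cover[OF surv_AE], folded N1_def] show "N1 \<in> null_sets M" "\<omega> \<in> space M \<Longrightarrow> \<omega> \<notin> N1 \<Longrightarrow> surv \<omega>" by auto
qed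

text \<open>Off the null set the sequence is eventually constant in \<open>n\<close> at each time;
  taking a limit yields one process whose adaptedness is inherited from \<open>uR\<close>.\<close>

definition ut :: "'a \<Rightarrow> real \<Rightarrow> seq" where
  "ut \<omega> t m = (if \<omega> \<in> N1 then 0 else lim (\<lambda>n. uR (real n) \<omega> t m))"

lemma ut_meas: assumes "0 \<le> t" shows "(\<lambda>\<omega>. ut \<omega> t m) \<in> borel_measurable (Fs t)"
proof -
  have [measurable]: "N1 \<in> sets (Fs t)" by (rule null_Fs[OF N1(1) assms])
  have [measurable]: "(\<lambda>\<omega>. uR R \<omega> t m) \<in> borel_measurable (Fs t)" for R by (rule uR_meas[OF assms])
  show ?thesis unfolding ut_def by measurable
qed

text \<open>Inside the smaller ball both retractions are the identity, so \<open>uR R\<close> also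
  solves the equation for \<open>R'\<close>, and \<open>duhamel_stable\<close> with zero remainder
  gives equality.\<close>

lemma uR_agree:
  assumes \<omega>: "\<omega> \<in> space M" and R: "0 \<le> R" "R \<le> R'" and b: "\<And>s. s \<in> {0..T} \<Longrightarrow> nrm (uR R \<omega> s) < R" and t: "t \<in> {0..T}"
  shows "uR R' \<omega> t = uR R \<omega> t"
proof -
  have R': "0 \<le> R'" and t0: "t \<in> {0..}" "0 \<le> t" using R t by auto
  have H: "Hs (uR r \<omega> t)" if "0 \<le> r" for r using uR_adm[OF \<omega> that] t0 by (simp add: adm_def)
  have Hd: "Hs (\<lambda>m. uR R' \<omega> t m - uR R \<omega> t m)" by (intro Hs_diff H R R')
  have "nrmd (uR R' \<omega> t) (uR R \<omega> t) \<le> 2 * 0 * exp (kt R' * t)"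
  proof (rule duhamel_stable[OF R' uR_adm[OF \<omega> R'] uR_adm[OF \<omega> R(1)] t0(1) order_refl])
    fix s m assume s: "s \<in> {0..t}"
    have "duh R (uR R \<omega>) s m = duh R' (uR R \<omega>) s m"
    proof (rule conv_cong)
      fix r assume "r \<in> {0..s}"
      then have "nrm (uR R \<omega> r) < R" using b[of r] s t by auto
      then show "FR R (uR R \<omega> r) m = FR R' (uR R \<omega> r) m" using FR_Fm[of "uR R \<omega> r" R] FR_Fm[of "uR R \<omega> r" R'] R by simp
    qed
    then show "uR R' \<omega> s m - uR R \<omega> s m = 0 + (duh R' (uR R' \<omega>) s m - duh R' (uR R \<omega>) s m)"
      using uR_eq[OF \<omega> R', of s m] uR_eq[OF \<omega> R(1), of s m] s by simp
  qed simp_all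
  then have "nrmd (uR R' \<omega> t) (uR R \<omega> t) = 0" using nrm_nonneg[OF Hd] by simp
  then have "uR R' \<omega> t m - uR R \<omega> t m = 0" for m using nrm_comp(2)[OF Hd, of m] by simp
  then show ?thesis by (intro ext) simp
qed

lemma ut_uR:
  assumes \<omega>: "\<omega> \<in> space M" "\<omega> \<notin> N1"
  obtains R where "0 \<le> R" "\<And>t. t \<in> {0..T} \<Longrightarrow> ut \<omega> t = uR R \<omega> t" "\<And>t. t \<in> {0..T} \<Longrightarrow> nrm (uR R \<omega> t) < R"
proof -
  obtain N :: nat where N: "T \<le> real N" using real_arch_simple by blast
  have "surv \<omega>" by (rule N1(2)[OF \<omega>])
  then obtain R where R: "0 \<le> R" "\<And>s. s \<in> {0..real N} \<Longrightarrow> nrm (uR R \<omega> s) < R" unfolding surv_def by blast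
  show ?thesis
  proof (rule that[OF R(1)])
    fix t assume t: "t \<in> {0..T}"
    then have tN: "t \<in> {0..real N}" using N by auto
    show "nrm (uR R \<omega> t) < R" by (rule R(2)[OF tN])
    show "ut \<omega> t = uR R \<omega> t"
    proof
      fix m
      obtain k :: nat where k: "R \<le> real k" using real_arch_simple by blast
      have "\<forall>\<^sub>F n in sequentially. uR R \<omega> t m = uR (real n) \<omega> t m"
        using eventually_ge_at_top[of k]
      proof eventually_elim
        case (elim n)
        then have "R \<le> real n" using k by linarith
        then show ?case using uR_agree[OF \<omega>(1) R(1) _ R(2) tN, of "real n"] by simp
      qed
      then have "(\<lambda>n. uR (real n) \<omega> t m) \<longlonglongrightarrow> uR R \<omega> t m" by (rule Lim_transform_eventually[OF tendsto_const])
      then show "ut \<omega> t m = uR R \<omega> t m" using \<omega>(2) by (simp add: ut_def limI)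
    qed
  qed
qed

lemma ut_issol: assumes \<omega>: "\<omega> \<in> space M" "\<omega> \<notin> N1" and T: "0 \<le> T" shows "issol T a (w \<omega>) (ut \<omega>)"
proof -
  obtain R where R: "0 \<le> R" "\<And>t. t \<in> {0..T} \<Longrightarrow> ut \<omega> t = uR R \<omega> t" "\<And>t. t \<in> {0..T} \<Longrightarrow> nrm (uR R \<omega> t) < R"
    by (rule ut_uR[OF \<omega>, of T]) (rule that; assumption | blast)
  have nc: "ncont {0..T} (ut \<omega>)" by (rule ncont_cong[OF uR_ncont[OF \<omega>(1) R(1) T]]) (simp add: R(2))
  have wc: "continuous_on {0..T} (\<lambda>t. w \<omega> t m)" for m
    using w_gp[OF \<omega>(1)] by (auto simp: gp_def intro: continuous_on_subset)
  show ?thesis unfolding issol_def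
  proof (intro conjI nc ballI allI)
    fix t m assume t: "t \<in> {0..T}"
    show "ut \<omega> t m = a m + sint t (\<lambda>s. Fm (ut \<omega> s) m - mu m * ut \<omega> s m) + w \<omega> t m"
    proof (rule mild_imp_int[OF ncont_Fm[OF nc] wc _ _ t])
      show "0 \<le> mu m" using mu_pos[of m] by simp
      fix s assume s: "s \<in> {0..T}"
      have "duh R (uR R \<omega>) s m = duF (ut \<omega>) s m"
      proof (rule conv_cong)
        fix r assume "r \<in> {0..s}"
        then have r: "r \<in> {0..T}" using s by auto
        show "FR R (uR R \<omega> r) m = Fm (ut \<omega> r) m" using R(2,3)[OF r] by (simp add: FR_Fm)
      qed
      then show "ut \<omega> s m = exp (- (mu m) * s) * a m + (w \<omega> s m - mu m * conv (mu m) (\<lambda>s. w \<omega> s m) s) + duF (ut \<omega>) s m"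
        using uR_eq[OF \<omega>(1) R(1), of s m] s by (simp add: R(2)[OF s] Yp_def)
    qed
  qed
qed

lemma ut_Hs: assumes \<omega>: "\<omega> \<in> space M" and t: "0 \<le> t" shows "Hs (ut \<omega> t)"
proof (cases "\<omega> \<in> N1")
  case True
  then have "ut \<omega> t = (\<lambda>_. 0)" by (intro ext) (simp add: ut_def)
  then show ?thesis by (simp add: Hs_def)
next
  case False
  from ut_issol[OF \<omega> this t] show ?thesis using t by (simp add: issol_def ncont_def)
qed

lemma ut_strong:
  assumes a: "\<And>m. coef u0 (Suc m) = a m"
  shows "strong_solution M F A \<nu> WQ u0 (\<lambda>\<omega> t. ser (ut \<omega> t))"
proof -
  let ?rhs = "\<lambda>\<omega> t m. coef u0 m +
           (LINT s|ton t. (LINT x|torus. A (ser (ut \<omega> s) x) * deriv (ebasis m) x) + \<nu> * lam m * coef (ser (ut \<omega> s)) m) + coef (WQ \<omega> t) m"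
  have cf: "coef (ser (ut \<omega> t)) (Suc m) = ut \<omega> t m" if "\<omega> \<in> space M" "0 \<le> t" for \<omega> t m
    by (rule ser_coef[OF ut_Hs[OF that]])
  have AE1: "AE \<omega> in M. \<omega> \<notin> N1" using N1(1) by (rule AE_not_in)
  show ?thesis unfolding strong_solution_def
  proof (intro conjI ballI allI impI)
    show "H20 (ser (ut \<omega> t))" if "\<omega> \<in> space M" "0 \<le> t" for \<omega> t by (rule ser_H20[OF ut_Hs[OF that]])
    fix t :: real and m :: nat assume t: "0 \<le> t" and m: "1 \<le> m"
    obtain k where k: "m = Suc k" using m by (cases m) auto
    have "(\<lambda>\<omega>. ut \<omega> t k) \<in> borel_measurable (Fs t)" by (rule ut_meas[OF t])
    also have "?this \<longleftrightarrow> (\<lambda>\<omega>. coef (ser (ut \<omega> t)) m) \<in> borel_measurable (Fs t)"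
      unfolding k by (rule measurable_cong) (use cf t in simp)
    finally show "(\<lambda>\<omega>. coef (ser (ut \<omega> t)) m) \<in> borel_measurable (Fs t)" .
  next
    show "AE \<omega> in M. (\<forall>t\<ge>0. ((\<lambda>s. H2norm (ser (ut \<omega> s) - ser (ut \<omega> t))) \<longlongrightarrow> 0) (at t within {0..})) \<and>
      (\<forall>t\<ge>0. \<forall>m\<ge>1. coef (ser (ut \<omega> t)) m = ?rhs \<omega> t m)"
      using AE1 w_AE AE_space
    proof eventually_elim
      case (elim \<omega>)
      show ?case
      proof (intro conjI allI impI)
        fix t :: real assume t: "0 \<le> t"
        \<comment> \<open>The horizon \<open>t + 1\<close> lies beyond \<open>t\<close>, so limits
          at \<open>t\<close> within this interval and within \<open>{0..}\<close> coincide.\<close>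
        have nc: "ncont {0..t + 1} (ut \<omega>)" using ut_issol[OF elim(3,1), of "t + 1"] t by (simp add: issol_def)
        have d: "H2norm (ser (ut \<omega> s) - ser (ut \<omega> t)) = nrmd (ut \<omega> s) (ut \<omega> t)" if "0 \<le> s" for s
          using coef_diff[OF ser_L20[OF ut_Hs[OF elim(3) that]] ser_L20[OF ut_Hs[OF elim(3) t]]] cf[OF elim(3) that] cf[OF elim(3) t]
          by (simp add: H2norm_eq)
        have "((\<lambda>s. nrmd (ut \<omega> s) (ut \<omega> t)) \<longlongrightarrow> 0) (at t within {0..t + 1})" using nc t by (simp add: ncont_def)
        also have "at t within {0..t + 1} = at t within {0..}"
          by (rule at_within_nhd[of t "{..<t + 1}"]) auto
        finally show "((\<lambda>s. H2norm (ser (ut \<omega> s) - ser (ut \<omega> t))) \<longlongrightarrow> 0) (at t within {0..})"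
          by (rule Lim_transform_eventually) (rule ev_within, use d in auto)
      next
        fix t :: real and m :: nat assume t: "0 \<le> t" and m: "1 \<le> m"
        obtain k where k: "m = Suc k" using m by (cases m) auto
        have "ut \<omega> t k = a k + (LINT s|ton t. Fm (ut \<omega> s) k - mu k * ut \<omega> s k) + w \<omega> t k"
          using ut_issol[OF elim(3,1) t] t by (simp add: issol_def)
        also have "(LINT s|ton t. Fm (ut \<omega> s) k - mu k * ut \<omega> s k)
          = (LINT s|ton t. (LINT x|torus. A (ser (ut \<omega> s) x) * deriv (ebasis m) x) + \<nu> * lam m * coef (ser (ut \<omega> s)) m)"
          by (rule Bochner_Integration.integral_cong) (use cf elim(3) in \<open>auto simp: k Fm_def deriv_ebasis lam_Suc\<close>)
        finally show "coef (ser (ut \<omega> t)) m = ?rhs \<omega> t m"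
          using cf[OF elim(3) t] elim(2) by (simp add: k a w_def wq_def)
      qed
    qed
  qed
qed

text \<open>The flux integral of an arbitrary solution involves its values as a function;
  completeness, through \<open>H20_ser_AE\<close>, replaces them almost everywhere by the series of
  the coefficients.\<close>

lemma strong_issol:
  assumes v: "strong_solution M F A \<nu> WQ b v"
  shows "AE \<omega> in M. \<forall>T. issol T (\<lambda>m. coef b (Suc m)) (w \<omega>) (\<lambda>t m. coef (v \<omega> t) (Suc m))"
proof -
  have H: "H20 (v \<omega> t)" if "\<omega> \<in> space M" "0 \<le> t" for \<omega> t using v that by (simp add: strong_solution_def)
  have "AE \<omega> in M. (\<forall>t\<ge>0. ((\<lambda>s. H2norm (v \<omega> s - v \<omega> t)) \<longlongrightarrow> 0) (at t within {0..})) \<and>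
      (\<forall>t\<ge>0. \<forall>m\<ge>1. coef (v \<omega> t) m = coef b m +
           (LINT s|ton t. (LINT x|torus. A (v \<omega> s x) * deriv (ebasis m) x) + \<nu> * lam m * coef (v \<omega> s) m) + coef (WQ \<omega> t) m)"
    using v unfolding strong_solution_def by blast
  with w_AE AE_space show ?thesis
  proof eventually_elim
    case (elim \<omega>)
    note HH = H[OF elim(2)]
    let ?c = "\<lambda>t m. coef (v \<omega> t) (Suc m)"
    have L: "L20 (v \<omega> t)" "Hs (?c t)" if "0 \<le> t" for t using HH[OF that] by (simp_all add: H20_iff)
    have F: "(LINT x|torus. A (v \<omega> s x) * deriv (ebasis (Suc m)) x) = Fm (?c s) m" if "0 \<le> s" for s m
      unfolding Fm_def deriv_ebasis
    proof (rule integral_cong_AE)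
      have "v \<omega> s \<in> borel_measurable torus" using L(1)[OF that] by (simp add: L20_def)
      from borel_measurable_times[OF measurable_compose[OF this A_meas] torus_meas_cont[OF deb_cont]]
      show "(\<lambda>x. A (v \<omega> s x) * deb m x) \<in> borel_measurable torus" .
      show "(\<lambda>x. A (ser (?c s) x) * deb m x) \<in> borel_measurable torus"
        by (intro torus_meas_cont continuous_intros Aser_cont L that)
      show "AE x in torus. A (v \<omega> s x) * deb m x = A (ser (?c s) x) * deb m x"
        using H20_ser_AE[OF HH[OF that]] by eventually_elim simp
    qed
    have nc: "ncont {0..} ?c" unfolding ncont_def
    proof (intro conjI ballI)
      fix t :: real assume "t \<in> {0..}"
      then have t: "0 \<le> t" by simp
      show "Hs (?c t)" by (rule L(2)[OF t])
      have d: "H2norm (v \<omega> s - v \<omega> t) = nrmd (?c s) (?c t)" if "0 \<le> s" for s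
        using coef_diff[OF L(1)[OF that] L(1)[OF t]] by (simp add: H2norm_eq)
      have "((\<lambda>s. H2norm (v \<omega> s - v \<omega> t)) \<longlongrightarrow> 0) (at t within {0..})" using elim(3) t by blast
      then show "((\<lambda>s. nrmd (?c s) (?c t)) \<longlongrightarrow> 0) (at t within {0..})"
        by (rule Lim_transform_eventually) (rule ev_within, use d in auto)
    qed
    show ?case unfolding issol_def
    proof (intro allI conjI ballI)
      fix T show "ncont {0..T} ?c" by (rule ncont_subset[OF nc]) auto
      fix t m assume "t \<in> {0..T}"
      then have t: "0 \<le> t" by simp
      have "?c t m = coef b (Suc m) + (LINT s|ton t. (LINT x|torus. A (v \<omega> s x) * deriv (ebasis (Suc m)) x) + \<nu> * lam (Suc m) * coef (v \<omega> s) (Suc m)) + coef (WQ \<omega> t) (Suc m)"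
        using conjunct2[OF elim(3)] t by simp
      also have "(LINT s|ton t. (LINT x|torus. A (v \<omega> s x) * deriv (ebasis (Suc m)) x) + \<nu> * lam (Suc m) * coef (v \<omega> s) (Suc m))
         = (LINT s|ton t. Fm (?c s) m - mu m * ?c s m)"
        by (rule Bochner_Integration.integral_cong) (use F in \<open>auto simp: lam_Suc\<close>)
      finally show "?c t m = coef b (Suc m) + (LINT s|ton t. Fm (?c s) m - mu m * ?c s m) + w \<omega> t m"
        using elim(1) by (simp add: w_def wq_def)
    qed
  qed
qed

lemma strong_diff:
  assumes "strong_solution M F A \<nu> WQ b u" "strong_solution M F A \<nu> WQ b' v" "\<omega> \<in> space M" "0 \<le> t"
  shows "H2norm (u \<omega> t - v \<omega> t) = nrm (\<lambda>m. coef (u \<omega> t) (Suc m) - coef (v \<omega> t) (Suc m))"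
    and "Hs (\<lambda>m. coef (u \<omega> t) (Suc m) - coef (v \<omega> t) (Suc m))"
proof -
  have H: "H20 (u \<omega> t)" "H20 (v \<omega> t)" using assms by (auto simp: strong_solution_def)
  then show "H2norm (u \<omega> t - v \<omega> t) = nrm (\<lambda>m. coef (u \<omega> t) (Suc m) - coef (v \<omega> t) (Suc m))"
    using coef_diff[of "u \<omega> t" "v \<omega> t"] by (simp add: H2norm_eq H20_iff)
  show "Hs (\<lambda>m. coef (u \<omega> t) (Suc m) - coef (v \<omega> t) (Suc m))" using H by (intro Hs_diff) (simp_all add: H20_iff)
qed

text \<open>Both paths are continuous, hence bounded on \<open>[0, t]\<close> by a common radius,
  and \<open>issol_stable\<close> with equal initial data makes the distance zero.\<close>

lemma strong_unique:
  assumes b: "H20 b" and u: "strong_solution M F A \<nu> WQ b u" and v: "strong_solution M F A \<nu> WQ b v"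
  shows "AE \<omega> in M. \<forall>t\<ge>0. H2norm (u \<omega> t - v \<omega> t) = 0"
  using strong_issol[OF u] strong_issol[OF v] AE_space
proof eventually_elim
  case (elim \<omega>)
  show ?case
  proof (intro allI impI)
    fix t :: real assume t: "0 \<le> t"
    let ?b = "\<lambda>m. coef b (Suc m)" and ?c = "\<lambda>t m. coef (u \<omega> t) (Suc m)" and ?d = "\<lambda>t m. coef (v \<omega> t) (Suc m)"
    have Hb: "Hs ?b" using b by (simp add: H20_iff)
    have s: "issol t ?b (w \<omega>) ?c" "issol t ?b (w \<omega>) ?d" using elim by auto
    obtain R1 where R1: "0 \<le> R1" "\<And>s. s \<in> {0..t} \<Longrightarrow> nrm (?c s) \<le> R1"
      by (rule ncont_bdd[of t ?c]) (use s in \<open>auto simp: issol_def\<close>)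
    obtain R2 where R2: "0 \<le> R2" "\<And>s. s \<in> {0..t} \<Longrightarrow> nrm (?d s) \<le> R2"
      by (rule ncont_bdd[of t ?d]) (use s in \<open>auto simp: issol_def\<close>)
    have "nrmd (?c t) (?d t) \<le> 2 * nrmd ?b ?b * exp (kt (max R1 R2) * t)"
      by (rule issol_stable[OF s Hb Hb]) (use t R1 R2 in \<open>auto simp: le_max_iff_disj\<close>)
    then show "H2norm (u \<omega> t - v \<omega> t) = 0"
      using strong_diff[OF u v elim(3) t] nrm_nonneg[OF strong_diff(2)[OF u v elim(3) t]] by (simp add: nrm_def)
  qed
qed

text \<open>The radius \<open>R\<close> bounds the limiting solution along the given path, so
  \<open>exp (kt (R + 1) * T)\<close> is a constant for that path; convergence of the initial data
  eventually meets the smallness premise of \<open>issol_dependence\<close>.\<close>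

lemma strong_dependence:
  assumes b: "H20 b" and u: "strong_solution M F A \<nu> WQ b u" and us: "\<And>j. H20 (bs j)" "\<And>j. strong_solution M F A \<nu> WQ (bs j) (us j)"
    and lim: "(\<lambda>j. H2norm (b - bs j)) \<longlonglongrightarrow> 0" and T: "0 \<le> T"
  shows "AE \<omega> in M. (\<lambda>j. SUP t\<in>{0..T}. H2norm (u \<omega> t - us j \<omega> t)) \<longlonglongrightarrow> 0"
proof -
  have "AE \<omega> in M. \<forall>j T. issol T (\<lambda>m. coef (bs j) (Suc m)) (w \<omega>) (\<lambda>t m. coef (us j \<omega> t) (Suc m))"
    unfolding AE_all_countable using strong_issol[OF us(2)] by blast
  with strong_issol[OF u] AE_space show ?thesis
  proof eventually_elim
    case (elim \<omega>)
    let ?b = "\<lambda>m. coef b (Suc m)" and ?bs = "\<lambda>j m. coef (bs j) (Suc m)" and ?c = "\<lambda>t m. coef (u \<omega> t) (Suc m)" and ?d = "\<lambda>j t m. coef (us j \<omega> t) (Suc m)"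
    have Hb: "Hs ?b" "Hs (?bs j)" for j using b us(1) by (auto simp: H20_iff)
    have s: "issol T ?b (w \<omega>) ?c" "issol T (?bs j) (w \<omega>) (?d j)" for j using elim by auto
    obtain R where R: "0 \<le> R" "\<And>s. s \<in> {0..T} \<Longrightarrow> nrm (?c s) \<le> R"
      by (rule ncont_bdd[of T ?c]) (use s in \<open>auto simp: issol_def\<close>)
    define \<epsilon> where "\<epsilon> j = 2 * nrmd ?b (?bs j) * exp (kt (R + 1) * T)" for j
    have "H2norm (b - bs j) = nrmd ?b (?bs j)" for j
      using coef_diff[of b "bs j"] b us(1)[of j] by (simp add: H2norm_eq H20_iff)
    then have "(\<lambda>j. 2 * nrmd ?b (?bs j) * exp (kt (R + 1) * T)) \<longlonglongrightarrow> 2 * 0 * exp (kt (R + 1) * T)"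
      using lim by (intro tendsto_intros) simp
    then have e0: "\<epsilon> \<longlonglongrightarrow> 0" by (simp add: \<epsilon>_def[abs_def])
    show ?case
    proof (rule Lim_null_comparison[OF _ e0])
      have "\<forall>\<^sub>F j in sequentially. \<epsilon> j < 1" by (rule order_tendstoD(2)[OF e0]) simp
      then show "\<forall>\<^sub>F j in sequentially. norm (SUP t\<in>{0..T}. H2norm (u \<omega> t - us j \<omega> t)) \<le> \<epsilon> j"
      proof eventually_elim
        case (elim j)
        have le: "H2norm (u \<omega> t - us j \<omega> t) \<le> \<epsilon> j" if t: "t \<in> {0..T}" for t
          using issol_dependence[OF s(1) s(2)[of j] Hb(1) Hb(2)[of j] R(2) R(1) _ t] elim strong_diff(1)[OF u us(2) \<open>\<omega> \<in> space M\<close>, of t j] t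
          by (simp add: \<epsilon>_def)
        have ge: "0 \<le> H2norm (u \<omega> t - us j \<omega> t)" if t: "t \<in> {0..T}" for t
          using nrm_nonneg[OF strong_diff(2)[OF u us(2) \<open>\<omega> \<in> space M\<close>, of t j]] strong_diff(1)[OF u us(2) \<open>\<omega> \<in> space M\<close>, of t j] t by simp
        have z: "0 \<in> {0..T}" using T by simp
        have "(SUP t\<in>{0..T}. H2norm (u \<omega> t - us j \<omega> t)) \<le> \<epsilon> j" by (rule cSUP_least) (use z le in auto)
        moreover have "0 \<le> (SUP t\<in>{0..T}. H2norm (u \<omega> t - us j \<omega> t))"
          by (rule order_trans[OF ge[OF z] cSUP_upper[OF z, of "\<lambda>t. H2norm (u \<omega> t - us j \<omega> t)"]]) (rule bdd_aboveI2[OF le])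
        ultimately show ?case by simp
      qed
    qed
  qed
qed

end

theorem theorem1p4:
  fixes M :: "'a measure" and F :: "real \<Rightarrow> 'a set set"
    and W :: "nat \<Rightarrow> 'a \<Rightarrow> real \<Rightarrow> real" and g :: "nat \<Rightarrow> real \<Rightarrow> real"
    and WQ :: "'a \<Rightarrow> real \<Rightarrow> real \<Rightarrow> real"
    and A :: "real \<Rightarrow> real" and \<nu> :: real and u0 :: "real \<Rightarrow> real"
  assumes "prob_space M"
    and "normal_filtration M F"
    and "\<forall>k. F_brownian M F (W k)"
    and "prob_space.indep_vars M (\<lambda>_. Pi\<^sub>M UNIV (\<lambda>_. borel)) W UNIV"
    and "flux_assms A"
    and "\<nu> > 0"
    and "\<forall>k. H20 (g k)"
    and "summable (\<lambda>k. (H2norm (g k))\<^sup>2)"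
    and "noise_WQ M W g WQ"
    and "H20 u0"
  shows "(\<exists>u. strong_solution M F A \<nu> WQ u0 u
            \<and> (\<forall>v. strong_solution M F A \<nu> WQ u0 v \<longrightarrow>
                   (AE \<omega> in M. \<forall>t\<ge>0. H2norm (u \<omega> t - v \<omega> t) = 0)))
       \<and> (\<forall>u u0s us. strong_solution M F A \<nu> WQ u0 u
            \<longrightarrow> (\<forall>j. H20 (u0s j) \<and> strong_solution M F A \<nu> WQ (u0s j) (us j))
            \<longrightarrow> (\<lambda>j. H2norm (u0 - u0s j)) \<longlonglongrightarrow> 0
            \<longrightarrow> (\<forall>T\<ge>0. AE \<omega> in M.
                   (\<lambda>j. SUP t\<in>{0..T}. H2norm (u \<omega> t - us j \<omega> t)) \<longlonglongrightarrow> 0))"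
proof -
  let ?a = "\<lambda>m. coef u0 (Suc m)"
  have noise: "noise M F W" using assms(1-4) by (simp add: noise_def noise_axioms_def)
  have flux: "flux A \<nu>" using assms(5,6) by (simp add: flux_def)
  have Ha: "Hs ?a" using assms(10) by (simp add: H20_iff)
  interpret spde A \<nu> M F W g WQ ?a
    by (intro spde.intro flux noisew.intro noise noisew_axioms.intro spde_axioms.intro Ha) (use assms in auto)
  show ?thesis
  proof (intro conjI allI impI)
    show "\<exists>u. strong_solution M F A \<nu> WQ u0 u \<and> (\<forall>v. strong_solution M F A \<nu> WQ u0 v \<longrightarrow> (AE \<omega> in M. \<forall>t\<ge>0. H2norm (u \<omega> t - v \<omega> t) = 0))"
    proof (intro exI conjI allI impI)
      show s: "strong_solution M F A \<nu> WQ u0 (\<lambda>\<omega> t. ser (ut \<omega> t))" by (rule ut_strong) simp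
      fix v assume "strong_solution M F A \<nu> WQ u0 v"
      then show "AE \<omega> in M. \<forall>t\<ge>0. H2norm (ser (ut \<omega> t) - v \<omega> t) = 0"
        by (rule strong_unique[OF assms(10) s])
    qed
  next
    fix u u0s us and T :: real
    assume "strong_solution M F A \<nu> WQ u0 u" "\<forall>j. H20 (u0s j) \<and> strong_solution M F A \<nu> WQ (u0s j) (us j)"
      "(\<lambda>j. H2norm (u0 - u0s j)) \<longlonglongrightarrow> 0" "0 \<le> T"
    then show "AE \<omega> in M. (\<lambda>j. SUP t\<in>{0..T}. H2norm (u \<omega> t - us j \<omega> t)) \<longlonglongrightarrow> 0"
      by (intro strong_dependence[OF assms(10)]) auto
  qed
qed

end
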